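(* Let $(W,\mathfrak h)$ be an irreducible complex reflection group with $\dim\mathfrak h>1$, let $t,\zeta\in\mathbb C$ and let $c:\mathcal S\to\mathbb C$ be a conjugation-invariant function. Consider $A_{t,c,\zeta}e$ as a left $A_{t,c,\zeta}$-module and a right $eA_{t,c,\zeta}e$-module. Then there is an isomorphism $$\operatorname{End}_{eA_{t,c,\zeta}e}(A_{t,c,\zeta}e)\cong A_{t,c,\zeta}.$$
   Context: $\mathfrak h$ is a finite-dimensional complex vector space, $n=\dim\mathfrak h$. A complex reflection is a finite-order $s\in GL(\mathfrak h)$ with $\operatorname{rank}(s-1)=1$. A complex reflection group $(W,\mathfrak h)$ is a finite subgroup $W\subset GL(\mathfrak h)$ generated by complex reflections; it is irreducible if $\mathfrak h$ is an irreducible representation. $\mathcal S$ is the set of complex reflections in $W$. For $s\in\mathcal S$, $\alpha_s\in\mathfrak h^*$ is such that $\ker\alpha_s$ is the hyperplane fixed by $s$, $\lambda_s$ is defined by $s(\alpha_s)=\lambda_s\alpha_s$, and $\alpha_s^\vee\in\mathfrak h$ is an eigenvector of $s$ with eigenvalue $\ne1$. The rational Cherednik algebra $H_{t,c}$ is the quotient of $T(\mathfrak h\oplus\mathfrak h^* )\rtimes W$ by $[x,x']=0$, $[y,y']=0$, $[y,x]=t\,x(y)-\sum_{s\in\mathcal S}\frac{2c_s}{\alpha_s(\alpha_s^\vee)}x(\alpha_s^\vee)\alpha_s(y)\,s$ for $x,x'\in\mathfrak h^*$, $y,y'\in\mathfrak h$. Let $y_1,\dots,y_n$ be a basis of $\mathfrak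 h$ with dual basis $x_1,\dots,x_n$. $H_{t,c}^{\mathfrak{gl}(n)}$ is the subalgebra generated by all $x_iy_j$ and $W$. The Euler element is $\mathrm{eu}_c=\sum_ix_iy_i-\sum_{s\in\mathcal S}\frac{2c_s}{1-\lambda_s}s$. Put $\mathbf a=\frac1{|Z(W)|}\sum_{z\in Z(W)}z$ and $e=\frac1{|W|}\sum_{w\in W}w$. $A_{t,c,\zeta}=\mathbf aH_{t,c}^{\mathfrak{gl}(n)}\mathbf a/\langle\mathbf a\,\mathrm{eu}_c-\zeta\rangle$ ($\zeta$ meaning $\zeta\mathbf a$). The isomorphism is one of algebras; this is the double centralizer property, i.e. it is given by the left multiplication action of $A_{t,c,\zeta}$ on $A_{t,c,\zeta}e$. *)

theory Defs
  imports
    Complex_Main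
    "HOL-Library.Poly_Mapping"
    "HOL-Algebra.Subrings"
    "HOL-Algebra.Module"
    "HOL-Algebra.Generated_Groups"
begin

text \<open>The space \<open>\<hh>\<close> is a whole type \<open>'h\<close> with scalar multiplication \<open>scale\<close>; its dual consists of
  the functions satisfying \<^term>\<open>Vector_Spaces.linear scale (*)\<close>.\<close>

definition dual_space :: "(complex \<Rightarrow> 'h::ab_group_add \<Rightarrow> 'h) \<Rightarrow> ('h \<Rightarrow> complex) set" where
  "dual_space scale = {f. Vector_Spaces.linear scale (*) f}"

definition GL :: "(complex \<Rightarrow> 'h::ab_group_add \<Rightarrow> 'h) \<Rightarrow> ('h \<Rightarrow> 'h) monoid" where
  "GL scale = \<lparr>carrier = {g. Vector_Spaces.linear scale scale g \<and> bij g},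
     monoid.mult = (\<circ>), one = id\<rparr>"

definition complex_reflection ::
    "(complex \<Rightarrow> 'h::ab_group_add \<Rightarrow> 'h) \<Rightarrow> ('h \<Rightarrow> 'h) \<Rightarrow> bool" where
  "complex_reflection scale s \<longleftrightarrow>
     s \<in> carrier (GL scale) \<and> (\<exists>k>0. (s ^^ k) = id) \<and>
     vector_space.dim scale ((\<lambda>v. s v - v) ` UNIV) = 1"

definition reflections ::
    "(complex \<Rightarrow> 'h::ab_group_add \<Rightarrow> 'h) \<Rightarrow> ('h \<Rightarrow> 'h) set \<Rightarrow> ('h \<Rightarrow> 'h) set" where
  "reflections scale W = {s \<in> W. complex_reflection scale s}"

definition complex_reflection_group ::
    "(complex \<Rightarrow> 'h::ab_group_add \<Rightarrow> 'h) \<Rightarrow> ('h \<Rightarrow> 'h) set \<Rightarrow> bool" where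
  "complex_reflection_group scale W \<longleftrightarrow>
     finite W \<and> subgroup W (GL scale) \<and> W = generate (GL scale) (reflections scale W)"

definition irreducible_group ::
    "(complex \<Rightarrow> 'h::ab_group_add \<Rightarrow> 'h) \<Rightarrow> ('h \<Rightarrow> 'h) set \<Rightarrow> bool" where
  "irreducible_group scale W \<longleftrightarrow>
     (UNIV :: 'h set) \<noteq> {0} \<and>
     (\<forall>U. module.subspace scale U \<and> (\<forall>w\<in>W. w ` U \<subseteq> U) \<longrightarrow> U = {0} \<or> U = UNIV)"

definition dual_action :: "('h \<Rightarrow> 'h) \<Rightarrow> ('h \<Rightarrow> complex) \<Rightarrow> 'h \<Rightarrow> complex" where
  "dual_action w f = f \<circ> inv_into UNIV w"

text \<open>\<open>\<alpha> s\<close> and \<open>\<alpha>v s\<close> are arbitrary choices (each is determined only up to a nonzero scalar).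
  Since \<open>lam s\<close> is the eigenvalue of \<open>s\<close> on the dual space, \<open>\<mu>\<close> below is its inverse.\<close>

definition reflection_data ::
    "(complex \<Rightarrow> 'h::ab_group_add \<Rightarrow> 'h) \<Rightarrow> ('h \<Rightarrow> 'h) set \<Rightarrow> (('h \<Rightarrow> 'h) \<Rightarrow> 'h \<Rightarrow> complex) \<Rightarrow>
      (('h \<Rightarrow> 'h) \<Rightarrow> 'h) \<Rightarrow> (('h \<Rightarrow> 'h) \<Rightarrow> complex) \<Rightarrow> bool" where
  "reflection_data scale W \<alpha> \<alpha>v lam \<longleftrightarrow>
     (\<forall>s\<in>reflections scale W.
        \<alpha> s \<in> dual_space scale \<and> {v. \<alpha> s v = 0} = {v. s v = v} \<and>
        dual_action s (\<alpha> s) = (\<lambda>v. lam s * \<alpha> s v) \<and>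
        \<alpha>v s \<noteq> 0 \<and> (\<exists>\<mu>. \<mu> \<noteq> 1 \<and> s (\<alpha>v s) = scale \<mu> (\<alpha>v s)))"

definition conj_invariant ::
    "(complex \<Rightarrow> 'h::ab_group_add \<Rightarrow> 'h) \<Rightarrow> ('h \<Rightarrow> 'h) set \<Rightarrow> (('h \<Rightarrow> 'h) \<Rightarrow> complex) \<Rightarrow> bool" where
  "conj_invariant scale W c \<longleftrightarrow>
     (\<forall>s\<in>reflections scale W. \<forall>w\<in>W.
        c (w \<otimes>\<^bsub>GL scale\<^esub> s \<otimes>\<^bsub>GL scale\<^esub> inv\<^bsub>GL scale\<^esub> w) = c s)"

text \<open>A (not necessarily commutative) complex algebra is a ring record together with the scalar
  multiplication of \<^typ>\<open>(complex, 'a) module\<close>.\<close>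

definition quot_class :: "('a, 'm) ring_scheme \<Rightarrow> 'a set \<Rightarrow> 'a \<Rightarrow> 'a set" where
  "quot_class A I x = I +>\<^bsub>A\<^esub> x"

definition quot_alg :: "(complex, 'a) module \<Rightarrow> 'a set \<Rightarrow> (complex, 'a set) module" where
  "quot_alg A I = ring.extend (A Quot I)
     (module.fields (\<lambda>z C. \<Union>x\<in>C. quot_class A I (z \<odot>\<^bsub>A\<^esub> x)))"

definition subalg :: "(complex, 'a) module \<Rightarrow> 'a set \<Rightarrow> bool" where
  "subalg A B \<longleftrightarrow> subring B A \<and> (\<forall>z. \<forall>x\<in>B. z \<odot>\<^bsub>A\<^esub> x \<in> B)"

definition subalg_gen :: "(complex, 'a) module \<Rightarrow> 'a set \<Rightarrow> 'a set" where
  "subalg_gen A S = \<Inter>{B. subalg A B \<and> S \<subseteq> B}"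

definition corner :: "(complex, 'a) module \<Rightarrow> 'a \<Rightarrow> (complex, 'a) module" where
  "corner A p = A\<lparr>carrier := {p \<otimes>\<^bsub>A\<^esub> x \<otimes>\<^bsub>A\<^esub> p | x. x \<in> carrier A}, one := p\<rparr>"

definition left_ideal_gen :: "(complex, 'a) module \<Rightarrow> 'a \<Rightarrow> 'a set" where
  "left_ideal_gen A p = {x \<otimes>\<^bsub>A\<^esub> p | x. x \<in> carrier A}"

definition alg_iso ::
    "(complex, 'a) module \<Rightarrow> (complex, 'b) module \<Rightarrow> ('a \<Rightarrow> 'b) set" where
  "alg_iso A B =
     {f \<in> ring_iso A B. \<forall>z. \<forall>x\<in>carrier A. f (z \<odot>\<^bsub>A\<^esub> x) = z \<odot>\<^bsub>B\<^esub> f x}"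

text \<open>For \<open>M \<subseteq> A\<close> stable under right multiplication by \<open>B \<subseteq> A\<close>: the algebra of endomorphisms of the
  right \<open>B\<close>-module \<open>M\<close>. When \<open>M = A p\<close> and \<open>B = p A p\<close>, complex linearity of an endomorphism follows
  from \<open>B\<close>-linearity, since \<open>z p \<in> B\<close> acts on \<open>M\<close> as the scalar \<open>z\<close>.\<close>

definition right_End :: "(complex, 'a) module \<Rightarrow> 'a set \<Rightarrow> 'a set \<Rightarrow> (complex, 'a \<Rightarrow> 'a) module" where
  "right_End A B M =
     \<lparr>carrier = {\<phi> \<in> M \<rightarrow>\<^sub>E M.
        (\<forall>m\<in>M. \<forall>m'\<in>M. \<phi> (m \<oplus>\<^bsub>A\<^esub> m') = \<phi> m \<oplus>\<^bsub>A\<^esub> \<phi> m') \<and>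
        (\<forall>m\<in>M. \<forall>b\<in>B. \<phi> (m \<otimes>\<^bsub>A\<^esub> b) = \<phi> m \<otimes>\<^bsub>A\<^esub> b)},
      monoid.mult = (\<lambda>\<phi> \<psi>. \<lambda>m\<in>M. \<phi> (\<psi> m)),
      one = (\<lambda>m\<in>M. m),
      zero = (\<lambda>m\<in>M. \<zero>\<^bsub>A\<^esub>),
      add = (\<lambda>\<phi> \<psi>. \<lambda>m\<in>M. \<phi> m \<oplus>\<^bsub>A\<^esub> \<psi> m),
      smult = (\<lambda>z \<phi>. \<lambda>m\<in>M. z \<odot>\<^bsub>A\<^esub> \<phi> m)\<rparr>"

definition left_mult :: "(complex, 'a) module \<Rightarrow> 'a set \<Rightarrow> 'a \<Rightarrow> 'a \<Rightarrow> 'a" where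
  "left_mult A M x = (\<lambda>m\<in>M. x \<otimes>\<^bsub>A\<^esub> m)"

datatype 'v fword = FWord (letters: "'v list")

instantiation fword :: (type) monoid_add
begin

definition zero_fword :: "'a fword" where "0 = FWord []"

definition plus_fword :: "'a fword \<Rightarrow> 'a fword \<Rightarrow> 'a fword" where
  "u + v = FWord (letters u @ letters v)"

instance by standard (simp_all add: zero_fword_def plus_fword_def)

end

text \<open>The product of \<^typ>\<open>'v fword \<Rightarrow>\<^sub>0 complex\<close> is convolution with respect to \<open>+\<close> on words, so
  this type is the free algebra on all of \<open>'v\<close>.\<close>

definition free_alg :: "'v set \<Rightarrow> (complex, 'v fword \<Rightarrow>\<^sub>0 complex) module" where
  "free_alg V =
     \<lparr>carrier = {p. \<forall>w\<in>Poly_Mapping.keys p. set (letters w) \<subseteq> V},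
      monoid.mult = (*), one = 1, zero = 0, add = (+),
      smult = (\<lambda>z p. Poly_Mapping.single 0 z * p)\<rparr>"

definition free_gen :: "'v \<Rightarrow> 'v fword \<Rightarrow>\<^sub>0 complex" where
  "free_gen v = Poly_Mapping.single (FWord [v]) 1"

definition free_map :: "('v \<Rightarrow> 'v) \<Rightarrow> ('v fword \<Rightarrow>\<^sub>0 complex) \<Rightarrow> ('v fword \<Rightarrow>\<^sub>0 complex)" where
  "free_map \<phi> p =
     (\<Sum>w\<in>Poly_Mapping.keys p. Poly_Mapping.single (FWord (map \<phi> (letters w))) (Poly_Mapping.lookup p w))"

text \<open>Only the additive group and the scalar multiplication of \<open>V\<close> are used.\<close>

definition tensor_rel :: "(complex, 'v) module \<Rightarrow> ('v fword \<Rightarrow>\<^sub>0 complex) set" where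
  "tensor_rel V = Idl\<^bsub>free_alg (carrier V)\<^esub>
     ({free_gen (u \<oplus>\<^bsub>V\<^esub> v) - (free_gen u + free_gen v) | u v. u \<in> carrier V \<and> v \<in> carrier V} \<union>
      {free_gen (z \<odot>\<^bsub>V\<^esub> v) - Poly_Mapping.single 0 z * free_gen v | z v. v \<in> carrier V})"

definition tensor_alg :: "(complex, 'v) module \<Rightarrow> (complex, ('v fword \<Rightarrow>\<^sub>0 complex) set) module" where
  "tensor_alg V = quot_alg (free_alg (carrier V)) (tensor_rel V)"

definition tensor_gen :: "(complex, 'v) module \<Rightarrow> 'v \<Rightarrow> ('v fword \<Rightarrow>\<^sub>0 complex) set" where
  "tensor_gen V v = quot_class (free_alg (carrier V)) (tensor_rel V) (free_gen v)"

definition tensor_map :: "(complex, 'v) module \<Rightarrow> ('v \<Rightarrow> 'v) \<Rightarrow>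
    ('v fword \<Rightarrow>\<^sub>0 complex) set \<Rightarrow> ('v fword \<Rightarrow>\<^sub>0 complex) set" where
  "tensor_map V \<phi> C = (\<Union>p\<in>C. quot_class (free_alg (carrier V)) (tensor_rel V) (free_map \<phi> p))"

text \<open>\<open>B \<rtimes> G\<close> for a finite group \<open>G\<close> acting on \<open>B\<close>: the function \<open>f\<close> stands for
  \<open>\<Sum>w. f w \<cdot> w\<close>, and \<open>(a u) (b v) = a (u b) (u v)\<close>.\<close>

definition crossed_product ::
    "(complex, 'b) module \<Rightarrow> 'g monoid \<Rightarrow> ('g \<Rightarrow> 'b \<Rightarrow> 'b) \<Rightarrow> (complex, 'g \<Rightarrow> 'b) module" where
  "crossed_product B G act =
     \<lparr>carrier = carrier G \<rightarrow>\<^sub>E carrier B,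
      monoid.mult = (\<lambda>f g. \<lambda>w\<in>carrier G.
        \<Oplus>\<^bsub>B\<^esub>u\<in>carrier G. f u \<otimes>\<^bsub>B\<^esub> act u (g (inv\<^bsub>G\<^esub> u \<otimes>\<^bsub>G\<^esub> w))),
      one = (\<lambda>w\<in>carrier G. if w = \<one>\<^bsub>G\<^esub> then \<one>\<^bsub>B\<^esub> else \<zero>\<^bsub>B\<^esub>),
      zero = (\<lambda>w\<in>carrier G. \<zero>\<^bsub>B\<^esub>),
      add = (\<lambda>f g. \<lambda>w\<in>carrier G. f w \<oplus>\<^bsub>B\<^esub> g w),
      smult = (\<lambda>z f. \<lambda>w\<in>carrier G. z \<odot>\<^bsub>B\<^esub> f w)\<rparr>"

definition crossed_elem :: "(complex, 'b) module \<Rightarrow> 'g monoid \<Rightarrow> 'b \<Rightarrow> 'g \<Rightarrow> 'g \<Rightarrow> 'b" where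
  "crossed_elem B G b g = (\<lambda>w\<in>carrier G. if w = g then b else \<zero>\<^bsub>B\<^esub>)"

type_synonym 'h hh = "'h \<times> ('h \<Rightarrow> complex)"
type_synonym 'h smash = "('h \<Rightarrow> 'h) \<Rightarrow> ('h hh fword \<Rightarrow>\<^sub>0 complex) set"

text \<open>\<open>\<hh> \<oplus> \<hh>\<^sup>*\<close>; the ring multiplication and unit of the record are irrelevant.\<close>

definition hh_space :: "(complex \<Rightarrow> 'h::ab_group_add \<Rightarrow> 'h) \<Rightarrow> (complex, 'h hh) module" where
  "hh_space scale =
     \<lparr>carrier = UNIV \<times> dual_space scale,
      monoid.mult = undefined, one = undefined,
      zero = (0, \<lambda>_. 0),
      add = (\<lambda>(y, x) (y', x'). (y + y', \<lambda>v. x v + x' v)),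
      smult = (\<lambda>z (y, x). (scale z y, \<lambda>v. z * x v))\<rparr>"

definition smash_alg ::
    "(complex \<Rightarrow> 'h::ab_group_add \<Rightarrow> 'h) \<Rightarrow> ('h \<Rightarrow> 'h) set \<Rightarrow> (complex, 'h smash) module" where
  "smash_alg scale W =
     crossed_product (tensor_alg (hh_space scale)) (GL scale\<lparr>carrier := W\<rparr>)
       (\<lambda>w. tensor_map (hh_space scale) (\<lambda>(y, x). (w y, dual_action w x)))"

definition smash_hh ::
    "(complex \<Rightarrow> 'h::ab_group_add \<Rightarrow> 'h) \<Rightarrow> ('h \<Rightarrow> 'h) set \<Rightarrow> 'h hh \<Rightarrow> 'h smash" where
  "smash_hh scale W v =
     crossed_elem (tensor_alg (hh_space scale)) (GL scale\<lparr>carrier := W\<rparr>)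
       (tensor_gen (hh_space scale) v) \<one>\<^bsub>GL scale\<^esub>"

definition smash_y ::
    "(complex \<Rightarrow> 'h::ab_group_add \<Rightarrow> 'h) \<Rightarrow> ('h \<Rightarrow> 'h) set \<Rightarrow> 'h \<Rightarrow> 'h smash" where
  "smash_y scale W y = smash_hh scale W (y, \<lambda>_. 0)"

definition smash_x ::
    "(complex \<Rightarrow> 'h::ab_group_add \<Rightarrow> 'h) \<Rightarrow> ('h \<Rightarrow> 'h) set \<Rightarrow> ('h \<Rightarrow> complex) \<Rightarrow> 'h smash" where
  "smash_x scale W x = smash_hh scale W (0, x)"

definition smash_w ::
    "(complex \<Rightarrow> 'h::ab_group_add \<Rightarrow> 'h) \<Rightarrow> ('h \<Rightarrow> 'h) set \<Rightarrow> ('h \<Rightarrow> 'h) \<Rightarrow> 'h smash" where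
  "smash_w scale W w =
     crossed_elem (tensor_alg (hh_space scale)) (GL scale\<lparr>carrier := W\<rparr>)
       \<one>\<^bsub>tensor_alg (hh_space scale)\<^esub> w"

definition commutator :: "(complex, 'a) module \<Rightarrow> 'a \<Rightarrow> 'a \<Rightarrow> 'a" where
  "commutator A a b = a \<otimes>\<^bsub>A\<^esub> b \<ominus>\<^bsub>A\<^esub> b \<otimes>\<^bsub>A\<^esub> a"

definition cherednik_rel ::
    "(complex \<Rightarrow> 'h::ab_group_add \<Rightarrow> 'h) \<Rightarrow> ('h \<Rightarrow> 'h) set \<Rightarrow> (('h \<Rightarrow> 'h) \<Rightarrow> 'h \<Rightarrow> complex) \<Rightarrow>
      (('h \<Rightarrow> 'h) \<Rightarrow> 'h) \<Rightarrow> complex \<Rightarrow> (('h \<Rightarrow> 'h) \<Rightarrow> complex) \<Rightarrow> 'h smash set" where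
  "cherednik_rel scale W \<alpha> \<alpha>v t c = (let K = smash_alg scale W;
       xx = smash_x scale W; yy = smash_y scale W in
     Idl\<^bsub>K\<^esub>
      ({commutator K (xx x) (xx x') | x x'. x \<in> dual_space scale \<and> x' \<in> dual_space scale} \<union>
       {commutator K (yy y) (yy y') | y y'. True} \<union>
       {commutator K (yy y) (xx x) \<ominus>\<^bsub>K\<^esub>
          ((t * x y) \<odot>\<^bsub>K\<^esub> \<one>\<^bsub>K\<^esub> \<ominus>\<^bsub>K\<^esub>
           (\<Oplus>\<^bsub>K\<^esub>s\<in>reflections scale W.
             (2 * c s / \<alpha> s (\<alpha>v s) * x (\<alpha>v s) * \<alpha> s y) \<odot>\<^bsub>K\<^esub> smash_w scale W s))
        | x y. x \<in> dual_space scale}))"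

definition cherednik ::
    "(complex \<Rightarrow> 'h::ab_group_add \<Rightarrow> 'h) \<Rightarrow> ('h \<Rightarrow> 'h) set \<Rightarrow> (('h \<Rightarrow> 'h) \<Rightarrow> 'h \<Rightarrow> complex) \<Rightarrow>
      (('h \<Rightarrow> 'h) \<Rightarrow> 'h) \<Rightarrow> complex \<Rightarrow> (('h \<Rightarrow> 'h) \<Rightarrow> complex) \<Rightarrow> (complex, 'h smash set) module" where
  "cherednik scale W \<alpha> \<alpha>v t c = quot_alg (smash_alg scale W) (cherednik_rel scale W \<alpha> \<alpha>v t c)"

definition cherednik_x ::
    "(complex \<Rightarrow> 'h::ab_group_add \<Rightarrow> 'h) \<Rightarrow> ('h \<Rightarrow> 'h) set \<Rightarrow> (('h \<Rightarrow> 'h) \<Rightarrow> 'h \<Rightarrow> complex) \<Rightarrow>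
      (('h \<Rightarrow> 'h) \<Rightarrow> 'h) \<Rightarrow> complex \<Rightarrow> (('h \<Rightarrow> 'h) \<Rightarrow> complex) \<Rightarrow> ('h \<Rightarrow> complex) \<Rightarrow> 'h smash set" where
  "cherednik_x scale W \<alpha> \<alpha>v t c x =
     quot_class (smash_alg scale W) (cherednik_rel scale W \<alpha> \<alpha>v t c) (smash_x scale W x)"

definition cherednik_y ::
    "(complex \<Rightarrow> 'h::ab_group_add \<Rightarrow> 'h) \<Rightarrow> ('h \<Rightarrow> 'h) set \<Rightarrow> (('h \<Rightarrow> 'h) \<Rightarrow> 'h \<Rightarrow> complex) \<Rightarrow>
      (('h \<Rightarrow> 'h) \<Rightarrow> 'h) \<Rightarrow> complex \<Rightarrow> (('h \<Rightarrow> 'h) \<Rightarrow> complex) \<Rightarrow> 'h \<Rightarrow> 'h smash set" where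
  "cherednik_y scale W \<alpha> \<alpha>v t c y =
     quot_class (smash_alg scale W) (cherednik_rel scale W \<alpha> \<alpha>v t c) (smash_y scale W y)"

definition cherednik_w ::
    "(complex \<Rightarrow> 'h::ab_group_add \<Rightarrow> 'h) \<Rightarrow> ('h \<Rightarrow> 'h) set \<Rightarrow> (('h \<Rightarrow> 'h) \<Rightarrow> 'h \<Rightarrow> complex) \<Rightarrow>
      (('h \<Rightarrow> 'h) \<Rightarrow> 'h) \<Rightarrow> complex \<Rightarrow> (('h \<Rightarrow> 'h) \<Rightarrow> complex) \<Rightarrow> ('h \<Rightarrow> 'h) \<Rightarrow> 'h smash set" where
  "cherednik_w scale W \<alpha> \<alpha>v t c w =
     quot_class (smash_alg scale W) (cherednik_rel scale W \<alpha> \<alpha>v t c) (smash_w scale W w)"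

text \<open>The basis \<open>y\<^sub>1, \<dots>, y\<^sub>n\<close> is given as a set \<open>Bs\<close> indexed by itself.\<close>

definition dual_basis :: "(complex \<Rightarrow> 'h::ab_group_add \<Rightarrow> 'h) \<Rightarrow> 'h set \<Rightarrow> 'h \<Rightarrow> 'h \<Rightarrow> complex" where
  "dual_basis scale Bs b = (\<lambda>v. module.representation scale Bs v b)"

definition cherednik_gl ::
    "(complex \<Rightarrow> 'h::ab_group_add \<Rightarrow> 'h) \<Rightarrow> 'h set \<Rightarrow> ('h \<Rightarrow> 'h) set \<Rightarrow> (('h \<Rightarrow> 'h) \<Rightarrow> 'h \<Rightarrow> complex) \<Rightarrow>
      (('h \<Rightarrow> 'h) \<Rightarrow> 'h) \<Rightarrow> complex \<Rightarrow> (('h \<Rightarrow> 'h) \<Rightarrow> complex) \<Rightarrow> (complex, 'h smash set) module" where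
  "cherednik_gl scale Bs W \<alpha> \<alpha>v t c = (let H = cherednik scale W \<alpha> \<alpha>v t c in
     H\<lparr>carrier := subalg_gen H
       ({cherednik_x scale W \<alpha> \<alpha>v t c (dual_basis scale Bs b) \<otimes>\<^bsub>H\<^esub> cherednik_y scale W \<alpha> \<alpha>v t c b'
          | b b'. b \<in> Bs \<and> b' \<in> Bs} \<union>
        cherednik_w scale W \<alpha> \<alpha>v t c ` W)\<rparr>)"

definition euler ::
    "(complex \<Rightarrow> 'h::ab_group_add \<Rightarrow> 'h) \<Rightarrow> 'h set \<Rightarrow> ('h \<Rightarrow> 'h) set \<Rightarrow> (('h \<Rightarrow> 'h) \<Rightarrow> 'h \<Rightarrow> complex) \<Rightarrow>
      (('h \<Rightarrow> 'h) \<Rightarrow> 'h) \<Rightarrow> (('h \<Rightarrow> 'h) \<Rightarrow> complex) \<Rightarrow> complex \<Rightarrow> (('h \<Rightarrow> 'h) \<Rightarrow> complex) \<Rightarrow>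
      'h smash set" where
  "euler scale Bs W \<alpha> \<alpha>v lam t c = (let H = cherednik scale W \<alpha> \<alpha>v t c in
     (\<Oplus>\<^bsub>H\<^esub>b\<in>Bs. cherednik_x scale W \<alpha> \<alpha>v t c (dual_basis scale Bs b)
                  \<otimes>\<^bsub>H\<^esub> cherednik_y scale W \<alpha> \<alpha>v t c b)
     \<ominus>\<^bsub>H\<^esub> (\<Oplus>\<^bsub>H\<^esub>s\<in>reflections scale W.
              (2 * c s / (1 - lam s)) \<odot>\<^bsub>H\<^esub> cherednik_w scale W \<alpha> \<alpha>v t c s))"

definition group_center :: "('h \<Rightarrow> 'h) set \<Rightarrow> ('h \<Rightarrow> 'h) set" where
  "group_center W = {z \<in> W. \<forall>w\<in>W. z \<circ> w = w \<circ> z}"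

definition average ::
    "(complex \<Rightarrow> 'h::ab_group_add \<Rightarrow> 'h) \<Rightarrow> ('h \<Rightarrow> 'h) set \<Rightarrow> (('h \<Rightarrow> 'h) \<Rightarrow> 'h \<Rightarrow> complex) \<Rightarrow>
      (('h \<Rightarrow> 'h) \<Rightarrow> 'h) \<Rightarrow> complex \<Rightarrow> (('h \<Rightarrow> 'h) \<Rightarrow> complex) \<Rightarrow> ('h \<Rightarrow> 'h) set \<Rightarrow> 'h smash set" where
  "average scale W \<alpha> \<alpha>v t c G = (let H = cherednik scale W \<alpha> \<alpha>v t c in
     (1 / of_nat (card G)) \<odot>\<^bsub>H\<^esub> (\<Oplus>\<^bsub>H\<^esub>w\<in>G. cherednik_w scale W \<alpha> \<alpha>v t c w))"

definition aHa ::
    "(complex \<Rightarrow> 'h::ab_group_add \<Rightarrow> 'h) \<Rightarrow> 'h set \<Rightarrow> ('h \<Rightarrow> 'h) set \<Rightarrow> (('h \<Rightarrow> 'h) \<Rightarrow> 'h \<Rightarrow> complex) \<Rightarrow>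
      (('h \<Rightarrow> 'h) \<Rightarrow> 'h) \<Rightarrow> complex \<Rightarrow> (('h \<Rightarrow> 'h) \<Rightarrow> complex) \<Rightarrow> (complex, 'h smash set) module" where
  "aHa scale Bs W \<alpha> \<alpha>v t c =
     corner (cherednik_gl scale Bs W \<alpha> \<alpha>v t c) (average scale W \<alpha> \<alpha>v t c (group_center W))"

definition A_rel ::
    "(complex \<Rightarrow> 'h::ab_group_add \<Rightarrow> 'h) \<Rightarrow> 'h set \<Rightarrow> ('h \<Rightarrow> 'h) set \<Rightarrow> (('h \<Rightarrow> 'h) \<Rightarrow> 'h \<Rightarrow> complex) \<Rightarrow>
      (('h \<Rightarrow> 'h) \<Rightarrow> 'h) \<Rightarrow> (('h \<Rightarrow> 'h) \<Rightarrow> complex) \<Rightarrow> complex \<Rightarrow> (('h \<Rightarrow> 'h) \<Rightarrow> complex) \<Rightarrow> complex \<Rightarrow>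
      'h smash set set" where
  "A_rel scale Bs W \<alpha> \<alpha>v lam t c \<zeta> = (let R = aHa scale Bs W \<alpha> \<alpha>v t c;
       a = average scale W \<alpha> \<alpha>v t c (group_center W) in
     Idl\<^bsub>R\<^esub> {a \<otimes>\<^bsub>R\<^esub> euler scale Bs W \<alpha> \<alpha>v lam t c \<ominus>\<^bsub>R\<^esub> \<zeta> \<odot>\<^bsub>R\<^esub> a})"

definition A_alg ::
    "(complex \<Rightarrow> 'h::ab_group_add \<Rightarrow> 'h) \<Rightarrow> 'h set \<Rightarrow> ('h \<Rightarrow> 'h) set \<Rightarrow> (('h \<Rightarrow> 'h) \<Rightarrow> 'h \<Rightarrow> complex) \<Rightarrow>
      (('h \<Rightarrow> 'h) \<Rightarrow> 'h) \<Rightarrow> (('h \<Rightarrow> 'h) \<Rightarrow> complex) \<Rightarrow> complex \<Rightarrow> (('h \<Rightarrow> 'h) \<Rightarrow> complex) \<Rightarrow> complex \<Rightarrow>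
      (complex, 'h smash set set) module" where
  "A_alg scale Bs W \<alpha> \<alpha>v lam t c \<zeta> =
     quot_alg (aHa scale Bs W \<alpha> \<alpha>v t c) (A_rel scale Bs W \<alpha> \<alpha>v lam t c \<zeta>)"

text \<open>The image of \<open>e\<close> in \<open>A\<close>; note \<open>e = a e a\<close>, so \<open>e\<close> lies in \<open>a H a\<close>.\<close>

definition A_e ::
    "(complex \<Rightarrow> 'h::ab_group_add \<Rightarrow> 'h) \<Rightarrow> 'h set \<Rightarrow> ('h \<Rightarrow> 'h) set \<Rightarrow> (('h \<Rightarrow> 'h) \<Rightarrow> 'h \<Rightarrow> complex) \<Rightarrow>
      (('h \<Rightarrow> 'h) \<Rightarrow> 'h) \<Rightarrow> (('h \<Rightarrow> 'h) \<Rightarrow> complex) \<Rightarrow> complex \<Rightarrow> (('h \<Rightarrow> 'h) \<Rightarrow> complex) \<Rightarrow> complex \<Rightarrow>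
      'h smash set set" where
  "A_e scale Bs W \<alpha> \<alpha>v lam t c \<zeta> =
     quot_class (aHa scale Bs W \<alpha> \<alpha>v t c) (A_rel scale Bs W \<alpha> \<alpha>v lam t c \<zeta>)
       (average scale W \<alpha> \<alpha>v t c W)"

end

theory Submission
  imports Defs "HOL-Computational_Algebra.Polynomial"
begin

text \<open>Let \<open>X\<close> be the cone of pairs \<open>(v, \<eta>)\<close> with \<open>\<langle>v, \<eta>\<rangle> = 0\<close>. By the PBW theorem, which follows from the action
 of \<open>H\<close> by Dunkl operators, \<open>A\<close> carries a filtration whose associated graded algebra consists of the
 \<open>Z(W)\<close>-invariant elements of the smash product of \<open>W\<close> with the functions of bidegree \<open>(k, k)\<close> on \<open>X\<close>:
 the Euler element has symbol \<open>\<langle>v, \<eta>\<rangle>\<close>. Since the functions on \<open>X\<close> are finite over the \<open>W\<close>-invariants, an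
 endomorphism \<open>\<phi>\<close> of \<open>A e\<close> over \<open>e A e\<close> has bounded degree \<open>d\<close>, hence a leading symbol, which is linear over
 the invariants. By Galois theory such a map is \<open>f \<mapsto> \<Sum>u. h\<^sub>u (f \<circ> u)\<close> with rational \<open>h\<^sub>u\<close>; as \<open>X\<close> is normal and
 the non-central elements of \<open>W\<close> fix only subsets of codimension at least two, the \<open>h\<^sub>u\<close> are regular of degree
 \<open>d\<close>. Lifting them to \<open>A\<close> and subtracting the left multiplication by the lift lowers \<open>d\<close>, and in negative
 degree \<open>\<phi> = 0\<close>.\<close>

text \<open>Everything happens in diagonal bidegrees \<open>(k, k)\<close>. By Schur's lemma a
  central element acts on \<open>v\<close> and on \<open>\<eta>\<close> by inverse scalars and is
  invisible there, whereas a non-central \<open>w\<close> has two distinct eigenvalues \<mu> and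
  \<nu>. With eigencoordinates x_a, x_b on the space and y_a, y_b on its dual, the functions x_a y_b
  and x_b y_a have the \<open>w\<close>-eigenvalues \<mu>/\<nu> and \<nu>/\<mu>, so both vanish on
  the fixed points of \<open>w\<close>. They form a regular pair on \<open>X\<close>, which takes
  the place of normality and of fields of fractions: a product with one factor for each non-central
  element serves as a denominator for all coefficients, each factor may be either member of its
  pair, and comparing all the choices removes the denominators. In dimension one the equation of
  \<open>X\<close> would be x y = 0, and in dimension two a coordinate hyperplane cuts
  \<open>X\<close> in two components, so that this case needs a parametrization of its own.
  Functions stand for polynomials throughout: over the complex numbers nothing is lost, and
  identities can be tested along lines.\<close>

type_synonym 'h pfun = "'h \<times> 'h \<Rightarrow> complex"
type_synonym 'h dfun = "'h \<Rightarrow> 'h \<Rightarrow> ('h \<Rightarrow> 'h) \<Rightarrow> complex"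
type_synonym 'h sym = "('h \<Rightarrow> 'h) \<Rightarrow> 'h \<times> 'h \<Rightarrow> complex"

abbreviation invf where "invf g \<equiv> inv_into UNIV g"
abbreviation keys where "keys \<equiv> Poly_Mapping.keys"
abbreviation lookup where "lookup \<equiv> Poly_Mapping.lookup"
abbreviation single where "single \<equiv> Poly_Mapping.single"

section \<open>Bihomogeneous functions\<close>

text \<open>The basis is declared orthonormal, which identifies the dual space with \<open>'h\<close> itself; a function on
 \<open>'h \<times> 'h\<close> is a function on \<open>\<hh> \<oplus> \<hh>\<^sup>*\<close>.\<close>

locale pairing_space = finite_dimensional_vector_space scale Bs
 for scale :: "complex \<Rightarrow> 'h::ab_group_add \<Rightarrow> 'h" (infixr "*s" 75) and Bs :: "'h set"
begin

definition pr :: "'h \<Rightarrow> 'h \<Rightarrow> complex" where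
 "pr u v = (\<Sum>b\<in>Bs. representation Bs u b * representation Bs v b)"

lemma in_span_Bs [simp]: "v \<in> span Bs"
 by (simp add: span_Basis)

lemma pr_sym: "pr u v = pr v u"
 by (simp add: pr_def mult.commute)

lemma pr_add_right: "pr u (v + w) = pr u v + pr u w"
 by (simp add: pr_def representation_add[OF independent_Basis] distrib_left sum.distrib)

lemma pr_scale_right: "pr u (c *s v) = c * pr u v"
 by (simp add: pr_def representation_scale[OF independent_Basis] sum_distrib_left mult_ac)

lemma pr_add_left: "pr (u + v) w = pr u w + pr v w"
 by (metis pr_add_right pr_sym)

lemma pr_scale_left: "pr (c *s u) v = c * pr u v"
 by (metis pr_scale_right pr_sym)

lemma pr_zero [simp]: "pr u 0 = 0" "pr 0 u = 0"
 by (simp_all add: pr_def representation_zero)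

lemma pr_neg_right: "pr u (- v) = - pr u v"
 using pr_add_right[of u v "-v"] by (simp add: eq_neg_iff_add_eq_0 add.commute)

lemma pr_neg_left: "pr (- u) v = - pr u v"
 by (metis pr_neg_right pr_sym)

lemma pr_diff_right: "pr u (v - w) = pr u v - pr u w"
 using pr_add_right[of u v "-w"] by (simp add: pr_neg_right)

lemma pr_diff_left: "pr (u - v) w = pr u w - pr v w"
 by (metis pr_diff_right pr_sym)

lemma pr_sum_right: "pr u (\<Sum>i\<in>I. f i) = (\<Sum>i\<in>I. pr u (f i))"
 by (induction I rule: infinite_finite_induct) (simp_all add: pr_add_right)

lemma pr_sum_left: "pr (\<Sum>i\<in>I. f i) u = (\<Sum>i\<in>I. pr (f i) u)"
 by (induction I rule: infinite_finite_induct) (simp_all add: pr_add_left)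

lemmas pr_simps = pr_add_right pr_scale_right pr_add_left pr_scale_left pr_diff_left pr_diff_right
 pr_neg_right pr_neg_left pr_sum_right pr_sum_left

lemma pr_Bs_left: "b \<in> Bs \<Longrightarrow> pr b v = representation Bs v b"
 by (simp add: pr_def representation_basis[OF independent_Basis] if_distrib[of "\<lambda>x. x * _"]
   sum.delta' finite_Basis cong: if_cong)

lemma pr_Bs: "b \<in> Bs \<Longrightarrow> b' \<in> Bs \<Longrightarrow> pr b b' = (if b = b' then 1 else 0)"
 by (simp add: pr_Bs_left representation_basis[OF independent_Basis])

lemma expand_Bs: "v = (\<Sum>b\<in>Bs. pr b v *s b)"
proof -
 have "v = (\<Sum>b\<in>Bs. representation Bs v b *s b)"
  by (rule sum_representation_eq[symmetric])
    (use finite_Basis independent_Basis in auto)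
 then show ?thesis by (simp add: pr_Bs_left)
qed

lemma pr_ext: "(\<And>u. pr u v = pr u w) \<Longrightarrow> v = w"
 by (metis (no_types, lifting) expand_Bs sum.cong)

lemma pr_ext_left: "(\<And>u. pr v u = pr w u) \<Longrightarrow> v = w"
 by (metis pr_ext pr_sym)

lemma functional_eq_pr:
 assumes "Vector_Spaces.linear scale (*) f"
 shows "f v = pr (\<Sum>b\<in>Bs. f b *s b) v"
proof -
 interpret f: Vector_Spaces.linear scale "(*)" f by fact
 have "f v = f (\<Sum>b\<in>Bs. pr b v *s b)" using expand_Bs[of v] by simp
 also have "\<dots> = (\<Sum>b\<in>Bs. pr b v * f b)" by (simp add: f.sum f.scale)
 finally show ?thesis by (simp add: pr_simps mult.commute)
qed

lemma linear_pr: "Vector_Spaces.linear scale (*) (pr u)"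
 by unfold_locales (auto simp: pr_simps algebra_simps)

lemma adjoint_exists:
 assumes "Vector_Spaces.linear scale scale g"
 shows "\<exists>u'. \<forall>v. pr u (g v) = pr u' v"
proof -
 interpret g: Vector_Spaces.linear scale scale g by fact
 have "Vector_Spaces.linear scale (*) (\<lambda>v. pr u (g v))"
  by unfold_locales (auto simp: pr_simps g.add g.scale algebra_simps)
 then show ?thesis using functional_eq_pr by blast
qed

text \<open>Degrees are integers so that they can be lowered freely; in negative degree only \<open>0\<close> remains.\<close>

inductive Pol :: "int \<Rightarrow> int \<Rightarrow> 'h pfun \<Rightarrow> bool" where
 Pol_zero: "Pol k l (\<lambda>_. 0)"
| Pol_const: "Pol 0 0 (\<lambda>_. c)"
| Pol_add: "Pol k l P \<Longrightarrow> Pol k l Q \<Longrightarrow> Pol k l (\<lambda>p. P p + Q p)"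
| Pol_x: "Pol k l P \<Longrightarrow> Pol (k + 1) l (\<lambda>p. pr u (fst p) * P p)"
| Pol_y: "Pol k l P \<Longrightarrow> Pol k (l + 1) (\<lambda>p. pr u (snd p) * P p)"

lemma Pol_cong: "Pol k l P \<Longrightarrow> k = k' \<Longrightarrow> l = l' \<Longrightarrow> (\<And>p. P p = Q p) \<Longrightarrow> Pol k' l' Q"
 by (metis ext)

lemma Pol_smult: "Pol k l P \<Longrightarrow> Pol k l (\<lambda>p. c * P p)"
proof (induction rule: Pol.induct)
 case (Pol_zero k l)
 then show ?case using Pol.Pol_zero by simp
next
 case (Pol_const d)
 then show ?case by (rule Pol.Pol_const)
next
 case (Pol_add k l P Q)
 then show ?case using Pol.Pol_add[of k l "\<lambda>p. c * P p" "\<lambda>p. c * Q p"] by (simp add: distrib_left)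
next
 case (Pol_x k l P u)
 then show ?case using Pol.Pol_x[of k l "\<lambda>p. c * P p" u] by (simp add: mult_ac)
next
 case (Pol_y k l P u)
 then show ?case using Pol.Pol_y[of k l "\<lambda>p. c * P p" u] by (simp add: mult_ac)
qed

lemma Pol_uminus: "Pol k l P \<Longrightarrow> Pol k l (\<lambda>p. - P p)"
 using Pol_smult[of k l P "-1"] by simp

lemma Pol_diff: "Pol k l P \<Longrightarrow> Pol k l Q \<Longrightarrow> Pol k l (\<lambda>p. P p - Q p)"
 using Pol_add[OF _ Pol_uminus, of k l P Q] by simp

lemma Pol_sum: "(\<And>i. i \<in> I \<Longrightarrow> Pol k l (f i)) \<Longrightarrow> Pol k l (\<lambda>p. \<Sum>i\<in>I. f i p)"
 by (induction I rule: infinite_finite_induct) (auto intro: Pol_zero Pol_add)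

lemma Pol_mult: "Pol k l P \<Longrightarrow> Pol k' l' Q \<Longrightarrow> Pol (k + k') (l + l') (\<lambda>p. P p * Q p)"
proof (induction rule: Pol.induct)
 case (Pol_zero k l)
 then show ?case using Pol.Pol_zero by simp
next
 case (Pol_const d)
 then show ?case by (simp add: Pol_smult)
next
 case (Pol_add k l P Q')
 then show ?case using Pol.Pol_add[of "k+k'" "l+l'" "\<lambda>p. P p * Q p" "\<lambda>p. Q' p * Q p"]
  by (simp add: distrib_right)
next
 case (Pol_x k l P u)
 show ?case by (rule Pol_cong[OF Pol.Pol_x[OF Pol_x.IH[OF Pol_x.prems], of u]]) auto
next
 case (Pol_y k l P u)
 show ?case by (rule Pol_cong[OF Pol.Pol_y[OF Pol_y.IH[OF Pol_y.prems], of u]]) auto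
qed

lemma Pol_x1: "Pol 1 0 (\<lambda>p. pr u (fst p))"
 using Pol_x[OF Pol_const[of 1], of u] by simp

lemma Pol_y1: "Pol 0 1 (\<lambda>p. pr u (snd p))"
 using Pol_y[OF Pol_const[of 1], of u] by simp

lemma Pol_xy: "Pol 1 1 (\<lambda>p. pr u (fst p) * pr u' (snd p))"
 using Pol_mult[OF Pol_x1 Pol_y1] by simp

lemma Pol_power: "Pol 1 1 P \<Longrightarrow> Pol (int n) (int n) (\<lambda>p. P p ^ n)"
proof (induction n)
 case 0
 then show ?case using Pol_const[of 1] by simp
next
 case (Suc n)
 then show ?case using Pol_mult[of 1 1 P "int n" "int n" "\<lambda>p. P p ^ n"] by (simp add: add.commute)
qed

lemma Pol_neg: "Pol k l P \<Longrightarrow> k < 0 \<or> l < 0 \<Longrightarrow> P = (\<lambda>_. 0)"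
 by (induction rule: Pol.induct) auto

lemma Pol_swap: "Pol k l P \<Longrightarrow> Pol l k (\<lambda>p. P (snd p, fst p))"
 by (induction rule: Pol.induct) (auto intro: Pol.intros)

text \<open>The scalar 0 is allowed, with 0^0 = 1. This is how a function of degree 0 in one
  variable is seen to be independent of that variable.\<close>

lemma Pol_hom: "Pol k l P \<Longrightarrow> P (c *s v, d *s \<eta>) = c ^ nat k * d ^ nat l * P (v, \<eta>)"
proof (induction rule: Pol.induct)
 case (Pol_x k l P u)
 then show ?case
  by (cases "k < 0") (auto dest: Pol_neg simp: pr_simps nat_add_distrib)
next
 case (Pol_y k l P u)
 then show ?case
  by (cases "l < 0") (auto dest: Pol_neg simp: pr_simps nat_add_distrib)
qed (auto simp: algebra_simps)

text \<open>Restriction to a line turns identities between functions into identities between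
  univariate polynomials. The degree bound serves the curve that parametrizes \<open>X\<close> in
  dimension two.\<close>

lemma Pol_line: "Pol k l P \<Longrightarrow>
 \<exists>r. degree r \<le> nat (k + l) \<and> (\<forall>T. P (v + T *s v', \<eta> + T *s \<eta>') = poly r T)"
proof (induction rule: Pol.induct)
 case (Pol_zero k l)
 then show ?case by (intro exI[of _ 0]) auto
next
 case (Pol_const c)
 then show ?case by (intro exI[of _ "[:c:]"]) auto
next
 case (Pol_add k l P Q)
 then obtain r r' where "degree r \<le> nat (k + l)" "\<forall>T. P (v + T *s v', \<eta> + T *s \<eta>') = poly r T"
  "degree r' \<le> nat (k + l)" "\<forall>T. Q (v + T *s v', \<eta> + T *s \<eta>') = poly r' T" by blast
 then show ?case by (intro exI[of _ "r + r'"]) (auto intro: degree_add_le)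
next
 case (Pol_x k l P u)
 show ?case
 proof (cases "k < 0 \<or> l < 0")
  case True
  then have "P = (\<lambda>_. 0)" using Pol_neg Pol_x.hyps by blast
  then show ?thesis by (intro exI[of _ 0]) auto
 next
  case False
  obtain r where r: "degree r \<le> nat (k + l)" "\<forall>T. P (v + T *s v', \<eta> + T *s \<eta>') = poly r T"
   using Pol_x.IH by blast
  have "degree ([:pr u v, pr u v':] * r) \<le> 1 + degree r"
   using degree_mult_le[of "[:pr u v, pr u v':]" r] degree_pCons_le[of "pr u v" "[:pr u v':]"]
   by (smt (verit, best) One_nat_def add_mono degree_pCons_0 le_trans order_refl)
  with r False show ?thesis
   by (intro exI[of _ "[:pr u v, pr u v':] * r"]) (auto simp: pr_simps algebra_simps)
 qed
next
 case (Pol_y k l P u)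
 show ?case
 proof (cases "k < 0 \<or> l < 0")
  case True
  then have "P = (\<lambda>_. 0)" using Pol_neg Pol_y.hyps by blast
  then show ?thesis by (intro exI[of _ 0]) auto
 next
  case False
  obtain r where r: "degree r \<le> nat (k + l)" "\<forall>T. P (v + T *s v', \<eta> + T *s \<eta>') = poly r T"
   using Pol_y.IH by blast
  have "degree ([:pr u \<eta>, pr u \<eta>':] * r) \<le> 1 + degree r"
   using degree_mult_le[of "[:pr u \<eta>, pr u \<eta>':]" r] degree_pCons_le[of "pr u \<eta>" "[:pr u \<eta>':]"]
   by (smt (verit, best) One_nat_def add_mono degree_pCons_0 le_trans order_refl)
  with r False show ?thesis
   by (intro exI[of _ "[:pr u \<eta>, pr u \<eta>':] * r"]) (auto simp: pr_simps algebra_simps)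
 qed
qed

text \<open>An affine subspace is irreducible: on the line from \<open>p\<close> to
  \<open>p0\<close> both functions are univariate polynomials, and that of \<open>Q\<close> is not
  zero because it is not zero at \<open>T = 1\<close>.\<close>

lemma Pol_dense:
 assumes P: "Pol k l P" and Q: "Pol k' l' Q"
  and L: "\<And>v \<eta> v' \<eta>' T. (v, \<eta>) \<in> L \<Longrightarrow> (v', \<eta>') \<in> L \<Longrightarrow> (v + T *s (v' - v), \<eta> + T *s (\<eta>' - \<eta>)) \<in> L"
  and PQ: "\<And>p. p \<in> L \<Longrightarrow> Q p * P p = 0" and p0: "p0 \<in> L" "Q p0 \<noteq> 0" and p: "p \<in> L"
 shows "P p = 0"
proof -
 obtain v \<eta> v' \<eta>' where pp: "p = (v, \<eta>)" "p0 = (v', \<eta>')" by (cases p, cases p0)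
 obtain r where r: "\<And>T. P (v + T *s (v' - v), \<eta> + T *s (\<eta>' - \<eta>)) = poly r T"
  using Pol_line[OF P] by blast
 obtain s where s: "\<And>T. Q (v + T *s (v' - v), \<eta> + T *s (\<eta>' - \<eta>)) = poly s T"
  using Pol_line[OF Q] by blast
 have "poly (s * r) T = 0" for T
  using PQ[OF L, of v \<eta> v' \<eta>' T] p p0 pp by (simp add: r s)
 then have "s * r = 0" using poly_all_0_iff_0 by blast
 moreover have "poly s 1 \<noteq> 0" using s[of 1] p0 pp by simp
 ultimately have "r = 0" by auto
 then show ?thesis using r[of 0] pp by simp
qed

lemma Pol_cancel:
 assumes "Pol k l P" "Pol k' l' Q" "\<And>p. Q p * P p = 0" "Q p0 \<noteq> 0"
 shows "P p = 0"
 using Pol_dense[of k l P k' l' Q UNIV p0 p] assms by simp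

lemma Pol_comp:
 assumes P: "Pol k l P" and A: "\<And>u. \<exists>u'. \<forall>v. pr u (A v) = pr u' v" and B: "\<And>u. \<exists>u'. \<forall>v. pr u (B v) = pr u' v"
 shows "Pol k l (\<lambda>p. P (A (fst p), B (snd p)))"
 using P
proof (induction rule: Pol.induct)
 case (Pol_x k l P u)
 obtain u' where "\<forall>v. pr u (A v) = pr u' v" using A by blast
 then show ?case using Pol.Pol_x[OF Pol_x.IH, of u'] by simp
next
 case (Pol_y k l P u)
 obtain u' where "\<forall>v. pr u (B v) = pr u' v" using B by blast
 then show ?case using Pol.Pol_y[OF Pol_y.IH, of u'] by simp
qed (auto intro: Pol.intros)

lemma Pol_proj_x:
 assumes "Pol k l P"
 shows "Pol k l (\<lambda>p. P (fst p - pr a (fst p) *s a', snd p))"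
proof -
 have "Pol k l (\<lambda>p. P ((\<lambda>v. v - pr a v *s a') (fst p), (\<lambda>v. v) (snd p)))"
 proof (rule Pol_comp[OF assms])
  fix u
  show "\<exists>u'. \<forall>v. pr u (v - pr a v *s a') = pr u' v"
   by (intro exI[of _ "u - pr u a' *s a"]) (simp add: pr_simps)
 qed auto
 then show ?thesis by simp
qed

text \<open>Factor theorem for the linear form of \<open>a\<close>: modulo this form every function
  equals its pullback along the projection \<open>v - pr a v *s a'\<close> onto the kernel.\<close>

lemma Pol_div_x:
 assumes P: "Pol k l P" and aa: "pr a a' = 1" and van: "\<And>p. pr a (fst p) = 0 \<Longrightarrow> P p = 0"
 shows "\<exists>P'. Pol (k - 1) l P' \<and> (\<forall>p. P p = pr a (fst p) * P' p)"
proof -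
 \<comment> \<open>The vanishing hypothesis is not inherited by the constituents of
   \<open>P\<close>, so the induction proves division with remainder instead.\<close>
 have "\<exists>P'. Pol (k - 1) l P' \<and>
   (\<forall>p. P p = P (fst p - pr a (fst p) *s a', snd p) + pr a (fst p) * P' p)"
  using P
 proof (induction rule: Pol.induct)
  case (Pol_zero k l)
  then show ?case by (intro exI[of _ "\<lambda>_. 0"]) (auto intro: Pol.Pol_zero)
 next
  case (Pol_const c)
  then show ?case by (intro exI[of _ "\<lambda>_. 0"]) (auto intro: Pol.Pol_zero)
 next
  case (Pol_add k l P Q)
  then obtain P' Q' where "Pol (k - 1) l P'" "Pol (k - 1) l Q'"
   and eq: "\<And>p. P p = P (fst p - pr a (fst p) *s a', snd p) + pr a (fst p) * P' p"
    "\<And>p. Q p = Q (fst p - pr a (fst p) *s a', snd p) + pr a (fst p) * Q' p" by metis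
  then have 1: "Pol (k - 1) l (\<lambda>p. P' p + Q' p)" by (intro Pol.Pol_add)
  have "P p + Q p = P (fst p - pr a (fst p) *s a', snd p) + Q (fst p - pr a (fst p) *s a', snd p)
     + pr a (fst p) * (P' p + Q' p)" for p
   using eq[of p] by (simp add: algebra_simps)
  then show ?case
   by (intro exI[of _ "\<lambda>p. P' p + Q' p"] conjI 1) blast
 next
  case (Pol_x k l P u)
  then obtain P' where P': "Pol (k - 1) l P'"
   and eq: "\<And>p. P p = P (fst p - pr a (fst p) *s a', snd p) + pr a (fst p) * P' p" by metis
  have 1: "Pol (k + 1 - 1) l (\<lambda>p. pr u a' * P p + (pr (u - pr u a' *s a) (fst p) * P' p))"
   using Pol.Pol_add[OF Pol_smult[OF Pol_x.hyps] Pol_cong[OF Pol.Pol_x[OF P'] _ refl refl]] by simp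
  have "pr u (fst p) * P p = pr u (fst p - pr a (fst p) *s a') * P (fst p - pr a (fst p) *s a', snd p)
    + pr a (fst p) * (pr u a' * P p + (pr (u - pr u a' *s a) (fst p) * P' p))" for p
   using eq[of p] by (simp add: pr_simps algebra_simps)
  then show ?case
   by (intro exI[of _ "\<lambda>p. pr u a' * P p + (pr (u - pr u a' *s a) (fst p) * P' p)"] conjI 1)
    (simp only: fst_conv snd_conv, blast)
 next
  case (Pol_y k l P u)
  then obtain P' where P': "Pol (k - 1) l P'"
   and eq: "\<And>p. P p = P (fst p - pr a (fst p) *s a', snd p) + pr a (fst p) * P' p" by metis
  have "pr u (snd p) * P p = pr u (snd p) * P (fst p - pr a (fst p) *s a', snd p)
    + pr a (fst p) * (pr u (snd p) * P' p)" for p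
   using eq[of p] by (simp add: algebra_simps)
  then show ?case
   by (intro exI[of _ "\<lambda>p. pr u (snd p) * P' p"] conjI Pol.Pol_y[OF P'])
    (simp only: fst_conv snd_conv, blast)
 qed
 then obtain P' where P': "Pol (k - 1) l P'"
  and eq: "\<And>p. P p = P (fst p - pr a (fst p) *s a', snd p) + pr a (fst p) * P' p" by blast
 have "P (fst p - pr a (fst p) *s a', snd p) = 0" for p
  by (rule van) (simp add: pr_simps aa)
 then have "P p = pr a (fst p) * P' p" for p using eq[of p] by simp
 with P' show ?thesis by blast
qed

text \<open>The functions \<open>pr (e' i) \<circ> fst\<close> and
  \<open>pr (e i) \<circ> snd\<close> are the coordinates x_i and y_i of a pair of dual bases. Bases
  other than \<open>Bs\<close> are needed so that they can contain eigenvectors of a given group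
  element.\<close>

definition dualb :: "'i set \<Rightarrow> ('i \<Rightarrow> 'h) \<Rightarrow> ('i \<Rightarrow> 'h) \<Rightarrow> bool" where
 "dualb J e e' \<longleftrightarrow> finite J \<and> (\<forall>i\<in>J. \<forall>j\<in>J. pr (e' i) (e j) = (if i = j then 1 else 0)) \<and>
   (\<forall>v. (\<Sum>i\<in>J. pr (e' i) v *s e i) = v) \<and> (\<forall>v. (\<Sum>i\<in>J. pr (e i) v *s e' i) = v)"

lemma dualb_swap: "dualb J e e' \<Longrightarrow> dualb J e' e"
 unfolding dualb_def using pr_sym by metis

lemma dualb_Bs: "dualb Bs id id"
 unfolding dualb_def using finite_Basis expand_Bs[symmetric] by (simp add: pr_Bs)

lemma dualb_pr:
 assumes "dualb J e e'"
 shows "pr v w = (\<Sum>i\<in>J. pr (e' i) v * pr (e i) w)"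
proof -
 have "pr v w = pr (\<Sum>i\<in>J. pr (e' i) v *s e i) w"
  using assms by (simp add: dualb_def)
 also have "\<dots> = (\<Sum>i\<in>J. pr (e' i) v * pr (e i) w)"
  by (simp only: pr_sum_left pr_scale_left)
 finally show ?thesis .
qed

text \<open>The partial sum of x_i y_i over \<open>I\<close>. For \<open>I = J\<close> it is the
  equation of \<open>X\<close>; for \<open>I = J - {c}\<close> it is the equation that remains on
  the hyperplane x_c = 0.\<close>

definition qI :: "('i \<Rightarrow> 'h) \<Rightarrow> ('i \<Rightarrow> 'h) \<Rightarrow> 'i set \<Rightarrow> 'h pfun" where
 "qI e e' I p = (\<Sum>i\<in>I. pr (e' i) (fst p) * pr (e i) (snd p))"

definition X :: "('h \<times> 'h) set" where "X = {p. pr (fst p) (snd p) = 0}"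

lemma X_qI: "dualb J e e' \<Longrightarrow> p \<in> X \<longleftrightarrow> qI e e' J p = 0"
 by (simp only: X_def mem_Collect_eq qI_def dualb_pr[of J e e', symmetric])

lemma qI_swap: "qI e e' I (snd p, fst p) = qI e' e I p"
 by (simp add: qI_def mult.commute)

lemma Pol_qI: "Pol 1 1 (qI e e' I)"
 unfolding qI_def[abs_def] by (rule Pol_sum, rule Pol_xy)

end

section \<open>Division on the quadric cone\<close>

context pairing_space
begin

lemma Pol_xpow: "Pol (int n) 0 (\<lambda>p. pr u (fst p) ^ n)"
proof (induction n)
 case 0
 then show ?case using Pol_const[of 1] by simp
next
 case (Suc n)
 show ?case by (rule Pol_cong[OF Pol_x[OF Suc, of u]]) auto
qed

lemma dualbD:
 assumes "dualb J e e'"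
 shows "finite J" "i \<in> J \<Longrightarrow> j \<in> J \<Longrightarrow> pr (e' i) (e j) = (if i = j then 1 else 0)"
  "i \<in> J \<Longrightarrow> j \<in> J \<Longrightarrow> pr (e i) (e' j) = (if i = j then 1 else 0)"
  "(\<Sum>i\<in>J. pr (e' i) v *s e i) = v" "(\<Sum>i\<in>J. pr (e i) v *s e' i) = v"
 using assms dualb_swap[OF assms] unfolding dualb_def by auto

text \<open>The form q_I is linear in y_c with leading coefficient x_c. Dividing by it as a
  polynomial in y_c therefore costs one factor x_c for each degree in y and leaves a remainder free
  of y_c, which is expressed by invariance under translation along \<open>e' c\<close>.\<close>

lemma pseudo_division:
 assumes dual: "dualb J e e'" and I: "I \<subseteq> J" "c \<in> I" and P: "Pol k l P"
 shows "\<exists>Q r. Pol (k + l - 1) (l - 1) Q \<and> Pol (k + l) l r \<and>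
  (\<forall>v \<eta> T. r (v, \<eta> + T *s e' c) = r (v, \<eta>)) \<and>
  (\<forall>p. pr (e' c) (fst p) ^ nat l * P p = qI e e' I p * Q p + r p)"
 using P
proof (induction rule: Pol.induct)
 case (Pol_zero k l)
 show ?case by (intro exI[of _ "\<lambda>_. 0"]) (auto intro: Pol.Pol_zero)
next
 case (Pol_const c)
 show ?case
  by (rule exI[of _ "\<lambda>_. 0"], rule exI[of _ "\<lambda>_. c"])
   (auto intro: Pol.Pol_zero Pol.Pol_const)
next
 case (Pol_add k l P1 P2)
 obtain Q1 r1 where 1: "Pol (k + l - 1) (l - 1) Q1" "Pol (k + l) l r1"
  "\<And>v \<eta> T. r1 (v, \<eta> + T *s e' c) = r1 (v, \<eta>)"
  "\<And>p. pr (e' c) (fst p) ^ nat l * P1 p = qI e e' I p * Q1 p + r1 p"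
  using Pol_add.IH(1) by blast
 obtain Q2 r2 where 2: "Pol (k + l - 1) (l - 1) Q2" "Pol (k + l) l r2"
  "\<And>v \<eta> T. r2 (v, \<eta> + T *s e' c) = r2 (v, \<eta>)"
  "\<And>p. pr (e' c) (fst p) ^ nat l * P2 p = qI e e' I p * Q2 p + r2 p"
  using Pol_add.IH(2) by blast
 show ?case
  by (rule exI[of _ "\<lambda>p. Q1 p + Q2 p"], rule exI[of _ "\<lambda>p. r1 p + r2 p"], intro conjI Pol.Pol_add 1 2)
   (simp_all only: 1 2 distrib_left add_ac, simp_all)
next
 case (Pol_x k l P u)
 obtain Q r where 1: "Pol (k + l - 1) (l - 1) Q" "Pol (k + l) l r"
  "\<And>v \<eta> T. r (v, \<eta> + T *s e' c) = r (v, \<eta>)"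
  "\<And>p. pr (e' c) (fst p) ^ nat l * P p = qI e e' I p * Q p + r p"
  using Pol_x.IH by blast
 have "Pol (k + 1 + l - 1) (l - 1) (\<lambda>p. pr u (fst p) * Q p)"
  by (rule Pol_cong[OF Pol.Pol_x[OF 1(1), of u]]) auto
 moreover have "Pol (k + 1 + l) l (\<lambda>p. pr u (fst p) * r p)"
  by (rule Pol_cong[OF Pol.Pol_x[OF 1(2), of u]]) auto
 moreover have "pr (e' c) (fst p) ^ nat l * (pr u (fst p) * P p) =
   qI e e' I p * (pr u (fst p) * Q p) + pr u (fst p) * r p" for p
  using arg_cong[OF 1(4)[of p], of "\<lambda>z. pr u (fst p) * z"] by (simp add: algebra_simps)
 ultimately show ?case using 1(3)
  apply - apply (rule exI[of _ "\<lambda>p. pr u (fst p) * Q p"], rule exI[of _ "\<lambda>p. pr u (fst p) * r p"]) by simp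
next
 case (Pol_y k l P u)
 show ?case
 proof (cases "l < 0")
  case True
  then have "P = (\<lambda>_. 0)" using Pol_neg Pol_y.hyps by blast
  then show ?thesis by (intro exI[of _ "\<lambda>_. 0"]) (auto intro: Pol.Pol_zero)
 next
  case False
  obtain Q r where 1: "Pol (k + l - 1) (l - 1) Q" "Pol (k + l) l r"
   "\<And>v \<eta> T. r (v, \<eta> + T *s e' c) = r (v, \<eta>)"
   "\<And>p. pr (e' c) (fst p) ^ nat l * P p = qI e e' I p * Q p + r p"
   using Pol_y.IH by blast
  \<comment> \<open>The linear form of \<open>u\<close> is \<open>cu\<close> y_c plus a form free of
    y_c. Multiplied by x_c, its first part is \<open>cu\<close> times q_I minus q_(I-{c}); the
    multiple of q_I goes to \<open>Q'\<close>, and \<open>m\<close> collects the rest.\<close>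
  define cu where "cu = pr u (e' c)"
  define Q' where "Q' p = pr (e' c) (fst p) * (pr u (snd p) * Q p) + cu * r p" for p
  define m where "m p = pr (e' c) (fst p) * pr (u - cu *s e c) (snd p) - cu * qI e e' (I - {c}) p" for p
  define r' where "r' p = m p * r p" for p
  have fin: "finite I" using dualbD(1)[OF dual] I finite_subset by blast
  have cJ: "c \<in> J" using I by blast
  have qc: "qI e e' I p = pr (e' c) (fst p) * pr (e c) (snd p) + qI e e' (I - {c}) p" for p
   unfolding qI_def using fin I by (simp add: sum.remove)
  have a: "Pol (k + (l + 1) - 1) (l + 1 - 1) Q'"
   unfolding Q'_def[abs_def]
   by (intro Pol.Pol_add Pol_smult Pol_cong[OF Pol.Pol_x[OF Pol.Pol_y[OF 1(1), of u], of "e' c"]] Pol_cong[OF 1(2)]) auto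
  have m1: "Pol 1 1 m" unfolding m_def[abs_def] by (intro Pol_diff Pol_xy Pol_smult Pol_qI)
  have b: "Pol (k + (l + 1)) (l + 1) r'"
   unfolding r'_def[abs_def] by (rule Pol_cong[OF Pol_mult[OF m1 1(2)]]) auto
  have yi: "pr (e i) (\<eta> + T *s e' c) = pr (e i) \<eta>" if "i \<in> I - {c}" for i \<eta> T
   using dualbD(3)[OF dual, of i c] that I by (auto simp: pr_simps)
  have "m (v, \<eta> + T *s e' c) = m (v, \<eta>)" for v \<eta> T
   unfolding m_def qI_def using dualbD(3)[OF dual cJ cJ] by (simp add: yi) (simp add: pr_simps cu_def)
  then have c: "r' (v, \<eta> + T *s e' c) = r' (v, \<eta>)" for v \<eta> T
   by (simp add: r'_def 1(3))
  have "pr (e' c) (fst p) ^ nat (l + 1) * (pr u (snd p) * P p) = qI e e' I p * Q' p + r' p" for p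
  proof -
   have "nat (l + 1) = Suc (nat l)" using False by simp
   then have "pr (e' c) (fst p) ^ nat (l + 1) * (pr u (snd p) * P p)
     = pr (e' c) (fst p) * pr u (snd p) * (pr (e' c) (fst p) ^ nat l * P p)" by simp
   also have "\<dots> = pr (e' c) (fst p) * pr u (snd p) * (qI e e' I p * Q p + r p)" by (simp only: 1(4))
   also have "\<dots> = qI e e' I p * Q' p + r' p"
    unfolding Q'_def r'_def m_def by (simp add: qc pr_simps algebra_simps)
   finally show ?thesis .
  qed
  with a b c show ?thesis apply - apply (rule exI[of _ Q'], rule exI[of _ r']) by blast
 qed
qed

lemma qI_diag:
 assumes dual: "dualb J e e'" and I: "I \<subseteq> J" "d \<in> I"
 shows "qI e e' I (e d, e' d) = 1"
proof -
 have fin: "finite I" using dualbD(1)[OF dual] I finite_subset by blast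
 have "qI e e' I (e d, e' d) = (\<Sum>i\<in>I. if i = d then 1 else 0)"
  unfolding qI_def using I dualbD(2,3)[OF dual] by (intro sum.cong refl) (auto simp: subset_eq)
 then show ?thesis using fin I by simp
qed

text \<open>Nullstellensatz for the quadric q_I = 0. Pseudo-division gives q_I Q = x_c^l P once the
  remainder is seen to vanish; the index \<open>d\<close> keeps q_I from vanishing on x_c = 0, so
  that the powers of x_c can be cancelled.\<close>

lemma quadric_divides:
 assumes dual: "dualb J e e'" and I: "I \<subseteq> J" "c \<in> I" "d \<in> I" "c \<noteq> d" and P: "Pol k l P"
  and van: "\<And>p. qI e e' I p = 0 \<Longrightarrow> P p = 0"
 shows "\<exists>Q. Pol (k - 1) (l - 1) Q \<and> (\<forall>p. P p = qI e e' I p * Q p)"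
proof (cases "l < 0")
 case True
 then have "P = (\<lambda>_. 0)" using Pol_neg P by blast
 then show ?thesis by (intro exI[of _ "\<lambda>_. 0"]) (auto intro: Pol.Pol_zero)
next
 case l: False
 obtain Q r where Q: "Pol (k + l - 1) (l - 1) Q" and r: "Pol (k + l) l r"
  "\<And>v \<eta> T. r (v, \<eta> + T *s e' c) = r (v, \<eta>)"
  and eq: "\<And>p. pr (e' c) (fst p) ^ nat l * P p = qI e e' I p * Q p + r p"
  using pseudo_division[OF dual I(1,2) P] by blast
 have fin: "finite I" using dualbD(1)[OF dual] I finite_subset by blast
 have cJ: "c \<in> J" "d \<in> J" using I by blast+
 have x0: "pr (e' c) (e c) = 1" "pr (e' c) (e d) = 0" using dualbD(2)[OF dual] cJ I by auto
 have "pr (e' c) (fst p) * r p = 0" for p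
 proof (cases "pr (e' c) (fst p) = 0")
  case False
  \<comment> \<open>The translate along \<open>e' c\<close> that lies on the quadric, because y_c
    enters q_I with coefficient x_c. The remainder does not notice the translation.\<close>
  define T where "T = - qI e e' I p / pr (e' c) (fst p)"
  define p' where "p' = (fst p, snd p + T *s e' c)"
  have "qI e e' I p' = (\<Sum>i\<in>I. pr (e' i) (fst p) * pr (e i) (snd p) + (if i = c then T * pr (e' c) (fst p) else 0))"
   unfolding qI_def p'_def using I dualbD(3)[OF dual]
   by (intro sum.cong refl) (auto simp: pr_simps subset_eq algebra_simps)
  also have "\<dots> = qI e e' I p + T * pr (e' c) (fst p)"
   using fin I by (simp add: sum.distrib qI_def)
  also have "\<dots> = 0" using False by (simp add: T_def)
  finally have "qI e e' I p' = 0" .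
  then have "r p' = 0" using van[of p'] eq[of p'] by simp
  then show ?thesis using r(2)[of "fst p" "snd p" T] by (simp add: p'_def)
 qed simp
 then have "r p = 0" for p
  using Pol_cancel[OF r(1) Pol_x1[of "e' c"], of "(e c, 0)"] x0 by simp
 with eq have eq: "\<And>p. pr (e' c) (fst p) ^ nat l * P p = qI e e' I p * Q p" by simp
 \<comment> \<open>Powers of x_c are removed one at a time: on x_c = 0 the product q_I Q vanishes
   while q_I is not identically zero, so x_c divides Q.\<close>
 have "\<exists>Q. Pol (k - 1) (l - 1) Q \<and> (\<forall>p. P p = qI e e' I p * Q p)"
  if "Pol (k - 1 + int n) (l - 1) Q" "\<And>p. pr (e' c) (fst p) ^ n * P p = qI e e' I p * Q p" for n Q
  using that
 proof (induction n arbitrary: Q)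
  case 0
  then show ?case by (intro exI[of _ Q]) auto
 next
  case (Suc n)
  have Q0: "Q p = 0" if "pr (e' c) (fst p) = 0" for p
  proof (rule Pol_dense[OF Suc.prems(1) Pol_qI, of "{p. pr (e' c) (fst p) = 0}"])
   show "qI e e' I p * Q p = 0" if "p \<in> {p. pr (e' c) (fst p) = 0}" for p
    using Suc.prems(2)[of p] that by simp
   show "qI e e' I (e d, e' d) \<noteq> 0" using qI_diag[OF dual I(1,3)] by simp
  qed (use that x0 in \<open>auto simp: pr_simps\<close>)
  obtain Q' where Q': "Pol (k - 1 + int (Suc n) - 1) (l - 1) Q'" "\<And>p. Q p = pr (e' c) (fst p) * Q' p"
   using Pol_div_x[OF Suc.prems(1) x0(1) Q0] by blast
  have 1: "Pol (k - 1 + int n) (l - 1) Q'"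
   by (rule Pol_cong[OF Q'(1)]) auto
  have 2: "Pol (int n + k) (0 + l) (\<lambda>p. pr (e' c) (fst p) ^ n * P p - qI e e' I p * Q' p)"
   by (intro Pol_diff Pol_mult[OF Pol_xpow P] Pol_cong[OF Pol_mult[OF Pol_qI[of e e' I] 1]]) auto
  have "pr (e' c) (fst p) * (pr (e' c) (fst p) ^ n * P p - qI e e' I p * Q' p) = 0" for p
   using Suc.prems(2)[of p] by (simp add: Q'(2) algebra_simps)
  then have "pr (e' c) (fst p) ^ n * P p - qI e e' I p * Q' p = 0" for p
   using Pol_cancel[OF 2 Pol_x1[of "e' c"], of "(e c, 0)"] x0 by simp
  then show ?case using Suc.IH[OF 1] by simp
 qed
 from this[OF Pol_cong[OF Q], of "nat l"] eq l show ?thesis by simp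
qed

text \<open>If x_b P = q_I Q, then Q vanishes on x_b = 0, where q_I is not identically zero; hence
  x_b divides Q and q_I divides P.\<close>

lemma quadric_cancel_x:
 assumes dual: "dualb J e e'" and I: "I \<subseteq> J" "c \<in> I" "d \<in> I" "c \<noteq> d" and b: "b \<in> J" and P: "Pol k l P"
  and van: "\<And>p. qI e e' I p = 0 \<Longrightarrow> pr (e' b) (fst p) * P p = 0" and p: "qI e e' I p = 0"
 shows "P p = 0"
proof -
 obtain Q where Q: "Pol (k + 1 - 1) (l - 1) Q" "\<And>p. pr (e' b) (fst p) * P p = qI e e' I p * Q p"
  using quadric_divides[OF dual I Pol_x[OF P] van] by blast
 \<comment> \<open>\<open>b\<close> may lie inside or outside \<open>I\<close>; one of the two
   distinct elements of \<open>I\<close> differs from it in any case, and at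
   \<open>(e d', e' d')\<close> the form q_I is 1 while x_b is 0.\<close>
 obtain d' where d': "d' \<in> I" "d' \<noteq> b" using I by metis
 have x0: "pr (e' b) (e b) = 1" "pr (e' b) (e d') = 0" using dualbD(2)[OF dual] d' b I by auto
 have Q0: "Q p = 0" if "pr (e' b) (fst p) = 0" for p
 proof (rule Pol_dense[OF Q(1) Pol_qI, of "{p. pr (e' b) (fst p) = 0}"])
  show "qI e e' I p * Q p = 0" if "p \<in> {p. pr (e' b) (fst p) = 0}" for p
   using Q(2)[of p] that by simp
  show "qI e e' I (e d', e' d') \<noteq> 0" using qI_diag[OF dual I(1) d'(1)] by simp
 qed (use that x0 in \<open>auto simp: pr_simps\<close>)
 obtain Q' where Q': "Pol (k + 1 - 1 - 1) (l - 1) Q'" "\<And>p. Q p = pr (e' b) (fst p) * Q' p"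
  using Pol_div_x[OF Q(1) x0(1) Q0] by blast
 have 2: "Pol k l (\<lambda>p. P p - qI e e' I p * Q' p)"
  by (intro Pol_diff P Pol_cong[OF Pol_mult[OF Pol_qI[of e e' I] Q'(1)]]) auto
 have "pr (e' b) (fst p) * (P p - qI e e' I p * Q' p) = 0" for p
  using Q(2)[of p] by (simp add: Q'(2) algebra_simps)
 then have "P p - qI e e' I p * Q' p = 0"
  using Pol_cancel[OF 2 Pol_x1[of "e' b"], of "(e b, 0)"] x0 by simp
 with p show ?thesis by simp
qed

lemma quadric_cancel_y:
 assumes dual: "dualb J e e'" and I: "I \<subseteq> J" "c \<in> I" "d \<in> I" "c \<noteq> d" and b: "b \<in> J" and P: "Pol k l P"
  and van: "\<And>p. qI e e' I p = 0 \<Longrightarrow> pr (e b) (snd p) * P p = 0" and p: "qI e e' I p = 0"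
 shows "P p = 0"
proof -
 have "P (snd p', fst p') = 0" if "qI e' e I p' = 0" for p'
  using that
 proof (rule quadric_cancel_x[OF dualb_swap[OF dual] I b Pol_swap[OF P], rotated])
  fix p assume "qI e' e I p = 0"
  then show "pr (e b) (fst p) * P (snd p, fst p) = 0"
   using van[of "(snd p, fst p)"] by (simp add: qI_swap)
 qed
 from this[of "(snd p, fst p)"] p show ?thesis by (simp add: qI_swap)
qed

lemma X_cancel_x:
 assumes dual: "dualb J e e'" and I: "c \<in> J" "d \<in> J" "c \<noteq> d" and b: "b \<in> J" and P: "Pol k l P"
  and van: "\<And>p. p \<in> X \<Longrightarrow> pr (e' b) (fst p) * P p = 0" and p: "p \<in> X"
 shows "P p = 0"
 using quadric_cancel_x[OF dual order.refl I b P] van p X_qI[OF dual] by blast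

lemma X_cancel_y:
 assumes dual: "dualb J e e'" and I: "c \<in> J" "d \<in> J" "c \<noteq> d" and b: "b \<in> J" and P: "Pol k l P"
  and van: "\<And>p. p \<in> X \<Longrightarrow> pr (e b) (snd p) * P p = 0" and p: "p \<in> X"
 shows "P p = 0"
 using quadric_cancel_y[OF dual order.refl I b P] van p X_qI[OF dual] by blast

text \<open>The part of \<open>X\<close> on x_c = 0 is the product of the y_c-line with the quadric
  of \<open>J - {c}\<close>. With two indices left this is irreducible, so it is enough that
  \<open>g\<close> vanishes where x_d and y_c are nonzero. Subtracting a multiple of the equation of
  \<open>X\<close> then makes \<open>g\<close> vanish on the whole hyperplane.\<close>

lemma X_divide_x:
 assumes dual: "dualb J e e'" and J: "c \<in> J" "d \<in> J" "f \<in> J" "c \<noteq> d" "c \<noteq> f" "d \<noteq> f" and g: "Pol k l g"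
  and van: "\<And>p. p \<in> X \<Longrightarrow> pr (e' c) (fst p) = 0 \<Longrightarrow> pr (e' d) (fst p) \<noteq> 0 \<Longrightarrow> pr (e c) (snd p) \<noteq> 0 \<Longrightarrow> g p = 0"
 shows "\<exists>g1. Pol (k - 1) l g1 \<and> (\<forall>p\<in>X. g p = pr (e' c) (fst p) * g1 p)"
proof -
 define I where "I = J - {c}"
 have I: "I \<subseteq> J" "d \<in> I" "f \<in> I" using J by (auto simp: I_def)
 have fin: "finite J" using dualbD(1)[OF dual] .
 \<comment> \<open>The restriction of \<open>g\<close> to x_c = 0, extended constantly along
   \<open>e c\<close>.\<close>
 define h where "h p = g (fst p - pr (e' c) (fst p) *s e c, snd p)" for p
 have h: "Pol k l h" unfolding h_def[abs_def] by (rule Pol_proj_x[OF g])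
 have qc: "qI e e' J p = pr (e' c) (fst p) * pr (e c) (snd p) + qI e e' I p" for p
  unfolding qI_def I_def using fin J by (simp add: sum.remove)
 have xc: "pr (e' c) (e c) = 1" "pr (e' d) (e c) = 0" using dualbD(2)[OF dual] J by auto
 have 1: "pr (e' d) (fst p) * (pr (e c) (snd p) * h p) = 0" if "qI e e' I p = 0" for p
 proof -
  let ?p = "(fst p - pr (e' c) (fst p) *s e c, snd p)"
  have "qI e e' I ?p = qI e e' I p"
   unfolding qI_def using dualbD(2)[OF dual] J by (intro sum.cong refl) (auto simp: I_def pr_simps)
  then have "?p \<in> X" using that by (simp add: X_qI[OF dual] qc pr_simps xc)
  from van[OF this] show ?thesis by (auto simp: h_def pr_simps xc)
 qed
 have 2: "pr (e c) (snd p) * h p = 0" if "qI e e' I p = 0" for p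
  by (rule quadric_cancel_x[OF dual I \<open>d \<noteq> f\<close> \<open>d \<in> J\<close> Pol_y[OF h] 1 that])
 have 3: "h p = 0" if "qI e e' I p = 0" for p
  by (rule quadric_cancel_y[OF dual I \<open>d \<noteq> f\<close> \<open>c \<in> J\<close> h 2 that])
 obtain Q where Q: "Pol (k - 1) (l - 1) Q" "\<And>p. h p = qI e e' I p * Q p"
  using quadric_divides[OF dual I \<open>d \<noteq> f\<close> h 3] by blast
 have 4: "Pol k l (\<lambda>p. g p - qI e e' J p * Q p)"
  by (intro Pol_diff g Pol_cong[OF Pol_mult[OF Pol_qI[of e e' J] Q(1)]]) auto
 have "g p - qI e e' J p * Q p = 0" if "pr (e' c) (fst p) = 0" for p
  using Q(2)[of p] that by (simp add: h_def qc)
 from Pol_div_x[OF 4 xc(1) this] obtain g1 where "Pol (k - 1) l g1"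
  "\<And>p. g p - qI e e' J p * Q p = pr (e' c) (fst p) * g1 p" by blast
 then show ?thesis using X_qI[OF dual] by (intro exI[of _ g1]) (metis diff_zero mult_zero_left)
qed

lemma X_divide_y:
 assumes dual: "dualb J e e'" and J: "c \<in> J" "d \<in> J" "f \<in> J" "c \<noteq> d" "c \<noteq> f" "d \<noteq> f" and g: "Pol k l g"
  and van: "\<And>p. p \<in> X \<Longrightarrow> pr (e c) (snd p) = 0 \<Longrightarrow> pr (e d) (snd p) \<noteq> 0 \<Longrightarrow> pr (e' c) (fst p) \<noteq> 0 \<Longrightarrow> g p = 0"
 shows "\<exists>g1. Pol k (l - 1) g1 \<and> (\<forall>p\<in>X. g p = pr (e c) (snd p) * g1 p)"
proof -
 have "g (snd p, fst p) = 0" if "p \<in> X" "pr (e c) (fst p) = 0" "pr (e d) (fst p) \<noteq> 0" "pr (e' c) (snd p) \<noteq> 0" for p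
  using van[of "(snd p, fst p)"] that by (simp add: X_def pr_sym)
 from X_divide_x[OF dualb_swap[OF dual] J Pol_swap[OF g] this]
 obtain g1 where g1: "Pol (l - 1) k g1" "\<And>p. p \<in> X \<Longrightarrow> g (snd p, fst p) = pr (e c) (fst p) * g1 p" by auto
 have "g p = pr (e c) (snd p) * g1 (snd p, fst p)" if "p \<in> X" for p
  using g1(2)[of "(snd p, fst p)"] that by (simp add: X_def pr_sym)
 then show ?thesis using Pol_swap[OF g1(1)] by blast
qed

text \<open>In dimension two x_b = 0 cuts \<open>X\<close> in two components, so x_b and y_a cannot
  be split off one after the other. Instead \<open>X\<close> is parametrized up to scaling by the
  curve \<open>\<gamma>\<close>, on which the functions of bidegree \<open>(m, m)\<close> become the
  polynomials of degree at most \<open>2 * m\<close>.\<close>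

lemma X_regular_pair_plane:
 assumes dual: "dualb J e e'" and J: "J = {a, b}" "a \<noteq> b" and g: "Pol m m g" and g': "Pol m m g'"
  and eq: "\<And>p. p \<in> X \<Longrightarrow> pr (e' a) (fst p) * pr (e b) (snd p) * g p = pr (e' b) (fst p) * pr (e a) (snd p) * g' p"
 shows "\<exists>h. Pol (m - 1) (m - 1) h \<and> (\<forall>p\<in>X. g p = pr (e' b) (fst p) * pr (e a) (snd p) * h p)"
proof -
 define \<gamma> where "\<gamma> T = (e a + T *s e b, e' b + T *s (- e' a))" for T
 have xs: "pr (e' a) (fst (\<gamma> T)) = 1" "pr (e' b) (fst (\<gamma> T)) = T"
  "pr (e a) (snd (\<gamma> T)) = - T" "pr (e b) (snd (\<gamma> T)) = 1" for T
  using dualbD(2)[OF dual] dualbD(3)[OF dual] J by (auto simp: \<gamma>_def pr_simps)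
 have sumJ: "(\<Sum>i\<in>J. f i) = f a + f b" for f :: "_ \<Rightarrow> complex"
  using J by simp
 have \<gamma>X: "\<gamma> T \<in> X" for T
  using X_qI[OF dual] by (simp add: qI_def sumJ xs)
 obtain r where r: "degree r \<le> nat (m + m)" "\<And>T. g (\<gamma> T) = poly r T"
  using Pol_line[OF g] unfolding \<gamma>_def by blast
 obtain r' where r': "\<And>T. g' (\<gamma> T) = poly r' T"
  using Pol_line[OF g'] unfolding \<gamma>_def by blast
 have "poly r T = poly ([:0, 0, -1:] * r') T" for T
  using eq[OF \<gamma>X[of T]] by (simp add: xs r r' algebra_simps)
 then have rr: "r = [:0, 0, -1:] * r'" using poly_eq_poly_eq_iff by blast
 \<comment> \<open>On the curve x_a y_b = 1, x_b y_b = T and x_b y_a = - T^2, so each step in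
   bidegree raises the largest reachable exponent by two.\<close>
 have mon: "j \<le> 2 * n \<Longrightarrow> \<exists>M. Pol (int n) (int n) M \<and> (\<forall>T. M (\<gamma> T) = T ^ j)" for n j
 proof (induction n arbitrary: j)
  case 0
  then show ?case using Pol_const[of 1] by (intro exI[of _ "\<lambda>_. 1"]) auto
 next
  case (Suc n)
  have "j \<le> 2 * n \<or> (\<exists>i. j = Suc i \<and> i \<le> 2 * n) \<or> j = Suc (Suc (2 * n))" using Suc.prems by presburger
  then consider "j \<le> 2 * n" | i where "j = Suc i" "i \<le> 2 * n" | "j = Suc (Suc (2 * n))" by blast
  then show ?case
  proof cases
   case 1
   then obtain M where M: "Pol (int n) (int n) M" "\<And>T. M (\<gamma> T) = T ^ j" using Suc.IH by blast
   show ?thesis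
    by (intro exI[of _ "\<lambda>p. pr (e' a) (fst p) * pr (e b) (snd p) * M p"] conjI
      Pol_cong[OF Pol_mult[OF Pol_xy[of "e' a" "e b"] M(1)]]) (auto simp: xs M)
  next
   case 2
   then obtain M where M: "Pol (int n) (int n) M" "\<And>T. M (\<gamma> T) = T ^ i" using Suc.IH by blast
   show ?thesis
    by (intro exI[of _ "\<lambda>p. pr (e' b) (fst p) * pr (e b) (snd p) * M p"] conjI
      Pol_cong[OF Pol_mult[OF Pol_xy[of "e' b" "e b"] M(1)]]) (auto simp: xs M 2)
  next
   case 3
   obtain M where M: "Pol (int n) (int n) M" "\<And>T. M (\<gamma> T) = T ^ (2 * n)" using Suc.IH by blast
   show ?thesis
    by (intro exI[of _ "\<lambda>p. - (pr (e' b) (fst p) * pr (e a) (snd p) * M p)"] conjI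
      Pol_uminus Pol_cong[OF Pol_mult[OF Pol_xy[of "e' b" "e a"] M(1)]]) (auto simp: xs M 3)
  qed
 qed
 have "\<exists>h. Pol (m - 1) (m - 1) h \<and> (\<forall>T. h (\<gamma> T) = poly r' T)"
 proof (cases "r' = 0")
  case True
  then show ?thesis by (intro exI[of _ "\<lambda>_. 0"]) (auto intro: Pol_zero)
 next
  case False
  \<comment> \<open>The factor T^2 accounts for exactly the two degrees that separate bidegree
    \<open>(m, m)\<close> from \<open>(m - 1, m - 1)\<close>.\<close>
  have "degree r = 2 + degree r'"
   unfolding rr by (subst degree_mult_eq) (use False in auto)
  then have deg: "degree r' + 2 \<le> nat (m + m)" using r by simp
  define n where "n = nat (m - 1)"
  have n: "int n = m - 1" "degree r' \<le> 2 * n" using deg by (auto simp: n_def)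
  have "\<forall>j. \<exists>M. j \<le> 2 * n \<longrightarrow> Pol (int n) (int n) M \<and> (\<forall>T. M (\<gamma> T) = T ^ j)" using mon by blast
  from choice[OF this] obtain M where M: "\<And>j. j \<le> 2 * n \<Longrightarrow> Pol (int n) (int n) (M j)"
   "\<And>j T. j \<le> 2 * n \<Longrightarrow> M j (\<gamma> T) = T ^ j" by blast
  have "Pol (m - 1) (m - 1) (\<lambda>p. \<Sum>j\<le>degree r'. coeff r' j * M j p)"
   using M(1) n by (intro Pol_sum Pol_smult) auto
  moreover have "(\<Sum>j\<le>degree r'. coeff r' j * M j (\<gamma> T)) = poly r' T" for T
   unfolding poly_altdef using M(2) n by (intro sum.cong refl) auto
  ultimately show ?thesis by blast
 qed
 then obtain h where h: "Pol (m - 1) (m - 1) h" "\<And>T. h (\<gamma> T) = poly r' T" by blast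
 define P where "P p = g p - pr (e' b) (fst p) * pr (e a) (snd p) * h p" for p
 have P: "Pol m m P"
  unfolding P_def[abs_def] by (intro Pol_diff g Pol_cong[OF Pol_mult[OF Pol_xy[of "e' b" "e a"] h(1)]]) auto
 have P0: "P (\<gamma> T) = 0" for T
  unfolding P_def by (simp add: xs h r rr algebra_simps)
 have "pr (e' a) (fst p) * P p = 0" if "p \<in> X" for p
 proof (cases "pr (e' a) (fst p) = 0")
  case False
  \<comment> \<open>A point of \<open>X\<close> with x_a nonzero is a rescaling, in each of its two
    components, of a point of the curve, and \<open>P\<close> is bihomogeneous.\<close>
  define T where "T = pr (e' b) (fst p) / pr (e' a) (fst p)"
  have q: "pr (e' a) (fst p) * pr (e a) (snd p) + pr (e' b) (fst p) * pr (e b) (snd p) = 0"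
   using that X_qI[OF dual] by (simp add: qI_def sumJ)
  then have ya: "pr (e a) (snd p) = - T * pr (e b) (snd p)"
   using False by (simp add: T_def field_simps eq_neg_iff_add_eq_0)
  have xb: "pr (e' b) (fst p) = pr (e' a) (fst p) * T" using False by (simp add: T_def)
  have "fst p = pr (e' a) (fst p) *s e a + pr (e' b) (fst p) *s e b"
   using dualbD(4)[OF dual, of "fst p"] J by simp
  then have 1: "fst p = pr (e' a) (fst p) *s (e a + T *s e b)"
   using xb by (metis scale_right_distrib scale_scale)
  have "snd p = pr (e a) (snd p) *s e' a + pr (e b) (snd p) *s e' b"
   using dualbD(5)[OF dual, of "snd p"] J by simp
  then have "snd p = (- T * pr (e b) (snd p)) *s e' a + pr (e b) (snd p) *s e' b"
   using ya by simp
  then have 2: "snd p = pr (e b) (snd p) *s (e' b + T *s (- e' a))"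
   by (simp add: scale_right_diff_distrib mult.commute)
  have "P p = P (pr (e' a) (fst p) *s (e a + T *s e b), pr (e b) (snd p) *s (e' b + T *s (- e' a)))"
   using 1 2 by (metis prod.collapse)
  also have "\<dots> = 0" using P0[of T] unfolding Pol_hom[OF P] \<gamma>_def by simp
  finally show ?thesis by simp
 qed simp
 then have "P p = 0" if "p \<in> X" for p
  using X_cancel_x[OF dual _ _ J(2) _ P] J that by blast
 then show ?thesis using h(1) unfolding P_def by (intro exI[of _ h]) auto
qed

text \<open>On x_b = 0 the equation forces \<open>g\<close> to vanish where x_a y_b is nonzero, so
  x_b divides \<open>g\<close> on \<open>X\<close>. After cancelling it, the same argument in the
  dual coordinates splits off y_a.\<close>

lemma X_regular_pair:
 assumes dual: "dualb J e e'" and J: "a \<in> J" "b \<in> J" "a \<noteq> b" and g: "Pol m m g" and g': "Pol m m g'"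
  and eq: "\<And>p. p \<in> X \<Longrightarrow> pr (e' a) (fst p) * pr (e b) (snd p) * g p = pr (e' b) (fst p) * pr (e a) (snd p) * g' p"
 shows "\<exists>h. Pol (m - 1) (m - 1) h \<and> (\<forall>p\<in>X. g p = pr (e' b) (fst p) * pr (e a) (snd p) * h p)"
proof (cases "J = {a, b}")
 case True
 then show ?thesis using X_regular_pair_plane[OF dual True J(3) g g' eq] by blast
next
 case False
 \<comment> \<open>The third index makes the hyperplane sections of \<open>X\<close>
   irreducible.\<close>
 then obtain f where f: "f \<in> J" "b \<noteq> f" "a \<noteq> f" using J by blast
 have "g p = 0" if "p \<in> X" "pr (e' b) (fst p) = 0" "pr (e' a) (fst p) \<noteq> 0" "pr (e b) (snd p) \<noteq> 0" for p
  using eq[OF that(1)] that by simp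
 from X_divide_x[OF dual J(2,1) f(1) J(3)[symmetric] f(2,3) g this]
 obtain g1 where g1: "Pol (m - 1) m g1" "\<And>p. p \<in> X \<Longrightarrow> g p = pr (e' b) (fst p) * g1 p" by blast
 define P where "P p = pr (e' a) (fst p) * (pr (e b) (snd p) * g1 p) - pr (e a) (snd p) * g' p" for p
 have "Pol m (m + 1) P" unfolding P_def[abs_def]
  by (intro Pol_diff Pol_y[OF g'] Pol_cong[OF Pol_x[OF Pol_y[OF g1(1), of "e b"], of "e' a"]]) auto
 moreover have "pr (e' b) (fst p) * P p = 0" if "p \<in> X" for p
  using eq[OF that] g1(2)[OF that] by (simp add: P_def algebra_simps)
 ultimately have P0: "P p = 0" if "p \<in> X" for p
  using X_cancel_x[OF dual J J(2)] that by blast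
 have "g1 p = 0" if "p \<in> X" "pr (e a) (snd p) = 0" "pr (e b) (snd p) \<noteq> 0" "pr (e' a) (fst p) \<noteq> 0" for p
  using P0[OF that(1)] that by (simp add: P_def)
 from X_divide_y[OF dual J(1,2) f(1) J(3) f(3,2) g1(1) this]
 obtain h where "Pol (m - 1) (m - 1) h" "\<And>p. p \<in> X \<Longrightarrow> g1 p = pr (e a) (snd p) * h p" by blast
 then show ?thesis using g1(2) by (intro exI[of _ h]) (auto simp: mult.assoc)
qed

end

section \<open>The group action\<close>

lemma group_GL:
 fixes scale :: "complex \<Rightarrow> 'h::ab_group_add \<Rightarrow> 'h"
 assumes "vector_space scale"
 shows "group (GL scale)"
proof (rule groupI)
 interpret vector_space scale by fact
 show "\<one>\<^bsub>GL scale\<^esub> \<in> carrier (GL scale)"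
  by (simp add: GL_def) (unfold_locales, auto simp: algebra_simps)
 fix g h assume g: "g \<in> carrier (GL scale)" and h: "h \<in> carrier (GL scale)"
 then show "g \<otimes>\<^bsub>GL scale\<^esub> h \<in> carrier (GL scale)"
  by (auto simp: GL_def bij_comp intro: Vector_Spaces.linear_compose)
 interpret g: Vector_Spaces.linear scale scale g using g by (simp add: GL_def)
 have inj: "inj g" and gi: "g (invf g x) = x" for x
  using g by (auto simp: GL_def bij_is_inj bij_is_surj surj_f_inv_f)
 have "invf g (a + b) = invf g a + invf g b" for a b
  by (rule injD[OF inj]) (simp add: g.add gi)
 moreover have "invf g (scale c a) = scale c (invf g a)" for c a
  by (rule injD[OF inj]) (simp add: g.scale gi)
 ultimately have "Vector_Spaces.linear scale scale (invf g)"
  by unfold_locales (auto simp: algebra_simps)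
 then show "\<exists>h\<in>carrier (GL scale). h \<otimes>\<^bsub>GL scale\<^esub> g = \<one>\<^bsub>GL scale\<^esub>"
  using g by (intro bexI[of _ "invf g"]) (auto simp: GL_def bij_imp_bij_inv bij_is_inj)
qed (auto simp: GL_def comp_assoc)

locale irred_group = pairing_space scale Bs
 for scale :: "complex \<Rightarrow> 'h::ab_group_add \<Rightarrow> 'h" (infixr "*s" 75) and Bs +
 fixes W :: "('h \<Rightarrow> 'h) set"
 assumes finite_W: "finite W" and subgroup_W: "subgroup W (GL scale)"
  and irreducible: "irreducible_group scale W" and card_Bs: "card Bs \<ge> 2"
begin

interpretation GL: group "GL scale"
 by (rule group_GL) unfold_locales

abbreviation Z where "Z \<equiv> group_center W"

lemma W_GL: "g \<in> W \<Longrightarrow> g \<in> carrier (GL scale)"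
 using subgroup_W subgroup.subset by blast

lemma W_linear: "g \<in> W \<Longrightarrow> Vector_Spaces.linear scale scale g"
 using W_GL by (auto simp: GL_def)

lemma W_bij: "g \<in> W \<Longrightarrow> bij g"
 using W_GL by (auto simp: GL_def)

lemma W_id [simp]: "id \<in> W"
 using subgroup.one_closed[OF subgroup_W] by (simp add: GL_def)

lemma W_comp [simp]: "g \<in> W \<Longrightarrow> h \<in> W \<Longrightarrow> g \<circ> h \<in> W"
 using subgroup.m_closed[OF subgroup_W] by (simp add: GL_def)

lemma m_inv_GL:
 assumes "g \<in> W" shows "inv\<^bsub>GL scale\<^esub> g = invf g"
proof -
 have "g \<circ> inv\<^bsub>GL scale\<^esub> g = id"
  using GL.r_inv[OF W_GL[OF assms]] by (simp add: GL_def)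
 then have "g ((inv\<^bsub>GL scale\<^esub> g) x) = x" for x by (metis comp_apply id_apply)
 then show ?thesis
  using W_bij[OF assms] by (metis bij_inv_eq_iff ext)
qed

lemma W_inv [simp]: "g \<in> W \<Longrightarrow> invf g \<in> W"
 using subgroup.m_inv_closed[OF subgroup_W] m_inv_GL by metis

lemma inv_cancel [simp]: "g \<in> W \<Longrightarrow> invf g (g v) = v" "g \<in> W \<Longrightarrow> g (invf g v) = v"
 using W_bij by (auto simp: bij_is_inj bij_is_surj surj_f_inv_f)

lemma inv_comp [simp]: "g \<in> W \<Longrightarrow> invf g \<circ> g = id" "g \<in> W \<Longrightarrow> g \<circ> invf g = id"
 by (auto simp: fun_eq_iff)

lemma inv_inv [simp]: "g \<in> W \<Longrightarrow> invf (invf g) = g"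
 using W_bij inv_inv_eq by blast

lemma inv_of_comp: "g \<in> W \<Longrightarrow> h \<in> W \<Longrightarrow> invf (g \<circ> h) = invf h \<circ> invf g"
 using W_bij o_inv_distrib by blast

lemma W_map:
 assumes "g \<in> W"
 shows "g (u + v) = g u + g v" "g (c *s u) = c *s g u" "g (u - v) = g u - g v" "g 0 = 0"
  "g (- u) = - g u" "g (\<Sum>i\<in>I. f i) = (\<Sum>i\<in>I. g (f i))"
proof -
 interpret g: Vector_Spaces.linear scale scale g using W_linear[OF assms] .
 show "g (u + v) = g u + g v" "g (c *s u) = c *s g u" "g (u - v) = g u - g v" "g 0 = 0"
  "g (- u) = - g u" "g (\<Sum>i\<in>I. f i) = (\<Sum>i\<in>I. g (f i))"
  by (rule g.add g.scale g.diff g.zero g.neg g.sum)+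
qed

lemma bij_betw_translate: "g \<in> W \<Longrightarrow> bij_betw (\<lambda>h. g \<circ> h) W W"
 by (rule bij_betw_byWitness[of _ "\<lambda>h. invf g \<circ> h"]) (auto simp: comp_assoc[symmetric] simp flip: id_def)

lemma bij_betw_translate_right: "g \<in> W \<Longrightarrow> bij_betw (\<lambda>h. h \<circ> g) W W"
 by (rule bij_betw_byWitness[of _ "\<lambda>h. h \<circ> invf g"]) (auto simp: comp_assoc simp flip: id_def)

lemma bij_betw_inverse: "bij_betw (\<lambda>h. invf h) W W"
 by (rule bij_betw_byWitness[of _ "\<lambda>h. invf h"]) auto

text \<open>The contragredient action, carried over from the dual space by the form
  \<open>pr\<close>.\<close>

definition cg :: "('h \<Rightarrow> 'h) \<Rightarrow> 'h \<Rightarrow> 'h" where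
 "cg g \<eta> = (\<Sum>b\<in>Bs. pr \<eta> (invf g b) *s b)"

lemma pr_cg:
 assumes "g \<in> W" shows "pr (cg g \<eta>) u = pr \<eta> (invf g u)"
proof -
 have "Vector_Spaces.linear scale (*) (\<lambda>u. pr \<eta> (invf g u))"
  using W_map[OF W_inv[OF assms]] by unfold_locales (auto simp: pr_simps algebra_simps)
 from functional_eq_pr[OF this, of u] show ?thesis by (simp add: cg_def)
qed

lemma pr_cg_right: "g \<in> W \<Longrightarrow> pr u (cg g \<eta>) = pr (invf g u) \<eta>"
 using pr_cg pr_sym by metis

lemma cg_id [simp]: "cg id \<eta> = \<eta>"
 by (rule pr_ext_left) (simp add: pr_cg)

lemma cg_comp: "g \<in> W \<Longrightarrow> h \<in> W \<Longrightarrow> cg (g \<circ> h) \<eta> = cg g (cg h \<eta>)"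
 by (rule pr_ext_left) (simp add: pr_cg inv_of_comp)

lemma cg_map:
 assumes "g \<in> W"
 shows "cg g (u + v) = cg g u + cg g v" "cg g (c *s u) = c *s cg g u" "cg g (u - v) = cg g u - cg g v"
 by (rule pr_ext_left, simp add: pr_cg[OF assms] pr_simps)+

definition act :: "('h \<Rightarrow> 'h) \<Rightarrow> 'h \<times> 'h \<Rightarrow> 'h \<times> 'h" where
 "act g p = (g (fst p), cg g (snd p))"

lemma act_id [simp]: "act id p = p"
 by (simp add: act_def)

lemma act_comp: "g \<in> W \<Longrightarrow> h \<in> W \<Longrightarrow> act (g \<circ> h) p = act g (act h p)"
 by (simp add: act_def cg_comp)

lemma act_inv [simp]: "g \<in> W \<Longrightarrow> act g (act (invf g) p) = p"
  "g \<in> W \<Longrightarrow> act (invf g) (act g p) = p"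
 by (simp_all add: act_comp[symmetric] del: act_id) (simp_all)

lemma q_act: "g \<in> W \<Longrightarrow> pr (fst (act g p)) (snd (act g p)) = pr (fst p) (snd p)"
 by (simp add: act_def pr_cg_right)

lemma act_X [simp]: "g \<in> W \<Longrightarrow> act g p \<in> X \<longleftrightarrow> p \<in> X"
 by (simp add: X_def q_act)

lemma Pol_act:
 assumes "Pol k l P" "g \<in> W" shows "Pol k l (\<lambda>p. P (act g p))"
 unfolding act_def
proof (rule Pol_comp[OF assms(1)])
 fix u
 show "\<exists>u'. \<forall>v. pr u (g v) = pr u' v" by (rule adjoint_exists[OF W_linear[OF assms(2)]])
 have "Vector_Spaces.linear scale scale (cg g)"
  by unfold_locales (auto simp: cg_map[OF assms(2)] algebra_simps)
 then show "\<exists>u'. \<forall>v. pr u (cg g v) = pr u' v" by (rule adjoint_exists)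
qed

section \<open>Eigenprojections and the centre of the group\<close>

lemma W_finite_order:
 assumes "g \<in> W" shows "\<exists>N>0. g ^^ N = id"
proof -
 have pow: "g ^^ n \<in> W" for n by (induction n) (simp_all only: funpow.simps W_id W_comp assms)
 then have "range (\<lambda>n. g ^^ n) \<subseteq> W" by blast
 then have "\<not> inj (\<lambda>n. g ^^ n)" using finite_W finite_subset finite_imageD infinite_UNIV_nat by metis
 then obtain m n where mn: "g ^^ m = g ^^ n" "m < n" by (metis injI linorder_neqE_nat)
 then have "g ^^ n = g ^^ m \<circ> g ^^ (n - m)" by (metis funpow_add le_add_diff_inverse less_imp_le)
 then have "invf (g ^^ m) \<circ> g ^^ m \<circ> g ^^ (n - m) = invf (g ^^ m) \<circ> g ^^ m"
  using mn by (simp add: comp_assoc)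
 then have "g ^^ (n - m) = id" using inv_comp(1)[OF pow] by simp
 with mn show ?thesis by (intro exI[of _ "n - m"]) auto
qed

text \<open>If \<open>g ^^ N = id\<close> and \<open>\<omega> ^ N = 1\<close>, this character sum
  over the cyclic group projects onto the \<omega>-eigenspace of \<open>g\<close> along the other
  eigenspaces. It gives diagonalizability without minimal polynomials.\<close>

definition eigproj :: "('h \<Rightarrow> 'h) \<Rightarrow> nat \<Rightarrow> complex \<Rightarrow> 'h \<Rightarrow> 'h" where
 "eigproj g N \<omega> v = (1 / of_nat N) *s (\<Sum>k<N. inverse \<omega> ^ k *s (g ^^ k) v)"

lemma W_funpow: "g \<in> W \<Longrightarrow> g ^^ n \<in> W"
 by (induction n) (simp_all only: funpow.simps W_id W_comp)

lemma eigproj_linear: "g \<in> W \<Longrightarrow> Vector_Spaces.linear scale scale (eigproj g N \<omega>)"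
 by unfold_locales
  (simp_all add: eigproj_def W_map[OF W_funpow] scale_right_distrib scale_sum_right sum.distrib mult_ac)

lemma eigproj_eigen:
 assumes g: "g \<in> W" "g ^^ N = id" "N > 0" and \<omega>: "\<omega> ^ N = 1"
 shows "g (eigproj g N \<omega> v) = \<omega> *s eigproj g N \<omega> v" "eigproj g N \<omega> (g v) = \<omega> *s eigproj g N \<omega> v"
proof -
 let ?f = "\<lambda>k. inverse \<omega> ^ k *s (g ^^ k) v"
 have \<omega>0: "\<omega> \<noteq> 0" using \<omega> g by (metis power_0_left neq0_conv zero_neq_one)
 \<comment> \<open>The summand is periodic in the exponent, so applying \<open>g\<close> only shifts
   the sum cyclically.\<close>
 have fN: "?f N = ?f 0" using g \<omega> by (simp add: power_inverse)
 have "(\<Sum>k<N. ?f (Suc k)) = (\<Sum>k<N. ?f k)"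
  using sum.lessThan_Suc_shift[of ?f N] sum.lessThan_Suc[of ?f N] fN by simp
 moreover have "\<omega> *s (\<Sum>k<N. ?f (Suc k)) = (\<Sum>k<N. inverse \<omega> ^ k *s g ((g ^^ k) v))"
  using \<omega>0 by (simp add: scale_sum_right mult.assoc[symmetric])
 ultimately have *: "(\<Sum>k<N. inverse \<omega> ^ k *s g ((g ^^ k) v)) = \<omega> *s (\<Sum>k<N. ?f k)" by metis
 have "g (eigproj g N \<omega> v) = (1 / of_nat N) *s (\<Sum>k<N. inverse \<omega> ^ k *s g ((g ^^ k) v))"
  by (simp only: eigproj_def W_map[OF g(1)])
 then show "g (eigproj g N \<omega> v) = \<omega> *s eigproj g N \<omega> v"
  by (simp only: * eigproj_def scale_scale mult.commute)
 have "eigproj g N \<omega> (g v) = (1 / of_nat N) *s (\<Sum>k<N. inverse \<omega> ^ k *s g ((g ^^ k) v))"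
  by (simp only: eigproj_def funpow_swap1)
 then show "eigproj g N \<omega> (g v) = \<omega> *s eigproj g N \<omega> v"
  by (simp only: * eigproj_def scale_scale mult.commute)
qed

lemma eigproj_eigenvector:
 assumes g: "g \<in> W" "N > 0" and \<omega>: "\<omega> ^ N = 1" "\<mu> ^ N = 1" and v: "g v = \<mu> *s v"
 shows "eigproj g N \<omega> v = (if \<mu> = \<omega> then v else 0)"
proof -
 have "(g ^^ k) v = \<mu> ^ k *s v" for k
  by (induction k) (simp_all add: W_map[OF g(1)] v)
 then have "eigproj g N \<omega> v = (1 / of_nat N * (\<Sum>k<N. (\<mu> / \<omega>) ^ k)) *s v"
  by (simp add: eigproj_def scale_sum_left[symmetric] power_mult_distrib[symmetric] divide_inverse mult.commute)
 also have "(\<Sum>k<N. (\<mu> / \<omega>) ^ k) = (if \<mu> = \<omega> then of_nat N else 0)"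
 proof (cases "\<mu> = \<omega>")
  case True
  moreover have "\<omega> \<noteq> 0" using \<omega> g by (metis power_0_left neq0_conv zero_neq_one)
  ultimately show ?thesis by simp
 next
  case False
  then have "\<mu> / \<omega> \<noteq> 1" by (metis divide_eq_1_iff)
  moreover have "(\<mu> / \<omega>) ^ N = 1" using \<omega> by (simp add: power_divide)
  ultimately show ?thesis using False geometric_sum[of "\<mu> / \<omega>" N] by simp
 qed
 finally show ?thesis using g by auto
qed

text \<open>Orthogonality of characters: summed over all roots of unity only the exponent 0
  survives, so the eigenspaces span the space.\<close>

lemma sum_eigproj:
 assumes g: "g ^^ N = id" "N > 0"
 shows "(\<Sum>\<omega>\<in>{z. z ^ N = 1}. eigproj g N \<omega> v) = v"
proof -
 let ?R = "{z :: complex. z ^ N = 1}"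
 have fin: "finite ?R" using finite_roots_unity[of N] g by simp
 have S: "(\<Sum>\<omega>\<in>?R. inverse \<omega> ^ k) = (if k = 0 then of_nat N else 0)" if "k < N" for k
 proof (cases "k = 0")
  case True
  then show ?thesis using card_roots_unity_eq[of N] g by simp
 next
  case False
  define \<zeta> where "\<zeta> = cis (2 * pi / of_nat N)"
  have \<zeta>N: "\<zeta> ^ N = 1" unfolding \<zeta>_def DeMoivre using g by simp
  have "\<zeta> ^ k = cis (2 * pi * real k / real N)" unfolding \<zeta>_def DeMoivre by (simp add: field_simps)
  moreover have "cis (2 * pi * real k / real N) \<noteq> cis (2 * pi * real 0 / real N)"
   using bij_betw_roots_unity[OF g(2)] that False unfolding bij_betw_def inj_on_def
   by (metis g(2) lessThan_iff)
  ultimately have \<zeta>k: "\<zeta> ^ k \<noteq> 1" by simp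
  have \<zeta>0: "\<zeta> \<noteq> 0" by (simp add: \<zeta>_def)
  \<comment> \<open>Multiplication by a primitive root permutes the roots and multiplies the sum by
    a factor different from 1, so the sum is zero.\<close>
  have "bij_betw (\<lambda>\<omega>. \<zeta> * \<omega>) ?R ?R"
   by (rule bij_betw_byWitness[of _ "\<lambda>\<omega>. \<omega> / \<zeta>"])
    (use \<zeta>0 \<zeta>N in \<open>auto simp: power_mult_distrib power_divide\<close>)
  then have "(\<Sum>\<omega>\<in>?R. inverse \<omega> ^ k) = (\<Sum>\<omega>\<in>?R. inverse (\<zeta> * \<omega>) ^ k)"
   by (rule sum.reindex_bij_betw[symmetric])
  also have "\<dots> = inverse (\<zeta> ^ k) * (\<Sum>\<omega>\<in>?R. inverse \<omega> ^ k)"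
   by (simp add: sum_distrib_left power_mult_distrib power_inverse)
  finally have "(inverse (\<zeta> ^ k) - 1) * (\<Sum>\<omega>\<in>?R. inverse \<omega> ^ k) = 0"
   by (simp add: algebra_simps)
  then show ?thesis using \<zeta>k False by auto
 qed
 have "(\<Sum>\<omega>\<in>?R. eigproj g N \<omega> v) = (1 / of_nat N) *s (\<Sum>k<N. (\<Sum>\<omega>\<in>?R. inverse \<omega> ^ k) *s (g ^^ k) v)"
  unfolding eigproj_def scale_sum_right[symmetric] scale_sum_left by (subst sum.swap) simp
 also have "(\<Sum>k<N. (\<Sum>\<omega>\<in>?R. inverse \<omega> ^ k) *s (g ^^ k) v) = (\<Sum>k<N. if k = 0 then of_nat N *s v else 0)"
  by (intro sum.cong refl) (auto simp: S)
 also have "\<dots> = of_nat N *s v" using g by simp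
 finally show ?thesis using g by simp
qed

text \<open>Schur's lemma: an eigenspace of a central element is stable under \<open>W\<close>, and
  some eigenprojection of a nonzero vector is nonzero.\<close>

lemma center_scalar:
 assumes "z \<in> Z" shows "\<exists>c. c \<noteq> 0 \<and> z = (\<lambda>v. c *s v)"
proof -
 have z: "z \<in> W" "\<And>w. w \<in> W \<Longrightarrow> z \<circ> w = w \<circ> z" using assms by (auto simp: group_center_def)
 obtain N where N: "N > 0" "z ^^ N = id" using W_finite_order[OF z(1)] by blast
 obtain v :: 'h where v: "v \<noteq> 0" using irreducible unfolding irreducible_group_def by blast
 then have "\<exists>\<omega>. \<omega> ^ N = 1 \<and> eigproj z N \<omega> v \<noteq> 0"
  using sum_eigproj[OF N(2,1), of v] by (metis (mono_tags, lifting) mem_Collect_eq sum.neutral)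
 then obtain \<omega> where \<omega>: "\<omega> ^ N = 1" "eigproj z N \<omega> v \<noteq> 0" by blast
 define U where "U = {v. z v = \<omega> *s v}"
 have "subspace U"
  unfolding U_def by (rule subspaceI) (auto simp: W_map[OF z(1)] scale_right_distrib mult.commute)
 moreover have "w ` U \<subseteq> U" if "w \<in> W" for w
  using z(2)[OF that] by (auto simp: U_def fun_eq_iff W_map[OF that])
 moreover have "eigproj z N \<omega> v \<in> U" using eigproj_eigen(1)[OF z(1) N(2,1) \<omega>(1)] by (simp add: U_def)
 ultimately have "U = UNIV" using irreducible \<omega>(2) unfolding irreducible_group_def by blast
 then have "z = (\<lambda>v. \<omega> *s v)" by (auto simp: U_def)
 moreover have "\<omega> \<noteq> 0" using \<omega> N by (metis power_0_left neq0_conv zero_neq_one)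
 ultimately show ?thesis by blast
qed

lemma Z_W: "z \<in> Z \<Longrightarrow> z \<in> W"
 by (simp add: group_center_def)

lemma scalar_in_Z:
 assumes "g \<in> W" "g = (\<lambda>v. c *s v)" shows "g \<in> Z"
proof -
 have "g \<circ> w = w \<circ> g" if "w \<in> W" for w
  using that by (simp add: fun_eq_iff assms(2) W_map)
 then show ?thesis using assms(1) by (simp add: group_center_def)
qed

lemma id_Z [simp]: "id \<in> Z"
 by (simp add: group_center_def)

lemma finite_Z: "finite Z"
 using finite_W Z_W finite_subset by (metis subsetI)

lemma Z_inv: "z \<in> Z \<Longrightarrow> invf z \<in> Z"
proof -
 assume z: "z \<in> Z"
 then obtain c where c: "c \<noteq> 0" "z = (\<lambda>v. c *s v)" using center_scalar by blast
 have "invf z v = inverse c *s v" for v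
  using inv_cancel(1)[OF Z_W[OF z], of "inverse c *s v"] c by simp
 then show ?thesis using scalar_in_Z[OF W_inv[OF Z_W[OF z]]] by blast
qed

text \<open>The scalar c acts by c on the first argument and by its inverse on the second, and the
  two powers cancel in diagonal bidegree. This is the origin of all the conditions on
  \<open>Z\<close> below.\<close>

lemma Pol_act_Z:
 assumes "z \<in> Z" "Pol k k P" shows "P (act z p) = P p"
proof -
 obtain c where c: "c \<noteq> 0" "z = (\<lambda>v. c *s v)" using center_scalar assms by blast
 have iz: "invf z v = inverse c *s v" for v
  using inv_cancel(1)[OF Z_W[OF assms(1)], of "inverse c *s v"] c by simp
 have "cg z \<eta> = inverse c *s \<eta>" for \<eta>
  by (rule pr_ext_left) (simp add: pr_cg Z_W[OF assms(1)] iz pr_simps)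
 then have "act z p = (c *s fst p, inverse c *s snd p)" by (simp add: act_def c)
 then show ?thesis using Pol_hom[OF assms(2), of c "fst p" "inverse c" "snd p"] c
  by (simp add: power_mult_distrib[symmetric])
qed

lemma eigen_dual_basis:
 assumes g: "g \<in> W" "g \<notin> Z"
 shows "\<exists>(J :: 'h set) e e' a b \<mu> \<nu>. dualb J e e' \<and> a \<in> J \<and> b \<in> J \<and> a \<noteq> b \<and> \<mu> \<noteq> \<nu> \<and> \<mu> \<noteq> 0 \<and> \<nu> \<noteq> 0 \<and>
  (\<forall>v. pr (e' a) (g v) = \<mu> * pr (e' a) v) \<and> (\<forall>v. pr (e' b) (g v) = \<nu> * pr (e' b) v) \<and>
  g (e a) = \<mu> *s e a \<and> g (e b) = \<nu> *s e b"
proof -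
 obtain N where N: "N > 0" "g ^^ N = id" using W_finite_order[OF g(1)] by blast
 let ?E = "eigproj g N"
 obtain v :: 'h where v: "v \<noteq> 0" using irreducible unfolding irreducible_group_def by blast
 then have "\<exists>\<omega>. \<omega> ^ N = 1 \<and> ?E \<omega> v \<noteq> 0"
  using sum_eigproj[OF N(2,1), of v] by (metis (mono_tags, lifting) mem_Collect_eq sum.neutral)
 then obtain \<mu> where \<mu>: "\<mu> ^ N = 1" "?E \<mu> v \<noteq> 0" by blast
 have "\<exists>\<nu> w. \<nu> ^ N = 1 \<and> \<nu> \<noteq> \<mu> \<and> ?E \<nu> w \<noteq> 0"
 proof (rule ccontr)
  assume "\<not> ?thesis"
  then have 0: "?E \<nu> w = 0" if "\<nu> ^ N = 1" "\<nu> \<noteq> \<mu>" for \<nu> w using that by blast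
  have "?E \<mu> w = w" for w
  proof -
   have "(\<Sum>\<omega>\<in>{z. z ^ N = 1}. ?E \<omega> w) = (\<Sum>\<omega>\<in>{z. z ^ N = 1}. if \<omega> = \<mu> then ?E \<omega> w else 0)"
    by (intro sum.cong refl) (auto simp: 0)
   also have "\<dots> = ?E \<mu> w"
    using \<mu> N finite_roots_unity[of N] by (subst sum.delta) auto
   finally show ?thesis using sum_eigproj[OF N(2,1), of w] by simp
  qed
  then have "g w = \<mu> *s w" for w using eigproj_eigen(1)[OF g(1) N(2,1) \<mu>(1), of w] by simp
  then show False using scalar_in_Z[OF g(1)] g(2) by blast
 qed
 then obtain \<nu> w where \<nu>: "\<nu> ^ N = 1" "\<nu> \<noteq> \<mu>" "?E \<nu> w \<noteq> 0" by blast
 define y1 where "y1 = ?E \<mu> v"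
 define y2 where "y2 = ?E \<nu> w"
 have gy: "g y1 = \<mu> *s y1" "g y2 = \<nu> *s y2"
  using eigproj_eigen(1)[OF g(1) N(2,1)] \<mu> \<nu> by (auto simp: y1_def y2_def)
 have Ey: "?E \<mu> y1 = y1" "?E \<nu> y1 = 0" "?E \<mu> y2 = 0" "?E \<nu> y2 = y2"
  using eigproj_eigenvector[OF g(1) N(1)] \<mu> \<nu> gy by auto
 have y0: "y1 \<noteq> 0" "y2 \<noteq> 0" using \<mu> \<nu> by (auto simp: y1_def y2_def)
 have dual: "\<exists>u. pr u y = 1" if y: "y \<noteq> 0" for y
 proof -
  obtain u where u: "pr u y \<noteq> 0" using pr_ext[of y 0] y by auto
  show ?thesis by (rule exI[of _ "inverse (pr u y) *s u"]) (use u in \<open>simp add: pr_simps\<close>)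
 qed
 obtain u1 u2 where u: "pr u1 y1 = 1" "pr u2 y2 = 1" using dual y0 by blast
 \<comment> \<open>Composed with the eigenprojection, a functional becomes an eigenvector of the
   transpose of \<open>g\<close>.\<close>
 obtain a1 where a1: "\<And>v. pr u1 (?E \<mu> v) = pr a1 v" using adjoint_exists[OF eigproj_linear[OF g(1)]] by blast
 obtain a2 where a2: "\<And>v. pr u2 (?E \<nu> v) = pr a2 v" using adjoint_exists[OF eigproj_linear[OF g(1)]] by blast
 have aa: "pr a1 y1 = 1" "pr a1 y2 = 0" "pr a2 y1 = 0" "pr a2 y2 = 1"
  by (simp_all add: a1[symmetric] a2[symmetric] Ey u)
 have ag: "pr a1 (g v) = \<mu> * pr a1 v" "pr a2 (g v) = \<nu> * pr a2 v" for v
  using eigproj_eigen(2)[OF g(1) N(2,1)] \<mu>(1) \<nu>(1) by (simp_all add: a1[symmetric] a2[symmetric] pr_simps)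
 have y12: "y1 \<noteq> y2" using aa by auto
 have "y2 \<notin> span {}" using y0 by simp
 moreover have "y1 \<notin> span {y2}"
  using aa by (auto simp: span_singleton pr_simps)
 ultimately have "independent {y1, y2}"
  using y12 by (simp add: independent_insert)
 then obtain B where B: "{y1, y2} \<subseteq> B" "independent B" "span B = UNIV"
  using extend_basis_superset[of "{y1, y2}"] independent_extend_basis span_extend_basis by metis
 have finB: "finite B" using finiteI_independent[OF B(2)] .
 have "\<exists>d. \<forall>v. representation B v b = pr d v" for b
 proof -
  have "Vector_Spaces.linear scale (*) (\<lambda>v. representation B v b)"
   by unfold_locales (simp_all add: representation_add[OF B(2)] representation_scale[OF B(2)] B(3) algebra_simps)
  then show ?thesis using functional_eq_pr by blast
 qed
 then obtain d where d: "\<And>v b. representation B v b = pr (d b) v" by metis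
 have expB: "(\<Sum>b\<in>B. pr (d b) v *s b) = v" for v
  using sum_representation_eq[OF B(2) _ finB, of v] B(3) by (simp add: d)
 have dB: "pr (d b) b' = (if b = b' then 1 else 0)" if "b' \<in> B" for b b'
  using representation_basis[OF B(2) that] by (simp add: d[symmetric])
 \<comment> \<open>The remaining basis vectors lose their components along \<open>y1\<close> and
   \<open>y2\<close> as measured by \<open>a1\<close> and \<open>a2\<close>; their own dual vectors
   already vanish on \<open>y1\<close> and \<open>y2\<close>.\<close>
 define e where "e b = (if b = y1 then y1 else if b = y2 then y2 else b - pr a1 b *s y1 - pr a2 b *s y2)" for b
 define e' where "e' b = (if b = y1 then a1 else if b = y2 then a2 else d b)" for b
 have 1: "pr (e' i) (e j) = (if i = j then 1 else 0)" if "i \<in> B" "j \<in> B" for i j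
  using that aa B(1) by (auto simp: e_def e'_def pr_simps dB)
 have 2: "(\<Sum>i\<in>B. pr (e' i) v *s e i) = v" for v
 proof -
  define B' where "B' = B - {y1, y2}"
  have split: "(\<Sum>i\<in>B. f i) = f y1 + f y2 + (\<Sum>i\<in>B'. f i)" for f :: "'h \<Rightarrow> 'z::comm_monoid_add"
  proof -
   have "B = insert y1 (insert y2 B')" using B(1) by (auto simp: B'_def)
   moreover have "finite B'" "y1 \<notin> B'" "y2 \<notin> B'" using finB by (auto simp: B'_def)
   ultimately show ?thesis using y12 by (simp add: add_ac)
  qed
  have B': "e b = b - pr a1 b *s y1 - pr a2 b *s y2" "e' b = d b" if "b \<in> B'" for b
   using that by (auto simp: e_def e'_def B'_def)
  have v: "v = pr (d y1) v *s y1 + pr (d y2) v *s y2 + (\<Sum>b\<in>B'. pr (d b) v *s b)"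
   using expB[of v] by (simp add: split)
  have p1: "pr a1 v = pr (d y1) v + (\<Sum>b\<in>B'. pr (d b) v * pr a1 b)"
   by (subst v, simp only: pr_simps aa) simp
  have p2: "pr a2 v = pr (d y2) v + (\<Sum>b\<in>B'. pr (d b) v * pr a2 b)"
   by (subst v, simp only: pr_simps aa) simp
  have "(\<Sum>i\<in>B'. pr (e' i) v *s e i) =
   (\<Sum>b\<in>B'. pr (d b) v *s b) - (\<Sum>b\<in>B'. pr (d b) v * pr a1 b) *s y1 - (\<Sum>b\<in>B'. pr (d b) v * pr a2 b) *s y2"
   by (simp add: B' scale_right_diff_distrib sum_subtractf scale_sum_left)
  then have "(\<Sum>i\<in>B. pr (e' i) v *s e i) = pr a1 v *s y1 + pr a2 v *s y2 +
   ((\<Sum>b\<in>B'. pr (d b) v *s b) - (\<Sum>b\<in>B'. pr (d b) v * pr a1 b) *s y1 - (\<Sum>b\<in>B'. pr (d b) v * pr a2 b) *s y2)"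
   using y12 by (simp add: split) (simp add: e_def e'_def)
  also have "\<dots> = pr (d y1) v *s y1 + pr (d y2) v *s y2 + (\<Sum>b\<in>B'. pr (d b) v *s b)"
   by (simp add: p1 p2 scale_left_distrib)
  also have "\<dots> = v" using v by simp
  finally show ?thesis .
 qed
 have 3: "(\<Sum>i\<in>B. pr (e i) \<eta> *s e' i) = \<eta>" for \<eta>
 proof (rule pr_ext_left)
  fix u
  have "pr (\<Sum>i\<in>B. pr (e i) \<eta> *s e' i) u = pr \<eta> (\<Sum>i\<in>B. pr (e' i) u *s e i)"
   by (simp add: pr_simps pr_sym[of \<eta>] mult.commute)
  then show "pr (\<Sum>i\<in>B. pr (e i) \<eta> *s e' i) u = pr \<eta> u" by (simp add: 2)
 qed
 have "dualb B e e'" unfolding dualb_def using finB 1 2 3 by blast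
 moreover have "\<mu> \<noteq> 0" "\<nu> \<noteq> 0" using \<mu> \<nu> N by (metis power_0_left neq0_conv zero_neq_one)+
 moreover have "e y1 = y1" "e y2 = y2" "e' y1 = a1" "e' y2 = a2" using y12 by (auto simp: e_def e'_def)
 moreover have "y1 \<in> B" "y2 \<in> B" using B(1) by auto
 ultimately show ?thesis using y12 \<nu>(2) ag gy
  apply -
  apply (rule exI[of _ B], rule exI[of _ e], rule exI[of _ e'], rule exI[of _ y1], rule exI[of _ y2],
    rule exI[of _ \<mu>], rule exI[of _ \<nu>])
  by simp
qed

end

section \<open>Regular pairs, simultaneous division and separating functions\<close>

context irred_group
begin

text \<open>Non-zero-divisors among the functions of diagonal bidegree on \<open>X\<close>, the only
  ones that ever have to be cancelled.\<close>

definition nzd :: "'h pfun \<Rightarrow> bool" where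
 "nzd F \<longleftrightarrow> (\<forall>m Q. Pol m m Q \<longrightarrow> (\<forall>p\<in>X. F p * Q p = 0) \<longrightarrow> (\<forall>p\<in>X. Q p = 0))"

lemma nzdD: "nzd F \<Longrightarrow> Pol m m Q \<Longrightarrow> (\<And>p. p \<in> X \<Longrightarrow> F p * Q p = 0) \<Longrightarrow> p \<in> X \<Longrightarrow> Q p = 0"
 unfolding nzd_def by blast

lemma nzd_mult:
 assumes "nzd F" "nzd G" "Pol n n G" shows "nzd (\<lambda>p. F p * G p)"
 unfolding nzd_def
proof (intro allI impI ballI)
 fix m Q p assume Q: "Pol m m Q" "\<forall>p\<in>X. F p * G p * Q p = 0" and p: "p \<in> X"
 have "G p * Q p = 0" if "p \<in> X" for p
  by (rule nzdD[OF assms(1) Pol_mult[OF assms(3) Q(1)] _ that]) (use Q(2) in \<open>auto simp: mult_ac\<close>)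
 from nzdD[OF assms(2) Q(1) this p] show "Q p = 0" .
qed

lemma nzd_one: "nzd (\<lambda>_. 1)"
 by (simp add: nzd_def)

lemma nzd_prod:
 assumes "finite S" "\<And>w. w \<in> S \<Longrightarrow> nzd (F w)" "\<And>w. w \<in> S \<Longrightarrow> Pol (d w) (d w) (F w)"
 shows "nzd (\<lambda>p. \<Prod>w\<in>S. F w p) \<and> Pol (\<Sum>w\<in>S. d w) (\<Sum>w\<in>S. d w) (\<lambda>p. \<Prod>w\<in>S. F w p)"
 using assms
proof (induction S rule: finite_induct)
 case empty
 then show ?case using nzd_one Pol_const[of 1] by simp
next
 case (insert x S)
 then have "nzd (\<lambda>p. \<Prod>w\<in>S. F w p)" "Pol (\<Sum>w\<in>S. d w) (\<Sum>w\<in>S. d w) (\<lambda>p. \<Prod>w\<in>S. F w p)" by auto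
 then show ?case using insert.hyps insert.prems nzd_mult[of "F x"] Pol_mult[of "d x" "d x" "F x"] by simp
qed

lemma nzd_act:
 assumes "nzd F" "g \<in> W" shows "nzd (\<lambda>p. F (act g p))"
 unfolding nzd_def
proof (intro allI impI ballI)
 fix m Q p assume Q: "Pol m m Q" "\<forall>p\<in>X. F (act g p) * Q p = 0" and p: "p \<in> X"
 have "Q (act (invf g) p) = 0" if "p \<in> X" for p
 proof (rule nzdD[OF assms(1) Pol_act[OF Q(1) W_inv[OF assms(2)]] _ that])
  fix p assume "p \<in> X"
  then show "F p * Q (act (invf g) p) = 0"
   using Q(2)[rule_format, of "act (invf g) p"] assms(2) by simp
 qed
 from this[of "act g p"] p show "Q p = 0" using assms(2) by simp
qed

text \<open>\<open>A\<close> and \<open>B\<close> are eigenfunctions of \<open>w\<close> on \<open>X\<close> with eigenvalue \<open>\<noteq> 1\<close> that form a regular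
 sequence in the coordinate ring of \<open>X\<close>; they exist because \<open>X\<close> is normal and the fixed locus of a
 non-central \<open>w\<close> has codimension at least two.\<close>

definition good_pair :: "('h \<Rightarrow> 'h) \<Rightarrow> 'h pfun \<Rightarrow> 'h pfun \<Rightarrow> bool" where
 "good_pair w A B \<longleftrightarrow> Pol 1 1 A \<and> Pol 1 1 B \<and> nzd A \<and> nzd B \<and>
   (\<exists>\<kappa>. \<kappa> \<noteq> 0 \<and> \<kappa> \<noteq> 1 \<and> (\<forall>p. A (act w p) = \<kappa> * A p)) \<and>
   (\<exists>\<kappa>. \<kappa> \<noteq> 0 \<and> \<kappa> \<noteq> 1 \<and> (\<forall>p. B (act w p) = \<kappa> * B p)) \<and>
   (\<forall>m g g'. Pol m m g \<longrightarrow> Pol m m g' \<longrightarrow> (\<forall>p\<in>X. B p * g p = A p * g' p) \<longrightarrow>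
    (\<exists>h. Pol (m - 1) (m - 1) h \<and> (\<forall>p\<in>X. g p = A p * h p)))"

lemma nzd_xy:
 assumes dual: "dualb J e e'" and J: "a \<in> J" "b \<in> J" "a \<noteq> b"
 shows "nzd (\<lambda>p. pr (e' a) (fst p) * pr (e b) (snd p))"
 unfolding nzd_def
proof (intro allI impI ballI)
 fix m Q p assume Q: "Pol m m Q" "\<forall>p\<in>X. pr (e' a) (fst p) * pr (e b) (snd p) * Q p = 0" and p: "p \<in> X"
 have "pr (e b) (snd p) * Q p = 0" if "p \<in> X" for p
  by (rule X_cancel_x[OF dual J J(1) Pol_y[OF Q(1)] _ that]) (use Q(2) in \<open>simp add: mult.assoc\<close>)
 from X_cancel_y[OF dual J J(2) Q(1) this p] show "Q p = 0" .
qed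

text \<open>Eigencoordinates for two eigenvalues \<mu> and \<nu> give \<open>A\<close> = x_a y_b and
  \<open>B\<close> = x_b y_a, with eigenvalues \<mu>/\<nu> and \<nu>/\<mu>; both are regular and
  neither obstructs division by the other.\<close>

lemma good_pair_exists:
 assumes w: "w \<in> W" "w \<notin> Z" shows "\<exists>A B. good_pair w A B"
proof -
 obtain J :: "'h set" and e e' a b \<mu> \<nu> where dual: "dualb J e e'" and J: "a \<in> J" "b \<in> J" "a \<noteq> b"
  and \<mu>: "\<mu> \<noteq> \<nu>" "\<mu> \<noteq> 0" "\<nu> \<noteq> 0"
  and ea: "\<And>v. pr (e' a) (w v) = \<mu> * pr (e' a) v" "\<And>v. pr (e' b) (w v) = \<nu> * pr (e' b) v"
  and ee: "w (e a) = \<mu> *s e a" "w (e b) = \<nu> *s e b"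
  using eigen_dual_basis[OF w] by blast
 have "invf w (e a) = inverse \<mu> *s e a"
  using inv_cancel(1)[OF w(1), of "inverse \<mu> *s e a"] \<mu> by (simp add: W_map[OF w(1)] ee)
 moreover have "invf w (e b) = inverse \<nu> *s e b"
  using inv_cancel(1)[OF w(1), of "inverse \<nu> *s e b"] \<mu> by (simp add: W_map[OF w(1)] ee)
 ultimately have ey: "pr (e a) (cg w \<eta>) = inverse \<mu> * pr (e a) \<eta>" "pr (e b) (cg w \<eta>) = inverse \<nu> * pr (e b) \<eta>" for \<eta>
  by (simp_all add: pr_cg_right[OF w(1)] pr_simps)
 define A where "A p = pr (e' a) (fst p) * pr (e b) (snd p)" for p
 define B where "B p = pr (e' b) (fst p) * pr (e a) (snd p)" for p
 have "A (act w p) = \<mu> / \<nu> * A p" "B (act w p) = \<nu> / \<mu> * B p" for p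
  using \<mu> by (simp_all add: A_def B_def act_def ea ey field_simps)
 moreover have "\<mu> / \<nu> \<noteq> 0" "\<mu> / \<nu> \<noteq> 1" "\<nu> / \<mu> \<noteq> 0" "\<nu> / \<mu> \<noteq> 1" using \<mu> by auto
 moreover have "Pol 1 1 A" "Pol 1 1 B" unfolding A_def[abs_def] B_def[abs_def] by (rule Pol_xy)+
 moreover have "nzd A" "nzd B" unfolding A_def[abs_def] B_def[abs_def]
  using nzd_xy[OF dual J] nzd_xy[OF dual J(2,1)] J(3) by auto
 moreover have "\<exists>h. Pol (m - 1) (m - 1) h \<and> (\<forall>p\<in>X. g p = A p * h p)"
  if "Pol m m g" "Pol m m g'" "\<forall>p\<in>X. B p * g p = A p * g' p" for m g g'
  using X_regular_pair[OF dual J(2,1) J(3)[symmetric] that(1,2)] that(3) by (simp add: A_def B_def)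
 ultimately have "good_pair w A B" unfolding good_pair_def by blast
 then show ?thesis by blast
qed

text \<open>A predicate \<chi> picks one member of every pair and so determines one of the possible
  denominators.\<close>

definition sel :: "('a \<Rightarrow> bool) \<Rightarrow> ('a \<Rightarrow> 'p \<Rightarrow> complex) \<Rightarrow> ('a \<Rightarrow> 'p \<Rightarrow> complex) \<Rightarrow> 'a \<Rightarrow> 'p \<Rightarrow> complex" where
 "sel \<chi> A B w = (if \<chi> w then A w else B w)"

text \<open>The quotient of \<open>g \<chi>\<close> by its product is one fraction written with many
  denominators. For a single pair, B g_A = A g_B makes \<open>A\<close> divide g_A, so the fraction
  is regular there; the pairs are treated one after another.\<close>

lemma common_divisor:
 assumes "finite S" "\<And>w. w \<in> S \<Longrightarrow> good_pair w (A w) (B w)"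
  and "\<And>\<chi>. Pol (int (card S) + d) (int (card S) + d) (g \<chi>)"
  and "\<And>\<chi> \<chi>' p. p \<in> X \<Longrightarrow> g \<chi> p * (\<Prod>w\<in>S. sel \<chi>' A B w p) = g \<chi>' p * (\<Prod>w\<in>S. sel \<chi> A B w p)"
 shows "\<exists>h. Pol d d h \<and> (\<forall>\<chi>. \<forall>p\<in>X. g \<chi> p = h p * (\<Prod>w\<in>S. sel \<chi> A B w p))"
 using assms
proof (induction S arbitrary: g rule: finite_induct)
 case empty
 \<comment> \<open>With no pairs all products are 1 and \<open>g\<close> does not depend on \<chi>,
   so an arbitrary value serves.\<close>
 show ?case
  by (rule exI[of _ "g undefined"]) (use empty.prems(2)[of undefined] empty.prems(3) in auto)
next
 case (insert x S)
 let ?D = "\<lambda>\<chi> p. \<Prod>w\<in>S. sel \<chi> A B w p"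
 have gx: "good_pair x (A x) (B x)" using insert.prems(1) by blast
 have gS: "nzd (sel \<chi> A B w)" "Pol 1 1 (sel \<chi> A B w)" if "w \<in> S" for w \<chi>
  using insert.prems(1)[of w] that by (auto simp: good_pair_def sel_def)
 have D: "nzd (?D \<chi>)" "Pol (int (card S)) (int (card S)) (?D \<chi>)" for \<chi>
  using nzd_prod[OF insert.hyps(1), of "sel \<chi> A B" "\<lambda>_. 1"] gS by auto
 have Dx: "?D (\<chi>(x := b)) p = ?D \<chi> p" for \<chi> b p
  by (rule prod.cong) (use insert.hyps in \<open>auto simp: sel_def\<close>)
 have sx: "sel (\<chi>(x := b)) A B x = (if b then A x else B x)" for \<chi> b by (simp add: sel_def)
 have cS: "int (card (insert x S)) = int (card S) + 1" using insert.hyps by simp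
 have nA: "nzd (A x)" and nB: "nzd (B x)" and PA: "Pol 1 1 (A x)" and PB: "Pol 1 1 (B x)"
  using gx by (auto simp: good_pair_def)
 have rel: "g \<chi> p * (sel \<chi>' A B x p * ?D \<chi>' p) = g \<chi>' p * (sel \<chi> A B x p * ?D \<chi> p)" if "p \<in> X" for \<chi> \<chi>' p
  using insert.prems(3)[OF that, of \<chi> \<chi>'] insert.hyps by simp
 have Pg: "Pol (int (card S) + 1 + d) (int (card S) + 1 + d) (g \<chi>)" for \<chi>
  using insert.prems(2)[of \<chi>] by (simp only: cS)
 \<comment> \<open>The predicates \<open>?T\<close> and \<open>?F\<close> differ only in the choice
   at \<open>x\<close>. The common factors over \<open>S\<close> are non-zero-divisors and cancel,
   which leaves the relation between \<open>A x\<close> and \<open>B x\<close>.\<close>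
 have step: "\<exists>g'. Pol (int (card S) + d) (int (card S) + d) g' \<and>
   (\<forall>p\<in>X. g (\<chi>(x := True)) p = A x p * g' p) \<and> (\<forall>p\<in>X. g (\<chi>(x := False)) p = B x p * g' p)" for \<chi>
 proof -
  let ?T = "\<chi>(x := True)" let ?F = "\<chi>(x := False)"
  have BA: "B x p * g ?T p = A x p * g ?F p" if "p \<in> X" for p
  proof -
   have "?D \<chi> p * (B x p * g ?T p - A x p * g ?F p) = 0" if "p \<in> X" for p
    using rel[OF that, of ?T ?F] by (simp add: Dx sx algebra_simps)
   from nzdD[OF D(1) _ this that] show ?thesis
    using Pol_diff[OF Pol_mult[OF PB Pg[of ?T]] Pol_mult[OF PA Pg[of ?F]]] by force
  qed
  from gx Pg BA obtain h where h: "Pol (int (card S) + 1 + d - 1) (int (card S) + 1 + d - 1) h"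
   "\<And>p. p \<in> X \<Longrightarrow> g ?T p = A x p * h p"
   unfolding good_pair_def by blast
  have h1: "Pol (int (card S) + d) (int (card S) + d) h"
   by (rule Pol_cong[OF h(1)]) auto
  have "g ?F p = B x p * h p" if "p \<in> X" for p
  proof -
   have "A x p * (g ?F p - B x p * h p) = 0" if "p \<in> X" for p
    using BA[OF that] h(2)[OF that] by (auto simp add: algebra_simps)
   moreover have "Pol (int (card S) + 1 + d) (int (card S) + 1 + d) (\<lambda>p. g ?F p - B x p * h p)"
    by (intro Pol_diff Pg Pol_cong[OF Pol_mult[OF PB h(1)]]) auto
   ultimately have "g ?F p - B x p * h p = 0" using nzdD[OF nA] that by blast
   then show ?thesis by simp
  qed
  with h h1 show ?thesis by blast
 qed
 then have "\<forall>\<chi>. \<exists>g'. Pol (int (card S) + d) (int (card S) + d) g' \<and>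
   (\<forall>p\<in>X. g (\<chi>(x := True)) p = A x p * g' p) \<and> (\<forall>p\<in>X. g (\<chi>(x := False)) p = B x p * g' p)" by blast
 from choice[OF this] obtain G where G: "\<And>\<chi>. Pol (int (card S) + d) (int (card S) + d) (G \<chi>)"
  "\<And>\<chi> p. p \<in> X \<Longrightarrow> g (\<chi>(x := True)) p = A x p * G \<chi> p"
  "\<And>\<chi> p. p \<in> X \<Longrightarrow> g (\<chi>(x := False)) p = B x p * G \<chi> p" by blast
 \<comment> \<open>With \<open>A x\<close> chosen in both products the relation for \<open>g\<close>
   is that for \<open>G\<close> with two extra factors \<open>A x\<close>.\<close>
 have "G \<chi> p * ?D \<chi>' p = G \<chi>' p * ?D \<chi> p" if "p \<in> X" for \<chi> \<chi>' p
 proof -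
  have "A x p * (A x p * (G \<chi> p * ?D \<chi>' p - G \<chi>' p * ?D \<chi> p)) = 0" if "p \<in> X" for p
   using rel[OF that, of "\<chi>(x := True)" "\<chi>'(x := True)"] G(2)[OF that]
   by (simp add: Dx sx algebra_simps)
  moreover have P: "Pol (int (card S) + d + int (card S)) (int (card S) + d + int (card S))
    (\<lambda>p. G \<chi> p * ?D \<chi>' p - G \<chi>' p * ?D \<chi> p)"
   by (intro Pol_diff Pol_mult G D)
  ultimately have "A x p * (G \<chi> p * ?D \<chi>' p - G \<chi>' p * ?D \<chi> p) = 0" if "p \<in> X" for p
   using nzdD[OF nA Pol_mult[OF PA P]] that by blast
  from nzdD[OF nA P this that] show ?thesis by simp
 qed
 from insert.IH[OF insert.prems(1) G(1) this]
 obtain h where h: "Pol d d h" "\<And>\<chi> p. p \<in> X \<Longrightarrow> G \<chi> p = h p * ?D \<chi> p" by blast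
 have "g \<chi> p = h p * (\<Prod>w\<in>insert x S. sel \<chi> A B w p)" if "p \<in> X" for \<chi> p
 proof -
  have "g \<chi> p = g (\<chi>(x := \<chi> x)) p" by simp
  also have "\<dots> = sel \<chi> A B x p * G \<chi> p"
   using G(2,3)[OF that, of \<chi>] by (cases "\<chi> x") (simp_all add: sel_def)
  finally show ?thesis using insert.hyps by (simp add: h(2)[OF that] mult_ac)
 qed
 with h(1) show ?case by blast
qed

text \<open>Elements of total degree \<open>N\<close> in the tensor square of the diagonal
  functions. The form as a sum of products is what lets a map act on the first factor alone.\<close>

inductive Bi :: "int \<Rightarrow> ('h \<times> 'h \<Rightarrow> 'h \<times> 'h \<Rightarrow> complex) \<Rightarrow> bool" where
 Bi_zero: "Bi N (\<lambda>p p'. 0)"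
| Bi_add: "Bi N E \<Longrightarrow> Bi N E' \<Longrightarrow> Bi N (\<lambda>p p'. E p p' + E' p p')"
| Bi_mon: "Pol j j a \<Longrightarrow> Pol (N - j) (N - j) b \<Longrightarrow> Bi N (\<lambda>p p'. a p * b p')"

lemma Bi_mult:
 assumes E: "Bi N E" and l: "Pol 1 1 l"
 shows "Bi (N + 1) (\<lambda>p p'. (l p - c * l p') * E p p')"
 using E
proof (induction rule: Bi.induct)
 case (Bi_zero N)
 then show ?case using Bi.Bi_zero by simp
next
 case (Bi_add N E E')
 then show ?case using Bi.Bi_add[OF Bi_add.IH] by (simp add: algebra_simps)
next
 case (Bi_mon j a N b)
 have 1: "Bi (N + 1) (\<lambda>p p'. (l p * a p) * b p')"
  by (rule Bi.Bi_mon[OF Pol_mult[OF l Bi_mon(1)]]) (use Bi_mon(2) in simp)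
 have "Pol (N + 1 - j) (N + 1 - j) (\<lambda>p. - c * (l p * b p))"
  by (intro Pol_smult Pol_cong[OF Pol_mult[OF l Bi_mon(2)]]) auto
 from Bi.Bi_add[OF 1 Bi.Bi_mon[OF Bi_mon(1) this]] show ?case by (simp add: algebra_simps)
qed

lemma Bi_prod:
 assumes "finite S" "\<And>w. w \<in> S \<Longrightarrow> Pol 1 1 (l w)"
 shows "Bi (int (card S)) (\<lambda>p p'. \<Prod>w\<in>S. l w p - c w * l w p')"
 using assms
proof (induction S rule: finite_induct)
 case empty
 show ?case using Bi_mon[OF Pol_const[of 1], of 0 "\<lambda>_. 1"] Pol_const[of 1] by simp
next
 case (insert x S)
 then show ?case using Bi_mult[of "int (card S)" _ "l x" "c x"] by (simp add: add.commute)
qed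

lemma Bi_Pol: "Bi N E \<Longrightarrow> u \<in> W \<Longrightarrow> Pol N N (\<lambda>p. E p (act u p))"
proof (induction rule: Bi.induct)
 case (Bi_mon j a N b)
 show ?case by (rule Pol_cong[OF Pol_mult[OF Bi_mon(1) Pol_act[OF Bi_mon(2,3)]]]) auto
qed (auto intro: Pol_zero Pol_add)

text \<open>A function \<open>E\<close> on \<open>X \<times> X\<close> that vanishes on the graph of every non-central \<open>u\<close> plays the role of
 the separability idempotent of Galois theory.\<close>

lemma separating_function:
 obtains A B E C where
  "\<And>w. w \<in> W - Z \<Longrightarrow> good_pair w (A w) (B w)"
  "\<And>\<chi>. Bi (int (card (W - Z))) (E \<chi>)"
  "\<And>\<chi>. C \<chi> \<noteq> 0"
  "\<And>\<chi> u p. u \<in> W \<Longrightarrow> E \<chi> p (act u p) = (if u \<in> Z then C \<chi> * (\<Prod>w\<in>W - Z. sel \<chi> A B w p) else 0)"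
proof -
 have "\<forall>w. \<exists>AB. w \<in> W - Z \<longrightarrow> good_pair w (fst AB) (snd AB)" using good_pair_exists by auto
 from choice[OF this] obtain AB where "\<And>w. w \<in> W - Z \<Longrightarrow> good_pair w (fst (AB w)) (snd (AB w))" by blast
 then obtain A B where AB: "\<And>w. w \<in> W - Z \<Longrightarrow> good_pair w (A w) (B w)"
  using that[of "\<lambda>w. fst (AB w)" "\<lambda>w. snd (AB w)"] by blast
 have fin: "finite (W - Z)" using finite_W by simp
 have "\<exists>\<kappa>. w \<in> W - Z \<longrightarrow> \<kappa> \<noteq> 0 \<and> \<kappa> \<noteq> 1 \<and> (\<forall>p. sel \<chi> A B w (act w p) = \<kappa> * sel \<chi> A B w p)" for \<chi> w
  using AB[of w] by (auto simp: good_pair_def sel_def)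
 then have "\<forall>\<chi> w. \<exists>\<kappa>. w \<in> W - Z \<longrightarrow> \<kappa> \<noteq> 0 \<and> \<kappa> \<noteq> 1 \<and> (\<forall>p. sel \<chi> A B w (act w p) = \<kappa> * sel \<chi> A B w p)" by blast
 then obtain \<kappa> where \<kappa>: "\<And>\<chi> w. w \<in> W - Z \<Longrightarrow> \<kappa> \<chi> w \<noteq> 0 \<and> \<kappa> \<chi> w \<noteq> 1 \<and> (\<forall>p. sel \<chi> A B w (act w p) = \<kappa> \<chi> w * sel \<chi> A B w p)"
  by metis
 \<comment> \<open>The factor of \<open>w\<close> vanishes at \<open>p' = act w p\<close> since its
   eigenvalue there is \<open>\<kappa> \<chi> w\<close>. A central \<open>u\<close> fixes every
   factor function, and the product becomes the constant \<open>C \<chi>\<close> times the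
   denominator.\<close>
 define E where "E \<chi> p p' = (\<Prod>w\<in>W - Z. sel \<chi> A B w p - inverse (\<kappa> \<chi> w) * sel \<chi> A B w p')" for \<chi> p p'
 define C where "C \<chi> = (\<Prod>w\<in>W - Z. 1 - inverse (\<kappa> \<chi> w))" for \<chi>
 have P: "Pol 1 1 (sel \<chi> A B w)" if "w \<in> W - Z" for \<chi> w
  using AB[OF that] by (simp add: good_pair_def sel_def)
 have 1: "Bi (int (card (W - Z))) (E \<chi>)" for \<chi>
  unfolding E_def[abs_def] by (rule Bi_prod[OF fin P])
 have 2: "C \<chi> \<noteq> 0" for \<chi>
  unfolding C_def using fin \<kappa>[of _ \<chi>] by (simp add: inverse_eq_1_iff)
 have 3: "E \<chi> p (act u p) = (if u \<in> Z then C \<chi> * (\<Prod>w\<in>W - Z. sel \<chi> A B w p) else 0)" if u: "u \<in> W" for \<chi> u p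
 proof (cases "u \<in> Z")
  case True
  have "E \<chi> p (act u p) = (\<Prod>w\<in>W - Z. (1 - inverse (\<kappa> \<chi> w)) * sel \<chi> A B w p)"
   unfolding E_def by (rule prod.cong) (auto simp: Pol_act_Z[OF True P] algebra_simps)
  then show ?thesis using True by (simp add: prod.distrib C_def)
 next
  case False
  then have "\<kappa> \<chi> u \<noteq> 0" "sel \<chi> A B u (act u p) = \<kappa> \<chi> u * sel \<chi> A B u p" using \<kappa>[of u \<chi>] u by blast+
  then have "sel \<chi> A B u p - inverse (\<kappa> \<chi> u) * sel \<chi> A B u (act u p) = 0" by simp
  then have "E \<chi> p (act u p) = 0"
   unfolding E_def using fin u False by (intro prod_zero) auto
  then show ?thesis using False by simp
 qed
 show ?thesis by (rule that[OF AB 1 2 3])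
qed

end

context irred_group
begin

section \<open>The graded double centralizer property\<close>

definition inv_Pol :: "int \<Rightarrow> 'h pfun \<Rightarrow> bool" where
 "inv_Pol j r \<longleftrightarrow> Pol j j r \<and> (\<forall>w\<in>W. \<forall>p. r (act w p) = r p)"

lemma sum_translate: "g \<in> W \<Longrightarrow> (\<Sum>u\<in>W. f (u \<circ> g)) = (\<Sum>u\<in>W. f u)"
 by (rule sum.reindex_bij_betw[OF bij_betw_translate_right])

lemma sum_inverse: "(\<Sum>u\<in>W. f (invf u)) = (\<Sum>u\<in>W. f u)"
 by (rule sum.reindex_bij_betw[OF bij_betw_inverse])

lemma inv_Pol_trace:
 assumes "Pol j j P" shows "inv_Pol j (\<lambda>p. \<Sum>u\<in>W. P (act u p))"
 unfolding inv_Pol_def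
proof (intro conjI ballI allI)
 show "Pol j j (\<lambda>p. \<Sum>u\<in>W. P (act u p))" by (intro Pol_sum Pol_act assms)
 fix w p assume w: "w \<in> W"
 have "(\<Sum>u\<in>W. P (act u (act w p))) = (\<Sum>u\<in>W. P (act (u \<circ> w) p))"
  by (rule sum.cong) (simp_all add: act_comp w)
 then show "(\<Sum>u\<in>W. P (act u (act w p))) = (\<Sum>u\<in>W. P (act u p))"
  by (simp add: sum_translate[OF w, of "\<lambda>u. P (act u p)"])
qed

text \<open>Multiplying all translates turns a denominator into an invariant one, over which the
  maps in question are linear.\<close>

lemma inv_Pol_norm:
 assumes "Pol j j P" shows "inv_Pol (int (card W) * j) (\<lambda>p. \<Prod>u\<in>W. P (act u p))"
 unfolding inv_Pol_def
proof (intro conjI ballI allI)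
 have "Pol (int n * j) (int n * j) (\<lambda>p. \<Prod>u\<in>S. P (act u p))" if "S \<subseteq> W" "card S = n" for S n
  using finite_subset[OF that(1) finite_W] that
 proof (induction S arbitrary: n rule: finite_induct)
  case empty
  then show ?case using Pol_const[of 1] by simp
 next
  case (insert x S)
  have "x \<in> W" and "Pol (int (card S) * j) (int (card S) * j) (\<lambda>p. \<Prod>u\<in>S. P (act u p))"
   using insert.prems insert.IH[of "card S"] by auto
  then have "Pol (j + int (card S) * j) (j + int (card S) * j) (\<lambda>p. P (act x p) * (\<Prod>u\<in>S. P (act u p)))"
   by (intro Pol_mult Pol_act[OF assms])
  then show ?case
   by (rule Pol_cong) (use insert in \<open>auto simp: algebra_simps\<close>)
 qed
 then show "Pol (int (card W) * j) (int (card W) * j) (\<lambda>p. \<Prod>u\<in>W. P (act u p))" by simp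
 fix w p assume w: "w \<in> W"
 have "(\<Prod>u\<in>W. P (act u (act w p))) = (\<Prod>u\<in>W. P (act (u \<circ> w) p))"
  by (rule prod.cong) (simp_all add: act_comp w)
 then show "(\<Prod>u\<in>W. P (act u (act w p))) = (\<Prod>u\<in>W. P (act u p))"
  by (simp add: prod.reindex_bij_betw[OF bij_betw_translate_right[OF w], of "\<lambda>u. P (act u p)"])
qed

lemma nzd_norm:
 assumes "nzd F" "Pol j j F" shows "nzd (\<lambda>p. \<Prod>u\<in>W. F (act u p))"
 using nzd_prod[OF finite_W, of "\<lambda>u p. F (act u p)" "\<lambda>_. j"] nzd_act[OF assms(1)] Pol_act[OF assms(2)] by simp

lemma good_sel:
 assumes "\<And>w. w \<in> W - Z \<Longrightarrow> good_pair w (A w) (B w)"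
 shows "nzd (\<lambda>p. \<Prod>w\<in>W - Z. sel \<chi> A B w p)"
  "Pol (int (card (W - Z))) (int (card (W - Z))) (\<lambda>p. \<Prod>w\<in>W - Z. sel \<chi> A B w p)"
proof -
 have "nzd (sel \<chi> A B w)" "Pol 1 1 (sel \<chi> A B w)" if "w \<in> W - Z" for w
  using assms[OF that] by (auto simp: good_pair_def sel_def)
 then show "nzd (\<lambda>p. \<Prod>w\<in>W - Z. sel \<chi> A B w p)"
  "Pol (int (card (W - Z))) (int (card (W - Z))) (\<lambda>p. \<Prod>w\<in>W - Z. sel \<chi> A B w p)"
  using nzd_prod[of "W - Z" "sel \<chi> A B" "\<lambda>_. 1"] finite_W by auto
qed

text \<open>Dedekind's independence of automorphisms: inserting the separating function at
  \<open>act u0 p\<close> kills every term outside the coset of \<open>u0\<close> modulo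
  \<open>Z\<close>, and on this coset the coefficients agree.\<close>

theorem translates_independent:
 assumes G: "\<And>u. u \<in> W \<Longrightarrow> Pol m m (G u)"
  and GZ: "\<And>u z p. u \<in> W \<Longrightarrow> z \<in> Z \<Longrightarrow> p \<in> X \<Longrightarrow> G (z \<circ> u) p = G u p"
  and van: "\<And>k f p. Pol k k f \<Longrightarrow> p \<in> X \<Longrightarrow> (\<Sum>u\<in>W. G u p * f (act u p)) = 0"
  and u0: "u0 \<in> W" and p: "p \<in> X"
 shows "G u0 p = 0"
proof -
 obtain A B E C where AB: "\<And>w. w \<in> W - Z \<Longrightarrow> good_pair w (A w) (B w)"
  and Bi: "\<And>\<chi>. Bi (int (card (W - Z))) (E \<chi>)" and C: "\<And>\<chi>. C \<chi> \<noteq> 0"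
  and E: "\<And>\<chi> u p. u \<in> W \<Longrightarrow> E \<chi> p (act u p) = (if u \<in> Z then C \<chi> * (\<Prod>w\<in>W - Z. sel \<chi> A B w p) else 0)"
  using separating_function by blast
 \<comment> \<open>Any choice will do: only the regularity of the resulting product matters.\<close>
 fix \<chi>
 let ?D = "\<lambda>p. \<Prod>w\<in>W - Z. sel \<chi> A B w p"
 \<comment> \<open>With the first argument frozen, a bihomogeneous kernel is a combination of
   functions of the second, to which the relation applies.\<close>
 have BiG: "(\<Sum>u\<in>W. G u p * F p'' (act u p)) = 0" if "Bi N F" "p \<in> X" for N F p p''
  using that
 proof (induction rule: Bi.induct)
  case (Bi_add N E E')
  then show ?case by (simp add: distrib_left sum.distrib)
 next
  case (Bi_mon j a N b)
  have "(\<Sum>u\<in>W. G u p * (a p'' * b (act u p))) = a p'' * (\<Sum>u\<in>W. G u p * b (act u p))"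
   by (simp add: sum_distrib_left mult_ac)
  then show ?case using van[OF Bi_mon(2,3)] by simp
 qed simp
 have "?D (act u0 p) * G u0 p = 0" if p: "p \<in> X" for p
 proof -
  let ?V = "{u \<in> W. u \<circ> invf u0 \<in> Z}"
  have "E \<chi> (act u0 p) (act u p) = (if u \<circ> invf u0 \<in> Z then C \<chi> * ?D (act u0 p) else 0)" if "u \<in> W" for u
   using E[of "u \<circ> invf u0" \<chi> "act u0 p"] that u0 by (simp add: act_comp)
  then have "0 = (\<Sum>u\<in>W. G u p * (if u \<circ> invf u0 \<in> Z then C \<chi> * ?D (act u0 p) else 0))"
   using BiG[OF Bi p, of \<chi> "act u0 p"] by simp
  also have "\<dots> = (\<Sum>u\<in>?V. G u p * (C \<chi> * ?D (act u0 p)))"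
   using finite_W by (intro sum.mono_neutral_cong_right) auto
  also have "\<dots> = (\<Sum>u\<in>?V. G u0 p * (C \<chi> * ?D (act u0 p)))"
  proof (rule sum.cong[OF refl])
   fix u assume u: "u \<in> ?V"
   have "u = (u \<circ> invf u0) \<circ> u0" using u0 by (simp add: comp_assoc)
   then have "G u p = G u0 p" using GZ[OF u0 _ p, of "u \<circ> invf u0"] u by auto
   then show "G u p * (C \<chi> * ?D (act u0 p)) = G u0 p * (C \<chi> * ?D (act u0 p))" by simp
  qed
  finally have "of_nat (card ?V) * (G u0 p * (C \<chi> * ?D (act u0 p))) = 0" by simp
  moreover have "card ?V \<noteq> 0" using finite_W u0 by auto
  ultimately show ?thesis using C[of \<chi>] by auto
 qed
 from nzdD[OF nzd_act[OF good_sel(1)[OF AB] u0] G[OF u0] this p] show ?thesis by simp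
qed

text \<open>\<open>\<Psi>\<close> is the graph of the leading symbol of an endomorphism. It is a relation because a function on \<open>X\<close>
 is represented by many polynomials.\<close>

theorem graded_double_centralizer:
 assumes tot: "\<And>k f. Pol k k f \<Longrightarrow> \<exists>g. \<Psi> k f g"
  and pol: "\<And>k f g. \<Psi> k f g \<Longrightarrow> Pol k k f \<and> Pol (k + d) (k + d) g"
  and add: "\<And>k f g f' g'. \<Psi> k f g \<Longrightarrow> \<Psi> k f' g' \<Longrightarrow> \<Psi> k (\<lambda>p. f p + f' p) (\<lambda>p. g p + g' p)"
  and zero: "\<And>k f g p. \<Psi> k f g \<Longrightarrow> (\<And>p. p \<in> X \<Longrightarrow> f p = 0) \<Longrightarrow> p \<in> X \<Longrightarrow> g p = 0"
  and mult: "\<And>k f g j r. \<Psi> k f g \<Longrightarrow> inv_Pol j r \<Longrightarrow> \<Psi> (k + j) (\<lambda>p. f p * r p) (\<lambda>p. g p * r p)"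
 shows "\<exists>h. (\<forall>u\<in>W. Pol d d (h u)) \<and> (\<forall>u\<in>W. \<forall>z\<in>Z. \<forall>p\<in>X. h (z \<circ> u) p = h u p) \<and>
   (\<forall>k f g. \<Psi> k f g \<longrightarrow> (\<forall>p\<in>X. g p = (\<Sum>u\<in>W. h u p * f (act u p))))"
proof -
 \<comment> \<open>Linearity over the constant invariant -1 turns additivity into subtraction, so
   that \<Psi> is a function modulo vanishing on \<open>X\<close>.\<close>
 have uniq: "g p = g' p" if 1: "\<Psi> k f g" "\<Psi> k f' g'" and eq: "\<And>p. p \<in> X \<Longrightarrow> f p = f' p" and p: "p \<in> X"
  for k f f' g g' p
 proof -
  have "inv_Pol 0 (\<lambda>_. -1)" by (simp add: inv_Pol_def Pol_const)
  from zero[OF add[OF 1(1) mult[OF 1(2) this, simplified]] _ p] show ?thesis using eq by simp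
 qed
 obtain A B E C where AB: "\<And>w. w \<in> W - Z \<Longrightarrow> good_pair w (A w) (B w)"
  and Bi: "\<And>\<chi>. Bi (int (card (W - Z))) (E \<chi>)" and C: "\<And>\<chi>. C \<chi> \<noteq> 0"
  and E: "\<And>\<chi> u p. u \<in> W \<Longrightarrow> E \<chi> p (act u p) = (if u \<in> Z then C \<chi> * (\<Prod>w\<in>W - Z. sel \<chi> A B w p) else 0)"
  using separating_function by blast
 define N where "N = int (card (W - Z))"
 define D where "D \<chi> p = (\<Prod>w\<in>W - Z. sel \<chi> A B w p)" for \<chi> p
 have D: "nzd (D \<chi>)" "Pol N N (D \<chi>)" for \<chi>
  using good_sel[OF AB] by (simp_all add: D_def[abs_def] N_def)
 have DZ: "D \<chi> (act z p) = D \<chi> p" if "z \<in> Z" for \<chi> z p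
  using Pol_act_Z[OF that D(2)] .
 \<comment> \<open>If the kernel is the sum of a_i(p) b_i(p'), then the sum of F'(p, u p) f(u p)
   over \<open>u\<close> equals the sum of a_i times the trace of b_i f. Traces are invariant and
   pass through \<Psi>, so the image has coefficients a_i' times the translate of b_i, where a_i' is
   the image of a_i.\<close>
 have BiH: "\<exists>H. (\<forall>u\<in>W. Pol (N + d) (N + d) (H u)) \<and> (\<forall>u\<in>W. \<forall>z\<in>Z. H (z \<circ> u) = H u) \<and>
   (\<forall>k f F g p. Pol k k f \<longrightarrow> \<Psi> (N + k) F g \<longrightarrow> (\<forall>p\<in>X. F p = (\<Sum>u\<in>W. F' p (act u p) * f (act u p))) \<longrightarrow> p \<in> X \<longrightarrow>
     g p = (\<Sum>u\<in>W. H u p * f (act u p)))" if "Bi N F'" for F' N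
  using that
 proof (induction rule: Bi.induct)
  case (Bi_zero N)
  show ?case
   by (intro exI[of _ "\<lambda>_ _. 0"] conjI) (auto intro: Pol_zero zero)
 next
  case (Bi_add N E1 E2)
  obtain H1 where H1: "\<And>u. u \<in> W \<Longrightarrow> Pol (N + d) (N + d) (H1 u)" "\<And>u z. u \<in> W \<Longrightarrow> z \<in> Z \<Longrightarrow> H1 (z \<circ> u) = H1 u"
   "\<And>k f F g p. Pol k k f \<Longrightarrow> \<Psi> (N + k) F g \<Longrightarrow> (\<forall>p\<in>X. F p = (\<Sum>u\<in>W. E1 p (act u p) * f (act u p))) \<Longrightarrow> p \<in> X \<Longrightarrow>
     g p = (\<Sum>u\<in>W. H1 u p * f (act u p))" using Bi_add.IH(1) by blast
  obtain H2 where H2: "\<And>u. u \<in> W \<Longrightarrow> Pol (N + d) (N + d) (H2 u)" "\<And>u z. u \<in> W \<Longrightarrow> z \<in> Z \<Longrightarrow> H2 (z \<circ> u) = H2 u"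
   "\<And>k f F g p. Pol k k f \<Longrightarrow> \<Psi> (N + k) F g \<Longrightarrow> (\<forall>p\<in>X. F p = (\<Sum>u\<in>W. E2 p (act u p) * f (act u p))) \<Longrightarrow> p \<in> X \<Longrightarrow>
     g p = (\<Sum>u\<in>W. H2 u p * f (act u p))" using Bi_add.IH(2) by blast
  define H where "H u = (\<lambda>p. H1 u p + H2 u p)" for u
  have "g p = (\<Sum>u\<in>W. H u p * f (act u p))"
   if f: "Pol k k f" and F: "\<Psi> (N + k) F g"
    and eq: "\<forall>p\<in>X. F p = (\<Sum>u\<in>W. (E1 p (act u p) + E2 p (act u p)) * f (act u p))" and p: "p \<in> X"
   for k f F g p
  proof -
   let ?F1 = "\<lambda>p. \<Sum>u\<in>W. E1 p (act u p) * f (act u p)"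
   let ?F2 = "\<lambda>p. \<Sum>u\<in>W. E2 p (act u p) * f (act u p)"
   have P1: "Pol (N + k) (N + k) ?F1" by (intro Pol_sum Pol_mult[OF Bi_Pol[OF Bi_add.hyps(1)] Pol_act[OF f]])
   have P2: "Pol (N + k) (N + k) ?F2" by (intro Pol_sum Pol_mult[OF Bi_Pol[OF Bi_add.hyps(2)] Pol_act[OF f]])
   obtain g1 where g1: "\<Psi> (N + k) ?F1 g1" using tot[OF P1] by blast
   obtain g2 where g2: "\<Psi> (N + k) ?F2 g2" using tot[OF P2] by blast
   have "g p = g1 p + g2 p"
    by (rule uniq[OF F add[OF g1 g2] _ p]) (simp add: eq distrib_right sum.distrib)
   then show ?thesis
    by (simp add: H1(3)[OF f g1 _ p] H2(3)[OF f g2 _ p] H_def distrib_right sum.distrib)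
  qed
  moreover have "H (z \<circ> u) = H u" if "u \<in> W" "z \<in> Z" for u z
   by (simp only: H_def H1(2)[OF that] H2(2)[OF that])
  moreover have "Pol (N + d) (N + d) (H u)" if "u \<in> W" for u
   unfolding H_def by (intro Pol_add H1(1) H2(1) that)
  ultimately show ?case by (intro exI[of _ H] conjI) blast+
 next
  case (Bi_mon j a N b)
  obtain a' where a': "\<Psi> j a a'" using tot[OF Bi_mon(1)] by blast
  define H where "H u = (\<lambda>p. a' p * b (act u p))" for u
  have "Pol (N + d) (N + d) (H u)" if "u \<in> W" for u
   unfolding H_def
   by (rule Pol_cong[OF Pol_mult[OF conjunct2[OF pol[OF a']] Pol_act[OF Bi_mon(2) that]]]) auto
  moreover have "H (z \<circ> u) = H u" if "u \<in> W" "z \<in> Z" for u z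
   using that Z_W[OF that(2)] Pol_act_Z[OF that(2) Bi_mon(2)] by (simp add: H_def act_comp)
  moreover have "g p = (\<Sum>u\<in>W. H u p * f (act u p))"
   if f: "Pol k k f" and F: "\<Psi> (N + k) F g"
    and eq: "\<forall>p\<in>X. F p = (\<Sum>u\<in>W. a p * b (act u p) * f (act u p))" and p: "p \<in> X"
   for k f F g p
  proof -
   let ?T = "\<lambda>p. \<Sum>u\<in>W. b (act u p) * f (act u p)"
   have "inv_Pol (N - j + k) ?T" using inv_Pol_trace[OF Pol_mult[OF Bi_mon(2) f]] by simp
   from mult[OF a' this] have "\<Psi> (N + k) (\<lambda>p. a p * ?T p) (\<lambda>p. a' p * ?T p)" by simp
   from uniq[OF F this _ p] eq show ?thesis
    by (simp add: H_def sum_distrib_left mult.assoc)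
  qed
  ultimately show ?case by (intro exI[of _ H] conjI) blast+
 qed
 have "\<forall>\<chi>. \<exists>H. (\<forall>u\<in>W. Pol (N + d) (N + d) (H u)) \<and> (\<forall>u\<in>W. \<forall>z\<in>Z. H (z \<circ> u) = H u) \<and>
   (\<forall>k f F g p. Pol k k f \<longrightarrow> \<Psi> (N + k) F g \<longrightarrow> (\<forall>p\<in>X. F p = (\<Sum>u\<in>W. E \<chi> p (act u p) * f (act u p))) \<longrightarrow> p \<in> X \<longrightarrow>
     g p = (\<Sum>u\<in>W. H u p * f (act u p)))"
  using BiH[OF Bi[folded N_def]] by blast
 from choice[OF this] obtain H0 where H0: "\<And>\<chi> u. u \<in> W \<Longrightarrow> Pol (N + d) (N + d) (H0 \<chi> u)"
   "\<And>\<chi> u z. u \<in> W \<Longrightarrow> z \<in> Z \<Longrightarrow> H0 \<chi> (z \<circ> u) = H0 \<chi> u"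
   "\<And>\<chi> k f F g p. Pol k k f \<Longrightarrow> \<Psi> (N + k) F g \<Longrightarrow> (\<forall>p\<in>X. F p = (\<Sum>u\<in>W. E \<chi> p (act u p) * f (act u p))) \<Longrightarrow> p \<in> X \<Longrightarrow>
     g p = (\<Sum>u\<in>W. H0 \<chi> u p * f (act u p))" by blast
 \<comment> \<open>The central elements each contribute the same term, which gives the factor
   \<open>card Z\<close>.\<close>
 define K where "K \<chi> = of_nat (card Z) * C \<chi>" for \<chi>
 have "card Z \<noteq> 0" using finite_Z id_Z by (metis card_eq_0_iff empty_iff)
 then have K0: "K \<chi> \<noteq> 0" for \<chi> using C by (auto simp: K_def)
 define H where "H \<chi> u = (\<lambda>p. H0 \<chi> u p / K \<chi>)" for \<chi> u
 have H: "Pol (N + d) (N + d) (H \<chi> u)" if "u \<in> W" for \<chi> u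
  using Pol_smult[OF H0(1)[OF that], of "inverse (K \<chi>)"] by (simp add: H_def divide_inverse mult.commute)
 have HZ: "H \<chi> (z \<circ> u) = H \<chi> u" if "u \<in> W" "z \<in> Z" for \<chi> u z
  using H0(2)[OF that] by (simp add: H_def)
 have ED: "(\<Sum>u\<in>W. E \<chi> p (act u p) * f (act u p)) = K \<chi> * (D \<chi> p * f p)" if f: "Pol k k f" for \<chi> k f p
 proof -
  have "(\<Sum>u\<in>W. E \<chi> p (act u p) * f (act u p)) = (\<Sum>u\<in>Z. C \<chi> * D \<chi> p * f p)"
   using finite_W Z_W by (intro sum.mono_neutral_cong_right) (auto simp: E D_def Pol_act_Z[OF _ f])
  then show ?thesis by (simp add: K_def mult_ac)
 qed
 \<comment> \<open>So \<open>H \<chi>\<close> are the coefficients of the map after its argument is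
   multiplied by \<open>D \<chi>\<close>.\<close>
 have main: "g p = (\<Sum>u\<in>W. H \<chi> u p * f (act u p))"
  if f: "Pol k k f" and F: "\<Psi> k' F g" and k': "k' = N + k" and eq: "\<And>p. p \<in> X \<Longrightarrow> F p = D \<chi> p * f p" and p: "p \<in> X"
  for \<chi> k k' f F g p
 proof -
  have "inv_Pol 0 (\<lambda>_. K \<chi>)" by (simp add: inv_Pol_def Pol_const)
  from mult[OF F this] have "\<Psi> (N + k) (\<lambda>p. F p * K \<chi>) (\<lambda>p. g p * K \<chi>)" by (simp add: k')
  from H0(3)[OF f this _ p, of \<chi>] have "g p * K \<chi> = (\<Sum>u\<in>W. H0 \<chi> u p * f (act u p))"
   using ED[OF f] eq by (simp add: mult.commute)
  then have "g p = (\<Sum>u\<in>W. H0 \<chi> u p * f (act u p)) / K \<chi>"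
   using K0[of \<chi>] by (simp add: field_simps)
  then show ?thesis by (simp add: H_def sum_divide_distrib)
 qed
 \<comment> \<open>Both sides give the coefficients of the image of D_\<chi> D_\<chi>' f, and
   coefficients are unique by the independence of translates.\<close>
 have cross: "H \<chi> u p * D \<chi>' (act u p) = H \<chi>' u p * D \<chi> (act u p)" if u: "u \<in> W" and p: "p \<in> X" for \<chi> \<chi>' u p
 proof -
  define G where "G u = (\<lambda>p. H \<chi> u p * D \<chi>' (act u p) - H \<chi>' u p * D \<chi> (act u p))" for u
  have "G u p = 0"
  proof (rule translates_independent[OF _ _ _ u p])
   show "Pol (N + d + N) (N + d + N) (G u)" if "u \<in> W" for u
    unfolding G_def by (intro Pol_diff Pol_mult H Pol_act D that)
   show "G (z \<circ> u) p = G u p" if "u \<in> W" "z \<in> Z" for u z p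
    using that by (simp add: G_def HZ act_comp Z_W DZ)
   show "(\<Sum>u\<in>W. G u p * f (act u p)) = 0" if f: "Pol k k f" and p: "p \<in> X" for k f p
   proof -
    have "Pol (N + (N + k)) (N + (N + k)) (\<lambda>p. D \<chi> p * (D \<chi>' p * f p))"
     by (intro Pol_mult D f)
    then obtain g where g: "\<Psi> (N + (N + k)) (\<lambda>p. D \<chi> p * (D \<chi>' p * f p)) g" using tot by blast
    have "g p = (\<Sum>u\<in>W. H \<chi> u p * (D \<chi>' (act u p) * f (act u p)))"
     by (rule main[OF Pol_mult[OF D(2) f] g refl refl p])
    moreover have "g p = (\<Sum>u\<in>W. H \<chi>' u p * (D \<chi> (act u p) * f (act u p)))"
     by (rule main[OF Pol_mult[OF D(2) f] g refl _ p]) simp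
    ultimately show ?thesis
     by (simp add: G_def left_diff_distrib sum_subtractf mult.assoc)
   qed
  qed
  then show ?thesis by (simp add: G_def)
 qed
 \<comment> \<open>The denominators occur at \<open>act u p\<close>. Moving the point by the inverse
   of \<open>u\<close> makes them the same for every \<open>u\<close>, as simultaneous division
   requires.\<close>
 have "\<exists>h. Pol d d h \<and> (\<forall>\<chi>. \<forall>p\<in>X. H \<chi> u (act (invf u) p) = h p * D \<chi> p)" if u: "u \<in> W" for u
  unfolding D_def
 proof (rule common_divisor)
  show "finite (W - Z)" using finite_W by simp
  show "good_pair w (A w) (B w)" if "w \<in> W - Z" for w using AB that .
  show "Pol (int (card (W - Z)) + d) (int (card (W - Z)) + d) (\<lambda>p. H \<chi> u (act (invf u) p))" for \<chi>
   using Pol_act[OF H[OF u] W_inv[OF u]] by (simp add: N_def)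
  fix \<chi> \<chi>' p assume "p \<in> X"
  then show "H \<chi> u (act (invf u) p) * (\<Prod>w\<in>W - Z. sel \<chi>' A B w p) =
    H \<chi>' u (act (invf u) p) * (\<Prod>w\<in>W - Z. sel \<chi> A B w p)"
   using cross[OF u, of "act (invf u) p" \<chi> \<chi>'] u by (simp add: D_def)
 qed
 then have "\<forall>u. \<exists>h. u \<in> W \<longrightarrow> Pol d d h \<and> (\<forall>\<chi>. \<forall>p\<in>X. H \<chi> u (act (invf u) p) = h p * D \<chi> p)" by blast
 from choice[OF this] obtain h0 where h0: "\<And>u. u \<in> W \<Longrightarrow> Pol d d (h0 u)"
  "\<And>u \<chi> p. u \<in> W \<Longrightarrow> p \<in> X \<Longrightarrow> H \<chi> u (act (invf u) p) = h0 u p * D \<chi> p" by blast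
 define h where "h u = (\<lambda>p. h0 u (act u p))" for u
 have h: "Pol d d (h u)" if "u \<in> W" for u
  unfolding h_def by (rule Pol_act[OF h0(1)[OF that] that])
 have Hh: "H \<chi> u p = h u p * D \<chi> (act u p)" if "u \<in> W" "p \<in> X" for \<chi> u p
  using h0(2)[OF that(1), of "act u p" \<chi>] that by (simp add: h_def)
 fix \<chi>
 have hZ: "h (z \<circ> u) p = h u p" if u: "u \<in> W" and z: "z \<in> Z" and p: "p \<in> X" for u z p
 proof -
  have "D \<chi> (act u p) * (h (z \<circ> u) p - h u p) = 0" if p: "p \<in> X" for p
   using Hh[OF _ p, of "z \<circ> u" \<chi>] Hh[OF u p, of \<chi>] HZ[OF u z, of \<chi>] u Z_W[OF z] DZ[OF z]
   by (auto simp add: act_comp algebra_simps)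
  from nzdD[OF nzd_act[OF D(1) u] Pol_diff[OF h h] this p] u Z_W[OF z] show ?thesis by simp
 qed
 have final: "g p = (\<Sum>u\<in>W. h u p * f (act u p))" if \<Psi>: "\<Psi> k f g" and p: "p \<in> X" for k f g p
 proof -
  have f: "Pol k k f" and g: "Pol (k + d) (k + d) g" using pol[OF \<Psi>] by auto
  \<comment> \<open>The norm of D is an invariant multiple R = D R'. The map is known on D times R'
    f, and invariance of R allows the factor to be cancelled afterwards.\<close>
  define R where "R p = (\<Prod>u\<in>W. D \<chi> (act u p))" for p
  define R' where "R' p = (\<Prod>u\<in>W - {id}. D \<chi> (act u p))" for p
  have R: "inv_Pol (int (card W) * N) R" unfolding R_def[abs_def] by (rule inv_Pol_norm[OF D(2)])
  have R': "Pol (\<Sum>u\<in>W-{id}. N) (\<Sum>u\<in>W-{id}. N) R'"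
   using nzd_prod[of "W - {id}" "\<lambda>u p. D \<chi> (act u p)" "\<lambda>_. N"] finite_W nzd_act[OF D(1)] Pol_act[OF D(2)]
   unfolding R'_def[abs_def] by simp
  have RD: "R p = D \<chi> p * R' p" for p
   unfolding R_def R'_def using finite_W by (subst prod.remove[of W id]) simp_all
  have cW: "int (card W) * N = N + (\<Sum>u\<in>W-{id}. N)"
  proof -
   have "(\<Sum>u\<in>W. N) = N + (\<Sum>u\<in>W-{id}. N)" by (rule sum.remove) (use finite_W in auto)
   then show ?thesis by simp
  qed
  have "R p * (g p - (\<Sum>u\<in>W. h u p * f (act u p))) = 0" if p: "p \<in> X" for p
  proof -
   have "g p * R p = (\<Sum>u\<in>W. H \<chi> u p * (R' (act u p) * f (act u p)))"
    by (rule main[OF Pol_mult[OF R' f] mult[OF \<Psi> R] _ _ p]) (simp_all only: cW RD, simp_all)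
   also have "\<dots> = (\<Sum>u\<in>W. R p * (h u p * f (act u p)))"
   proof (rule sum.cong[OF refl])
    fix u assume u: "u \<in> W"
    have "H \<chi> u p * R' (act u p) = h u p * R (act u p)" using Hh[OF u p, of \<chi>] by (simp add: RD)
    moreover have "R (act u p) = R p" using R u unfolding inv_Pol_def by blast
    ultimately show "H \<chi> u p * (R' (act u p) * f (act u p)) = R p * (h u p * f (act u p))"
     by (metis mult.assoc mult.commute)
   qed
   finally show ?thesis by (simp add: sum_distrib_left right_diff_distrib mult.commute)
  qed
  moreover have "Pol (k + d) (k + d) (\<lambda>p. g p - (\<Sum>u\<in>W. h u p * f (act u p)))"
  proof (intro Pol_diff g Pol_sum)
   fix u assume u: "u \<in> W"
   show "Pol (k + d) (k + d) (\<lambda>p. h u p * f (act u p))"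
    by (rule Pol_cong[OF Pol_mult[OF h[OF u] Pol_act[OF f u]]]) auto
  qed
  moreover have "nzd R" unfolding R_def[abs_def] by (rule nzd_norm[OF D])
  ultimately have "g p - (\<Sum>u\<in>W. h u p * f (act u p)) = 0" using nzdD p by blast
  then show ?thesis by simp
 qed
 show ?thesis using h hZ final by (intro exI[of _ h]) blast
qed

abbreviation xymon where
 "xymon \<alpha> \<beta> p \<equiv> (\<Prod>b\<in>Bs. pr b (fst p) ^ \<alpha> b) * (\<Prod>b\<in>Bs. pr b (snd p) ^ \<beta> b)"

text \<open>The definition of \<open>Pol\<close> allows all linear forms; monomials in the
  coordinates of \<open>Bs\<close> give finite spanning sets in each bidegree and exponents that can
  be compared.\<close>

inductive Mon_span :: "int \<Rightarrow> int \<Rightarrow> 'h pfun \<Rightarrow> bool" for k l where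
 zero: "Mon_span k l (\<lambda>_. 0)"
| add: "Mon_span k l P \<Longrightarrow> Mon_span k l Q \<Longrightarrow> Mon_span k l (\<lambda>p. P p + Q p)"
| mon: "int (\<Sum>b\<in>Bs. \<alpha> b) = k \<Longrightarrow> int (\<Sum>b\<in>Bs. \<beta> b) = l \<Longrightarrow>
  Mon_span k l (\<lambda>p. c * (xymon \<alpha> \<beta> p))"

lemma Mon_span_sum: "(\<And>i. i \<in> I \<Longrightarrow> Mon_span k l (f i)) \<Longrightarrow> Mon_span k l (\<lambda>p. \<Sum>i\<in>I. f i p)"
 by (induction I rule: infinite_finite_induct) (auto intro: Mon_span.intros)

lemma Mon_span_smult: "Mon_span k l P \<Longrightarrow> Mon_span k l (\<lambda>p. c * P p)"
proof (induction rule: Mon_span.induct)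
 case (mon \<alpha> \<beta> d)
 then show ?case using Mon_span.mon[of \<alpha> k \<beta> l "c * d"] by (simp add: mult.assoc)
qed (auto simp: distrib_left intro: Mon_span.intros)

lemma Bs_prod_Suc: "b \<in> Bs \<Longrightarrow> (\<Prod>a\<in>Bs. f a ^ (\<alpha>(b := Suc (\<alpha> b))) a) = (f b :: complex) * (\<Prod>a\<in>Bs. f a ^ \<alpha> a)"
 "b \<in> Bs \<Longrightarrow> (\<Sum>a\<in>Bs. (\<alpha>(b := Suc (\<alpha> b))) a) = Suc (\<Sum>a\<in>Bs. \<alpha> a)"
 by (simp_all add: prod.remove[OF finite_Basis, of b] sum.remove[OF finite_Basis, of b])

lemma Mon_span_x: "Mon_span k l P \<Longrightarrow> b \<in> Bs \<Longrightarrow> Mon_span (k + 1) l (\<lambda>p. pr b (fst p) * P p)"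
proof (induction rule: Mon_span.induct)
 case (mon \<alpha> \<beta> d)
 have "Mon_span (k + 1) l (\<lambda>p. d * ((\<Prod>a\<in>Bs. pr a (fst p) ^ (\<alpha>(b := Suc (\<alpha> b))) a) * (\<Prod>b\<in>Bs. pr b (snd p) ^ \<beta> b)))"
  by (rule Mon_span.mon) (simp_all only: Bs_prod_Suc(2)[OF mon(3), of \<alpha>] mon(1,2)[symmetric], (simp_all)?)
 moreover have "(\<lambda>p. pr b (fst p) * (d * (xymon \<alpha> \<beta> p))) =
  (\<lambda>p. d * ((\<Prod>a\<in>Bs. pr a (fst p) ^ (\<alpha>(b := Suc (\<alpha> b))) a) * (\<Prod>b\<in>Bs. pr b (snd p) ^ \<beta> b)))"
  by (rule ext, subst Bs_prod_Suc(1)[OF mon(3)]) (simp only: mult_ac)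
 ultimately show ?case by simp
qed (auto simp: distrib_left mult.left_commute intro: Mon_span.intros)

lemma Mon_span_y: "Mon_span k l P \<Longrightarrow> b \<in> Bs \<Longrightarrow> Mon_span k (l + 1) (\<lambda>p. pr b (snd p) * P p)"
proof (induction rule: Mon_span.induct)
 case (mon \<alpha> \<beta> d)
 have "Mon_span k (l + 1) (\<lambda>p. d * ((\<Prod>b\<in>Bs. pr b (fst p) ^ \<alpha> b) * (\<Prod>a\<in>Bs. pr a (snd p) ^ (\<beta>(b := Suc (\<beta> b))) a)))"
  by (rule Mon_span.mon) (simp_all only: Bs_prod_Suc(2)[OF mon(3), of \<beta>] mon(1,2)[symmetric], (simp_all)?)
 moreover have "(\<lambda>p. pr b (snd p) * (d * (xymon \<alpha> \<beta> p))) =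
  (\<lambda>p. d * ((\<Prod>b\<in>Bs. pr b (fst p) ^ \<alpha> b) * (\<Prod>a\<in>Bs. pr a (snd p) ^ (\<beta>(b := Suc (\<beta> b))) a)))"
  by (rule ext, subst Bs_prod_Suc(1)[OF mon(3)]) (simp only: mult_ac)
 ultimately show ?case by simp
qed (auto simp: distrib_left intro: Mon_span.intros)

lemma pr_expand_left: "pr u v = (\<Sum>b\<in>Bs. pr u b * pr b v)"
 using dualb_pr[OF dualb_Bs, of u v] by (simp add: pr_sym)

lemma Pol_Mon_span: "Pol k l P \<Longrightarrow> Mon_span k l P"
proof (induction rule: Pol.induct)
 case (Pol_zero k l)
 show ?case by (rule Mon_span.zero)
next
 case (Pol_const c)
 show ?case using Mon_span.mon[of "\<lambda>_. 0" 0 "\<lambda>_. 0" 0 c] by simp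
next
 case (Pol_add k l P Q)
 then show ?case by (intro Mon_span.add)
next
 case (Pol_x k l P u)
 have "Mon_span (k + 1) l (\<lambda>p. \<Sum>b\<in>Bs. pr u b * (pr b (fst p) * P p))"
  by (intro Mon_span_sum Mon_span_smult Mon_span_x) (rule Pol_x.IH)
 moreover have "(\<lambda>p. \<Sum>b\<in>Bs. pr u b * (pr b (fst p) * P p)) = (\<lambda>p. pr u (fst p) * P p)"
  by (rule ext) (simp only: pr_expand_left[of u "fst _"] sum_distrib_right mult.assoc)
 ultimately show ?case by simp
next
 case (Pol_y k l P u)
 have "Mon_span k (l + 1) (\<lambda>p. \<Sum>b\<in>Bs. pr u b * (pr b (snd p) * P p))"
  by (intro Mon_span_sum Mon_span_smult Mon_span_y) (rule Pol_y.IH)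
 moreover have "(\<lambda>p. \<Sum>b\<in>Bs. pr u b * (pr b (snd p) * P p)) = (\<lambda>p. pr u (snd p) * P p)"
  by (rule ext) (simp only: pr_expand_left[of u "snd _"] sum_distrib_right mult.assoc)
 ultimately show ?case by simp
qed

end

context irred_group
begin

section \<open>Filtered algebras\<close>

text \<open>The monic polynomial with roots z(w p). For the full group it is an equation of integral
  dependence of \<open>z\<close> over the invariants; subsets serve the induction.\<close>

definition orbit_poly :: "'h pfun \<Rightarrow> ('h \<Rightarrow> 'h) set \<Rightarrow> 'h \<times> 'h \<Rightarrow> complex poly" where
 "orbit_poly z S p = (\<Prod>w\<in>S. [:- z (act w p), 1:])"

lemma orbit_poly_insert:
 assumes "finite S" "x \<notin> S"
 shows "coeff (orbit_poly z (insert x S) p) i =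
  - z (act x p) * coeff (orbit_poly z S p) i + (case i of 0 \<Rightarrow> 0 | Suc j \<Rightarrow> coeff (orbit_poly z S p) j)"
 using assms by (simp add: orbit_poly_def coeff_pCons split: nat.split)

lemma orbit_poly_coeff:
 assumes z: "Pol 1 1 z" and S: "finite S" "S \<subseteq> W"
 shows "Pol (int (card S) - int i) (int (card S) - int i) (\<lambda>p. coeff (orbit_poly z S p) i)"
 using S
proof (induction S arbitrary: i rule: finite_induct)
 case empty
 show ?case
 proof (cases i)
  case 0
  then show ?thesis using Pol_const[of 1] by (simp add: orbit_poly_def)
 next
  case (Suc j)
  then show ?thesis using Pol_zero by (simp add: orbit_poly_def)
 qed
next
 case (insert x S)
 have IH: "Pol (int (card S) - int i) (int (card S) - int i) (\<lambda>p. coeff (orbit_poly z S p) i)" for i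
  using insert by blast
 have zx: "Pol 1 1 (\<lambda>p. - z (act x p))" using insert.prems by (intro Pol_uminus Pol_act[OF z]) auto
 have 1: "Pol (int (card (insert x S)) - int i) (int (card (insert x S)) - int i)
   (\<lambda>p. - z (act x p) * coeff (orbit_poly z S p) i)"
  by (rule Pol_cong[OF Pol_mult[OF zx IH[of i]]]) (use insert.hyps in auto)
 have 2: "Pol (int (card (insert x S)) - int i) (int (card (insert x S)) - int i)
   (\<lambda>p. case i of 0 \<Rightarrow> 0 | Suc j \<Rightarrow> coeff (orbit_poly z S p) j)"
 proof (cases i)
  case 0
  then show ?thesis using Pol_zero by simp
 next
  case (Suc j)
  show ?thesis by (rule Pol_cong[OF IH[of j]]) (use insert.hyps Suc in auto)
 qed
 show ?case using Pol_add[OF 1 2] by (simp only: orbit_poly_insert[OF insert.hyps])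
qed

lemma orbit_poly_lead:
 assumes z: "Pol 1 1 z" and S: "finite S" "S \<subseteq> W"
 shows "coeff (orbit_poly z S p) (card S) = 1"
 using S
proof (induction S rule: finite_induct)
 case empty
 then show ?case by (simp add: orbit_poly_def)
next
 case (insert x S)
 \<comment> \<open>A coefficient beyond the degree has negative bidegree and is therefore
   zero.\<close>
 have "Pol (-1) (-1) (\<lambda>p. coeff (orbit_poly z S p) (Suc (card S)))"
  by (rule Pol_cong[OF orbit_poly_coeff[OF z]]) (use insert in auto)
 then have "coeff (orbit_poly z S p) (Suc (card S)) = 0" using Pol_neg by (metis neg_less_0_iff_less zero_less_one)
 then show ?case using insert by (simp add: orbit_poly_insert)
qed

lemma orbit_poly_inv: "Pol 1 1 z \<Longrightarrow> inv_Pol (int (card W) - int i) (\<lambda>p. coeff (orbit_poly z W p) i)"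
 unfolding inv_Pol_def
proof (intro conjI ballI allI)
 show "Pol 1 1 z \<Longrightarrow> Pol (int (card W) - int i) (int (card W) - int i) (\<lambda>p. coeff (orbit_poly z W p) i)"
  using orbit_poly_coeff finite_W by blast
 fix w p assume w: "w \<in> W"
 have "orbit_poly z W (act w p) = (\<Prod>u\<in>W. [:- z (act (u \<circ> w) p), 1:])"
  unfolding orbit_poly_def by (rule prod.cong) (simp_all add: act_comp w)
 also have "\<dots> = orbit_poly z W p"
  unfolding orbit_poly_def by (rule prod.reindex_bij_betw[OF bij_betw_translate_right[OF w], of "\<lambda>u. [:- z (act u p), 1:]"])
 finally show "coeff (orbit_poly z W (act w p)) i = coeff (orbit_poly z W p) i" by simp
qed

text \<open>\<open>z p\<close> is the root belonging to the identity of a monic polynomial of degree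
  \<open>card W\<close>. Every coefficient below the leading one has positive bidegree.\<close>

lemma integral_power:
 assumes z: "Pol 1 1 z"
 shows "z p ^ card W = (\<Sum>i<card W. - coeff (orbit_poly z W p) i * z p ^ i)"
proof -
 let ?q = "orbit_poly z W p"
 have "coeff ?q i = 0" if "i > card W" for i
 proof -
  have "Pol (int (card W) - int i) (int (card W) - int i) (\<lambda>p. coeff (orbit_poly z W p) i)"
   using orbit_poly_coeff[OF z finite_W] by blast
  then show ?thesis using Pol_neg that by (metis diff_less_0_iff_less of_nat_less_iff)
 qed
 then have deg: "degree ?q \<le> card W" by (intro degree_le) auto
 have "poly ?q (z p) = 0"
  unfolding orbit_poly_def poly_prod using finite_W W_id by (intro prod_zero bexI[of _ id]) auto
 moreover have "poly ?q (z p) = (\<Sum>i\<le>card W. coeff ?q i * z p ^ i)"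
  unfolding poly_altdef using deg by (intro sum.mono_neutral_left) (auto simp: coeff_eq_0)
 ultimately have "0 = (\<Sum>i<card W. coeff ?q i * z p ^ i) + z p ^ card W"
  using orbit_poly_lead[OF z finite_W order.refl, of p] by (simp add: lessThan_Suc_atMost[symmetric])
 then show ?thesis by (simp add: sum_negf eq_neg_iff_add_eq_0 add.commute)
qed

text \<open>The part of degree \<open>k\<close> of the ideal generated by invariants of positive
  degree.\<close>

inductive Dec :: "int \<Rightarrow> 'h pfun \<Rightarrow> bool" for k where
 Dec_zero: "Dec k (\<lambda>_. 0)"
| Dec_add: "Dec k P \<Longrightarrow> Dec k Q \<Longrightarrow> Dec k (\<lambda>p. P p + Q p)"
| Dec_mult: "j \<ge> 1 \<Longrightarrow> Pol (k - j) (k - j) s \<Longrightarrow> inv_Pol j r \<Longrightarrow> Dec k (\<lambda>p. s p * r p)"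

lemma Dec_sum: "(\<And>i. i \<in> I \<Longrightarrow> Dec k (f i)) \<Longrightarrow> Dec k (\<lambda>p. \<Sum>i\<in>I. f i p)"
 by (induction I rule: infinite_finite_induct) (auto intro: Dec.intros)

lemma Pol_monomial:
 "Pol (int (\<Sum>b\<in>Bs. \<alpha> b)) (int (\<Sum>b\<in>Bs. \<beta> b)) (\<lambda>p. xymon \<alpha> \<beta> p)"
proof -
 have ypow: "Pol 0 (int n) (\<lambda>p. pr u (snd p) ^ n)" for u n
  using Pol_swap[OF Pol_xpow[of n u]] by simp
 have x: "Pol (int (\<Sum>b\<in>S. \<alpha> b)) 0 (\<lambda>p. \<Prod>b\<in>S. pr b (fst p) ^ \<alpha> b)" if "finite S" for S
  using that
 proof (induction S rule: finite_induct)
  case empty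
  then show ?case using Pol_const[of 1] by simp
 next
  case (insert x S)
  show ?case by (rule Pol_cong[OF Pol_mult[OF Pol_xpow[of "\<alpha> x" x] insert.IH]]) (use insert.hyps in auto)
 qed
 have y: "Pol 0 (int (\<Sum>b\<in>S. \<beta> b)) (\<lambda>p. \<Prod>b\<in>S. pr b (snd p) ^ \<beta> b)" if "finite S" for S
  using that
 proof (induction S rule: finite_induct)
  case empty
  then show ?case using Pol_const[of 1] by simp
 next
  case (insert x S)
  show ?case by (rule Pol_cong[OF Pol_mult[OF ypow[of "\<beta> x" x] insert.IH]]) (use insert.hyps in auto)
 qed
 show ?thesis using Pol_mult[OF x[OF finite_Basis] y[OF finite_Basis]] by simp
qed

lemma Bs_prod_split:
 fixes f :: "'h \<Rightarrow> complex"
 assumes "b \<in> Bs" "M \<le> \<alpha> b"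
 shows "(\<Prod>a\<in>Bs. f a ^ \<alpha> a) = f b ^ M * (\<Prod>a\<in>Bs. f a ^ (\<alpha>(b := \<alpha> b - M)) a)"
  "(\<Sum>a\<in>Bs. \<alpha> a) = M + (\<Sum>a\<in>Bs. (\<alpha>(b := \<alpha> b - M)) a)"
 using assms by (simp_all add: prod.remove[OF finite_Basis, of b] sum.remove[OF finite_Basis, of b] power_add[symmetric] mult.assoc[symmetric])

lemma large_exponent:
 assumes "int (\<Sum>b\<in>Bs. \<alpha> b) > int (card Bs * M)"
 shows "\<exists>b\<in>Bs. M \<le> \<alpha> b"
proof (rule ccontr)
 assume "\<not> ?thesis"
 then have "(\<Sum>b\<in>Bs. \<alpha> b) \<le> (\<Sum>b\<in>Bs. M)" by (intro sum_mono) (auto simp: not_le)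
 then show False using assms by simp
qed

text \<open>Finiteness over the invariants with an explicit bound: beyond it the pigeonhole
  principle finds exponents of at least \<open>card W\<close> among the x and among the y.\<close>

lemma large_degree_Dec:
 assumes k: "k > int (card Bs * card W)" and P: "Pol k k P"
 shows "Dec k P"
 using Pol_Mon_span[OF P]
proof (induction rule: Mon_span.induct)
 case (mon \<alpha> \<beta> c)
 obtain a where a: "a \<in> Bs" "card W \<le> \<alpha> a" using large_exponent[of "card W" \<alpha>] mon k by auto
 obtain b where b: "b \<in> Bs" "card W \<le> \<beta> b" using large_exponent[of "card W" \<beta>] mon k by auto
 define \<alpha>' where "\<alpha>' = \<alpha>(a := \<alpha> a - card W)"
 define \<beta>' where "\<beta>' = \<beta>(b := \<beta> b - card W)"
 \<comment> \<open>A single coordinate has no diagonal bidegree, so the integral equation is applied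
   to a product of one x and one y.\<close>
 define z where "z p = pr a (fst p) * pr b (snd p)" for p
 define rest where "rest p = xymon \<alpha>' \<beta>' p" for p
 have z: "Pol 1 1 z" unfolding z_def[abs_def] by (rule Pol_xy)
 have sums: "int (\<Sum>b\<in>Bs. \<alpha>' b) = k - int (card W)" "int (\<Sum>b\<in>Bs. \<beta>' b) = k - int (card W)"
  using mon Bs_prod_split(2)[of a "card W" \<alpha>, OF a] Bs_prod_split(2)[of b "card W" \<beta>, OF b] by (auto simp: \<alpha>'_def \<beta>'_def)
 have rest: "Pol (k - int (card W)) (k - int (card W)) rest"
  using Pol_monomial[of \<alpha>' \<beta>'] unfolding sums rest_def[abs_def] .
 have "c * (xymon \<alpha> \<beta> p) =
   (\<Sum>i<card W. (- c * (rest p * z p ^ i)) * coeff (orbit_poly z W p) i)" for p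
 proof -
  have "c * (xymon \<alpha> \<beta> p) = c * rest p * z p ^ card W"
   unfolding Bs_prod_split(1)[of a "card W" \<alpha>, OF a] Bs_prod_split(1)[of b "card W" \<beta>, OF b]
   by (simp add: rest_def z_def \<alpha>'_def \<beta>'_def power_mult_distrib)
  also have "\<dots> = (\<Sum>i<card W. (- c * (rest p * z p ^ i)) * coeff (orbit_poly z W p) i)"
   unfolding integral_power[OF z] sum_distrib_left by (rule sum.cong) (auto simp: mult_ac)
  finally show ?thesis .
 qed
 moreover have "Dec k (\<lambda>p. \<Sum>i<card W. (- c * (rest p * z p ^ i)) * coeff (orbit_poly z W p) i)"
 proof (rule Dec_sum)
  fix i assume i: "i \<in> {..<card W}"
  show "Dec k (\<lambda>p. - c * (rest p * z p ^ i) * coeff (orbit_poly z W p) i)"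
  proof (rule Dec_mult[OF _ _ orbit_poly_inv[OF z]])
   show "1 \<le> int (card W) - int i" using i by auto
   show "Pol (k - (int (card W) - int i)) (k - (int (card W) - int i)) (\<lambda>p. - c * (rest p * z p ^ i))"
    by (intro Pol_smult Pol_cong[OF Pol_mult[OF rest Pol_power[OF z, of i]]]) auto
  qed
 qed
 ultimately show ?case by simp
qed (auto intro: Dec.intros)

text \<open>The shape of symbols of \<open>Z\<close>-averaged elements: central elements act
  trivially on diagonal functions, so left multiplication by the average makes the coefficient
  constant along cosets of \<open>Z\<close>. Symbols of \<open>A\<close> matter only on
  \<open>X\<close>.\<close>

definition Tw :: "int \<Rightarrow> 'h sym \<Rightarrow> bool" where
 "Tw k P \<longleftrightarrow> (\<forall>u\<in>W. Pol k k (P u)) \<and> (\<forall>z\<in>Z. \<forall>u\<in>W. \<forall>p\<in>X. P (z \<circ> u) p = P u p)"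

text \<open>Multiplication in the smash product of functions with \<open>W\<close>: moving
  \<open>v\<close> past a function pulls the function back along the inverse of
  \<open>v\<close>.\<close>

definition tmul :: "'h sym \<Rightarrow> 'h sym \<Rightarrow>
  ('h \<Rightarrow> 'h) \<Rightarrow> 'h pfun" where
 "tmul P Q u p = (\<Sum>v\<in>W. P v p * Q (invf v \<circ> u) (act (invf v) p))"

end

text \<open>\<open>Sym k x P\<close>: \<open>x\<close> has filtration degree at most \<open>k\<close> with symbol \<open>\<Sum>u. P u \<cdot> u\<close> in degree \<open>k\<close>.\<close>

locale filtered_algebra = irred_group scale Bs W + ring A
 for scale :: "complex \<Rightarrow> 'h::ab_group_add \<Rightarrow> 'h" (infixr "*s" 75) and Bs W
  and A :: "(complex, 'a) module" (structure) +
 fixes e :: 'a and Sym :: "int \<Rightarrow> 'a \<Rightarrow> 'h sym \<Rightarrow> bool"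
 assumes smult_closed: "x \<in> carrier A \<Longrightarrow> c \<odot> x \<in> carrier A"
  and smult_mult: "x \<in> carrier A \<Longrightarrow> y \<in> carrier A \<Longrightarrow> (c \<odot> x) \<otimes> y = c \<odot> (x \<otimes> y)"
  and Sym_carrier: "Sym k x P \<Longrightarrow> x \<in> carrier A"
  and Sym_Tw: "Sym k x P \<Longrightarrow> Tw k P"
  and Sym_total: "x \<in> carrier A \<Longrightarrow> \<exists>k P. Sym k x P"
  and Sym_lift: "Tw k P \<Longrightarrow> \<exists>x. Sym k x P"
  and Sym_add: "Sym k x P \<Longrightarrow> Sym k y Q \<Longrightarrow> Sym k (x \<oplus> y) (\<lambda>u p. P u p + Q u p)"
  and Sym_minus: "Sym k x P \<Longrightarrow> Sym k (\<ominus> x) (\<lambda>u p. - P u p)"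
  and Sym_mult: "Sym k x P \<Longrightarrow> Sym l y Q \<Longrightarrow> Sym (k + l) (x \<otimes> y) (tmul P Q)"
  and Sym_kernel: "Sym k x P \<Longrightarrow> (\<And>u p. u \<in> W \<Longrightarrow> p \<in> X \<Longrightarrow> P u p = 0) \<Longrightarrow> \<exists>Q. Sym (k - 1) x Q"
  and Sym_neg: "Sym k x P \<Longrightarrow> k < 0 \<Longrightarrow> x = \<zero>"
  and Sym_up: "Sym k x P \<Longrightarrow> Sym (k + 1) x (\<lambda>_ _. 0)"
  and Sym_unique: "Sym k \<zero> P \<Longrightarrow> u \<in> W \<Longrightarrow> p \<in> X \<Longrightarrow> P u p = 0"
  and Sym_cong: "Sym k x P \<Longrightarrow> Tw k Q \<Longrightarrow> (\<And>u p. u \<in> W \<Longrightarrow> p \<in> X \<Longrightarrow> P u p = Q u p) \<Longrightarrow> Sym k x Q"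
  and e_closed: "e \<in> carrier A" and e_idem: "e \<otimes> e = e"
  and e_Sym: "Sym 0 e (\<lambda>_ _. 1 / of_nat (card W))"
begin

lemma card_W: "card W \<noteq> 0"
 using finite_W W_id by (metis card_eq_0_iff empty_iff)

text \<open>Right multiplication by \<open>e\<close> averages the coefficients of a symbol, so an
  element of \<open>A e\<close> has a symbol that is one and the same function at every group
  element.\<close>

definition Ms :: "int \<Rightarrow> 'a \<Rightarrow> 'h pfun \<Rightarrow> bool" where
 "Ms k m s \<longleftrightarrow> m \<in> carrier A \<and> m \<otimes> e = m \<and> Pol k k s \<and> Sym k m (\<lambda>_. s)"

lemma Tw_const: "Pol k k s \<Longrightarrow> Tw k (\<lambda>_. s)"
 by (simp add: Tw_def)

lemma Ms_of_Sym:
 assumes "Sym k m P" "m \<otimes> e = m" shows "\<exists>s. Ms k m s"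
proof -
 define s where "s p = (\<Sum>v\<in>W. P v p * (1 / of_nat (card W)))" for p
 have "Pol k k (\<lambda>p. P v p * (1 / of_nat (card W)))" if "v \<in> W" for v
  using Pol_smult[of k k "P v" "1 / of_nat (card W)"] Sym_Tw[OF assms(1)] that by (simp add: Tw_def mult.commute)
 then have "Pol k k s" unfolding s_def[abs_def] by (rule Pol_sum)
 moreover have "Sym k m (\<lambda>_. s)"
  using Sym_mult[OF assms(1) e_Sym] assms(2) by (simp add: tmul_def[abs_def] s_def[abs_def])
 ultimately show ?thesis using Sym_carrier[OF assms(1)] assms(2) unfolding Ms_def by blast
qed

lemma Ms_total: "m \<in> carrier A \<Longrightarrow> m \<otimes> e = m \<Longrightarrow> \<exists>k s. Ms k m s"
 using Sym_total Ms_of_Sym by blast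

lemma Ms_mult_e: "x \<in> carrier A \<Longrightarrow> x \<otimes> e \<otimes> e = x \<otimes> e"
 by (simp add: m_assoc e_closed e_idem)

lemma Ms_lift:
 assumes "Pol k k s" shows "\<exists>m. Ms k m s"
proof -
 obtain x where x: "Sym k x (\<lambda>_. s)" using Sym_lift[OF Tw_const[OF assms]] by blast
 have "tmul (\<lambda>_. s) (\<lambda>_ _. 1 / of_nat (card W)) = (\<lambda>_. s)"
  using card_W by (simp add: tmul_def fun_eq_iff)
 then have "Sym k (x \<otimes> e) (\<lambda>_. s)" using Sym_mult[OF x e_Sym] by simp
 then have "Ms k (x \<otimes> e) s"
  unfolding Ms_def using Sym_carrier[OF x] e_closed assms Ms_mult_e by auto
 then show ?thesis by blast
qed

lemma Ms_add: "Ms k m s \<Longrightarrow> Ms k m' s' \<Longrightarrow> Ms k (m \<oplus> m') (\<lambda>p. s p + s' p)"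
 unfolding Ms_def using Sym_add[of k m "\<lambda>_. s" m' "\<lambda>_. s'"] e_closed by (auto simp: l_distr intro: Pol_add)

lemma Ms_minus: "Ms k m s \<Longrightarrow> Ms k (\<ominus> m) (\<lambda>p. - s p)"
 unfolding Ms_def using Sym_minus[of k m "\<lambda>_. s"] e_closed by (auto simp: l_minus intro: Pol_uminus)

lemma Ms_diff: "Ms k m s \<Longrightarrow> Ms k m' s' \<Longrightarrow> Ms k (m \<ominus> m') (\<lambda>p. s p - s' p)"
 using Ms_add[OF _ Ms_minus, of k m s m' s'] by (simp add: a_minus_def)

lemma Ms_down: "Ms k m s \<Longrightarrow> (\<And>p. p \<in> X \<Longrightarrow> s p = 0) \<Longrightarrow> \<exists>s'. Ms (k - 1) m s'"
 unfolding Ms_def using Sym_kernel[of k m "\<lambda>_. s"] Ms_of_Sym unfolding Ms_def by blast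

lemma Ms_up: "Ms k m s \<Longrightarrow> Ms (k + 1) m (\<lambda>_. 0)"
 unfolding Ms_def using Sym_up[of k m "\<lambda>_. s"] by (auto intro: Pol_zero)

lemma Ms_raise:
 assumes "Ms k m s" "k \<le> k'" shows "\<exists>s'. Ms k' m s'"
proof -
 have "\<exists>s'. Ms (k + int n) m s'" for n
 proof (induction n)
  case 0
  then show ?case using assms by auto
 next
  case (Suc n)
  then obtain s' where "Ms (k + int n) m s'" by blast
  from Ms_up[OF this] show ?case by (auto simp: algebra_simps)
 qed
 from this[of "nat (k' - k)"] assms(2) show ?thesis by simp
qed

lemma Ms_carrier: "Ms k m s \<Longrightarrow> m \<in> carrier A" "Ms k m s \<Longrightarrow> m \<otimes> e = m" "Ms k m s \<Longrightarrow> Pol k k s"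
 by (auto simp: Ms_def)

lemma Ms_zero_unique: "Ms k \<zero> s \<Longrightarrow> p \<in> X \<Longrightarrow> s p = 0"
 unfolding Ms_def using Sym_unique[of k "\<lambda>_. s" id] by auto

lemma Ms_unique: "Ms k m s \<Longrightarrow> Ms k m s' \<Longrightarrow> p \<in> X \<Longrightarrow> s p = s' p"
 using Ms_zero_unique[of k "\<lambda>p. s p - s' p" p] Ms_diff[of k m s m s'] Ms_carrier(1)[of k m s]
 by (simp add: a_minus_def r_neg)

lemma Ms_neg: "Ms k m s \<Longrightarrow> k < 0 \<Longrightarrow> m = \<zero>"
 unfolding Ms_def using Sym_neg by blast

lemma Ms_zero: "Ms k \<zero> (\<lambda>_. 0)"
proof -
 obtain m where m: "Ms k m (\<lambda>_. 0)" using Ms_lift[OF Pol_zero] by blast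
 show ?thesis using Ms_diff[OF m m] Ms_carrier(1)[OF m] by (simp add: a_minus_def r_neg)
qed

definition Rs :: "int \<Rightarrow> 'a \<Rightarrow> 'h pfun \<Rightarrow> bool" where
 "Rs j r t \<longleftrightarrow> r \<in> carrier A \<and> r \<otimes> e = r \<and> e \<otimes> r = r \<and> inv_Pol j t \<and> Sym j r (\<lambda>_. t)"

lemma Rs_lift:
 assumes t: "inv_Pol j t" shows "\<exists>r. Rs j r t"
proof -
 obtain m where m: "Ms j m t" using Ms_lift[of j t] t by (auto simp: inv_Pol_def)
 have "t (act (invf v) p) = t p" if "v \<in> W" for v p
  using t W_inv[OF that] unfolding inv_Pol_def by blast
 then have "tmul (\<lambda>_ _. 1 / of_nat (card W)) (\<lambda>_. t) = (\<lambda>_. t)"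
  using card_W by (simp add: tmul_def fun_eq_iff)
 then have "Sym j (e \<otimes> m) (\<lambda>_. t)"
  using Sym_mult[OF e_Sym, of j m "\<lambda>_. t"] m unfolding Ms_def by simp
 moreover have "e \<otimes> m \<otimes> e = e \<otimes> m" "e \<otimes> (e \<otimes> m) = e \<otimes> m" "e \<otimes> m \<in> carrier A"
  using m e_closed e_idem m_assoc[of e m e] m_assoc[of e e m] by (auto simp: Ms_def)
 ultimately show ?thesis using t unfolding Rs_def by blast
qed

text \<open>The factor \<open>card W\<close> arises because the convolution of two constant families
  has that many equal terms.\<close>

lemma Ms_Rs:
 assumes "Ms k m s" "Rs j r t" shows "Ms (k + j) (m \<otimes> r) (\<lambda>p. of_nat (card W) * (s p * t p))"
proof -
 have "t (act (invf v) p) = t p" if "v \<in> W" for v p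
  using assms(2) W_inv[OF that] unfolding inv_Pol_def Rs_def by blast
 then have "tmul (\<lambda>_. s) (\<lambda>_. t) = (\<lambda>_ p. of_nat (card W) * (s p * t p))"
  by (simp add: tmul_def fun_eq_iff)
 then have "Sym (k + j) (m \<otimes> r) (\<lambda>_ p. of_nat (card W) * (s p * t p))"
  using Sym_mult[of k m "\<lambda>_. s" j r "\<lambda>_. t"] assms unfolding Ms_def Rs_def by simp
 moreover have "m \<otimes> r \<otimes> e = m \<otimes> r" "m \<otimes> r \<in> carrier A"
  using assms e_closed m_assoc[of m r e] by (auto simp: Ms_def Rs_def)
 moreover have "Pol (k + j) (k + j) (\<lambda>p. of_nat (card W) * (s p * t p))"
  using assms by (intro Pol_smult Pol_mult) (auto simp: Ms_def Rs_def inv_Pol_def)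
 ultimately show ?thesis unfolding Ms_def by blast
qed

text \<open>The division by \<open>card W\<close> is absorbed into the lift, so right multiplication
  by \<open>r\<close> acts on symbols as plain multiplication by \<open>t\<close>.\<close>

lemma Rs_lift_scaled:
 assumes t: "inv_Pol j t"
 shows "\<exists>r. r \<in> carrier A \<and> r \<otimes> e = r \<and> e \<otimes> r = r \<and>
  (\<forall>k m s. Ms k m s \<longrightarrow> Ms (k + j) (m \<otimes> r) (\<lambda>p. s p * t p))"
proof -
 have "inv_Pol j (\<lambda>p. inverse (of_nat (card W)) * t p)"
  using t unfolding inv_Pol_def by (auto intro: Pol_smult)
 then obtain r where r: "Rs j r (\<lambda>p. inverse (of_nat (card W)) * t p)" using Rs_lift by blast
 have "Ms (k + j) (m \<otimes> r) (\<lambda>p. s p * t p)" if "Ms k m s" for k m s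
 proof -
  have "(\<lambda>p. of_nat (card W) * (s p * (inverse (of_nat (card W)) * t p))) = (\<lambda>p. s p * t p)"
   using card_W by (auto simp: field_simps)
  then show ?thesis using Ms_Rs[OF that r] by simp
 qed
 then show ?thesis using r by (intro exI[of _ r]) (auto simp: Rs_def)
qed

section \<open>Endomorphisms and their filtration degree\<close>

definition endo :: "('a \<Rightarrow> 'a) \<Rightarrow> bool" where
 "endo \<phi> \<longleftrightarrow> (\<forall>m. m \<in> carrier A \<longrightarrow> m \<otimes> e = m \<longrightarrow> \<phi> m \<in> carrier A \<and> \<phi> m \<otimes> e = \<phi> m) \<and>
   (\<forall>m m'. m \<in> carrier A \<longrightarrow> m \<otimes> e = m \<longrightarrow> m' \<in> carrier A \<longrightarrow> m' \<otimes> e = m' \<longrightarrow> \<phi> (m \<oplus> m') = \<phi> m \<oplus> \<phi> m') \<and>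
   (\<forall>m r. m \<in> carrier A \<longrightarrow> m \<otimes> e = m \<longrightarrow> r \<in> carrier A \<longrightarrow> r \<otimes> e = r \<longrightarrow> e \<otimes> r = r \<longrightarrow> \<phi> (m \<otimes> r) = \<phi> m \<otimes> r)"

text \<open>The bound is stated for one degree \<open>k\<close> at a time, since a uniform
  \<open>d\<close> is only obtained by induction over \<open>k\<close>.\<close>

definition Bd :: "('a \<Rightarrow> 'a) \<Rightarrow> int \<Rightarrow> int \<Rightarrow> bool" where
 "Bd \<phi> d k \<longleftrightarrow> (\<forall>m s. Ms k m s \<longrightarrow> (\<exists>s'. Ms (k + d) (\<phi> m) s'))"

lemma endo_zero:
 assumes "endo \<phi>" shows "\<phi> \<zero> = \<zero>"
proof -
 have z: "\<zero> \<in> carrier A" "\<zero> \<otimes> e = \<zero>" using e_closed by auto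
 then have "\<phi> \<zero> \<in> carrier A" "\<phi> (\<zero> \<oplus> \<zero>) = \<phi> \<zero> \<oplus> \<phi> \<zero>"
  using assms unfolding endo_def by blast+
 then show ?thesis by (metis add.r_cancel_one' r_zero zero_closed)
qed

lemma Bd_raise: "Bd \<phi> d k \<Longrightarrow> d \<le> d' \<Longrightarrow> Bd \<phi> d' k"
 unfolding Bd_def using Ms_raise by (metis add_left_mono)

text \<open>Two elements with the same symbol differ by an element of lower degree, where the bound
  is known; one lift of each symbol therefore suffices.\<close>

lemma Bd_step:
 assumes \<phi>: "endo \<phi>" and 1: "Bd \<phi> d (k - 1)" and m: "Ms k m s" "Ms (k + d) (\<phi> m) s1" and m': "Ms k m' s"
 shows "\<exists>s2. Ms (k + d) (\<phi> m') s2"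
proof -
 have c: "m \<in> carrier A" "m' \<in> carrier A" "m \<otimes> e = m" "m' \<otimes> e = m'" using m m' by (auto simp: Ms_def)
 obtain s3 where s3: "Ms (k - 1) (m' \<ominus> m) s3" using Ms_down[OF Ms_diff[OF m' m(1)]] by auto
 then obtain s4 where s4: "Ms (k - 1 + d) (\<phi> (m' \<ominus> m)) s4" using 1 unfolding Bd_def by blast
 have "k - 1 + d \<le> k + d" by simp
 then obtain s5 where s5: "Ms (k + d) (\<phi> (m' \<ominus> m)) s5" using Ms_raise[OF s4] by blast
 have "m' = (m' \<ominus> m) \<oplus> m" using c by (simp add: a_minus_def a_assoc l_neg)
 then have "\<phi> m' = \<phi> (m' \<ominus> m) \<oplus> \<phi> m"
  using \<phi> Ms_carrier(1,2)[OF s3] c unfolding endo_def by metis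
 then show ?thesis using Ms_add[OF s5 m(2)] by metis
qed

lemma Bd_of_generators:
 assumes \<phi>: "endo \<phi>" and 1: "Bd \<phi> d (k - 1)"
  and gen: "\<And>s. Pol k k s \<Longrightarrow> \<exists>m s1. Ms k m s \<and> Ms (k + d) (\<phi> m) s1"
 shows "Bd \<phi> d k"
 unfolding Bd_def using Bd_step[OF \<phi> 1] gen Ms_carrier(3) by metis

text \<open>Each degree has a finite spanning set of monomials, so finitely many degrees admit a
  common bound; it may still grow with \<open>n\<close>.\<close>

lemma Bd_low:
 assumes \<phi>: "endo \<phi>" shows "\<exists>d. \<forall>k < int n. Bd \<phi> d k"
proof (induction n)
 case 0
 have "Bd \<phi> 0 k" if "k < 0" for k
  unfolding Bd_def using Ms_neg[OF _ that] endo_zero[OF \<phi>] Ms_zero by metis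
 then show ?case by (intro exI[of _ 0]) simp
next
 case (Suc n)
 then obtain d0 where d0: "\<And>k. k < int n \<Longrightarrow> Bd \<phi> d0 k" by blast
 define mono where "mono = (\<lambda>(\<alpha>, \<beta>) p. xymon \<alpha> \<beta> p)"
 define I where "I = {(\<alpha>, \<beta>) \<in> (Bs \<rightarrow>\<^sub>E {..n}) \<times> (Bs \<rightarrow>\<^sub>E {..n}). (\<Sum>b\<in>Bs. \<alpha> b) = n \<and> (\<Sum>b\<in>Bs. \<beta> b) = n}"
 have "finite ((Bs \<rightarrow>\<^sub>E {..n}) \<times> (Bs \<rightarrow>\<^sub>E {..n}))"
  using finite_Basis by (intro finite_cartesian_product finite_PiE) auto
 then have finI: "finite I" unfolding I_def by (rule finite_subset[rotated]) auto
 have monoP: "Pol (int n) (int n) (mono i)" if "i \<in> I" for i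
 proof -
  obtain \<alpha> \<beta> where i: "i = (\<alpha>, \<beta>)" "(\<Sum>b\<in>Bs. \<alpha> b) = n" "(\<Sum>b\<in>Bs. \<beta> b) = n"
   using \<open>i \<in> I\<close> unfolding I_def by blast
  show ?thesis using Pol_monomial[of \<alpha> \<beta>] unfolding i(2,3) by (simp only: i(1) mono_def prod.case)
 qed
 \<comment> \<open>The bound is enlarged once for each monomial; \<open>d \<ge> d0\<close> preserves
   what is known in lower degrees.\<close>
 have "\<exists>d\<ge>d0. \<forall>i\<in>J. \<exists>m s1. Ms (int n) m (mono i) \<and> Ms (int n + d) (\<phi> m) s1" if "finite J" "J \<subseteq> I" for J
  using that
 proof (induction J rule: finite_induct)
  case empty
  then show ?case by auto
 next
  case (insert i J)
  then obtain d where d: "d \<ge> d0" "\<And>i. i \<in> J \<Longrightarrow> \<exists>m s1. Ms (int n) m (mono i) \<and> Ms (int n + d) (\<phi> m) s1" by auto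
  obtain m where m: "Ms (int n) m (mono i)" using Ms_lift monoP insert.prems by blast
  then have "\<phi> m \<in> carrier A" "\<phi> m \<otimes> e = \<phi> m" using \<phi> unfolding endo_def Ms_def by auto
  then obtain k s where k: "Ms k (\<phi> m) s" using Ms_total by blast
  define d' where "d' = max d (k - int n)"
  have le: "int n + d \<le> int n + d'" "k \<le> int n + d'" by (auto simp: d'_def)
  have "\<exists>m s1. Ms (int n) m (mono j) \<and> Ms (int n + d') (\<phi> m) s1" if j: "j \<in> insert i J" for j
  proof (cases "j = i")
   case True
   then show ?thesis using m Ms_raise[OF k le(2)] by blast
  next
   case False
   then obtain m1 s1 where 1: "Ms (int n) m1 (mono j)" "Ms (int n + d) (\<phi> m1) s1" using d(2) j by blast
   then show ?thesis using Ms_raise[OF 1(2) le(1)] by blast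
  qed
  then show ?case using d(1) by (intro exI[of _ d']) (auto simp: d'_def)
 qed
 from this[OF finI order.refl] obtain d where d: "d \<ge> d0"
  and gen: "\<And>i. i \<in> I \<Longrightarrow> \<exists>m s1. Ms (int n) m (mono i) \<and> Ms (int n + d) (\<phi> m) s1" by blast
 have "\<exists>m s1. Ms (int n) m s \<and> Ms (int n + d) (\<phi> m) s1" if "Pol (int n) (int n) s" for s
  using Pol_Mon_span[OF that]
 proof (induction rule: Mon_span.induct)
  case zero
  have "Ms (int n) \<zero> (\<lambda>_. 0)" "Ms (int n + d) (\<phi> \<zero>) (\<lambda>_. 0)" using Ms_zero endo_zero[OF \<phi>] by auto
  then show ?case by blast
 next
  case (add P Q)
  then obtain m1 s1 m2 s2 where *: "Ms (int n) m1 P" "Ms (int n + d) (\<phi> m1) s1"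
   "Ms (int n) m2 Q" "Ms (int n + d) (\<phi> m2) s2" by blast
  have "\<phi> (m1 \<oplus> m2) = \<phi> m1 \<oplus> \<phi> m2" using \<phi> * unfolding endo_def Ms_def by blast
  then show ?case using Ms_add[OF *(1,3)] Ms_add[OF *(2,4)] by metis
 next
  case (mon \<alpha> \<beta> c)
  let ?i = "(restrict \<alpha> Bs, restrict \<beta> Bs)"
  have sums: "(\<Sum>b\<in>Bs. \<alpha> b) = n" "(\<Sum>b\<in>Bs. \<beta> b) = n" using mon by (simp_all only: of_nat_eq_iff)
  have le: "\<alpha> b \<le> n" "\<beta> b \<le> n" if "b \<in> Bs" for b
   using member_le_sum[OF that, of \<alpha>] member_le_sum[OF that, of \<beta>] finite_Basis sums by auto
  then have "?i \<in> I" using sums by (auto simp: I_def)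
  then obtain m s1 where m: "Ms (int n) m (mono ?i)" "Ms (int n + d) (\<phi> m) s1" using gen by blast
  \<comment> \<open>\<open>endo\<close> asks for linearity over \<open>e A e\<close> only, so the
    scalar \<open>c\<close> is realized by an element of it with symbol \<open>c\<close>.\<close>
  have "inv_Pol 0 (\<lambda>_. c)" by (simp add: inv_Pol_def Pol_const)
  then obtain r where r: "r \<in> carrier A" "r \<otimes> e = r" "e \<otimes> r = r"
   "\<And>k m s. Ms k m s \<Longrightarrow> Ms (k + 0) (m \<otimes> r) (\<lambda>p. s p * c)" using Rs_lift_scaled by blast
  have "\<phi> (m \<otimes> r) = \<phi> m \<otimes> r" using \<phi> m r unfolding endo_def Ms_def by blast
  moreover have "(\<lambda>p. mono ?i p * c) = (\<lambda>p. c * (xymon \<alpha> \<beta> p))"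
   by (simp add: mono_def mult.commute)
  moreover have "Ms (int n) (m \<otimes> r) (\<lambda>p. mono ?i p * c)" "Ms (int n + d) (\<phi> m \<otimes> r) (\<lambda>p. s1 p * c)"
   using r(4)[OF m(1)] r(4)[OF m(2)] by simp_all
  ultimately show ?case by metis
 qed
 then have n: "Bd \<phi> d (int n)"
  using Bd_of_generators[OF \<phi> Bd_raise[OF d0 d]] by simp
 have "Bd \<phi> d k" if "k < int (Suc n)" for k
  using that n Bd_raise[OF d0 d, of k] by (cases "k = int n") auto
 then show ?case by blast
qed

text \<open>Beyond the bound for integrality every symbol is a sum of products of lower symbols with
  invariants. As \<phi> commutes with right multiplication by lifts of the invariants, the bound
  \<open>d\<close> is inherited and no longer grows.\<close>

lemma Bd_all:
 assumes \<phi>: "endo \<phi>" shows "\<exists>d. \<forall>k. Bd \<phi> d k"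
proof -
 define K where "K = Suc (card Bs * card W)"
 obtain d where d: "\<And>k. k < int K \<Longrightarrow> Bd \<phi> d k" using Bd_low[OF \<phi>] by blast
 have "\<forall>k < int n. Bd \<phi> d k" for n
 proof (induction n)
  case 0
  have "k < int K" if "k < 0" for k using that by linarith
  then show ?case using d by simp
 next
  case (Suc n)
  have "Bd \<phi> d (int n)"
  proof (cases "int n < int K")
   case True
   then show ?thesis using d by blast
  next
   case False
   then have large: "int n > int (card Bs * card W)" by (simp add: K_def)
   show ?thesis
   proof (rule Bd_of_generators[OF \<phi>])
    show "Bd \<phi> d (int n - 1)" using Suc by simp
    fix s assume "Pol (int n) (int n) s"
    from large_degree_Dec[OF large this]
    show "\<exists>m s1. Ms (int n) m s \<and> Ms (int n + d) (\<phi> m) s1"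
    proof (induction rule: Dec.induct)
     case Dec_zero
     have "Ms (int n) \<zero> (\<lambda>_. 0)" "Ms (int n + d) (\<phi> \<zero>) (\<lambda>_. 0)" using Ms_zero endo_zero[OF \<phi>] by auto
     then show ?case by blast
    next
     case (Dec_add P Q)
     then obtain m1 s1 m2 s2 where *: "Ms (int n) m1 P" "Ms (int n + d) (\<phi> m1) s1"
      "Ms (int n) m2 Q" "Ms (int n + d) (\<phi> m2) s2" by blast
     have "\<phi> (m1 \<oplus> m2) = \<phi> m1 \<oplus> \<phi> m2" using \<phi> * unfolding endo_def Ms_def by blast
     then show ?case using Ms_add[OF *(1,3)] Ms_add[OF *(2,4)] by metis
    next
     case (Dec_mult j s r)
     obtain m where m: "Ms (int n - j) m s" using Ms_lift[OF Dec_mult(2)] by blast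
     have "int n - j < int n" using Dec_mult(1) by simp
     then obtain s1 where s1: "Ms (int n - j + d) (\<phi> m) s1" using Suc m unfolding Bd_def by blast
     obtain r' where r: "r' \<in> carrier A" "r' \<otimes> e = r'" "e \<otimes> r' = r'"
      "\<And>k m s. Ms k m s \<Longrightarrow> Ms (k + j) (m \<otimes> r') (\<lambda>p. s p * r p)"
      using Rs_lift_scaled[OF Dec_mult(3)] by blast
     have "\<phi> (m \<otimes> r') = \<phi> m \<otimes> r'" using \<phi> m r unfolding endo_def Ms_def by blast
     then have "Ms (int n + d) (\<phi> (m \<otimes> r')) (\<lambda>p. s1 p * r p)" using r(4)[OF s1] by (simp add: algebra_simps)
     moreover have "Ms (int n) (m \<otimes> r') (\<lambda>p. s p * r p)" using r(4)[OF m] by simp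
     ultimately show ?case by blast
    qed
   qed
  qed
  then show ?case using Suc by (metis less_add_one of_nat_Suc zless_add1_eq add.commute)
 qed
 then have "Bd \<phi> d k" for k
  using spec[of "\<lambda>n. \<forall>k<int n. Bd \<phi> d k" "nat (k + 1)"] by simp
 then show ?thesis by blast
qed

end

context filtered_algebra
begin

lemma endo_subtract:
 assumes \<phi>: "endo \<phi>" and x: "x \<in> carrier A"
 shows "endo (\<lambda>m. \<phi> m \<ominus> x \<otimes> m)"
 unfolding endo_def
proof (intro conjI allI impI)
 fix m assume m: "m \<in> carrier A" "m \<otimes> e = m"
 have pm: "\<phi> m \<in> carrier A" "\<phi> m \<otimes> e = \<phi> m" using \<phi> m unfolding endo_def by blast+
 then show "\<phi> m \<ominus> x \<otimes> m \<in> carrier A" using m x by simp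
 have "x \<otimes> m \<otimes> e = x \<otimes> m" using m x e_closed by (simp add: m_assoc)
 then show "(\<phi> m \<ominus> x \<otimes> m) \<otimes> e = \<phi> m \<ominus> x \<otimes> m"
  using pm m x e_closed by (simp add: a_minus_def l_distr l_minus)
next
 fix m m' assume m: "m \<in> carrier A" "m \<otimes> e = m" "m' \<in> carrier A" "m' \<otimes> e = m'"
 have pm: "\<phi> m \<in> carrier A" "\<phi> m' \<in> carrier A" "\<phi> (m \<oplus> m') = \<phi> m \<oplus> \<phi> m'"
  using \<phi> m unfolding endo_def by blast+
 have "\<phi> m \<oplus> \<phi> m' \<ominus> (x \<otimes> m \<oplus> x \<otimes> m') = (\<phi> m \<ominus> x \<otimes> m) \<oplus> (\<phi> m' \<ominus> x \<otimes> m')"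
  using pm m x by (simp add: a_minus_def minus_add a_assoc a_lcomm)
 then show "\<phi> (m \<oplus> m') \<ominus> x \<otimes> (m \<oplus> m') = (\<phi> m \<ominus> x \<otimes> m) \<oplus> (\<phi> m' \<ominus> x \<otimes> m')"
  using pm m x by (simp add: r_distr)
next
 fix m r assume m: "m \<in> carrier A" "m \<otimes> e = m" and r: "r \<in> carrier A" "r \<otimes> e = r" "e \<otimes> r = r"
 have pm: "\<phi> m \<in> carrier A" "\<phi> (m \<otimes> r) = \<phi> m \<otimes> r" using \<phi> m r unfolding endo_def by blast+
 then show "\<phi> (m \<otimes> r) \<ominus> x \<otimes> (m \<otimes> r) = (\<phi> m \<ominus> x \<otimes> m) \<otimes> r"
  using m r x by (simp add: a_minus_def l_distr l_minus m_assoc)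
qed

text \<open>A group element acts on functions by pullback along its inverse. Hence the operator with
  coefficient \<open>h u\<close> at the translate by \<open>u\<close> is left multiplication by the
  family with \<open>h (invf v)\<close> at \<open>v\<close>.\<close>

lemma tmul_inverse_sum:
 "tmul (\<lambda>v. h (invf v)) (\<lambda>_. s) u p = (\<Sum>v\<in>W. h v p * s (act v p))"
 unfolding tmul_def using sum_inverse[of "\<lambda>v. h v p * s (act v p)"] by simp

text \<open>The leading symbol is a sum of translates by the graded theorem, and its coefficients
  lift to an element of \<open>A\<close>. In negative degree the lift is zero, so the bound drops
  without changing \<phi>.\<close>

lemma endo_reduce:
 assumes \<phi>: "endo \<phi>" and B: "\<And>k. Bd \<phi> d k"
 shows "\<exists>x\<in>carrier A. (\<forall>k. Bd (\<lambda>m. \<phi> m \<ominus> x \<otimes> m) (d - 1) k) \<and> (d < 0 \<longrightarrow> x = \<zero>)"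
proof -
 \<comment> \<open>The requirement that this relation respects vanishing on \<open>X\<close> is met
   because such a symbol means lower degree, and the bound then lowers the degree of the
   image.\<close>
 define \<Psi> where "\<Psi> k f g \<longleftrightarrow> Pol (k + d) (k + d) g \<and> (\<exists>m. Ms k m f \<and> Ms (k + d) (\<phi> m) g)" for k f g
 have "\<exists>h. (\<forall>u\<in>W. Pol d d (h u)) \<and> (\<forall>u\<in>W. \<forall>z\<in>Z. \<forall>p\<in>X. h (z \<circ> u) p = h u p) \<and>
   (\<forall>k f g. \<Psi> k f g \<longrightarrow> (\<forall>p\<in>X. g p = (\<Sum>u\<in>W. h u p * f (act u p))))"
 proof (rule graded_double_centralizer)
  fix k f assume "Pol k k f"
  then obtain m where m: "Ms k m f" using Ms_lift by blast
  then obtain g where "Ms (k + d) (\<phi> m) g" using B unfolding Bd_def by blast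
  then show "\<exists>g. \<Psi> k f g" using m Ms_carrier(3) unfolding \<Psi>_def by blast
 next
  fix k f g assume "\<Psi> k f g"
  then show "Pol k k f \<and> Pol (k + d) (k + d) g" using Ms_carrier(3) unfolding \<Psi>_def by blast
 next
  fix k f g f' g' assume 1: "\<Psi> k f g" "\<Psi> k f' g'"
  obtain m where m: "Ms k m f" "Ms (k + d) (\<phi> m) g" "Pol (k + d) (k + d) g" using 1 unfolding \<Psi>_def by blast
  obtain m' where m': "Ms k m' f'" "Ms (k + d) (\<phi> m') g'" "Pol (k + d) (k + d) g'" using 1 unfolding \<Psi>_def by blast
  have "\<phi> (m \<oplus> m') = \<phi> m \<oplus> \<phi> m'" using \<phi> m m' unfolding endo_def Ms_def by blast
  then have "Ms (k + d) (\<phi> (m \<oplus> m')) (\<lambda>p. g p + g' p)" using Ms_add[OF m(2) m'(2)] by simp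
  with Ms_add[OF m(1) m'(1)] Pol_add[OF m(3) m'(3)]
  show "\<Psi> k (\<lambda>p. f p + f' p) (\<lambda>p. g p + g' p)" unfolding \<Psi>_def by blast
 next
  fix k f g p assume 1: "\<Psi> k f g" and f0: "\<And>p. p \<in> X \<Longrightarrow> f p = 0" and p: "p \<in> X"
  obtain m where m: "Ms k m f" "Ms (k + d) (\<phi> m) g" using 1 unfolding \<Psi>_def by blast
  obtain s where "Ms (k - 1) m s" using Ms_down[OF m(1) f0] by blast
  then obtain s' where "Ms (k - 1 + d) (\<phi> m) s'" using B unfolding Bd_def by blast
  from Ms_up[OF this] have "Ms (k + d) (\<phi> m) (\<lambda>_. 0)" by (simp add: algebra_simps)
  from Ms_unique[OF m(2) this p] show "g p = 0" .
 next
  fix k f g j r assume 1: "\<Psi> k f g" and r: "inv_Pol j r"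
  obtain m where m: "Ms k m f" "Ms (k + d) (\<phi> m) g" using 1 unfolding \<Psi>_def by blast
  obtain r' where r': "r' \<in> carrier A" "r' \<otimes> e = r'" "e \<otimes> r' = r'"
   "\<And>k m s. Ms k m s \<Longrightarrow> Ms (k + j) (m \<otimes> r') (\<lambda>p. s p * r p)" using Rs_lift_scaled[OF r] by blast
  have "\<phi> (m \<otimes> r') = \<phi> m \<otimes> r'" using \<phi> m r' unfolding endo_def Ms_def by blast
  then have 2: "Ms (k + j + d) (\<phi> (m \<otimes> r')) (\<lambda>p. g p * r p)" using r'(4)[OF m(2)] by (simp add: algebra_simps)
  then show "\<Psi> (k + j) (\<lambda>p. f p * r p) (\<lambda>p. g p * r p)"
   using r'(4)[OF m(1)] Ms_carrier(3)[OF 2] unfolding \<Psi>_def by blast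
 qed
 then obtain h where h: "\<And>u. u \<in> W \<Longrightarrow> Pol d d (h u)" "\<And>u z p. u \<in> W \<Longrightarrow> z \<in> Z \<Longrightarrow> p \<in> X \<Longrightarrow> h (z \<circ> u) p = h u p"
  "\<And>k f g p. \<Psi> k f g \<Longrightarrow> p \<in> X \<Longrightarrow> g p = (\<Sum>u\<in>W. h u p * f (act u p))" by blast
 define P where "P v = h (invf v)" for v
 have "Tw d P" unfolding Tw_def P_def
 proof (intro conjI ballI)
  show "Pol d d (h (invf u))" if "u \<in> W" for u using h(1) that by simp
  fix z u p assume z: "z \<in> Z" and u: "u \<in> W" and p: "p \<in> X"
  have "invf (z \<circ> u) = invf u \<circ> invf z" using inv_of_comp Z_W z u by blast
  also have "\<dots> = invf z \<circ> invf u"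
   using Z_inv[OF z] W_inv[OF u] by (simp add: group_center_def)
  finally show "h (invf (z \<circ> u)) p = h (invf u) p"
   using h(2)[OF W_inv[OF u] Z_inv[OF z] p] by simp
 qed
 then obtain x where x: "Sym d x P" using Sym_lift by blast
 have xc: "x \<in> carrier A" using Sym_carrier[OF x] .
 have "Bd (\<lambda>m. \<phi> m \<ominus> x \<otimes> m) (d - 1) k" for k
  unfolding Bd_def
 proof (intro allI impI)
  fix m s assume m: "Ms k m s"
  then obtain g where g: "Ms (k + d) (\<phi> m) g" using B unfolding Bd_def by blast
  have gp: "g p = (\<Sum>u\<in>W. h u p * s (act u p))" if "p \<in> X" for p
   using h(3)[of k s g p] m g that Ms_carrier(3)[OF g] unfolding \<Psi>_def by blast
  have "tmul P (\<lambda>_. s) = (\<lambda>_ p. \<Sum>u\<in>W. h u p * s (act u p))"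
   by (intro ext) (simp only: P_def[abs_def] tmul_inverse_sum)
  then have "Sym (k + d) (x \<otimes> m) (\<lambda>_ p. \<Sum>u\<in>W. h u p * s (act u p))"
   using Sym_mult[OF x, of k m "\<lambda>_. s"] m unfolding Ms_def by (simp add: add.commute)
  moreover have "x \<otimes> m \<otimes> e = x \<otimes> m" "x \<otimes> m \<in> carrier A"
   using xc m e_closed by (auto simp: Ms_def m_assoc)
  moreover have "Pol (k + d) (k + d) (\<lambda>p. \<Sum>u\<in>W. h u p * s (act u p))"
  proof (rule Pol_sum)
   fix u assume u: "u \<in> W"
   show "Pol (k + d) (k + d) (\<lambda>p. h u p * s (act u p))"
    by (rule Pol_cong[OF Pol_mult[OF h(1)[OF u] Pol_act[OF Ms_carrier(3)[OF m] u]]]) auto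
  qed
  ultimately have "Ms (k + d) (x \<otimes> m) (\<lambda>p. \<Sum>u\<in>W. h u p * s (act u p))" unfolding Ms_def by blast
  from Ms_down[OF Ms_diff[OF g this]] gp show "\<exists>s'. Ms (k + (d - 1)) (\<phi> m \<ominus> x \<otimes> m) s'"
   by (simp add: algebra_simps)
 qed
 then show ?thesis using xc Sym_neg[OF x] by blast
qed

text \<open>Reduction in negative degree subtracts nothing, so it can be repeated until the image of
  a given element falls into negative filtration degree.\<close>

lemma endo_vanishes:
 assumes \<phi>: "endo \<phi>" and B: "\<And>k. Bd \<phi> d k" and d: "d < 0" and m: "m \<in> carrier A" "m \<otimes> e = m"
 shows "\<phi> m = \<zero>"
proof -
 have "\<forall>k. Bd \<phi> (d - int j) k" for j
 proof (induction j)
  case 0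
  then show ?case using B by simp
 next
  case (Suc j)
  have "d - int j < 0" using d by simp
  then have 1: "\<forall>k. Bd (\<lambda>m. \<phi> m \<ominus> \<zero> \<otimes> m) (d - int j - 1) k"
   using endo_reduce[OF \<phi>, of "d - int j"] Suc by auto
  have "\<phi> m \<ominus> \<zero> \<otimes> m = \<phi> m" if "m \<in> carrier A" "m \<otimes> e = m" for m
   using \<phi> that unfolding endo_def by (simp add: a_minus_def)
  then have "Bd \<phi> (d - int j - 1) k" for k
   using 1 Ms_carrier(1,2) unfolding Bd_def by metis
  moreover have "d - int j - 1 = d - int (Suc j)" by simp
  ultimately show ?case by metis
 qed
 moreover obtain k s where k: "Ms k m s" using Ms_total m by blast
 \<comment> \<open>Lowering by \<bar>k\<bar> + 1 suffices to make the degree negative whatever the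
   sign of \<open>k\<close>.\<close>
 ultimately obtain s' where "Ms (k + (d - int (nat (\<bar>k\<bar> + 1)))) (\<phi> m) s'" unfolding Bd_def by blast
 then show ?thesis by (rule Ms_neg) (use d in simp)
qed

lemma endo_left_mult:
 assumes "endo \<phi>"
 shows "\<exists>x\<in>carrier A. \<forall>m. m \<in> carrier A \<longrightarrow> m \<otimes> e = m \<longrightarrow> \<phi> m = x \<otimes> m"
proof -
 \<comment> \<open>The degree is written \<open>int n - 1\<close> so that the induction starts with
   the degree -1, where the endomorphism vanishes.\<close>
 have "\<exists>x\<in>carrier A. \<forall>m. m \<in> carrier A \<longrightarrow> m \<otimes> e = m \<longrightarrow> \<phi> m = x \<otimes> m"
  if "endo \<phi>" "\<And>k. Bd \<phi> (int n - 1) k" for n \<phi>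
  using that
 proof (induction n arbitrary: \<phi>)
  case 0
  have "\<phi> m = \<zero> \<otimes> m" if "m \<in> carrier A" "m \<otimes> e = m" for m
   using endo_vanishes[OF 0(1,2) _ that] that by simp
  then show ?case by blast
 next
  case (Suc n)
  obtain x where x: "x \<in> carrier A" "\<And>k. Bd (\<lambda>m. \<phi> m \<ominus> x \<otimes> m) (int (Suc n) - 1 - 1) k"
   using endo_reduce[OF Suc.prems] by blast
  then obtain x' where x': "x' \<in> carrier A"
   "\<And>m. m \<in> carrier A \<Longrightarrow> m \<otimes> e = m \<Longrightarrow> \<phi> m \<ominus> x \<otimes> m = x' \<otimes> m"
   using Suc.IH[OF endo_subtract[OF Suc.prems(1) x(1)]] by auto
  have "\<phi> m = (x' \<oplus> x) \<otimes> m" if m: "m \<in> carrier A" "m \<otimes> e = m" for m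
  proof -
   have "\<phi> m \<in> carrier A" using Suc.prems(1) m unfolding endo_def by blast
   then have "\<phi> m = (\<phi> m \<ominus> x \<otimes> m) \<oplus> x \<otimes> m" using m x by (simp add: a_minus_def a_assoc l_neg)
   then show ?thesis using x'(2)[OF m] x x' m by (simp add: l_distr)
  qed
  then show ?case using x x' by blast
 qed
 moreover obtain d where d: "\<And>k. Bd \<phi> d k" using Bd_all[OF assms] by blast
 moreover have "Bd \<phi> (int (nat (\<bar>d\<bar> + 1)) - 1) k" for k by (rule Bd_raise[OF d]) simp
 ultimately show ?thesis using assms by blast
qed

text \<open>An element that kills \<open>A e\<close> has a symbol that annihilates every function,
  and independence of translates makes it zero on \<open>X\<close>; the filtration degree then drops
  without end.\<close>

lemma left_mult_faithful:
 assumes x: "x \<in> carrier A" and ann: "\<And>m. m \<in> carrier A \<Longrightarrow> m \<otimes> e = m \<Longrightarrow> x \<otimes> m = \<zero>"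
 shows "x = \<zero>"
proof -
 have "k < int n \<Longrightarrow> Sym k x P \<Longrightarrow> x = \<zero>" for n k P
 proof (induction n arbitrary: k P)
  case 0
  then show ?case using Sym_neg by simp
 next
  case (Suc n)
  define G where "G u = P (invf u)" for u
  have Tw: "Tw k P" using Sym_Tw[OF Suc.prems(2)] .
  have G0: "G u p = 0" if "u \<in> W" "p \<in> X" for u p
  proof (rule translates_independent[OF _ _ _ that])
   show "Pol k k (G u)" if "u \<in> W" for u using Tw that unfolding Tw_def G_def by simp
   fix z u p assume u: "u \<in> W" and z: "z \<in> Z" and p: "p \<in> X"
   have "invf (z \<circ> u) = invf u \<circ> invf z" using inv_of_comp Z_W z u by blast
   also have "\<dots> = invf z \<circ> invf u"
    using Z_inv[OF z] W_inv[OF u] by (simp add: group_center_def)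
   finally show "G (z \<circ> u) p = G u p"
    using Tw Z_inv[OF z] W_inv[OF u] p unfolding Tw_def G_def by simp
  next
   fix l f p assume f: "Pol l l f" and p: "p \<in> X"
   obtain m where m: "Ms l m f" using Ms_lift[OF f] by blast
   have "Sym (k + l) (x \<otimes> m) (tmul P (\<lambda>_. f))"
    using Sym_mult[OF Suc.prems(2)] m unfolding Ms_def by blast
   then have "tmul P (\<lambda>_. f) id p = 0"
    using ann Ms_carrier(1,2)[OF m] Sym_unique[of "k + l" "tmul P (\<lambda>_. f)" id p] p by simp
   then show "(\<Sum>u\<in>W. G u p * f (act u p)) = 0"
    unfolding G_def tmul_def using sum_inverse[of "\<lambda>u. P (invf u) p * f (act u p)"] by simp
  qed
  have "P u p = 0" if "u \<in> W" "p \<in> X" for u p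
   using G0[OF W_inv[OF that(1)] that(2)] that by (simp add: G_def)
  then obtain Q where "Sym (k - 1) x Q" using Sym_kernel[OF Suc.prems(2)] by blast
  then show ?case using Suc.IH[of "k - 1" Q] Suc.prems(1) by simp
 qed
 moreover obtain k P where "Sym k x P" using Sym_total[OF x] by blast
 moreover have "k < int (nat (k + 1))" by simp
 ultimately show ?thesis by blast
qed

theorem double_centralizer:
 "left_mult A (left_ideal_gen A e) \<in> alg_iso A (right_End A (carrier (corner A e)) (left_ideal_gen A e))"
proof -
 let ?M = "left_ideal_gen A e" and ?B = "carrier (corner A e)"
 have M: "m \<in> ?M \<longleftrightarrow> m \<in> carrier A \<and> m \<otimes> e = m" for m
 proof
  assume "m \<in> ?M"
  then show "m \<in> carrier A \<and> m \<otimes> e = m"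
   using e_closed Ms_mult_e by (auto simp: left_ideal_gen_def)
 next
  assume "m \<in> carrier A \<and> m \<otimes> e = m"
  then show "m \<in> ?M" unfolding left_ideal_gen_def by (metis (mono_tags, lifting) mem_Collect_eq)
 qed
 have B: "b \<in> ?B \<longleftrightarrow> b \<in> carrier A \<and> b \<otimes> e = b \<and> e \<otimes> b = b" for b
 proof
  assume "b \<in> ?B"
  then obtain x where "x \<in> carrier A" "b = e \<otimes> x \<otimes> e" by (auto simp: corner_def)
  then show "b \<in> carrier A \<and> b \<otimes> e = b \<and> e \<otimes> b = b"
   using e_closed e_idem m_assoc[of e e "x \<otimes> e"] m_assoc[of e x e] Ms_mult_e[of "e \<otimes> x"] by auto
 next
  assume "b \<in> carrier A \<and> b \<otimes> e = b \<and> e \<otimes> b = b"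
  then show "b \<in> ?B" unfolding corner_def by (auto intro!: exI[of _ b])
 qed
 let ?E = "right_End A ?B ?M"
 let ?f = "left_mult A ?M"
 have fM: "?f x \<in> carrier ?E" if x: "x \<in> carrier A" for x
 proof -
  have "x \<otimes> m \<in> ?M" if "m \<in> ?M" for m
   using that x e_closed unfolding M by (auto simp: m_assoc)
  moreover have "m \<oplus> m' \<in> ?M" if "m \<in> ?M" "m' \<in> ?M" for m m'
   using that e_closed unfolding M by (auto simp: l_distr)
  moreover have "m \<otimes> b \<in> ?M" if "m \<in> ?M" "b \<in> ?B" for m b
   using that e_closed unfolding M B by (auto simp: m_assoc)
  ultimately show ?thesis using x M B
   unfolding right_End_def left_mult_def by (auto simp: r_distr m_assoc)
 qed
 have hom: "?f \<in> ring_hom A ?E"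
 proof (rule ring_hom_memI)
  show "?f x \<in> carrier ?E" if "x \<in> carrier A" for x using fM[OF that] .
  show "?f (x \<otimes> y) = ?f x \<otimes>\<^bsub>?E\<^esub> ?f y" if "x \<in> carrier A" "y \<in> carrier A" for x y
  proof -
   have "y \<otimes> m \<in> ?M" if "m \<in> ?M" for m
    using that \<open>y \<in> carrier A\<close> e_closed unfolding M by (auto simp: m_assoc)
   then show ?thesis using that M by (auto simp: right_End_def left_mult_def m_assoc intro!: restrict_ext)
  qed
  show "?f (x \<oplus> y) = ?f x \<oplus>\<^bsub>?E\<^esub> ?f y" if "x \<in> carrier A" "y \<in> carrier A" for x y
   using that M by (auto simp: right_End_def left_mult_def l_distr intro!: restrict_ext)
  show "?f \<one> = \<one>\<^bsub>?E\<^esub>"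
   using M by (auto simp: right_End_def left_mult_def intro!: restrict_ext)
 qed
 have "inj_on ?f (carrier A)"
 proof (rule inj_onI)
  fix x y assume x: "x \<in> carrier A" and y: "y \<in> carrier A" and eq: "?f x = ?f y"
  have "(x \<ominus> y) \<otimes> m = \<zero>" if m: "m \<in> carrier A" "m \<otimes> e = m" for m
  proof -
   have "x \<otimes> m = y \<otimes> m" using fun_cong[OF eq, of m] M m by (simp add: left_mult_def)
   then show ?thesis using x y m by (simp add: a_minus_def l_distr l_minus r_neg)
  qed
  then have "x \<ominus> y = \<zero>" using left_mult_faithful[of "x \<ominus> y"] x y by simp
  then show "x = y" using x y by simp
 qed
 moreover have "?f ` carrier A = carrier ?E"
 proof
  show "?f ` carrier A \<subseteq> carrier ?E" using fM by blast
  show "carrier ?E \<subseteq> ?f ` carrier A"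
  proof
   fix \<phi> assume \<phi>: "\<phi> \<in> carrier ?E"
   then have \<phi>1: "\<phi> \<in> ?M \<rightarrow>\<^sub>E ?M" "\<And>m m'. m \<in> ?M \<Longrightarrow> m' \<in> ?M \<Longrightarrow> \<phi> (m \<oplus> m') = \<phi> m \<oplus> \<phi> m'"
    "\<And>m b. m \<in> ?M \<Longrightarrow> b \<in> ?B \<Longrightarrow> \<phi> (m \<otimes> b) = \<phi> m \<otimes> b" by (auto simp: right_End_def)
   have "endo \<phi>" unfolding endo_def
    using \<phi>1 PiE_mem[OF \<phi>1(1)] unfolding M B by blast
   then obtain x where x: "x \<in> carrier A" "\<And>m. m \<in> carrier A \<Longrightarrow> m \<otimes> e = m \<Longrightarrow> \<phi> m = x \<otimes> m"
    using endo_left_mult by blast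
   have "\<phi> = ?f x"
   proof
    fix m
    show "\<phi> m = ?f x m"
     using x(2)[of m] PiE_arb[OF \<phi>1(1), of m] M[of m] by (cases "m \<in> ?M") (auto simp: left_mult_def)
   qed
   then show "\<phi> \<in> ?f ` carrier A" using x(1) by blast
  qed
 qed
 ultimately have "?f \<in> ring_iso A ?E"
  using hom by (simp add: ring_iso_def bij_betw_def)
 moreover have "?f (z \<odot> x) = z \<odot>\<^bsub>?E\<^esub> ?f x" if "x \<in> carrier A" for z x
  using that M smult_mult by (auto simp: right_End_def left_mult_def intro!: restrict_ext)
 ultimately show ?thesis by (simp add: alg_iso_def)
qed

end

section \<open>Complex algebras\<close>

locale calg = ring A for A :: "(complex, 'a) module" (structure) +
 assumes smult_closed [simp]: "x \<in> carrier A \<Longrightarrow> c \<odot> x \<in> carrier A"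
  and smult_add_left: "x \<in> carrier A \<Longrightarrow> (c + d) \<odot> x = c \<odot> x \<oplus> d \<odot> x"
  and smult_add_right: "x \<in> carrier A \<Longrightarrow> y \<in> carrier A \<Longrightarrow> c \<odot> (x \<oplus> y) = c \<odot> x \<oplus> c \<odot> y"
  and smult_smult: "x \<in> carrier A \<Longrightarrow> c \<odot> (d \<odot> x) = (c * d) \<odot> x"
  and smult_one: "x \<in> carrier A \<Longrightarrow> 1 \<odot> x = x"
  and smult_mult_left: "x \<in> carrier A \<Longrightarrow> y \<in> carrier A \<Longrightarrow> (c \<odot> x) \<otimes> y = c \<odot> (x \<otimes> y)"
  and smult_mult_right: "x \<in> carrier A \<Longrightarrow> y \<in> carrier A \<Longrightarrow> x \<otimes> (c \<odot> y) = c \<odot> (x \<otimes> y)"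
begin

lemma smult_zero_right [simp]: "c \<odot> \<zero> = \<zero>"
 using smult_add_right[of \<zero> \<zero> c] by (metis add.r_cancel_one' r_zero smult_closed zero_closed)

lemma smult_zero_left [simp]: "x \<in> carrier A \<Longrightarrow> 0 \<odot> x = \<zero>"
 using smult_add_left[of x 0 0] by (metis add.r_cancel_one' add_0 smult_closed)

lemma smult_minus_one: "x \<in> carrier A \<Longrightarrow> (-1) \<odot> x = \<ominus> x"
 using smult_add_left[of x "-1" 1] by (simp add: smult_one minus_equality)

lemma smult_minus_left: "x \<in> carrier A \<Longrightarrow> (- c) \<odot> x = \<ominus> (c \<odot> x)"
 using smult_minus_one[of "c \<odot> x"] by (simp add: smult_smult)

lemma smult_minus_right: "x \<in> carrier A \<Longrightarrow> c \<odot> (\<ominus> x) = \<ominus> (c \<odot> x)"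
 using smult_smult[of x c "-1"] by (simp add: smult_minus_one smult_minus_left smult_one)

lemma smult_finsum: "f \<in> I \<rightarrow> carrier A \<Longrightarrow> c \<odot> (\<Oplus>i\<in>I. f i) = (\<Oplus>i\<in>I. c \<odot> f i)"
proof (induction I rule: infinite_finite_induct)
 case (insert x F)
 then have "f \<in> F \<rightarrow> carrier A" "f x \<in> carrier A" by auto
 moreover have "(\<Oplus>i\<in>insert x F. c \<odot> f i) = c \<odot> f x \<oplus> (\<Oplus>i\<in>F. c \<odot> f i)"
  using insert by (subst finsum_insert) (auto simp: Pi_iff)
 ultimately show ?case using insert by (simp add: smult_add_right)
qed (simp_all)

lemma finsum_single:
 assumes "finite I" "j \<in> I" "\<And>i. i \<in> I \<Longrightarrow> f i \<in> carrier A" "\<And>i. i \<in> I \<Longrightarrow> i \<noteq> j \<Longrightarrow> f i = \<zero>"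
 shows "(\<Oplus>i\<in>I. f i) = f j"
proof -
 have "(\<Oplus>i\<in>I. f i) = (\<Oplus>i\<in>insert j (I - {j}). f i)" using assms by (simp add: insert_absorb)
 also have "\<dots> = f j \<oplus> (\<Oplus>i\<in>I - {j}. f i)" using assms by (subst finsum_insert) auto
 also have "(\<Oplus>i\<in>I - {j}. f i) = (\<Oplus>i\<in>I - {j}. \<zero>)" using assms by (intro finsum_cong') auto
 finally show ?thesis using assms by simp
qed

lemma subalg_calg:
 assumes "subalg A B" shows "calg (A\<lparr>carrier := B\<rparr>)"
proof -
 have B: "subring B A" "\<And>z x. x \<in> B \<Longrightarrow> z \<odot> x \<in> B" using assms by (auto simp: subalg_def)
 interpret B: ring "A\<lparr>carrier := B\<rparr>" using subring_is_ring[OF B(1)] .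
 have "B \<subseteq> carrier A" using subringE(1)[OF B(1)] .
 then show ?thesis
  by unfold_locales (auto simp: B subset_eq smult_add_left smult_add_right smult_smult smult_one
    smult_mult_left smult_mult_right)
qed

lemma corner_carrier:
 assumes p: "p \<in> carrier A" "p \<otimes> p = p"
 shows "carrier (corner A p) = {x \<in> carrier A. p \<otimes> x = x \<and> x \<otimes> p = x}"
proof
 show "carrier (corner A p) \<subseteq> {x \<in> carrier A. p \<otimes> x = x \<and> x \<otimes> p = x}"
 proof
  fix y assume "y \<in> carrier (corner A p)"
  then obtain x where "x \<in> carrier A" "y = p \<otimes> x \<otimes> p" by (auto simp: corner_def)
  then show "y \<in> {x \<in> carrier A. p \<otimes> x = x \<and> x \<otimes> p = x}"
   using p m_assoc[of "p \<otimes> x" p p] m_assoc[of p p "x \<otimes> p"] m_assoc[of p x p] by auto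
 qed
 show "{x \<in> carrier A. p \<otimes> x = x \<and> x \<otimes> p = x} \<subseteq> carrier (corner A p)"
  by (auto simp: corner_def intro!: exI)
qed

lemma corner_calg:
 assumes p: "p \<in> carrier A" "p \<otimes> p = p"
 shows "calg (corner A p)"
proof -
 let ?C = "corner A p"
 have C: "x \<in> carrier ?C \<longleftrightarrow> x \<in> carrier A \<and> p \<otimes> x = x \<and> x \<otimes> p = x" for x
  by (simp add: corner_carrier[OF p])
 have ops: "x \<oplus>\<^bsub>?C\<^esub> y = x \<oplus> y" "x \<otimes>\<^bsub>?C\<^esub> y = x \<otimes> y" "\<zero>\<^bsub>?C\<^esub> = \<zero>" "\<one>\<^bsub>?C\<^esub> = p" "z \<odot>\<^bsub>?C\<^esub> x = z \<odot> x" for x y z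
  by (simp_all add: corner_def)
 have minus: "\<ominus> x \<in> carrier ?C" if "x \<in> carrier ?C" for x
  using that p unfolding C by (simp add: l_minus r_minus)
 have mult: "x \<otimes> y \<in> carrier ?C" if "x \<in> carrier ?C" "y \<in> carrier ?C" for x y
  using that p m_assoc[of p x y] m_assoc[of x y p] unfolding C by auto
 have "ring ?C"
 proof (rule ringI)
  show "abelian_group ?C"
  proof (rule abelian_groupI)
   show "\<exists>y\<in>carrier ?C. y \<oplus>\<^bsub>?C\<^esub> x = \<zero>\<^bsub>?C\<^esub>" if "x \<in> carrier ?C" for x
    using that minus[OF that] by (intro bexI[of _ "\<ominus> x"]) (auto simp: ops C l_neg)
  qed (use p in \<open>auto simp: ops C r_distr l_distr a_ac\<close>)
  show "monoid ?C"
   by (rule monoidI) (use p mult in \<open>auto simp: ops C m_assoc\<close>)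
 qed (auto simp: ops C l_distr r_distr)
 then interpret C: ring ?C .
 show ?thesis
  by unfold_locales (use p in \<open>auto simp: ops C smult_add_left smult_add_right smult_smult smult_one
    smult_mult_left smult_mult_right\<close>)
qed

end

locale calg_ideal = calg A + ideal I A for A :: "(complex, 'a) module" (structure) and I
begin

abbreviation cls where "cls \<equiv> quot_class A I"

lemma quot_carrier: "carrier (quot_alg A I) = cls ` carrier A"
 by (auto simp: quot_alg_def ring.defs module.defs FactRing_def A_RCOSETS_def' quot_class_def)

lemma cls_eq_iff: "x \<in> carrier A \<Longrightarrow> y \<in> carrier A \<Longrightarrow> cls x = cls y \<longleftrightarrow> x \<ominus> y \<in> I"
 unfolding quot_class_def using quotient_eq_iff_same_a_r_cos[OF is_ideal] by auto

lemma smult_I: "x \<in> I \<Longrightarrow> c \<odot> x \<in> I"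
proof -
 assume x: "x \<in> I"
 then have "x \<in> carrier A" using a_Hcarr by blast
 then have "c \<odot> x = (c \<odot> \<one>) \<otimes> x" by (simp add: smult_mult_left)
 then show ?thesis using I_l_closed[OF x, of "c \<odot> \<one>"] by simp
qed

lemma cls_mem: "x \<in> carrier A \<Longrightarrow> y \<in> cls x \<Longrightarrow> y \<in> carrier A \<and> cls y = cls x"
proof -
 assume x: "x \<in> carrier A" and y: "y \<in> cls x"
 then obtain i where i: "i \<in> I" "y = i \<oplus> x" by (auto simp: quot_class_def a_r_coset_def')
 have ic: "i \<in> carrier A" using i a_Hcarr by blast
 then have "y \<ominus> x = i" using x i by (simp add: a_minus_def a_assoc r_neg)
 then show ?thesis using cls_eq_iff[of y x] x i ic by auto
qed

lemma cls_self: "x \<in> carrier A \<Longrightarrow> x \<in> cls x"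
 using a_rcos_self by (simp add: quot_class_def)

lemma cls_UN:
 assumes x: "x \<in> carrier A" and f: "\<And>y. y \<in> cls x \<Longrightarrow> f y = f x"
 shows "(\<Union>y\<in>cls x. f y) = f x"
 using cls_self[OF x] f by blast

lemma quot_ops:
 assumes "x \<in> carrier A" "y \<in> carrier A"
 shows "cls x \<oplus>\<^bsub>quot_alg A I\<^esub> cls y = cls (x \<oplus> y)" "cls x \<otimes>\<^bsub>quot_alg A I\<^esub> cls y = cls (x \<otimes> y)"
  "c \<odot>\<^bsub>quot_alg A I\<^esub> cls x = cls (c \<odot> x)"
proof -
 show "cls x \<oplus>\<^bsub>quot_alg A I\<^esub> cls y = cls (x \<oplus> y)"
  using assms a_rcos_sum by (simp add: quot_alg_def ring.defs module.defs FactRing_def quot_class_def)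
 show "cls x \<otimes>\<^bsub>quot_alg A I\<^esub> cls y = cls (x \<otimes> y)"
  using assms rcoset_mult_add by (simp add: quot_alg_def ring.defs module.defs FactRing_def quot_class_def)
 have "c \<odot>\<^bsub>quot_alg A I\<^esub> cls x = (\<Union>y\<in>cls x. cls (c \<odot> y))"
  by (simp add: quot_alg_def ring.defs module.defs)
 also have "\<dots> = cls (c \<odot> x)"
 proof (rule cls_UN[OF assms(1)])
  fix y assume y: "y \<in> cls x"
  then have yc: "y \<in> carrier A" "y \<ominus> x \<in> I" using cls_mem[OF assms(1) y] cls_eq_iff assms by auto
  have "c \<odot> y \<ominus> c \<odot> x = c \<odot> (y \<ominus> x)"
   using yc assms by (simp add: a_minus_def smult_add_right smult_minus_right)
  then show "cls (c \<odot> y) = cls (c \<odot> x)" using cls_eq_iff smult_I[OF yc(2)] yc assms by simp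
 qed
 finally show "c \<odot>\<^bsub>quot_alg A I\<^esub> cls x = cls (c \<odot> x)" .
qed

lemma quot_one: "\<one>\<^bsub>quot_alg A I\<^esub> = cls \<one>"
 by (simp add: quot_alg_def ring.defs module.defs FactRing_def quot_class_def)

lemma quot_zero: "\<zero>\<^bsub>quot_alg A I\<^esub> = cls \<zero>"
 using a_rcos_zero[OF is_ideal zero_closed] additive_subgroup.zero_closed
 by (simp add: quot_alg_def ring.defs module.defs FactRing_def quot_class_def)

lemma quot_ring: "ring (quot_alg A I)"
proof -
 interpret Q: ring "A Quot I" using quotient_is_ring .
 have eqs: "carrier (quot_alg A I) = carrier (A Quot I)" "monoid.mult (quot_alg A I) = monoid.mult (A Quot I)"
  "one (quot_alg A I) = one (A Quot I)" "add (quot_alg A I) = add (A Quot I)" "ring.zero (quot_alg A I) = ring.zero (A Quot I)"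
  by (simp_all add: quot_alg_def ring.defs module.defs)
 show ?thesis
 proof (rule ringI)
  show "abelian_group (quot_alg A I)"
  proof (rule abelian_groupI)
   show "\<exists>y\<in>carrier (quot_alg A I). y \<oplus>\<^bsub>quot_alg A I\<^esub> x = \<zero>\<^bsub>quot_alg A I\<^esub>"
    if "x \<in> carrier (quot_alg A I)" for x
    using that by (intro bexI[of _ "\<ominus>\<^bsub>A Quot I\<^esub> x"]) (auto simp: eqs Q.l_neg)
  qed (auto simp: eqs Q.a_ac)
  show "monoid (quot_alg A I)"
   by (rule monoidI) (auto simp: eqs Q.m_assoc)
 qed (auto simp: eqs Q.l_distr Q.r_distr)
qed

lemma quot_calg: "calg (quot_alg A I)"
proof -
 interpret Q: ring "quot_alg A I" by (rule quot_ring)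
 show ?thesis
  by unfold_locales
   (auto simp: quot_carrier quot_ops smult_add_left smult_add_right smult_smult smult_one
    smult_mult_left smult_mult_right)
qed

lemma quot_minus: "x \<in> carrier A \<Longrightarrow> \<ominus>\<^bsub>quot_alg A I\<^esub> cls x = cls (\<ominus> x)"
proof -
 interpret Q: ring "quot_alg A I" by (rule quot_ring)
 assume x: "x \<in> carrier A"
 show ?thesis
  by (rule Q.minus_equality) (use x in \<open>auto simp: quot_carrier quot_ops quot_zero l_neg\<close>)
qed

lemma quot_diff: "x \<in> carrier A \<Longrightarrow> y \<in> carrier A \<Longrightarrow> cls x \<ominus>\<^bsub>quot_alg A I\<^esub> cls y = cls (x \<ominus> y)"
 by (simp add: a_minus_def quot_minus quot_ops)

lemma quot_finsum:
 assumes "\<And>i. i \<in> J \<Longrightarrow> f i \<in> carrier A"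
 shows "(\<Oplus>\<^bsub>quot_alg A I\<^esub>i\<in>J. cls (f i)) = cls (\<Oplus>i\<in>J. f i)"
proof -
 interpret Q: ring "quot_alg A I" by (rule quot_ring)
 show ?thesis using assms
 proof (induction J rule: infinite_finite_induct)
  case (insert x F)
  have "f \<in> F \<rightarrow> carrier A" "f x \<in> carrier A" "(\<lambda>i. cls (f i)) \<in> F \<rightarrow> carrier (quot_alg A I)"
   using insert.prems by (auto simp: quot_carrier)
  then show ?case using insert by (simp add: Q.finsum_insert quot_carrier quot_ops)
 qed (simp_all add: quot_zero)
qed

end

section \<open>Normal ordering\<close>

text \<open>\<open>\<pi> x w\<close> is the coefficient of \<open>w\<close> in the normally ordered form of \<open>x\<close>, with \<open>xg u\<close> and \<open>yg u\<close> replaced by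
 the linear functions \<open>pr u \<circ> fst\<close> and \<open>pr u \<circ> snd\<close>; its existence is the PBW theorem.\<close>

locale cherednik_like = irred_group scale Bs W + calg H
 for scale :: "complex \<Rightarrow> 'h::ab_group_add \<Rightarrow> 'h" (infixr "*s" 75) and Bs W
  and H :: "(complex, 'a) module" (structure) +
 fixes xg yg :: "'h \<Rightarrow> 'a" and wg :: "('h \<Rightarrow> 'h) \<Rightarrow> 'a"
  and \<gamma> :: "'h dfun"
  and \<pi> :: "'a \<Rightarrow> ('h \<Rightarrow> 'h) \<Rightarrow> 'h pfun"
 assumes xg_closed [simp]: "xg u \<in> carrier H" and yg_closed [simp]: "yg u \<in> carrier H"
  and wg_closed [simp]: "g \<in> W \<Longrightarrow> wg g \<in> carrier H"
  and xg_add: "xg (u + u') = xg u \<oplus> xg u'" and xg_scale: "xg (c *s u) = c \<odot> xg u"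
  and yg_add: "yg (u + u') = yg u \<oplus> yg u'" and yg_scale: "yg (c *s u) = c \<odot> yg u"
  and wg_id: "wg id = \<one>" and wg_comp: "g \<in> W \<Longrightarrow> h \<in> W \<Longrightarrow> wg (g \<circ> h) = wg g \<otimes> wg h"
  and wg_xg: "g \<in> W \<Longrightarrow> wg g \<otimes> xg u = xg (cg g u) \<otimes> wg g"
  and wg_yg: "g \<in> W \<Longrightarrow> wg g \<otimes> yg u = yg (g u) \<otimes> wg g"
  and xg_comm: "xg u \<otimes> xg u' = xg u' \<otimes> xg u" and yg_comm: "yg u \<otimes> yg u' = yg u' \<otimes> yg u"
  and yg_xg: "yg u' \<otimes> xg u = xg u \<otimes> yg u' \<oplus> (\<Oplus>g\<in>W. \<gamma> u' u g \<odot> wg g)"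
  and pi_add: "x \<in> carrier H \<Longrightarrow> x' \<in> carrier H \<Longrightarrow> \<pi> (x \<oplus> x') w p = \<pi> x w p + \<pi> x' w p"
  and pi_smult: "x \<in> carrier H \<Longrightarrow> \<pi> (c \<odot> x) w p = c * \<pi> x w p"
  and pi_wg: "g \<in> W \<Longrightarrow> \<pi> (wg g) w p = (if w = g then 1 else 0)"
  and pi_xg: "x \<in> carrier H \<Longrightarrow> \<pi> (xg u \<otimes> x) w p = pr u (fst p) * \<pi> x w p"
  and pi_yg: "x \<in> carrier H \<Longrightarrow> (\<And>w v v' \<eta>. \<pi> x w (v, \<eta>) = \<pi> x w (v', \<eta>)) \<Longrightarrow>
   \<pi> (yg u \<otimes> x) w p = pr u (snd p) * \<pi> x w p"
begin

lemma xg_zero: "xg 0 = \<zero>"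
 using xg_scale[of 0 0] by simp

lemma yg_zero: "yg 0 = \<zero>"
 using yg_scale[of 0 0] by simp

inductive S :: "'h set \<Rightarrow> 'h set \<Rightarrow> int \<Rightarrow> int \<Rightarrow> 'a \<Rightarrow> 'h sym \<Rightarrow> bool"
 for A1 A2 where
 S_w: "g \<in> W \<Longrightarrow> S A1 A2 0 0 (c \<odot> wg g) (\<lambda>w p. if w = g then c else 0)"
| S_zero: "S A1 A2 k l \<zero> (\<lambda>_ _. 0)"
| S_add: "S A1 A2 k l x P \<Longrightarrow> S A1 A2 k l y Q \<Longrightarrow> S A1 A2 k l (x \<oplus> y) (\<lambda>w p. P w p + Q w p)"
| S_Y: "S A1 A2 0 l x P \<Longrightarrow> u \<in> A2 \<Longrightarrow> S A1 A2 0 (l + 1) (yg u \<otimes> x) (\<lambda>w p. pr u (snd p) * P w p)"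
| S_X: "S A1 A2 k l x P \<Longrightarrow> u \<in> A1 \<Longrightarrow> S A1 A2 (k + 1) l (xg u \<otimes> x) (\<lambda>w p. pr u (fst p) * P w p)"

lemma S_cong: "S A1 A2 k l x P \<Longrightarrow> k = k' \<Longrightarrow> l = l' \<Longrightarrow> x = x' \<Longrightarrow> (\<And>w p. P w p = Q w p) \<Longrightarrow> S A1 A2 k' l' x' Q"
 by (metis ext)

lemma S_closed: "S A1 A2 k l x P \<Longrightarrow> x \<in> carrier H"
 by (induction rule: S.induct) auto

lemma S_Pol: "S A1 A2 k l x P \<Longrightarrow> Pol k l (P w)"
proof (induction rule: S.induct)
 case (S_w g c)
 then show ?case using Pol_const Pol_zero by (cases "w = g") auto
qed (auto intro: Pol.intros)

lemma S_neg: "S A1 A2 k l x P \<Longrightarrow> k < 0 \<or> l < 0 \<Longrightarrow> x = \<zero> \<and> P = (\<lambda>_ _. 0)"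
proof (induction rule: S.induct)
 case (S_Y l x P u)
 then show ?case by (auto simp: fun_eq_iff)
next
 case (S_X k l x P u)
 then show ?case by (auto simp: fun_eq_iff)
qed auto

lemma S_smult: "S A1 A2 k l x P \<Longrightarrow> S A1 A2 k l (c \<odot> x) (\<lambda>w p. c * P w p)"
proof (induction rule: S.induct)
 case (S_w g d)
 show ?case by (rule S_cong[OF S.S_w[OF S_w, of A1 A2 "c * d"]]) (use S_w in \<open>auto simp: smult_smult\<close>)
next
 case (S_zero k l)
 show ?case by (rule S_cong[OF S.S_zero]) auto
next
 case (S_add k l x P y Q)
 show ?case by (rule S_cong[OF S.S_add[OF S_add.IH]])
   (use S_closed S_add.hyps in \<open>auto simp: smult_add_right distrib_left\<close>)
next
 case (S_Y l x P u)
 show ?case by (rule S_cong[OF S.S_Y[OF S_Y.IH S_Y.hyps(2)]])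
   (use S_closed[OF S_Y.hyps(1)] in \<open>auto simp: smult_mult_right\<close>)
next
 case (S_X k l x P u)
 show ?case by (rule S_cong[OF S.S_X[OF S_X.IH S_X.hyps(2)]])
   (use S_closed[OF S_X.hyps(1)] in \<open>auto simp: smult_mult_right\<close>)
qed

lemma S_X_all:
 assumes x: "S Bs A2 k l x P" shows "S Bs A2 (k + 1) l (xg u \<otimes> x) (\<lambda>w p. pr u (fst p) * P w p)"
proof -
 have xc: "x \<in> carrier H" using S_closed[OF x] .
 have "u \<in> span Bs" by simp
 then show ?thesis
 proof (induction rule: span_induct_alt)
  case base
  show ?case by (rule S_cong[OF S.S_zero]) (use xc in \<open>auto simp: xg_zero\<close>)
 next
  case (step c b u)
  show ?case
   by (rule S_cong[OF S_add[OF S_smult[OF S_X[OF x step(1)], of c] step(2)]])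
    (use xc in \<open>auto simp: xg_add xg_scale l_distr smult_mult_left pr_simps algebra_simps a_comm\<close>)
 qed
qed

lemma S_Y_all:
 assumes x: "S A1 Bs 0 l x P" shows "S A1 Bs 0 (l + 1) (yg u \<otimes> x) (\<lambda>w p. pr u (snd p) * P w p)"
proof -
 have xc: "x \<in> carrier H" using S_closed[OF x] .
 have "u \<in> span Bs" by simp
 then show ?thesis
 proof (induction rule: span_induct_alt)
  case base
  show ?case by (rule S_cong[OF S.S_zero]) (use xc in \<open>auto simp: yg_zero\<close>)
 next
  case (step c b u)
  show ?case
   by (rule S_cong[OF S_add[OF S_smult[OF S_Y[OF x step(1)], of c] step(2)]])
    (use xc in \<open>auto simp: yg_add yg_scale l_distr smult_mult_left pr_simps algebra_simps a_comm\<close>)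
 qed
qed

lemma xg_lcomm: "x \<in> carrier H \<Longrightarrow> xg u \<otimes> (xg u' \<otimes> x) = xg u' \<otimes> (xg u \<otimes> x)"
 using xg_comm[of u u'] m_assoc[of "xg u" "xg u'" x] m_assoc[of "xg u'" "xg u" x] by simp

lemma yg_lcomm: "x \<in> carrier H \<Longrightarrow> yg u \<otimes> (yg u' \<otimes> x) = yg u' \<otimes> (yg u \<otimes> x)"
 using yg_comm[of u u'] m_assoc[of "yg u" "yg u'" x] m_assoc[of "yg u'" "yg u" x] by simp

text \<open>Commuting the letter \<open>b\<close> to the front separates the words that contain it
  from those that do not, both for the element and for its function.\<close>

lemma S_split_x: "S (insert b A1) A2 k l x P \<Longrightarrow> \<exists>x' P' x'' P''. x = xg b \<otimes> x' \<oplus> x'' \<and>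
  (\<forall>w p. P w p = pr b (fst p) * P' w p + P'' w p) \<and> S (insert b A1) A2 (k - 1) l x' P' \<and> S A1 A2 k l x'' P''"
proof (induction rule: S.induct)
 case (S_w g c)
 show ?case
  by (rule exI[of _ \<zero>], rule exI[of _ "\<lambda>_ _. 0"], rule exI[of _ "c \<odot> wg g"],
    rule exI[of _ "\<lambda>w p. if w = g then c else 0"]) (use S_w in \<open>auto intro: S.intros\<close>)
next
 case (S_zero k l)
 show ?case
  by (rule exI[of _ \<zero>], rule exI[of _ "\<lambda>_ _. 0"], rule exI[of _ \<zero>], rule exI[of _ "\<lambda>_ _. 0"])
   (auto intro: S.intros)
next
 case (S_add k l x P y Q)
 obtain x' P' x'' P'' where 1: "x = xg b \<otimes> x' \<oplus> x''" "\<And>w p. P w p = pr b (fst p) * P' w p + P'' w p"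
  "S (insert b A1) A2 (k - 1) l x' P'" "S A1 A2 k l x'' P''" using S_add.IH(1) by blast
 obtain y' Q' y'' Q'' where 2: "y = xg b \<otimes> y' \<oplus> y''" "\<And>w p. Q w p = pr b (fst p) * Q' w p + Q'' w p"
  "S (insert b A1) A2 (k - 1) l y' Q'" "S A1 A2 k l y'' Q''" using S_add.IH(2) by blast
 have c: "x' \<in> carrier H" "x'' \<in> carrier H" "y' \<in> carrier H" "y'' \<in> carrier H" using 1 2 S_closed by blast+
 show ?case
  apply (rule exI[of _ "x' \<oplus> y'"], rule exI[of _ "\<lambda>w p. P' w p + Q' w p"], rule exI[of _ "x'' \<oplus> y''"],
    rule exI[of _ "\<lambda>w p. P'' w p + Q'' w p"])
  using S.S_add[OF 1(3) 2(3)] S.S_add[OF 1(4) 2(4)] c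
  by (simp add: 1(1,2) 2(1,2) r_distr a_ac algebra_simps)
next
 case (S_Y l x P u)
 obtain x' P' x'' P'' where 1: "x = xg b \<otimes> x' \<oplus> x''" "\<And>w p. P w p = pr b (fst p) * P' w p + P'' w p"
  "S (insert b A1) A2 (0 - 1) l x' P'" "S A1 A2 0 l x'' P''" using S_Y.IH by blast
 have z: "x' = \<zero>" "P' = (\<lambda>_ _. 0)" using S_neg[OF 1(3)] by auto
 have c: "x'' \<in> carrier H" using 1 S_closed by blast
 show ?case
  apply (rule exI[of _ \<zero>], rule exI[of _ "\<lambda>_ _. 0"], rule exI[of _ "yg u \<otimes> x''"],
    rule exI[of _ "\<lambda>w p. pr u (snd p) * P'' w p"])
  using S.S_Y[OF 1(4) S_Y.hyps(2)] c S.S_zero by (simp add: 1(1,2) z)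
next
 case (S_X k l x P u)
 have xc: "x \<in> carrier H" using S_closed[OF S_X.hyps(1)] .
 show ?case
 proof (cases "u = b")
  case True
  have "S (insert b A1) A2 (k + 1 - 1) l x P" using S_X.hyps(1) by simp
  then show ?thesis using True xc
   by - (rule exI[of _ x], rule exI[of _ P], rule exI[of _ \<zero>], rule exI[of _ "\<lambda>_ _. 0"], auto intro: S.intros)
 next
  case False
  then have u: "u \<in> A1" using S_X.hyps(2) by simp
  obtain x' P' x'' P'' where 1: "x = xg b \<otimes> x' \<oplus> x''" "\<And>w p. P w p = pr b (fst p) * P' w p + P'' w p"
   "S (insert b A1) A2 (k - 1) l x' P'" "S A1 A2 k l x'' P''" using S_X.IH by blast
  have c: "x' \<in> carrier H" "x'' \<in> carrier H" using 1 S_closed by blast+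
  have 2: "S (insert b A1) A2 (k + 1 - 1) l (xg u \<otimes> x') (\<lambda>w p. pr u (fst p) * P' w p)"
   by (rule S_cong[OF S.S_X[OF 1(3) S_X.hyps(2)]]) auto
  show ?thesis
   apply (rule exI[of _ "xg u \<otimes> x'"], rule exI[of _ "\<lambda>w p. pr u (fst p) * P' w p"], rule exI[of _ "xg u \<otimes> x''"],
     rule exI[of _ "\<lambda>w p. pr u (fst p) * P'' w p"])
   using 2 S.S_X[OF 1(4) u] c by (simp add: 1(1,2) r_distr xg_lcomm[of x' u b] algebra_simps)
 qed
qed

lemma S_split_y: "S {} (insert b A2) k l x P \<Longrightarrow> \<exists>x' P' x'' P''. x = yg b \<otimes> x' \<oplus> x'' \<and>
  (\<forall>w p. P w p = pr b (snd p) * P' w p + P'' w p) \<and> S {} (insert b A2) k (l - 1) x' P' \<and> S {} A2 k l x'' P''"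
proof (induction rule: S.induct)
 case (S_w g c)
 show ?case
  by (rule exI[of _ \<zero>], rule exI[of _ "\<lambda>_ _. 0"], rule exI[of _ "c \<odot> wg g"],
    rule exI[of _ "\<lambda>w p. if w = g then c else 0"]) (use S_w in \<open>auto intro: S.intros\<close>)
next
 case (S_zero k l)
 show ?case
  by (rule exI[of _ \<zero>], rule exI[of _ "\<lambda>_ _. 0"], rule exI[of _ \<zero>], rule exI[of _ "\<lambda>_ _. 0"])
   (auto intro: S.intros)
next
 case (S_add k l x P y Q)
 obtain x' P' x'' P'' where 1: "x = yg b \<otimes> x' \<oplus> x''" "\<And>w p. P w p = pr b (snd p) * P' w p + P'' w p"
  "S {} (insert b A2) k (l - 1) x' P'" "S {} A2 k l x'' P''" using S_add.IH(1) by blast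
 obtain y' Q' y'' Q'' where 2: "y = yg b \<otimes> y' \<oplus> y''" "\<And>w p. Q w p = pr b (snd p) * Q' w p + Q'' w p"
  "S {} (insert b A2) k (l - 1) y' Q'" "S {} A2 k l y'' Q''" using S_add.IH(2) by blast
 have c: "x' \<in> carrier H" "x'' \<in> carrier H" "y' \<in> carrier H" "y'' \<in> carrier H" using 1 2 S_closed by blast+
 show ?case
  apply (rule exI[of _ "x' \<oplus> y'"], rule exI[of _ "\<lambda>w p. P' w p + Q' w p"], rule exI[of _ "x'' \<oplus> y''"],
    rule exI[of _ "\<lambda>w p. P'' w p + Q'' w p"])
  using S.S_add[OF 1(3) 2(3)] S.S_add[OF 1(4) 2(4)] c
  by (simp add: 1(1,2) 2(1,2) r_distr a_ac algebra_simps)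
next
 case (S_Y l x P u)
 have xc: "x \<in> carrier H" using S_closed[OF S_Y.hyps(1)] .
 show ?case
 proof (cases "u = b")
  case True
  have "S {} (insert b A2) 0 (l + 1 - 1) x P" using S_Y.hyps(1) by simp
  then show ?thesis using True xc
   by - (rule exI[of _ x], rule exI[of _ P], rule exI[of _ \<zero>], rule exI[of _ "\<lambda>_ _. 0"], auto intro: S.intros)
 next
  case False
  then have u: "u \<in> A2" using S_Y.hyps(2) by simp
  obtain x' P' x'' P'' where 1: "x = yg b \<otimes> x' \<oplus> x''" "\<And>w p. P w p = pr b (snd p) * P' w p + P'' w p"
   "S {} (insert b A2) 0 (l - 1) x' P'" "S {} A2 0 l x'' P''" using S_Y.IH by blast
  have c: "x' \<in> carrier H" "x'' \<in> carrier H" using 1 S_closed by blast+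
  have 2: "S {} (insert b A2) 0 (l + 1 - 1) (yg u \<otimes> x') (\<lambda>w p. pr u (snd p) * P' w p)"
   by (rule S_cong[OF S.S_Y[OF 1(3) S_Y.hyps(2)]]) auto
  show ?thesis
   apply (rule exI[of _ "yg u \<otimes> x'"], rule exI[of _ "\<lambda>w p. pr u (snd p) * P' w p"], rule exI[of _ "yg u \<otimes> x''"],
     rule exI[of _ "\<lambda>w p. pr u (snd p) * P'' w p"])
   using 2 S.S_Y[OF 1(4) u] c by (simp add: 1(1,2) r_distr yg_lcomm[of x' u b] algebra_simps)
 qed
qed auto

lemma S_indep_x: "S A1 A2 k l x P \<Longrightarrow> A1 \<subseteq> Bs - {b} \<Longrightarrow> b \<in> Bs \<Longrightarrow> P w (v - c *s b, \<eta>) = P w (v, \<eta>)"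
proof (induction rule: S.induct)
 case (S_X k l x P u)
 then have "u \<in> Bs" "u \<noteq> b" by auto
 then have "pr u b = 0" using pr_Bs[of u b] S_X.prems by simp
 then show ?case using S_X by (simp add: pr_simps)
qed auto

lemma S_indep_y: "S A1 A2 k l x P \<Longrightarrow> A2 \<subseteq> Bs - {b} \<Longrightarrow> b \<in> Bs \<Longrightarrow> P w (v, \<eta> - c *s b) = P w (v, \<eta>)"
proof (induction rule: S.induct)
 case (S_Y l x P u)
 then have "u \<in> Bs" "u \<noteq> b" by auto
 then have "pr u b = 0" using pr_Bs[of u b] S_Y.prems by simp
 then show ?case using S_Y by (simp add: pr_simps)
qed auto

lemma S_const: "S {} {} k l x P \<Longrightarrow> x = (\<Oplus>g\<in>W. P g p \<odot> wg g)"
proof (induction rule: S.induct)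
 case (S_w g c)
 have "(\<Oplus>h\<in>W. (if h = g then c else 0) \<odot> wg h) = (if g = g then c else 0) \<odot> wg g"
  by (rule finsum_single) (use finite_W S_w in auto)
 then show ?case by simp
next
 case (S_zero k l)
 have "(\<Oplus>g\<in>W. 0 \<odot> wg g) = (\<Oplus>g\<in>W. \<zero>)" by (rule finsum_cong') auto
 then show ?case by simp
next
 case (S_add k l x P y Q)
 have "(\<Oplus>g\<in>W. (P g p + Q g p) \<odot> wg g) = (\<Oplus>g\<in>W. P g p \<odot> wg g \<oplus> Q g p \<odot> wg g)"
  by (rule finsum_cong') (auto simp: smult_add_left)
 also have "\<dots> = (\<Oplus>g\<in>W. P g p \<odot> wg g) \<oplus> (\<Oplus>g\<in>W. Q g p \<odot> wg g)"
  by (rule finsum_addf) auto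
 finally show ?case using S_add.IH by simp
qed auto

text \<open>The function determines the element because coordinates are algebraically independent:
  setting one coordinate to zero isolates the words without that letter, and in the others the
  letter is cancelled. The y are treated while no x is present, where they can be moved to the
  front.\<close>

lemma S_inj_y:
 assumes "finite A2" "A2 \<subseteq> Bs" "S {} A2 k l x P" "\<And>w p. P w p = 0"
 shows "x = \<zero>"
 using assms
proof (induction A2 arbitrary: k l x P rule: finite_induct)
 case empty
 have "x = (\<Oplus>g\<in>W. P g undefined \<odot> wg g)" by (rule S_const[OF empty.prems(2)])
 also have "\<dots> = (\<Oplus>g\<in>W. \<zero>)" by (rule finsum_cong') (auto simp: empty.prems(3))
 finally show ?case by simp
next
 case (insert b A2)
 have b: "b \<in> Bs" "A2 \<subseteq> Bs - {b}" using insert by auto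
 have "l < int n \<Longrightarrow> S {} (insert b A2) k l x P \<Longrightarrow> (\<And>w p. P w p = 0) \<Longrightarrow> x = \<zero>" for n k l x P
 proof (induction n arbitrary: k l x P)
  case 0
  then show ?case using S_neg by auto
 next
  case (Suc n)
  obtain x' P' x'' P'' where 1: "x = yg b \<otimes> x' \<oplus> x''" "\<And>w p. P w p = pr b (snd p) * P' w p + P'' w p"
   "S {} (insert b A2) k (l - 1) x' P'" "S {} A2 k l x'' P''" using S_split_y[OF Suc.prems(2)] by blast
  \<comment> \<open>The projection removes the coordinate of \<open>b\<close>, on which
    \<open>P''\<close> does not depend.\<close>
  have P'': "P'' w p = 0" for w p
  proof -
   have "P'' w p = P'' w (fst p, snd p - pr b (snd p) *s b)" using S_indep_y[OF 1(4) b(2,1)] by simp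
   also have "\<dots> = 0" using Suc.prems(3)[of w "(fst p, snd p - pr b (snd p) *s b)"] b(1)
    by (simp add: 1(2) pr_simps pr_Bs)
   finally show ?thesis .
  qed
  have "P' w p = 0" for w p
   by (rule Pol_cancel[OF S_Pol[OF 1(3)] Pol_y1[of b], where ?p0.0 = "(0, b)"])
    (use Suc.prems(3) P'' 1(2) b(1) in \<open>auto simp: pr_Bs\<close>)
  then have "x' = \<zero>" using Suc.IH[OF _ 1(3)] Suc.prems(1) by simp
  moreover have "x'' = \<zero>" using insert.IH[OF _ 1(4) P''] insert.prems(1) by simp
  ultimately show ?case using 1(1) by simp
 qed
 from this[of l "nat (l + 1)", OF _ insert.prems(2,3)] show ?case by simp
qed

text \<open>The same elimination for the x-letters, with \<open>S_inj_y\<close> once they are used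
  up.\<close>

lemma S_inj:
 assumes "finite A1" "A1 \<subseteq> Bs" "S A1 Bs k l x P" "\<And>w p. P w p = 0"
 shows "x = \<zero>"
 using assms
proof (induction A1 arbitrary: k l x P rule: finite_induct)
 case empty
 then show ?case using S_inj_y[OF finite_Basis order.refl] by blast
next
 case (insert b A1)
 have b: "b \<in> Bs" "A1 \<subseteq> Bs - {b}" using insert by auto
 have "k < int n \<Longrightarrow> S (insert b A1) Bs k l x P \<Longrightarrow> (\<And>w p. P w p = 0) \<Longrightarrow> x = \<zero>" for n k l x P
 proof (induction n arbitrary: k l x P)
  case 0
  then show ?case using S_neg by auto
 next
  case (Suc n)
  obtain x' P' x'' P'' where 1: "x = xg b \<otimes> x' \<oplus> x''" "\<And>w p. P w p = pr b (fst p) * P' w p + P'' w p"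
   "S (insert b A1) Bs (k - 1) l x' P'" "S A1 Bs k l x'' P''" using S_split_x[OF Suc.prems(2)] by blast
  have P'': "P'' w p = 0" for w p
  proof -
   have "P'' w p = P'' w (fst p - pr b (fst p) *s b, snd p)" using S_indep_x[OF 1(4) b(2,1)] by simp
   also have "\<dots> = 0" using Suc.prems(3)[of w "(fst p - pr b (fst p) *s b, snd p)"] b(1)
    by (simp add: 1(2) pr_simps pr_Bs)
   finally show ?thesis .
  qed
  have "P' w p = 0" for w p
   by (rule Pol_cancel[OF S_Pol[OF 1(3)] Pol_x1[of b], where ?p0.0 = "(b, 0)"])
    (use Suc.prems(3) P'' 1(2) b(1) in \<open>auto simp: pr_Bs\<close>)
  then have "x' = \<zero>" using Suc.IH[OF _ 1(3)] Suc.prems(1) by simp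
  moreover have "x'' = \<zero>" using insert.IH[OF _ 1(4) P''] insert.prems(1) by simp
  ultimately show ?case using 1(1) by simp
 qed
 from this[of k "nat (k + 1)", OF _ insert.prems(2,3)] show ?case by simp
qed

lemma translate_eq_iff: "g \<in> W \<Longrightarrow> invf g \<circ> w = g' \<longleftrightarrow> w = g \<circ> g'"
 by (metis comp_assoc comp_id inv_comp(1) inv_comp(2) id_comp)

lemma S_W:
 assumes g: "g \<in> W"
 shows "S Bs Bs k l x P \<Longrightarrow> S Bs Bs k l (wg g \<otimes> x) (\<lambda>w p. P (invf g \<circ> w) (act (invf g) p))"
proof (induction rule: S.induct)
 case (S_w g' c)
 show ?case
  by (rule S_cong[OF S.S_w[of "g \<circ> g'" Bs Bs c]])
   (use S_w g in \<open>auto simp: wg_comp smult_mult_right translate_eq_iff\<close>)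
next
 case (S_zero k l)
 show ?case by (rule S_cong[OF S.S_zero]) (use g in auto)
next
 case (S_add k l x P y Q)
 show ?case by (rule S_cong[OF S.S_add[OF S_add.IH]])
   (use S_closed S_add.hyps g in \<open>auto simp: r_distr\<close>)
next
 case (S_Y l x P u)
 have "wg g \<otimes> (yg u \<otimes> x) = yg (g u) \<otimes> (wg g \<otimes> x)"
  using S_closed[OF S_Y.hyps(1)] g wg_yg[OF g, of u] by (simp add: m_assoc[symmetric])
 then show ?case
  by (intro S_cong[OF S_Y_all[OF S_Y.IH, of "g u"]]) (use g in \<open>auto simp: act_def pr_cg_right\<close>)
next
 case (S_X k l x P u)
 have "wg g \<otimes> (xg u \<otimes> x) = xg (cg g u) \<otimes> (wg g \<otimes> x)"
  using S_closed[OF S_X.hyps(1)] g wg_xg[OF g, of u] by (simp add: m_assoc[symmetric])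
 then show ?case
  by (intro S_cong[OF S_X_all[OF S_X.IH, of "cg g u"]]) (use g in \<open>auto simp: act_def pr_cg\<close>)
qed

text \<open>\<open>S\<close> describes normally ordered words, \<open>R\<close> the same modulo words with fewer \<open>x\<close> and fewer \<open>y\<close>.\<close>

inductive R :: "int \<Rightarrow> int \<Rightarrow> 'a \<Rightarrow> 'h sym \<Rightarrow> bool" where
 R_S: "S Bs Bs k l x P \<Longrightarrow> R k l x P"
| R_low: "R k l x P \<Longrightarrow> R (k + 1) (l + 1) x (\<lambda>_ _. 0)"
| R_add: "R k l x P \<Longrightarrow> R k l y Q \<Longrightarrow> R k l (x \<oplus> y) (\<lambda>w p. P w p + Q w p)"

lemma R_cong: "R k l x P \<Longrightarrow> k = k' \<Longrightarrow> l = l' \<Longrightarrow> x = x' \<Longrightarrow> (\<And>w p. P w p = Q w p) \<Longrightarrow> R k' l' x' Q"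
 by (metis ext)

lemma R_closed: "R k l x P \<Longrightarrow> x \<in> carrier H"
 by (induction rule: R.induct) (auto dest: S_closed)

lemma R_Pol: "R k l x P \<Longrightarrow> Pol k l (P w)"
 by (induction rule: R.induct) (auto dest: S_Pol intro: Pol.intros)

lemma R_zero: "R k l \<zero> (\<lambda>_ _. 0)"
 by (rule R_S[OF S_zero])

lemma R_neg: "R k l x P \<Longrightarrow> k < 0 \<or> l < 0 \<Longrightarrow> x = \<zero> \<and> P = (\<lambda>_ _. 0)"
proof (induction rule: R.induct)
 case (R_S k l x P)
 then show ?case by (rule S_neg)
qed auto

lemma R_smult: "R k l x P \<Longrightarrow> R k l (c \<odot> x) (\<lambda>w p. c * P w p)"
proof (induction rule: R.induct)
 case (R_S k l x P)
 then show ?case by (intro R.R_S S_smult)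
next
 case (R_low k l x P)
 show ?case by (rule R_cong[OF R.R_low[OF R_low.IH]]) auto
next
 case (R_add k l x P y Q)
 show ?case by (rule R_cong[OF R.R_add[OF R_add.IH]])
   (use R_closed R_add.hyps in \<open>auto simp: smult_add_right distrib_left\<close>)
qed

lemma R_minus: "R k l x P \<Longrightarrow> R k l (\<ominus> x) (\<lambda>w p. - P w p)"
 using R_smult[of k l x P "-1"] R_closed[of k l x P] by (simp add: smult_minus_one)

lemma R_diff: "R k l x P \<Longrightarrow> R k l y Q \<Longrightarrow> R k l (x \<ominus> y) (\<lambda>w p. P w p - Q w p)"
 using R_add[OF _ R_minus, of k l x P y Q] by (simp add: a_minus_def)

lemma R_finsum:
 assumes "finite I" "\<And>i. i \<in> I \<Longrightarrow> R k l (f i) (P i)"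
 shows "R k l (\<Oplus>i\<in>I. f i) (\<lambda>w p. \<Sum>i\<in>I. P i w p)"
 using assms
proof (induction I rule: finite_induct)
 case empty
 then show ?case using R_zero by simp
next
 case (insert i I)
 have "f j \<in> carrier H" if "j \<in> insert i I" for j by (rule R_closed[OF insert.prems[OF that]])
 then have "(\<Oplus>i\<in>insert i I. f i) = f i \<oplus> (\<Oplus>i\<in>I. f i)"
  using insert.hyps by (intro finsum_insert) auto
 then show ?case using R_add[of k l "f i" "P i"] insert by simp
qed

lemma R_X: "R k l x P \<Longrightarrow> R (k + 1) l (xg u \<otimes> x) (\<lambda>w p. pr u (fst p) * P w p)"
proof (induction rule: R.induct)
 case (R_S k l x P)
 then show ?case by (intro R.R_S S_X_all)
next
 case (R_low k l x P)
 show ?case by (rule R_cong[OF R.R_low[OF R_low.IH]]) auto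
next
 case (R_add k l x P y Q)
 show ?case by (rule R_cong[OF R.R_add[OF R_add.IH]])
   (use R_closed R_add.hyps in \<open>auto simp: r_distr distrib_left\<close>)
qed

lemma R_W:
 assumes g: "g \<in> W"
 shows "R k l x P \<Longrightarrow> R k l (wg g \<otimes> x) (\<lambda>w p. P (invf g \<circ> w) (act (invf g) p))"
proof (induction rule: R.induct)
 case (R_S k l x P)
 then show ?case by (intro R.R_S S_W g)
next
 case (R_low k l x P)
 show ?case by (rule R_cong[OF R.R_low[OF R_low.IH]]) auto
next
 case (R_add k l x P y Q)
 show ?case by (rule R_cong[OF R.R_add[OF R_add.IH]])
   (use R_closed R_add.hyps g in \<open>auto simp: r_distr\<close>)
qed

lemma R_wsum:
 assumes x: "R k l x P" shows "\<exists>Q. R k l ((\<Oplus>g\<in>W. a g \<odot> wg g) \<otimes> x) Q"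
proof -
 have xc: "x \<in> carrier H" using R_closed[OF x] .
 have "(\<Oplus>g\<in>W. a g \<odot> wg g) \<otimes> x = (\<Oplus>g\<in>W. (a g \<odot> wg g) \<otimes> x)"
  using finite_W xc by (intro finsum_ldistr) auto
 also have "\<dots> = (\<Oplus>g\<in>W. a g \<odot> (wg g \<otimes> x))"
  using xc by (intro finsum_cong') (auto simp: smult_mult_left)
 finally show ?thesis using R_finsum[OF finite_W R_smult[OF R_W[OF _ x]], of "\<lambda>g. g" a] by auto
qed

text \<open>Each exchange of y and x produces a correction in the group algebra that removes one x
  and one y at once. The filtration lowers both degrees together, so it absorbs these terms.\<close>

lemma R_Y_S: "S Bs Bs k l x P \<Longrightarrow> R k (l + 1) (yg u \<otimes> x) (\<lambda>w p. pr u (snd p) * P w p)"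
proof (induction rule: S.induct)
 case (S_w g c)
 show ?case by (rule R_cong[OF R_S[OF S_Y_all[OF S.S_w[OF S_w]]]]) auto
next
 case (S_zero k l)
 show ?case by (rule R_cong[OF R_zero]) auto
next
 case (S_add k l x P y Q)
 show ?case by (rule R_cong[OF R.R_add[OF S_add.IH]])
   (use S_closed S_add.hyps in \<open>auto simp: r_distr distrib_left\<close>)
next
 case (S_Y l x P u')
 show ?case by (rule R_S[OF S_Y_all[OF S.S_Y[OF S_Y.hyps]]])
next
 case (S_X k l x P u')
 let ?C = "\<Oplus>g\<in>W. \<gamma> u u' g \<odot> wg g"
 have xc: "x \<in> carrier H" using S_closed[OF S_X.hyps(1)] .
 have Cc: "?C \<in> carrier H" by (rule finsum_closed) auto
 obtain Q where Q: "R k l (?C \<otimes> x) Q" using R_wsum[OF R_S[OF S_X.hyps(1)]] by blast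
 have "yg u \<otimes> (xg u' \<otimes> x) = (yg u \<otimes> xg u') \<otimes> x" using xc by (simp add: m_assoc)
 also have "\<dots> = xg u' \<otimes> (yg u \<otimes> x) \<oplus> ?C \<otimes> x"
  unfolding yg_xg using xc Cc by (simp add: l_distr m_assoc)
 finally have eq: "xg u' \<otimes> (yg u \<otimes> x) \<oplus> ?C \<otimes> x = yg u \<otimes> (xg u' \<otimes> x)" ..
 show ?case
  by (rule R_cong[OF R_add[OF R_X[OF S_X.IH] R_low[OF Q]] _ _ eq]) auto
qed

lemma R_Y: "R k l x P \<Longrightarrow> R k (l + 1) (yg u \<otimes> x) (\<lambda>w p. pr u (snd p) * P w p)"
proof (induction rule: R.induct)
 case (R_S k l x P)
 then show ?case by (rule R_Y_S)
next
 case (R_low k l x P)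
 show ?case by (rule R_cong[OF R.R_low[OF R_low.IH]]) auto
next
 case (R_add k l x P y Q)
 show ?case by (rule R_cong[OF R.R_add[OF R_add.IH]])
   (use R_closed R_add.hyps in \<open>auto simp: r_distr distrib_left\<close>)
qed

lemma R_mult_S:
 assumes y: "R k' l' y Q"
 shows "S Bs Bs k l x P \<Longrightarrow> R (k + k') (l + l') (x \<otimes> y) (tmul P Q)"
proof (induction rule: S.induct)
 case (S_w g c)
 have "tmul (\<lambda>w p. if w = g then c else 0) Q u p = c * Q (invf g \<circ> u) (act (invf g) p)" for u p
 proof -
  have "tmul (\<lambda>w p. if w = g then c else 0) Q u p =
    (\<Sum>v\<in>W. if v = g then c * Q (invf g \<circ> u) (act (invf g) p) else 0)"
   unfolding tmul_def by (rule sum.cong) auto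
  then show ?thesis using finite_W S_w by simp
 qed
 then show ?case
  by (intro R_cong[OF R_smult[OF R_W[OF S_w y], of c]]) (use S_w R_closed[OF y] in \<open>auto simp: smult_mult_left\<close>)
next
 case (S_zero k l)
 show ?case by (rule R_cong[OF R_zero]) (use R_closed[OF y] in \<open>auto simp: tmul_def\<close>)
next
 case (S_add k l x P z P')
 show ?case by (rule R_cong[OF R.R_add[OF S_add.IH]])
   (use S_closed S_add.hyps R_closed[OF y] in \<open>auto simp: l_distr tmul_def distrib_right sum.distrib\<close>)
next
 case (S_Y l x P u)
 show ?case by (rule R_cong[OF R_Y[OF S_Y.IH, of u]])
   (use S_closed[OF S_Y.hyps(1)] R_closed[OF y] in \<open>auto simp: m_assoc tmul_def sum_distrib_left mult.assoc\<close>)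
next
 case (S_X k l x P u)
 show ?case by (rule R_cong[OF R_X[OF S_X.IH, of u]])
   (use S_closed[OF S_X.hyps(1)] R_closed[OF y] in \<open>auto simp: m_assoc tmul_def sum_distrib_left mult.assoc\<close>)
qed

lemma R_mult:
 assumes y: "R k' l' y Q"
 shows "R k l x P \<Longrightarrow> R (k + k') (l + l') (x \<otimes> y) (tmul P Q)"
proof (induction rule: R.induct)
 case (R_S k l x P)
 then show ?case by (rule R_mult_S[OF y])
next
 case (R_low k l x P)
 show ?case by (rule R_cong[OF R.R_low[OF R_low.IH]]) (auto simp: tmul_def)
next
 case (R_add k l x P z P')
 show ?case by (rule R_cong[OF R.R_add[OF R_add.IH]])
   (use R_closed R_add.hyps R_closed[OF y] in \<open>auto simp: l_distr tmul_def distrib_right sum.distrib\<close>)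
qed

text \<open>Separates the top part, which is normally ordered, from the part of lower bidegree, so
  that injectivity can be applied to the former.\<close>

lemma R_split: "R k l x P \<Longrightarrow> \<exists>x0 x1 Q. x = x0 \<oplus> x1 \<and> S Bs Bs k l x0 P \<and> R (k - 1) (l - 1) x1 Q"
proof (induction rule: R.induct)
 case (R_S k l x P)
 then show ?case using S_closed[OF R_S] R_zero by (intro exI[of _ x] exI[of _ \<zero>]) auto
next
 case (R_low k l x P)
 have "R (k + 1 - 1) (l + 1 - 1) x P" using R_low.hyps by simp
 then show ?case using R_closed[OF R_low.hyps] S_zero[of Bs Bs "k + 1" "l + 1"]
  by - (rule exI[of _ \<zero>], rule exI[of _ x], auto)
next
 case (R_add k l x P y Q)
 obtain x0 x1 P1 where 1: "x = x0 \<oplus> x1" "S Bs Bs k l x0 P" "R (k - 1) (l - 1) x1 P1" using R_add.IH(1) by blast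
 obtain y0 y1 Q1 where 2: "y = y0 \<oplus> y1" "S Bs Bs k l y0 Q" "R (k - 1) (l - 1) y1 Q1" using R_add.IH(2) by blast
 have "x0 \<in> carrier H" "x1 \<in> carrier H" "y0 \<in> carrier H" "y1 \<in> carrier H"
  using 1 2 S_closed R_closed by blast+
 then have "x \<oplus> y = (x0 \<oplus> y0) \<oplus> (x1 \<oplus> y1)" by (simp add: 1(1) 2(1) a_ac)
 then show ?case using S_add[OF 1(2) 2(2)] R.R_add[OF 1(3) 2(3)] by blast
qed

lemma R_kernel:
 assumes "R k l x P" "\<And>w p. P w p = 0" shows "\<exists>Q. R (k - 1) (l - 1) x Q"
proof -
 obtain x0 x1 Q where 1: "x = x0 \<oplus> x1" "S Bs Bs k l x0 P" "R (k - 1) (l - 1) x1 Q" using R_split[OF assms(1)] by blast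
 have "x0 = \<zero>" using S_inj[OF finite_Basis order.refl 1(2) assms(2)] .
 then show ?thesis using 1 R_closed[OF 1(3)] by auto
qed

lemma pi_zero: "\<pi> \<zero> w p = 0"
 using pi_smult[of \<zero> 0] by simp

lemma S_pi: "S Bs Bs k l x P \<Longrightarrow> \<pi> x w p = P w p"
proof (induction arbitrary: w p rule: S.induct)
 case (S_w g c)
 then show ?case by (simp add: pi_smult pi_wg)
next
 case (S_zero k l)
 show ?case by (rule pi_zero)
next
 case (S_add k l x P y Q)
 then show ?case using S_closed by (simp add: pi_add)
next
 case (S_Y l x P u)
 \<comment> \<open>Bidegree \<open>(0, l)\<close> makes the function independent of
   \<open>v\<close>, which is what the rule for y under \<open>\<pi>\<close> demands.\<close>
 have "P w (v, \<eta>) = P w (v', \<eta>)" for w v v' \<eta>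
  using Pol_hom[OF S_Pol[OF S_Y.hyps(1), of w], of 0 v 1 \<eta>] Pol_hom[OF S_Pol[OF S_Y.hyps(1), of w], of 0 v' 1 \<eta>]
  by simp
 then show ?case using pi_yg[OF S_closed[OF S_Y.hyps(1)]] S_Y.IH by simp
next
 case (S_X k l x P u)
 then show ?case using pi_xg[OF S_closed[OF S_X.hyps(1)]] by simp
qed

text \<open>Scaling \<open>v\<close> by \<open>T\<close> reads off the x-degree. As the corrections
  have smaller x-degree too, the symbol is the coefficient of T^k in \<open>\<pi>\<close>, which is
  a function of the element alone.\<close>

lemma R_leading: "R k l x P \<Longrightarrow>
 \<exists>r. (\<forall>T. \<pi> x w (T *s v, \<eta>) = T ^ nat k * P w (v, \<eta>) + poly r T) \<and> (r = 0 \<or> int (degree r) < k)"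
proof (induction rule: R.induct)
 case (R_S k l x P)
 have "\<pi> x w (T *s v, \<eta>) = T ^ nat k * P w (v, \<eta>)" for T
  using Pol_hom[OF S_Pol[OF R_S], of w T v 1 \<eta>] by (simp add: S_pi[OF R_S])
 then show ?case by (intro exI[of _ 0]) auto
next
 case (R_low k l x P)
 show ?case
 proof (cases "k < 0")
  case True
  then have "x = \<zero>" using R_neg[OF R_low.hyps] by simp
  then show ?thesis by (intro exI[of _ 0]) (simp add: pi_zero)
 next
  case False
  obtain r where r: "\<And>T. \<pi> x w (T *s v, \<eta>) = T ^ nat k * P w (v, \<eta>) + poly r T" "r = 0 \<or> int (degree r) < k"
   using R_low.IH by blast
  have "degree (monom (P w (v, \<eta>)) (nat k) + r) \<le> nat k"
   using r(2) False by (intro degree_add_le degree_monom_le) auto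
  then show ?thesis using False
   by (intro exI[of _ "monom (P w (v, \<eta>)) (nat k) + r"]) (auto simp: r(1) poly_monom)
 qed
next
 case (R_add k l x P y Q)
 obtain r where r: "\<And>T. \<pi> x w (T *s v, \<eta>) = T ^ nat k * P w (v, \<eta>) + poly r T" "r = 0 \<or> int (degree r) < k"
  using R_add.IH(1) by blast
 obtain s where s: "\<And>T. \<pi> y w (T *s v, \<eta>) = T ^ nat k * Q w (v, \<eta>) + poly s T" "s = 0 \<or> int (degree s) < k"
  using R_add.IH(2) by blast
 have "degree (r + s) \<le> max (degree r) (degree s)" by (rule degree_add_le_max)
 then have "r + s = 0 \<or> int (degree (r + s)) < k" using r(2) s(2) by auto
 then show ?case using R_closed R_add.hyps
  by (intro exI[of _ "r + s"]) (auto simp: pi_add r(1) s(1) algebra_simps)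
qed

text \<open>Here the PBW theorem takes effect: \<open>\<pi>\<close> of zero vanishes, so the
  coefficient that carries the symbol does too.\<close>

lemma R_unique: "R k l \<zero> P \<Longrightarrow> P w p = 0"
proof -
 assume R: "R k l \<zero> P"
 show ?thesis
 proof (cases "k < 0")
  case True
  then show ?thesis using R_neg[OF R] by simp
 next
  case False
  obtain r where r: "\<And>T. \<pi> \<zero> w (T *s fst p, snd p) = T ^ nat k * P w p + poly r T" "r = 0 \<or> int (degree r) < k"
   using R_leading[OF R, of w "fst p" "snd p"] by auto
  have "poly (monom (P w p) (nat k) + r) T = 0" for T
   using r(1)[of T] by (simp add: pi_zero poly_monom mult.commute)
  then have "monom (P w p) (nat k) + r = 0" using poly_all_0_iff_0 by blast
  moreover have "coeff r (nat k) = 0" using r(2) False by (auto intro: coeff_eq_0)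
  ultimately have "coeff (monom (P w p) (nat k)) (nat k) = 0" by (metis add.right_neutral coeff_0 coeff_add)
  then show ?thesis by simp
 qed
qed

text \<open>Multiplication by y from the left would break the order, so the letter is inserted to
  the right of the x-letters.\<close>

lemma S_mult_y: "S Bs Bs k l x P \<Longrightarrow> \<exists>x'. S Bs Bs k (l + 1) x' (\<lambda>w p. pr u (snd p) * P w p)"
proof (induction rule: S.induct)
 case (S_w g c)
 show ?case using S_Y_all[OF S.S_w[OF S_w]] by auto
next
 case (S_zero k l)
 have "S Bs Bs k (l + 1) \<zero> (\<lambda>w p. pr u (snd p) * 0)" by (rule S_cong[OF S.S_zero]) auto
 then show ?case by blast
next
 case (S_add k l x P y Q)
 then obtain x' y' where "S Bs Bs k (l + 1) x' (\<lambda>w p. pr u (snd p) * P w p)" "S Bs Bs k (l + 1) y' (\<lambda>w p. pr u (snd p) * Q w p)"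
  by blast
 from S.S_add[OF this] show ?case by (auto simp: distrib_left)
next
 case (S_Y l x P u')
 show ?case using S_Y_all[OF S.S_Y[OF S_Y.hyps]] by blast
next
 case (S_X k l x P u')
 then obtain x' where "S Bs Bs k (l + 1) x' (\<lambda>w p. pr u (snd p) * P w p)" by blast
 from S.S_X[OF this S_X.hyps(2)] show ?case by (auto simp: mult.left_commute)
qed

lemma S_lift_single:
 assumes g: "g \<in> W"
 shows "Pol k l P \<Longrightarrow> \<exists>x. S Bs Bs k l x (\<lambda>w p. if w = g then P p else 0)"
proof (induction rule: Pol.induct)
 case (Pol_zero k l)
 have "S Bs Bs k l \<zero> (\<lambda>w p. if w = g then 0 else 0)" by (rule S_cong[OF S.S_zero]) auto
 then show ?case by blast
next
 case (Pol_const c)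
 show ?case using S_w[OF g] by blast
next
 case (Pol_add k l P Q)
 then obtain x y where xy: "S Bs Bs k l x (\<lambda>w p. if w = g then P p else 0)"
  "S Bs Bs k l y (\<lambda>w p. if w = g then Q p else 0)" by blast
 have "S Bs Bs k l (x \<oplus> y) (\<lambda>w p. if w = g then P p + Q p else 0)"
  by (rule S_cong[OF S_add[OF xy]]) auto
 then show ?case by blast
next
 case (Pol_x k l P u)
 then obtain x where "S Bs Bs k l x (\<lambda>w p. if w = g then P p else 0)" by blast
 have "S Bs Bs (k + 1) l (xg u \<otimes> x) (\<lambda>w p. if w = g then pr u (fst p) * P p else 0)"
  by (rule S_cong[OF S_X_all[OF \<open>S Bs Bs k l x _\<close>, of u]]) auto
 then show ?case by blast
next
 case (Pol_y k l P u)
 then obtain x where "S Bs Bs k l x (\<lambda>w p. if w = g then P p else 0)" by blast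
 then obtain x' where "S Bs Bs k (l + 1) x' (\<lambda>w p. pr u (snd p) * (if w = g then P p else 0))" using S_mult_y by blast
 then have "S Bs Bs k (l + 1) x' (\<lambda>w p. if w = g then pr u (snd p) * P p else 0)"
  by (rule S_cong) auto
 then show ?case by blast
qed

lemma R_lift:
 assumes "\<And>g. g \<in> W \<Longrightarrow> Pol k l (P g)"
 shows "\<exists>x. R k l x (\<lambda>w p. if w \<in> W then P w p else 0)"
proof -
 have "\<forall>g. \<exists>x. g \<in> W \<longrightarrow> R k l x (\<lambda>w p. if w = g then P g p else 0)"
  using S_lift_single assms R_S by blast
 from choice[OF this] obtain f where f: "\<And>g. g \<in> W \<Longrightarrow> R k l (f g) (\<lambda>w p. if w = g then P g p else 0)" by blast
 have "R k l (\<Oplus>g\<in>W. f g) (\<lambda>w p. \<Sum>g\<in>W. if w = g then P g p else 0)"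
  using R_finsum[OF finite_W f] by simp
 then have "R k l (\<Oplus>g\<in>W. f g) (\<lambda>w p. if w \<in> W then P w p else 0)"
  by (rule R_cong) (use finite_W in auto)
 then show ?thesis by blast
qed

end

section \<open>The diagonal subalgebra and the averaging idempotents\<close>

context cherednik_like
begin

lemma S_diff: "S A1 A2 k l x P \<Longrightarrow> S A1 A2 k l y Q \<Longrightarrow> S A1 A2 k l (x \<ominus> y) (\<lambda>w p. P w p - Q w p)"
proof -
 assume x: "S A1 A2 k l x P" and y: "S A1 A2 k l y Q"
 show ?thesis
  by (rule S_cong[OF S_add[OF x S_smult[OF y, of "-1"]]])
   (use S_closed[OF y] in \<open>auto simp: smult_minus_one a_minus_def\<close>)
qed

lemma S_eqI:
 assumes "S Bs Bs k l x P" "S Bs Bs k l y Q" "\<And>w p. P w p = Q w p" shows "x = y"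
proof -
 have "x \<ominus> y = \<zero>"
  using S_inj[OF finite_Basis order.refl S_diff[OF assms(1,2)]] assms(3) by simp
 then show ?thesis using S_closed[OF assms(1)] S_closed[OF assms(2)] by simp
qed

lemma S_finsum:
 assumes "finite I" "\<And>i. i \<in> I \<Longrightarrow> S A1 A2 k l (f i) (P i)"
 shows "S A1 A2 k l (\<Oplus>i\<in>I. f i) (\<lambda>w p. \<Sum>i\<in>I. P i w p)"
 using assms
proof (induction I rule: finite_induct)
 case empty
 then show ?case using S_zero by simp
next
 case (insert i I)
 have "f j \<in> carrier H" if "j \<in> insert i I" for j by (rule S_closed[OF insert.prems[OF that]])
 then have "(\<Oplus>i\<in>insert i I. f i) = f i \<oplus> (\<Oplus>i\<in>I. f i)"
  using insert.hyps by (intro finsum_insert) auto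
 then show ?case using S_add[of A1 A2 k l "f i" "P i"] insert by simp
qed

lemma right_translate_eq_iff: "g \<in> W \<Longrightarrow> w \<circ> invf g = g' \<longleftrightarrow> w = g' \<circ> g"
 by (metis comp_assoc comp_id inv_comp(1) inv_comp(2))

lemma S_Wr:
 assumes g: "g \<in> W"
 shows "S A1 A2 k l x P \<Longrightarrow> S A1 A2 k l (x \<otimes> wg g) (\<lambda>w p. P (w \<circ> invf g) p)"
proof (induction rule: S.induct)
 case (S_w g' c)
 show ?case
  by (rule S_cong[OF S.S_w[of "g' \<circ> g" A1 A2 c]])
   (use S_w g in \<open>auto simp: wg_comp smult_mult_left right_translate_eq_iff\<close>)
next
 case (S_zero k l)
 show ?case by (rule S_cong[OF S.S_zero]) (use g in auto)
next
 case (S_add k l x P y Q)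
 show ?case by (rule S_cong[OF S.S_add[OF S_add.IH]])
   (use S_closed S_add.hyps g in \<open>auto simp: l_distr\<close>)
next
 case (S_Y l x P u)
 show ?case by (rule S_cong[OF S.S_Y[OF S_Y.IH S_Y.hyps(2)]])
   (use S_closed[OF S_Y.hyps(1)] g in \<open>auto simp: m_assoc\<close>)
next
 case (S_X k l x P u)
 show ?case by (rule S_cong[OF S.S_X[OF S_X.IH S_X.hyps(2)]])
   (use S_closed[OF S_X.hyps(1)] g in \<open>auto simp: m_assoc\<close>)
qed

lemma S_wg: "g \<in> W \<Longrightarrow> S A1 A2 0 0 (wg g) (\<lambda>w p. if w = g then 1 else 0)"
 by (rule S_cong[OF S_w[of g A1 A2 1]]) (auto simp: smult_one)

lemma S_wsum:
 assumes "V \<subseteq> W"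
 shows "S A1 A2 0 0 (\<Oplus>g\<in>V. a g \<odot> wg g) (\<lambda>w p. if w \<in> V then a w else 0)"
proof -
 have fin: "finite V" using assms finite_W finite_subset by blast
 have "S A1 A2 0 0 (\<Oplus>g\<in>V. a g \<odot> wg g) (\<lambda>w p. \<Sum>g\<in>V. if w = g then a g else 0)"
  by (rule S_finsum[OF fin]) (use assms in \<open>auto intro: S_w\<close>)
 then show ?thesis by (rule S_cong) (use fin in auto)
qed

lemma R_offW: "R k l x P \<Longrightarrow> w \<notin> W \<Longrightarrow> P w p = 0"
proof -
 have S: "S Bs Bs k l x P \<Longrightarrow> w \<notin> W \<Longrightarrow> P w p = 0" for k l x P
  by (induction rule: S.induct) auto
 show "R k l x P \<Longrightarrow> w \<notin> W \<Longrightarrow> P w p = 0"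
  by (induction rule: R.induct) (auto simp: S)
qed

lemma R_eq: "R k l x P \<Longrightarrow> R k l x Q \<Longrightarrow> P w p = Q w p"
 using R_unique[of k l "\<lambda>w p. P w p - Q w p" w p] R_diff[of k l x P x Q] R_closed[of k l x P]
 by (simp add: a_minus_def r_neg)

text \<open>Below bidegree \<open>(0, 0)\<close> the filtration is zero. Identities in the group
  algebra therefore reduce to identities of symbols.\<close>

lemma R_eq00: "R 0 0 x P \<Longrightarrow> R 0 0 y Q \<Longrightarrow> (\<And>w p. P w p = Q w p) \<Longrightarrow> x = y"
proof -
 assume 1: "R 0 0 x P" "R 0 0 y Q" and eq: "\<And>w p. P w p = Q w p"
 obtain Q' where "R (0 - 1) (0 - 1) (x \<ominus> y) Q'" using R_kernel[OF R_diff[OF 1]] eq by auto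
 then have "x \<ominus> y = \<zero>" using R_neg by auto
 then show ?thesis using 1 R_closed by auto
qed

lemma R_raise: "R k l x P \<Longrightarrow> \<exists>Q. R (k + int n) (l + int n) x Q \<and> (n > 0 \<longrightarrow> Q = (\<lambda>_ _. 0))"
proof (induction n)
 case 0
 then show ?case by auto
next
 case (Suc n)
 then obtain Q where "R (k + int n) (l + int n) x Q" by blast
 from R_low[OF this] show ?case by (auto simp: algebra_simps)
qed

lemma R_raise_le:
 assumes "R k k x P" "k \<le> l" shows "\<exists>Q. R l l x Q"
 using R_raise[OF assms(1), of "nat (l - k)"] assms(2) by auto

text \<open>The elements of diagonal filtration degree. This description of the subalgebra generated
  by the x_i y_j and \<open>W\<close> is the one for which symbols exist.\<close>

definition Hgl :: "'a set" where "Hgl = {x. \<exists>k P. R k k x P}"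

lemma Hgl_closed: "x \<in> Hgl \<Longrightarrow> x \<in> carrier H"
 unfolding Hgl_def using R_closed by blast

lemma Hgl_common:
 assumes "x \<in> Hgl" "y \<in> Hgl" obtains k P Q where "R k k x P" "R k k y Q"
proof -
 obtain k P l Q where "R k k x P" "R l l y Q" using assms unfolding Hgl_def by blast
 then obtain P' Q' where "R (max k l) (max k l) x P'" "R (max k l) (max k l) y Q'"
  using R_raise_le[of k x P "max k l"] R_raise_le[of l y Q "max k l"] by auto
 then show ?thesis by (rule that)
qed

lemma subalg_Hgl: "subalg H Hgl"
proof -
 have "subring Hgl H"
 proof (rule subringI)
  show "Hgl \<subseteq> carrier H" using Hgl_closed by blast
  show "\<one> \<in> Hgl" using R_S[OF S_wg[of id]] unfolding Hgl_def wg_id[symmetric] by auto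
  show "\<ominus> x \<in> Hgl" if "x \<in> Hgl" for x using that R_minus unfolding Hgl_def by blast
  show "x \<otimes> y \<in> Hgl" if "x \<in> Hgl" "y \<in> Hgl" for x y
   using that R_mult unfolding Hgl_def by blast
  show "x \<oplus> y \<in> Hgl" if xy: "x \<in> Hgl" "y \<in> Hgl" for x y
  proof -
   obtain k P Q where "R k k x P" "R k k y Q" using Hgl_common[OF xy] .
   from R_add[OF this] show ?thesis unfolding Hgl_def by blast
  qed
 qed
 moreover have "z \<odot> x \<in> Hgl" if "x \<in> Hgl" for z x using that R_smult unfolding Hgl_def by blast
 ultimately show ?thesis by (simp add: subalg_def)
qed

text \<open>A monomial of bidegree \<open>(n + 1, n + 1)\<close> has a factor x_a y_b. Products of
  the generators are not normally ordered, but their symbols are right.\<close>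

lemma gl_gen_lift:
 assumes B: "subalg H B" and gen: "\<And>b b'. b \<in> Bs \<Longrightarrow> b' \<in> Bs \<Longrightarrow> xg b \<otimes> yg b' \<in> B" "\<And>g. g \<in> W \<Longrightarrow> wg g \<in> B"
  and g: "g \<in> W"
 shows "Pol (int n) (int n) P \<Longrightarrow> \<exists>x\<in>B. R (int n) (int n) x (\<lambda>w p. if w = g then P p else 0)"
proof (induction n arbitrary: P)
 have Bsub: "subring B H" "\<And>z x. x \<in> B \<Longrightarrow> z \<odot> x \<in> B" using B by (auto simp: subalg_def)
 {
  case 0
  have P0: "P p = P (0, 0)" for p using Pol_hom[OF 0, of 0 "fst p" 0 "snd p"] by simp
  have "R 0 0 (P (0, 0) \<odot> wg g) (\<lambda>w p. if w = g then P p else 0)"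
   by (rule R_cong[OF R_S[OF S_w[OF g]]]) (simp, simp, simp, metis P0)
  then show ?case using Bsub(2) gen(2)[OF g] by auto
 next
  case (Suc n)
  show ?case using Pol_Mon_span[OF Suc.prems]
  proof (induction rule: Mon_span.induct)
   case zero
   have "R (int (Suc n)) (int (Suc n)) \<zero> (\<lambda>w p. if w = g then 0 else 0)" by (rule R_cong[OF R_zero]) auto
   then show ?case using subringE(2)[OF Bsub(1)] by blast
  next
   case (add P Q)
   then obtain x y where xy: "x \<in> B" "y \<in> B" "R (int (Suc n)) (int (Suc n)) x (\<lambda>w p. if w = g then P p else 0)"
    "R (int (Suc n)) (int (Suc n)) y (\<lambda>w p. if w = g then Q p else 0)" by blast
   have "R (int (Suc n)) (int (Suc n)) (x \<oplus> y) (\<lambda>w p. if w = g then P p + Q p else 0)"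
    by (rule R_cong[OF R_add[OF xy(3,4)]]) auto
   then show ?case using subringE(7)[OF Bsub(1) xy(1,2)] by blast
  next
   case (mon \<alpha> \<beta> c)
   have pos: "1 \<le> \<delta> b \<longrightarrow> \<delta> b \<noteq> 0" for \<delta> :: "'h \<Rightarrow> nat" and b by simp
   have ex: "\<exists>b\<in>Bs. 1 \<le> \<delta> b" if "int (\<Sum>b\<in>Bs. \<delta> b) = int (Suc n)" for \<delta> :: "'h \<Rightarrow> nat"
   proof (rule ccontr)
    assume "\<not> ?thesis"
    then have "(\<Sum>b\<in>Bs. \<delta> b) = 0" by (auto simp: not_le)
    then show False using that by simp
   qed
   obtain a where a: "a \<in> Bs" "1 \<le> \<alpha> a" using ex[OF mon(1)] by blast
   obtain b where b: "b \<in> Bs" "1 \<le> \<beta> b" using ex[OF mon(2)] by blast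
   define \<alpha>' where "\<alpha>' = \<alpha>(a := \<alpha> a - 1)"
   define \<beta>' where "\<beta>' = \<beta>(b := \<beta> b - 1)"
   define rest where "rest p = c * (xymon \<alpha>' \<beta>' p)" for p
   have sums: "int (\<Sum>b\<in>Bs. \<alpha>' b) = int n" "int (\<Sum>b\<in>Bs. \<beta>' b) = int n"
    using mon Bs_prod_split(2)[of a 1 \<alpha>, OF a] Bs_prod_split(2)[of b 1 \<beta>, OF b] by (auto simp: \<alpha>'_def \<beta>'_def)
   have "Pol (int n) (int n) rest"
    unfolding rest_def[abs_def] using Pol_smult[OF Pol_monomial[of \<alpha>' \<beta>']] unfolding sums .
   then obtain x where x: "x \<in> B" "R (int n) (int n) x (\<lambda>w p. if w = g then rest p else 0)" using Suc.IH by blast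
   have xc: "x \<in> carrier H" using R_closed[OF x(2)] .
   have "c * (xymon \<alpha> \<beta> p) =
     pr a (fst p) * (pr b (snd p) * rest p)" for p
    unfolding Bs_prod_split(1)[of a 1 \<alpha>, OF a] Bs_prod_split(1)[of b 1 \<beta>, OF b]
    by (simp add: rest_def \<alpha>'_def \<beta>'_def)
   then have "R (int (Suc n)) (int (Suc n)) ((xg a \<otimes> yg b) \<otimes> x)
     (\<lambda>w p. if w = g then c * (xymon \<alpha> \<beta> p) else 0)"
    by (intro R_cong[OF R_X[OF R_Y[OF x(2), of b], of a]]) (use xc in \<open>auto simp: m_assoc\<close>)
   then show ?case using subringE(6)[OF Bsub(1) gen(1)[OF a(1) b(1)] x(1)] by blast
  qed
 }
qed

text \<open>An element of diagonal degree and a lift of its symbol inside the generated subalgebra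
  differ by an element of lower diagonal degree.\<close>

lemma Hgl_generated: "subalg_gen H ({xg b \<otimes> yg b' | b b'. b \<in> Bs \<and> b' \<in> Bs} \<union> wg ` W) = Hgl"
proof
 let ?G = "{xg b \<otimes> yg b' | b b'. b \<in> Bs \<and> b' \<in> Bs} \<union> wg ` W"
 have "R 1 1 (xg b \<otimes> yg b') (\<lambda>w p. pr b (fst p) * (pr b' (snd p) * (if w = id then 1 else 0)))" for b b'
  by (rule R_cong[OF R_X[OF R_Y[OF R_S[OF S_wg[OF W_id]], of b'], of b]]) (auto simp: wg_id)
 moreover have "R 0 0 (wg g) (\<lambda>w p. if w = g then 1 else 0)" if "g \<in> W" for g
  using R_S[OF S_wg[OF that]] .
 ultimately have "?G \<subseteq> Hgl" unfolding Hgl_def by blast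
 then show "subalg_gen H ?G \<subseteq> Hgl" using subalg_Hgl unfolding subalg_gen_def by blast
 show "Hgl \<subseteq> subalg_gen H ?G"
  unfolding subalg_gen_def
 proof (rule Inter_greatest)
  fix B assume "B \<in> {B. subalg H B \<and> ?G \<subseteq> B}"
  then have B: "subalg H B" and G: "?G \<subseteq> B" by auto
  have Bsub: "subring B H" "\<And>z x. x \<in> B \<Longrightarrow> z \<odot> x \<in> B" using B by (auto simp: subalg_def)
  have gen: "\<And>b b'. b \<in> Bs \<Longrightarrow> b' \<in> Bs \<Longrightarrow> xg b \<otimes> yg b' \<in> B" "\<And>g. g \<in> W \<Longrightarrow> wg g \<in> B" using G by blast+
  have "k < int n \<Longrightarrow> R k k x P \<Longrightarrow> x \<in> B" for n k x P
  proof (induction n arbitrary: k x P)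
   case 0
   then show ?case using R_neg subringE(2)[OF Bsub(1)] by auto
  next
   case (Suc n)
   show ?case
   proof (cases "k < 0")
    case True
    then show ?thesis using R_neg[OF Suc.prems(2)] subringE(2)[OF Bsub(1)] by auto
   next
    case False
    then have k: "int (nat k) = k" by simp
    have "\<exists>y\<in>B. R k k y (\<lambda>w p. if w \<in> V then P w p else 0)" if "finite V" "V \<subseteq> W" for V
     using that
    proof (induction V rule: finite_induct)
     case empty
     have "R k k \<zero> (\<lambda>w p. if w \<in> {} then P w p else 0)" by (rule R_cong[OF R_zero]) auto
     then show ?case using subringE(2)[OF Bsub(1)] by blast
    next
     case (insert g V)
     obtain y where y: "y \<in> B" "R k k y (\<lambda>w p. if w \<in> V then P w p else 0)" using insert by blast
     obtain x' where x': "x' \<in> B" "R k k x' (\<lambda>w p. if w = g then P g p else 0)"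
      using gl_gen_lift[OF B gen, of g "nat k" "P g"] insert.prems R_Pol[OF Suc.prems(2)] k by auto
     have "R k k (x' \<oplus> y) (\<lambda>w p. if w \<in> insert g V then P w p else 0)"
      by (rule R_cong[OF R_add[OF x'(2) y(2)]]) (use insert.hyps in auto)
     then show ?case using subringE(7)[OF Bsub(1) x'(1) y(1)] by blast
    qed
    from this[OF finite_W order.refl] obtain y where y: "y \<in> B" "R k k y (\<lambda>w p. if w \<in> W then P w p else 0)" by blast
    have "R k k y P" by (rule R_cong[OF y(2)]) (use R_offW[OF Suc.prems(2)] in auto)
    from R_kernel[OF R_diff[OF Suc.prems(2) this]] obtain Q where "R (k - 1) (k - 1) (x \<ominus> y) Q" by auto
    moreover have "k - 1 < int n" using Suc.prems(1) by simp
    ultimately have "x \<ominus> y \<in> B" using Suc.IH by blast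
    moreover have "x = (x \<ominus> y) \<oplus> y" using R_closed[OF Suc.prems(2)] R_closed[OF y(2)]
     by (simp add: a_minus_def a_assoc l_neg)
    ultimately show ?thesis using subringE(7)[OF Bsub(1) _ y(1)] by metis
   qed
  qed
  moreover have "k < int (nat (k + 1))" for k by simp
  ultimately show "Hgl \<subseteq> B" unfolding Hgl_def by blast
 qed
qed

definition av :: "('h \<Rightarrow> 'h) set \<Rightarrow> 'a" where
 "av G = (1 / of_nat (card G)) \<odot> (\<Oplus>w\<in>G. wg w)"

lemma S_av:
 assumes "G \<subseteq> W" shows "S A1 A2 0 0 (av G) (\<lambda>w p. if w \<in> G then 1 / of_nat (card G) else 0)"
proof -
 have "(\<Oplus>w\<in>G. 1 \<odot> wg w) = (\<Oplus>w\<in>G. wg w)" using assms by (intro finsum_cong') (auto simp: smult_one)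
 then show ?thesis unfolding av_def
  by (intro S_cong[OF S_smult[OF S_wsum[OF assms, of A1 A2 "\<lambda>_. 1"], of "1 / of_nat (card G)"]]) auto
qed

lemma R_av: "G \<subseteq> W \<Longrightarrow> R 0 0 (av G) (\<lambda>w p. if w \<in> G then 1 / of_nat (card G) else 0)"
 by (rule R_S[OF S_av])

lemma av_closed: "G \<subseteq> W \<Longrightarrow> av G \<in> carrier H"
 using R_closed[OF R_av] .

text \<open>In bidegree \<open>(0, 0)\<close> the symbol product is convolution on the group, and
  the average over the larger group is invariant under translation by the smaller one.\<close>

lemma av_absorb:
 assumes G1: "G1 \<subseteq> W" "id \<in> G1" and sub: "G1 \<subseteq> G2" and G2: "G2 \<subseteq> W"
  and c2: "\<And>g h. g \<in> G2 \<Longrightarrow> h \<in> G2 \<Longrightarrow> g \<circ> h \<in> G2" and i2: "\<And>g. g \<in> G2 \<Longrightarrow> invf g \<in> G2"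
 shows "av G1 \<otimes> av G2 = av G2" "av G2 \<otimes> av G1 = av G2"
proof -
 let ?f = "\<lambda>w p. if w \<in> G1 then 1 / of_nat (card G1) else (0::complex)"
 let ?g = "\<lambda>w p. if w \<in> G2 then 1 / of_nat (card G2) else (0::complex)"
 have fin: "finite G1" "finite G2" using G1 G2 finite_W finite_subset by blast+
 have c1: "of_nat (card G1) \<noteq> (0::complex)" using fin G1 by auto
 have sumG1: "(\<Sum>v\<in>W. if v \<in> G1 then c / of_nat (card G1) else 0) = (c::complex)" for c
 proof -
  have "(\<Sum>v\<in>W. if v \<in> G1 then c / of_nat (card G1) else 0) = (\<Sum>v\<in>G1. c / of_nat (card G1))"
   using finite_W G1 by (intro sum.mono_neutral_cong_right) auto
  then show ?thesis using c1 by simp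
 qed
 have 1: "tmul ?f ?g u p = ?g u p" for u p
 proof -
  have "invf v \<circ> u \<in> G2 \<longleftrightarrow> u \<in> G2" if "v \<in> G1" for v
  proof -
   have v: "v \<in> G2" "v \<in> W" using that sub G2 by auto
   have "u \<in> G2" if "invf v \<circ> u \<in> G2"
    using c2[OF v(1) that] v by (simp add: comp_assoc[symmetric])
   then show ?thesis using c2 i2 v by blast
  qed
  then have "tmul ?f ?g u p = (\<Sum>v\<in>W. if v \<in> G1 then ?g u p / of_nat (card G1) else 0)"
   unfolding tmul_def by (intro sum.cong) auto
  then show ?thesis using sumG1 by simp
 qed
 show "av G1 \<otimes> av G2 = av G2"
  by (rule R_eq00[OF R_mult[OF R_av[OF G2] R_av[OF G1(1)], simplified] R_av[OF G2] 1])
 have 2: "tmul ?g ?f u p = ?g u p" for u p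
 proof (cases "u \<in> W")
  case True
  \<comment> \<open>The substitution \<open>v \<mapsto> u \<circ> invf v\<close> makes the right
    factor the one with the summation variable as argument.\<close>
  have "tmul ?g ?f u p = (\<Sum>v\<in>W. ?g (u \<circ> invf v) p * ?f v p)"
  proof -
   have "bij_betw (\<lambda>v. u \<circ> invf v) W W"
    using bij_betw_trans[OF bij_betw_inverse bij_betw_translate[OF True]] by (simp add: comp_def)
   then have "tmul ?g ?f u p = (\<Sum>v\<in>W. ?g (u \<circ> invf v) p * ?f (invf (u \<circ> invf v) \<circ> u) p)"
    unfolding tmul_def by (subst sum.reindex_bij_betw[symmetric]) auto
   also have "\<dots> = (\<Sum>v\<in>W. ?g (u \<circ> invf v) p * ?f v p)"
    using True by (intro sum.cong refl) (auto simp: inv_of_comp comp_assoc)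
   finally show ?thesis .
  qed
  also have "\<dots> = (\<Sum>v\<in>W. if v \<in> G1 then ?g u p / of_nat (card G1) else 0)"
  proof (rule sum.cong[OF refl])
   fix v assume v: "v \<in> W"
   have "u \<circ> invf v \<in> G2 \<longleftrightarrow> u \<in> G2" if "v \<in> G1"
   proof -
    have v2: "v \<in> G2" using that sub by auto
    have "u \<in> G2" if "u \<circ> invf v \<in> G2"
     using c2[OF that v2] v by (simp add: comp_assoc)
    then show ?thesis using c2 i2 v2 by blast
   qed
   then show "?g (u \<circ> invf v) p * ?f v p = (if v \<in> G1 then ?g u p / of_nat (card G1) else 0)" by auto
  qed
  finally show ?thesis using sumG1 by simp
 next
  case False
  have n: "invf v \<circ> u \<notin> G1" if v: "v \<in> W" for v
  proof
   assume "invf v \<circ> u \<in> G1"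
   then have "v \<circ> (invf v \<circ> u) \<in> W" using W_comp[OF v] G1(1) by blast
   moreover have "v \<circ> (invf v \<circ> u) = u" by (simp add: comp_assoc[symmetric] inv_comp(2)[OF v])
   ultimately show False using False by simp
  qed
  have "tmul ?g ?f u p = (\<Sum>v\<in>W. 0)"
   unfolding tmul_def by (rule sum.cong[OF refl]) (simp only: n if_False mult_zero_right)
  moreover have "u \<notin> G2" using False G2 by blast
  ultimately show ?thesis by simp
 qed
 show "av G2 \<otimes> av G1 = av G2"
  by (rule R_eq00[OF R_mult[OF R_av[OF G1(1)] R_av[OF G2], simplified] R_av[OF G2] 2])
qed

lemma Z_closed:
 assumes "g \<in> Z" "h \<in> Z" shows "g \<circ> h \<in> Z"
proof -
 have "(g \<circ> h) \<circ> w = w \<circ> (g \<circ> h)" if "w \<in> W" for w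
 proof -
  have "g \<circ> w = w \<circ> g" "h \<circ> w = w \<circ> h" using assms that by (auto simp: group_center_def)
  then show ?thesis by (metis comp_assoc)
 qed
 then show ?thesis using Z_W[OF assms(1)] Z_W[OF assms(2)] by (simp add: group_center_def)
qed

lemma av_ZW:
 "av Z \<otimes> av Z = av Z" "av Z \<otimes> av W = av W" "av W \<otimes> av Z = av W" "av W \<otimes> av W = av W"
proof -
 have Z: "Z \<subseteq> W" using Z_W by blast
 show "av Z \<otimes> av Z = av Z" by (rule av_absorb(1)[OF Z id_Z order.refl Z Z_closed Z_inv])
 show "av Z \<otimes> av W = av W" by (rule av_absorb(1)[OF Z id_Z Z order.refl W_comp W_inv])
 show "av W \<otimes> av Z = av W" by (rule av_absorb(2)[OF Z id_Z Z order.refl W_comp W_inv])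
 show "av W \<otimes> av W = av W" by (rule av_absorb(1)[OF order.refl W_id order.refl order.refl W_comp W_inv])
qed

end

section \<open>The Euler element\<close>

text \<open>Written with \<open>v - invf g v\<close>, the term of a reflection in [y, x] no longer
  involves its root and coroot. The coefficient \<kappa> that remains is the one with which
  reflections enter the Euler element.\<close>

locale cherednik_euler = cherednik_like scale Bs W H xg yg wg \<gamma> \<pi>
 for scale :: "complex \<Rightarrow> 'h::ab_group_add \<Rightarrow> 'h" (infixr "*s" 75) and Bs W
  and H :: "(complex, 'a) module" (structure) and xg yg wg \<gamma> \<pi> +
 fixes t :: complex and \<kappa> :: "('h \<Rightarrow> 'h) \<Rightarrow> complex" and Rf :: "('h \<Rightarrow> 'h) set"
 assumes Rf_W: "Rf \<subseteq> W"
  and Rf_conj: "g \<in> W \<Longrightarrow> s \<in> Rf \<Longrightarrow> g \<circ> s \<circ> invf g \<in> Rf"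
  and \<kappa>_conj: "g \<in> W \<Longrightarrow> s \<in> Rf \<Longrightarrow> \<kappa> (g \<circ> s \<circ> invf g) = \<kappa> s"
  and \<gamma>_eq: "g \<in> W \<Longrightarrow> \<gamma> v u g = (if g = id then t * pr u v else 0) - (if g \<in> Rf then \<kappa> g * pr u (v - invf g v) else 0)"
begin

definition qh :: 'a where "qh = (\<Oplus>b\<in>Bs. xg b \<otimes> yg b)"

definition kh :: 'a where "kh = (\<Oplus>s\<in>Rf. \<kappa> s \<odot> wg s)"

definition eu :: 'a where "eu = qh \<ominus> kh"

lemma S_qh: "S Bs Bs 1 1 qh (\<lambda>w p. if w = id then pr (fst p) (snd p) else 0)"
proof -
 have "S Bs Bs 1 1 qh (\<lambda>w p. \<Sum>b\<in>Bs. pr b (fst p) * (pr b (snd p) * (if w = id then 1 else 0)))"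
  unfolding qh_def
 proof (rule S_finsum[OF finite_Basis])
  fix b
  show "S Bs Bs 1 1 (xg b \<otimes> yg b) (\<lambda>w p. pr b (fst p) * (pr b (snd p) * (if w = id then 1 else 0)))"
   by (rule S_cong[OF S_X_all[OF S_Y_all[OF S_wg[OF W_id], where u = b], where u = b]]) (auto simp: wg_id)
 qed
 then show ?thesis
 proof (rule S_cong)
  show "(\<Sum>b\<in>Bs. pr b (fst p) * (pr b (snd p) * (if w = id then 1 else 0))) =
    (if w = id then pr (fst p) (snd p) else 0)" for w and p :: "'h \<times> 'h"
   using dualb_pr[OF dualb_Bs, of "fst p" "snd p"] by simp
 qed auto
qed

lemma S_kh: "S A1 A2 0 0 kh (\<lambda>w p. if w \<in> Rf then \<kappa> w else 0)"
 unfolding kh_def by (rule S_wsum[OF Rf_W])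

lemma qh_closed [simp]: "qh \<in> carrier H"
 using S_closed[OF S_qh] .

lemma kh_closed [simp]: "kh \<in> carrier H"
 using S_closed[OF S_kh[of "{}" "{}"]] .

lemma eu_closed [simp]: "eu \<in> carrier H"
 by (simp add: eu_def)

text \<open>The group algebra part has bidegree \<open>(0, 0)\<close>, so the symbol in bidegree
  \<open>(1, 1)\<close> is the pairing, whose zero set is \<open>X\<close>.\<close>

lemma R_eu: "R 1 1 eu (\<lambda>w p. if w = id then pr (fst p) (snd p) else 0)"
proof -
 have "R 1 1 kh (\<lambda>_ _. 0)" using R_low[OF R_S[OF S_kh]] by simp
 from R_diff[OF R_S[OF S_qh] this] show ?thesis by (simp add: eu_def)
qed

lemma qh_wg:
 assumes g: "g \<in> W" shows "wg g \<otimes> qh = qh \<otimes> wg g"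
proof (rule S_eqI[OF S_W[OF g S_qh] S_Wr[OF g S_qh]])
 fix w :: "'h \<Rightarrow> 'h" and p
 have "invf g \<circ> w = id \<longleftrightarrow> w = g" using translate_eq_iff[OF g, of w id] by simp
 moreover have "w \<circ> invf g = id \<longleftrightarrow> w = g" using right_translate_eq_iff[OF g, of w id] by simp
 ultimately show "(if invf g \<circ> w = id then pr (fst (act (invf g) p)) (snd (act (invf g) p)) else 0) =
   (if w \<circ> invf g = id then pr (fst p) (snd p) else 0)"
  using q_act[OF W_inv[OF g]] by simp
qed

lemma kh_wg:
 assumes g: "g \<in> W" shows "wg g \<otimes> kh = kh \<otimes> wg g"
proof (rule S_eqI[OF S_W[OF g S_kh] S_Wr[OF g S_kh]])
 fix w :: "'h \<Rightarrow> 'h" and p :: "'h \<times> 'h"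
 let ?a = "invf g \<circ> w" and ?b = "w \<circ> invf g"
 have b: "?b = g \<circ> ?a \<circ> invf g" and a: "?a = invf g \<circ> ?b \<circ> invf (invf g)"
  using g by (simp_all add: comp_assoc[symmetric])
   (simp add: comp_assoc)
 have "?a \<in> Rf \<longleftrightarrow> ?b \<in> Rf"
  using Rf_conj[OF g, of ?a] Rf_conj[OF W_inv[OF g], of ?b] a b by metis
 moreover have "\<kappa> ?b = \<kappa> ?a" if "?a \<in> Rf" using \<kappa>_conj[OF g that] b by metis
 ultimately show "(if ?a \<in> Rf then \<kappa> ?a else 0) = (if ?b \<in> Rf then \<kappa> ?b else 0)" by auto
qed

lemma eu_wg: "g \<in> W \<Longrightarrow> eu \<otimes> wg g = wg g \<otimes> eu"
 by (simp add: eu_def a_minus_def l_distr r_distr l_minus r_minus qh_wg kh_wg)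

lemma S_Csum: "S A1 A2 0 0 (\<Oplus>g\<in>W. \<gamma> v u g \<odot> wg g) (\<lambda>w p. if w \<in> W then \<gamma> v u w else 0)"
 by (rule S_wsum[OF order.refl])

lemma C_closed: "(\<Oplus>g\<in>W. \<gamma> v u g \<odot> wg g) \<in> carrier H"
 by (rule finsum_closed) auto

lemma sum_pr_pr: "(\<Sum>b\<in>Bs. pr u b * pr b v) = pr u v"
 using pr_expand_left[of u v] by simp

lemma S_kh_xg: "S Bs Bs (0 + 1) 0 (kh \<otimes> xg u) (\<lambda>w p. if w \<in> Rf then \<kappa> w * pr u (invf w (fst p)) else 0)"
proof -
 have fin: "finite Rf" using Rf_W finite_W finite_subset by blast
 have "kh \<otimes> xg u = (\<Oplus>s\<in>Rf. (\<kappa> s \<odot> wg s) \<otimes> xg u)"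
  unfolding kh_def using fin Rf_W by (intro finsum_ldistr) auto
 also have "\<dots> = (\<Oplus>s\<in>Rf. xg (cg s u) \<otimes> (\<kappa> s \<odot> wg s))"
  using Rf_W by (intro finsum_cong') (auto simp: smult_mult_left smult_mult_right wg_xg subset_eq)
 finally have eq: "kh \<otimes> xg u = (\<Oplus>s\<in>Rf. xg (cg s u) \<otimes> (\<kappa> s \<odot> wg s))" .
 have "S Bs Bs (0 + 1) 0 (kh \<otimes> xg u) (\<lambda>w p. \<Sum>s\<in>Rf. pr (cg s u) (fst p) * (if w = s then \<kappa> s else 0))"
  unfolding eq by (rule S_finsum[OF fin]) (use Rf_W in \<open>auto intro!: S_X_all S_w simp del: add_0\<close>)
 then show ?thesis
 proof (rule S_cong)
  fix w :: "'h \<Rightarrow> 'h" and p :: "'h \<times> 'h"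
  have "(\<Sum>s\<in>Rf. pr (cg s u) (fst p) * (if w = s then \<kappa> s else 0)) = (\<Sum>s\<in>Rf. if s = w then pr (cg w u) (fst p) * \<kappa> w else 0)"
   by (rule sum.cong) auto
  also have "\<dots> = (if w \<in> Rf then \<kappa> w * pr u (invf w (fst p)) else 0)"
   using fin Rf_W by (auto simp: pr_cg)
  finally show "(\<Sum>s\<in>Rf. pr (cg s u) (fst p) * (if w = s then \<kappa> s else 0)) =
    (if w \<in> Rf then \<kappa> w * pr u (invf w (fst p)) else 0)" .
 qed auto
qed

lemma S_kh_yg: "S Bs Bs 0 (0 + 1) (kh \<otimes> yg u) (\<lambda>w p. if w \<in> Rf then \<kappa> w * pr (w u) (snd p) else 0)"
proof -
 have fin: "finite Rf" using Rf_W finite_W finite_subset by blast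
 have "kh \<otimes> yg u = (\<Oplus>s\<in>Rf. (\<kappa> s \<odot> wg s) \<otimes> yg u)"
  unfolding kh_def using fin Rf_W by (intro finsum_ldistr) auto
 also have "\<dots> = (\<Oplus>s\<in>Rf. yg (s u) \<otimes> (\<kappa> s \<odot> wg s))"
  using Rf_W by (intro finsum_cong') (auto simp: smult_mult_left smult_mult_right wg_yg subset_eq)
 finally have eq: "kh \<otimes> yg u = (\<Oplus>s\<in>Rf. yg (s u) \<otimes> (\<kappa> s \<odot> wg s))" .
 have "S Bs Bs 0 (0 + 1) (kh \<otimes> yg u) (\<lambda>w p. \<Sum>s\<in>Rf. pr (s u) (snd p) * (if w = s then \<kappa> s else 0))"
  unfolding eq by (rule S_finsum[OF fin]) (use Rf_W in \<open>auto intro!: S_Y_all S_w simp del: add_0\<close>)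
 then show ?thesis
 proof (rule S_cong)
  fix w :: "'h \<Rightarrow> 'h" and p :: "'h \<times> 'h"
  have "(\<Sum>s\<in>Rf. pr (s u) (snd p) * (if w = s then \<kappa> s else 0)) = (\<Sum>s\<in>Rf. if s = w then pr (w u) (snd p) * \<kappa> w else 0)"
   by (rule sum.cong) auto
  also have "\<dots> = (if w \<in> Rf then \<kappa> w * pr (w u) (snd p) else 0)" using fin by auto
  finally show "(\<Sum>s\<in>Rf. pr (s u) (snd p) * (if w = s then \<kappa> s else 0)) =
    (if w \<in> Rf then \<kappa> w * pr (w u) (snd p) else 0)" .
 qed auto
qed

lemma S_xg: "S Bs Bs (0 + 1) 0 (xg u) (\<lambda>w p. if w = id then pr u (fst p) else 0)"
 by (rule S_cong[OF S_X_all[OF S_wg[OF W_id], where u = u]]) (auto simp: wg_id)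

lemma S_yg: "S Bs Bs 0 (0 + 1) (yg u) (\<lambda>w p. if w = id then pr u (snd p) else 0)"
 by (rule S_cong[OF S_Y_all[OF S_wg[OF W_id], where u = u]]) (auto simp: wg_id)

text \<open>[eu, x] = t x: the reflection terms from [y_b, x] sum to minus those with x - s x, and
  the commutator with \<open>kh\<close> contributes the same terms with the opposite effect.\<close>

lemma eu_xg: "eu \<otimes> xg u = xg u \<otimes> eu \<oplus> t \<odot> xg u"
proof -
 let ?C = "\<lambda>b. \<Oplus>g\<in>W. \<gamma> b u g \<odot> wg g"
 define E where "E = (\<Oplus>b\<in>Bs. xg b \<otimes> ?C b)"
 have Ec: "E \<in> carrier H" unfolding E_def by (rule finsum_closed) (auto simp: C_closed)
 have "qh \<otimes> xg u = (\<Oplus>b\<in>Bs. (xg b \<otimes> yg b) \<otimes> xg u)"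
  unfolding qh_def by (intro finsum_ldistr finite_Basis) auto
 also have "\<dots> = (\<Oplus>b\<in>Bs. xg u \<otimes> (xg b \<otimes> yg b) \<oplus> xg b \<otimes> ?C b)"
 proof (rule finsum_cong')
  fix b
  have "(xg b \<otimes> yg b) \<otimes> xg u = xg b \<otimes> (xg u \<otimes> yg b \<oplus> ?C b)"
   by (simp add: m_assoc yg_xg)
  then show "(xg b \<otimes> yg b) \<otimes> xg u = xg u \<otimes> (xg b \<otimes> yg b) \<oplus> xg b \<otimes> ?C b"
   by (simp add: r_distr C_closed xg_lcomm[of "yg b" b u])
 qed (auto simp: C_closed)
 also have "\<dots> = (\<Oplus>b\<in>Bs. xg u \<otimes> (xg b \<otimes> yg b)) \<oplus> E"
  unfolding E_def by (rule finsum_addf) (auto simp: C_closed)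
 also have "(\<Oplus>b\<in>Bs. xg u \<otimes> (xg b \<otimes> yg b)) = xg u \<otimes> qh"
  unfolding qh_def by (rule finsum_rdistr[symmetric]) (auto simp: finite_Basis)
 finally have 1: "qh \<otimes> xg u = xg u \<otimes> qh \<oplus> E" .
 have SE: "S Bs Bs (0 + 1) 0 E (\<lambda>w p. \<Sum>b\<in>Bs. pr b (fst p) * (if w \<in> W then \<gamma> b u w else 0))"
  unfolding E_def by (rule S_finsum[OF finite_Basis S_X_all[OF S_Csum]])
 \<comment> \<open>Both sides have normally ordered forms of bidegree \<open>(1, 0)\<close>, so
   comparing functions is enough.\<close>
 have "E \<ominus> kh \<otimes> xg u = t \<odot> xg u \<ominus> xg u \<otimes> kh"
 proof (rule S_eqI[OF S_diff[OF SE S_kh_xg] S_diff[OF S_smult[OF S_xg] S_X_all[OF S_kh]]])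
  fix w :: "'h \<Rightarrow> 'h" and p :: "'h \<times> 'h"
  let ?i = "invf w"
  show "(\<Sum>b\<in>Bs. pr b (fst p) * (if w \<in> W then \<gamma> b u w else 0)) -
     (if w \<in> Rf then \<kappa> w * pr u (?i (fst p)) else 0) =
     t * (if w = id then pr u (fst p) else 0) - pr u (fst p) * (if w \<in> Rf then \<kappa> w else 0)"
  proof (cases "w \<in> W")
   case False
   then have "w \<notin> Rf" "w \<noteq> id" using Rf_W by auto
   then show ?thesis using False by simp
  next
   case True
   have 2: "(\<Sum>b\<in>Bs. pr b (fst p) * pr u (?i b)) = pr u (?i (fst p))"
    using sum_pr_pr[of "cg w u" "fst p"] by (simp add: pr_cg[OF True] mult.commute)
   have 3: "(\<Sum>b\<in>Bs. pr b (fst p) * pr u b) = pr u (fst p)"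
    using sum_pr_pr[of u "fst p"] by (simp add: mult.commute)
   have "(\<Sum>b\<in>Bs. pr b (fst p) * \<gamma> b u w) = (\<Sum>b\<in>Bs. (if w = id then t else 0) * (pr b (fst p) * pr u b) -
     (if w \<in> Rf then \<kappa> w else 0) * (pr b (fst p) * pr u b - pr b (fst p) * pr u (?i b)))"
    by (rule sum.cong) (auto simp: \<gamma>_eq[OF True] pr_simps algebra_simps)
   also have "\<dots> = (if w = id then t else 0) * pr u (fst p) - (if w \<in> Rf then \<kappa> w else 0) * (pr u (fst p) - pr u (?i (fst p)))"
    by (simp only: sum_subtractf sum_distrib_left[symmetric] 2 3)
   finally show ?thesis using True by (auto simp: algebra_simps)
  qed
 qed
 then have "E = t \<odot> xg u \<ominus> xg u \<otimes> kh \<oplus> kh \<otimes> xg u"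
  using Ec by (metis a_minus_def add.inv_closed a_assoc kh_closed l_neg m_closed r_zero xg_closed)
 then have "eu \<otimes> xg u = xg u \<otimes> qh \<oplus> (t \<odot> xg u \<ominus> xg u \<otimes> kh \<oplus> kh \<otimes> xg u) \<ominus> kh \<otimes> xg u"
  unfolding eu_def by (simp add: a_minus_def l_distr l_minus 1[unfolded a_minus_def])
 also have "\<dots> = xg u \<otimes> eu \<oplus> t \<odot> xg u"
  unfolding eu_def by (simp add: a_minus_def r_distr r_minus a_assoc r_neg) (simp add: a_ac)
 finally show ?thesis .
qed

text \<open>[y, eu] = t y, with the sign opposite to that for x; the products x y therefore commute
  with \<open>eu\<close>.\<close>

lemma yg_eu: "yg v \<otimes> eu = eu \<otimes> yg v \<oplus> t \<odot> yg v"
proof -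
 let ?C = "\<lambda>b. \<Oplus>g\<in>W. \<gamma> v b g \<odot> wg g"
 define E where "E = (\<Oplus>b\<in>Bs. ?C b \<otimes> yg b)"
 have Ec: "E \<in> carrier H" unfolding E_def by (rule finsum_closed) (auto simp: C_closed)
 have "yg v \<otimes> qh = (\<Oplus>b\<in>Bs. yg v \<otimes> (xg b \<otimes> yg b))"
  unfolding qh_def by (intro finsum_rdistr finite_Basis) auto
 also have "\<dots> = (\<Oplus>b\<in>Bs. (xg b \<otimes> yg b) \<otimes> yg v \<oplus> ?C b \<otimes> yg b)"
 proof (rule finsum_cong')
  fix b
  have "yg v \<otimes> (xg b \<otimes> yg b) = (xg b \<otimes> yg v \<oplus> ?C b) \<otimes> yg b"
   by (simp add: m_assoc[symmetric] yg_xg)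
  also have "\<dots> = xg b \<otimes> (yg v \<otimes> yg b) \<oplus> ?C b \<otimes> yg b" by (simp add: l_distr C_closed m_assoc)
  finally show "yg v \<otimes> (xg b \<otimes> yg b) = (xg b \<otimes> yg b) \<otimes> yg v \<oplus> ?C b \<otimes> yg b"
   by (simp add: yg_comm[of v b] m_assoc)
 qed (auto simp: C_closed)
 also have "\<dots> = (\<Oplus>b\<in>Bs. (xg b \<otimes> yg b) \<otimes> yg v) \<oplus> E"
  unfolding E_def by (rule finsum_addf) (auto simp: C_closed)
 also have "(\<Oplus>b\<in>Bs. (xg b \<otimes> yg b) \<otimes> yg v) = qh \<otimes> yg v"
  unfolding qh_def by (rule finsum_ldistr[symmetric]) (auto simp: finite_Basis)
 finally have 1: "yg v \<otimes> qh = qh \<otimes> yg v \<oplus> E" .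
 have SC: "S Bs Bs 0 (0 + 1) (?C b \<otimes> yg b) (\<lambda>w p. if w \<in> W then \<gamma> v b w * pr (w b) (snd p) else 0)" for b
 proof -
  have "?C b \<otimes> yg b = (\<Oplus>g\<in>W. (\<gamma> v b g \<odot> wg g) \<otimes> yg b)"
   using finite_W by (intro finsum_ldistr) auto
  also have "\<dots> = (\<Oplus>g\<in>W. yg (g b) \<otimes> (\<gamma> v b g \<odot> wg g))"
   by (intro finsum_cong') (auto simp: smult_mult_left smult_mult_right wg_yg)
  finally have eq: "?C b \<otimes> yg b = (\<Oplus>g\<in>W. yg (g b) \<otimes> (\<gamma> v b g \<odot> wg g))" .
  have "S Bs Bs 0 (0 + 1) (?C b \<otimes> yg b) (\<lambda>w p. \<Sum>g\<in>W. pr (g b) (snd p) * (if w = g then \<gamma> v b g else 0))"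
   unfolding eq by (rule S_finsum[OF finite_W]) (auto intro!: S_Y_all S_w simp del: add_0)
  then show ?thesis
  proof (rule S_cong)
   fix w :: "'h \<Rightarrow> 'h" and p :: "'h \<times> 'h"
   have "(\<Sum>g\<in>W. pr (g b) (snd p) * (if w = g then \<gamma> v b g else 0)) = (\<Sum>g\<in>W. if g = w then pr (w b) (snd p) * \<gamma> v b w else 0)"
    by (rule sum.cong) auto
   also have "\<dots> = (if w \<in> W then \<gamma> v b w * pr (w b) (snd p) else 0)" using finite_W by auto
   finally show "(\<Sum>g\<in>W. pr (g b) (snd p) * (if w = g then \<gamma> v b g else 0)) =
    (if w \<in> W then \<gamma> v b w * pr (w b) (snd p) else 0)" .
  qed auto
 qed
 have SE: "S Bs Bs 0 (0 + 1) E (\<lambda>w p. \<Sum>b\<in>Bs. if w \<in> W then \<gamma> v b w * pr (w b) (snd p) else 0)"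
  unfolding E_def by (rule S_finsum[OF finite_Basis SC])
 have "E \<ominus> yg v \<otimes> kh = t \<odot> yg v \<ominus> kh \<otimes> yg v"
 proof (rule S_eqI[OF S_diff[OF SE S_Y_all[OF S_kh]] S_diff[OF S_smult[OF S_yg] S_kh_yg]])
  fix w :: "'h \<Rightarrow> 'h" and p :: "'h \<times> 'h"
  let ?i = "invf w"
  show "(\<Sum>b\<in>Bs. if w \<in> W then \<gamma> v b w * pr (w b) (snd p) else 0) - pr v (snd p) * (if w \<in> Rf then \<kappa> w else 0) =
     t * (if w = id then pr v (snd p) else 0) - (if w \<in> Rf then \<kappa> w * pr (w v) (snd p) else 0)"
  proof (cases "w \<in> W")
   case False
   then have "w \<notin> Rf" "w \<noteq> id" using Rf_W by auto
   then show ?thesis using False by simp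
  next
   case True
   have 2: "(\<Sum>b\<in>Bs. pr b a * pr (w b) (snd p)) = pr (w a) (snd p)" for a
   proof -
    have "pr (w a) (snd p) = pr (w (\<Sum>b\<in>Bs. pr b a *s b)) (snd p)" using expand_Bs[of a] by simp
    then show ?thesis by (simp add: W_map[OF True] pr_simps)
   qed
   have "(\<Sum>b\<in>Bs. \<gamma> v b w * pr (w b) (snd p)) = (\<Sum>b\<in>Bs. (if w = id then t else 0) * (pr b v * pr (w b) (snd p)) -
     (if w \<in> Rf then \<kappa> w else 0) * (pr b (v - ?i v) * pr (w b) (snd p)))"
    by (rule sum.cong) (auto simp: \<gamma>_eq[OF True] algebra_simps)
   also have "\<dots> = (if w = id then t else 0) * pr (w v) (snd p) - (if w \<in> Rf then \<kappa> w else 0) * pr (w (v - ?i v)) (snd p)"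
    by (simp only: sum_subtractf sum_distrib_left[symmetric] 2)
   finally show ?thesis using True by (auto simp: algebra_simps W_map[OF True] pr_simps)
  qed
 qed
 then have "E = t \<odot> yg v \<ominus> kh \<otimes> yg v \<oplus> yg v \<otimes> kh"
  using Ec by (metis a_minus_def add.inv_closed a_assoc kh_closed l_neg m_closed r_zero yg_closed)
 then have "yg v \<otimes> eu = qh \<otimes> yg v \<oplus> (t \<odot> yg v \<ominus> kh \<otimes> yg v \<oplus> yg v \<otimes> kh) \<ominus> yg v \<otimes> kh"
  unfolding eu_def by (simp add: a_minus_def r_distr r_minus 1[unfolded a_minus_def])
 also have "\<dots> = eu \<otimes> yg v \<oplus> t \<odot> yg v"
  unfolding eu_def by (simp add: a_minus_def l_distr l_minus a_assoc r_neg) (simp add: a_ac)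
 finally show ?thesis .
qed

lemma eu_xy: "eu \<otimes> (xg u \<otimes> yg v) = (xg u \<otimes> yg v) \<otimes> eu"
proof -
 have "eu \<otimes> (xg u \<otimes> yg v) = (xg u \<otimes> eu \<oplus> t \<odot> xg u) \<otimes> yg v"
  by (simp add: m_assoc[symmetric] eu_xg)
 also have "\<dots> = xg u \<otimes> (eu \<otimes> yg v \<oplus> t \<odot> yg v)"
  by (simp add: l_distr r_distr m_assoc smult_mult_left smult_mult_right)
 also have "\<dots> = (xg u \<otimes> yg v) \<otimes> eu" by (simp add: yg_eu[symmetric] m_assoc)
 finally show ?thesis .
qed

text \<open>The commutant of \<open>eu\<close> is a subalgebra that contains the generators.\<close>

lemma eu_central: "x \<in> Hgl \<Longrightarrow> eu \<otimes> x = x \<otimes> eu"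
proof -
 let ?B = "{x \<in> carrier H. eu \<otimes> x = x \<otimes> eu}"
 have "subring ?B H"
 proof (rule subringI)
  fix x y assume x: "x \<in> ?B" and y: "y \<in> ?B"
  have "eu \<otimes> (x \<otimes> y) = (eu \<otimes> x) \<otimes> y" using x y by (intro m_assoc[symmetric]) auto
  also have "\<dots> = (x \<otimes> eu) \<otimes> y" using x by simp
  also have "\<dots> = x \<otimes> (eu \<otimes> y)" using x y by (intro m_assoc) auto
  also have "\<dots> = x \<otimes> (y \<otimes> eu)" using y by simp
  also have "\<dots> = (x \<otimes> y) \<otimes> eu" using x y by (intro m_assoc[symmetric]) auto
  finally show "x \<otimes> y \<in> ?B" using x y by simp
 qed (auto simp: l_distr r_distr l_minus r_minus)
 then have B: "subalg H ?B" unfolding subalg_def by (auto simp: smult_mult_left smult_mult_right)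
 have "{xg b \<otimes> yg b' | b b'. b \<in> Bs \<and> b' \<in> Bs} \<union> wg ` W \<subseteq> ?B"
  using eu_xy eu_wg by auto
 with B have "subalg_gen H ({xg b \<otimes> yg b' | b b'. b \<in> Bs \<and> b' \<in> Bs} \<union> wg ` W) \<subseteq> ?B"
  unfolding subalg_gen_def by blast
 then show "x \<in> Hgl \<Longrightarrow> eu \<otimes> x = x \<otimes> eu" unfolding Hgl_generated by blast
qed

end

section \<open>The quotient by the Euler element\<close>

context cherednik_euler
begin

abbreviation Gl where "Gl \<equiv> H\<lparr>carrier := Hgl\<rparr>"
abbreviation Rr where "Rr \<equiv> corner Gl (av Z)"
definition theta where "theta \<zeta> = av Z \<otimes>\<^bsub>Rr\<^esub> eu \<ominus>\<^bsub>Rr\<^esub> \<zeta> \<odot>\<^bsub>Rr\<^esub> av Z"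
abbreviation JJ where "JJ \<zeta> \<equiv> Idl\<^bsub>Rr\<^esub> {theta \<zeta>}"
abbreviation AA where "AA \<zeta> \<equiv> quot_alg Rr (JJ \<zeta>)"

lemma Z_sub_W: "Z \<subseteq> W"
 using Z_W by blast

lemma Gl_calg: "calg Gl"
 by (rule subalg_calg[OF subalg_Hgl])

lemma av_Hgl: "G \<subseteq> W \<Longrightarrow> av G \<in> Hgl"
 using R_av unfolding Hgl_def by blast

lemma Rr_calg: "calg Rr"
 by (rule calg.corner_calg[OF Gl_calg]) (use av_Hgl[OF Z_sub_W] av_ZW in auto)

lemma Rr_carrier: "x \<in> carrier Rr \<longleftrightarrow> x \<in> Hgl \<and> av Z \<otimes> x = x \<and> x \<otimes> av Z = x"
proof -
 have "carrier Rr = {x \<in> carrier Gl. av Z \<otimes>\<^bsub>Gl\<^esub> x = x \<and> x \<otimes>\<^bsub>Gl\<^esub> av Z = x}"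
  by (rule calg.corner_carrier[OF Gl_calg]) (use av_Hgl[OF Z_sub_W] av_ZW in auto)
 then show ?thesis by simp
qed

lemma Rr_ops [simp]: "x \<oplus>\<^bsub>Rr\<^esub> y = x \<oplus> y" "x \<otimes>\<^bsub>Rr\<^esub> y = x \<otimes> y" "\<zero>\<^bsub>Rr\<^esub> = \<zero>"
 "\<one>\<^bsub>Rr\<^esub> = av Z" "z \<odot>\<^bsub>Rr\<^esub> x = z \<odot> x"
 by (simp_all add: corner_def)

interpretation Rr: calg Rr
 by (rule Rr_calg)

lemma Rr_closed: "x \<in> carrier Rr \<Longrightarrow> x \<in> carrier H"
 using Rr_carrier Hgl_closed by blast

lemma Rr_minus: "x \<in> carrier Rr \<Longrightarrow> \<ominus>\<^bsub>Rr\<^esub> x = \<ominus> x"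
 using Rr.smult_minus_one[of x] smult_minus_one[of x] Rr_closed[of x] by simp

lemma Rr_diff: "x \<in> carrier Rr \<Longrightarrow> y \<in> carrier Rr \<Longrightarrow> x \<ominus>\<^bsub>Rr\<^esub> y = x \<ominus> y"
 unfolding a_minus_def using Rr_minus by simp

lemma eu_Hgl: "eu \<in> Hgl"
 using R_eu unfolding Hgl_def by blast

lemma Hgl_mult: "x \<in> Hgl \<Longrightarrow> y \<in> Hgl \<Longrightarrow> x \<otimes> y \<in> Hgl"
 using subalg_Hgl subringE(6) unfolding subalg_def by metis

lemma corner_mem: "x \<in> Hgl \<Longrightarrow> av Z \<otimes> x \<otimes> av Z \<in> carrier Rr"
proof -
 assume x: "x \<in> Hgl"
 have a: "av Z \<in> Hgl" "av Z \<in> carrier H" "x \<in> carrier H" using av_Hgl[OF Z_sub_W] Hgl_closed x by auto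
 have "av Z \<otimes> (av Z \<otimes> x \<otimes> av Z) = (av Z \<otimes> av Z) \<otimes> x \<otimes> av Z" using a by (simp add: m_assoc)
 moreover have "(av Z \<otimes> x \<otimes> av Z) \<otimes> av Z = av Z \<otimes> x \<otimes> (av Z \<otimes> av Z)" using a by (simp add: m_assoc)
 ultimately show ?thesis unfolding Rr_carrier using a x by (simp add: av_ZW Hgl_mult)
qed

lemma eu_Rr: "x \<in> carrier Rr \<Longrightarrow> eu \<otimes> x \<in> carrier Rr"
proof -
 assume x: "x \<in> carrier Rr"
 have a: "av Z \<in> Hgl" "av Z \<in> carrier H" "x \<in> carrier H" "x \<in> Hgl"
  using av_Hgl[OF Z_sub_W] Hgl_closed x Rr_carrier by auto
 have "av Z \<otimes> (eu \<otimes> x) = (av Z \<otimes> eu) \<otimes> x" using a by (simp add: m_assoc)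
 also have "\<dots> = eu \<otimes> (av Z \<otimes> x)" using a eu_central[OF a(1)] by (simp add: m_assoc[symmetric])
 also have "\<dots> = eu \<otimes> x" using x Rr_carrier by simp
 finally have "av Z \<otimes> (eu \<otimes> x) = eu \<otimes> x" .
 moreover have "(eu \<otimes> x) \<otimes> av Z = eu \<otimes> x" using x Rr_carrier a by (simp add: m_assoc)
 ultimately show ?thesis unfolding Rr_carrier using Hgl_mult[OF eu_Hgl a(4)] by simp
qed

lemma aa_Rr: "av Z \<in> carrier Rr"
 unfolding Rr_carrier using av_Hgl[OF Z_sub_W] av_ZW by simp

lemma theta_eq: "theta \<zeta> = eu \<otimes> av Z \<ominus> \<zeta> \<odot> av Z"
proof -
 have "av Z \<otimes> eu = eu \<otimes> av Z" using eu_central[OF av_Hgl[OF Z_sub_W]] by simp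
 then show ?thesis using Rr_diff[OF eu_Rr[OF aa_Rr] Rr.smult_closed[OF aa_Rr, of \<zeta>]] by (simp add: theta_def)
qed

lemma theta_Rr: "theta \<zeta> \<in> carrier Rr"
 using Rr.minus_closed[OF eu_Rr[OF aa_Rr] Rr.smult_closed[OF aa_Rr, of \<zeta>]]
  eu_central[OF av_Hgl[OF Z_sub_W]] by (simp add: theta_def)

lemma theta_mult: "x \<in> carrier Rr \<Longrightarrow> theta \<zeta> \<otimes> x = eu \<otimes> x \<ominus> \<zeta> \<odot> x"
proof -
 assume x: "x \<in> carrier Rr"
 have a: "av Z \<in> carrier H" "x \<in> carrier H" "av Z \<otimes> x = x"
  using av_closed[OF Z_sub_W] Rr_closed[OF x] x Rr_carrier by auto
 show ?thesis unfolding theta_eq using a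
  by (simp add: a_minus_def l_distr l_minus m_assoc smult_mult_left)
qed

lemma theta_central: "x \<in> carrier Rr \<Longrightarrow> x \<otimes> theta \<zeta> = theta \<zeta> \<otimes> x"
proof -
 assume x: "x \<in> carrier Rr"
 have a: "av Z \<in> carrier H" "x \<in> carrier H" "x \<otimes> av Z = x" "x \<in> Hgl"
  using av_closed[OF Z_sub_W] Rr_closed[OF x] x Rr_carrier by auto
 have "x \<otimes> (eu \<otimes> av Z) = eu \<otimes> x"
  using a eu_central[OF a(4)] by (metis eu_closed m_assoc)
 then show ?thesis unfolding theta_mult[OF x] unfolding theta_eq using a
  by (simp add: a_minus_def r_distr r_minus smult_mult_right)
qed

text \<open>As \<open>theta\<close> is central in the corner, the ideal consists of its multiples
  with a single cofactor, whose symbol can then be examined.\<close>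

lemma JJ_eq: "JJ \<zeta> = {theta \<zeta> \<otimes> u | u. u \<in> carrier Rr}"
proof
 let ?I = "{theta \<zeta> \<otimes> u | u. u \<in> carrier Rr}"
 note th = theta_Rr[of \<zeta>]
 have "ideal ?I Rr"
 proof (rule idealI)
  show "ring Rr" by (rule Rr.ring_axioms)
  show "subgroup ?I (add_monoid Rr)"
  proof (rule subgroup.intro)
   show "?I \<subseteq> carrier (add_monoid Rr)" using Rr.m_closed[OF th] by auto
   show "\<one>\<^bsub>add_monoid Rr\<^esub> \<in> ?I" using Rr.r_null[OF th] Rr.zero_closed by (auto intro!: exI[of _ \<zero>])
   fix x y assume "x \<in> ?I"
   then obtain u where u: "x = theta \<zeta> \<otimes> u" "u \<in> carrier Rr" by blast
   {
    assume "y \<in> ?I"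
    then obtain v where v: "y = theta \<zeta> \<otimes> v" "v \<in> carrier Rr" by blast
    have "x \<otimes>\<^bsub>add_monoid Rr\<^esub> y = theta \<zeta> \<otimes> (u \<oplus> v)" using Rr.r_distr[OF u(2) v(2) th] u v by simp
    then show "x \<otimes>\<^bsub>add_monoid Rr\<^esub> y \<in> ?I" using Rr.a_closed[OF u(2) v(2)] by auto
   }
   have "inv\<^bsub>add_monoid Rr\<^esub> x = theta \<zeta> \<otimes> (\<ominus>\<^bsub>Rr\<^esub> u)"
    using Rr.r_minus[OF th u(2)] u by (simp add: a_inv_def)
   then show "inv\<^bsub>add_monoid Rr\<^esub> x \<in> ?I" using Rr.a_inv_closed[OF u(2)] by blast
  qed
  fix a x assume "a \<in> ?I" and x: "x \<in> carrier Rr"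
  then obtain u where u: "a = theta \<zeta> \<otimes> u" "u \<in> carrier Rr" by blast
  have "a \<otimes>\<^bsub>Rr\<^esub> x = theta \<zeta> \<otimes> (u \<otimes> x)" using Rr.m_assoc[OF th u(2) x] u by simp
  then show "a \<otimes>\<^bsub>Rr\<^esub> x \<in> ?I" using Rr.m_closed[OF u(2) x] by auto
  have "x \<otimes>\<^bsub>Rr\<^esub> a = theta \<zeta> \<otimes> (x \<otimes> u)"
   using Rr.m_assoc[OF x th u(2)] Rr.m_assoc[OF th x u(2)] theta_central[OF x] u by simp
  then show "x \<otimes>\<^bsub>Rr\<^esub> a \<in> ?I" using Rr.m_closed[OF x u(2)] by auto
 qed
 moreover have "theta \<zeta> = theta \<zeta> \<otimes> av Z" using Rr.r_one[OF th] by simp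
 then have "{theta \<zeta>} \<subseteq> ?I" using aa_Rr by blast
 ultimately show "JJ \<zeta> \<subseteq> ?I" by (rule Rr.genideal_minimal)
 have id: "ideal (JJ \<zeta>) Rr" using Rr.genideal_ideal th by simp
 have "theta \<zeta> \<in> JJ \<zeta>" using Rr.genideal_self'[OF th] .
 then show "?I \<subseteq> JJ \<zeta>" using ideal.I_r_closed[OF id] by fastforce
qed

lemma JJ_ideal: "calg_ideal Rr (JJ \<zeta>)"
 unfolding calg_ideal_def using Rr.calg_axioms Rr.genideal_ideal theta_Rr by simp

lemma tmul_av_left:
 assumes P: "\<And>u. u \<in> W \<Longrightarrow> Pol k k (P u)"
  and inv: "\<And>z u. z \<in> Z \<Longrightarrow> u \<in> W \<Longrightarrow> P (z \<circ> u) p = P u p" and u: "u \<in> W"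
 shows "tmul (\<lambda>w p. if w \<in> Z then 1 / of_nat (card Z) else 0) P u p = P u p"
proof -
 have "tmul (\<lambda>w p. if w \<in> Z then 1 / of_nat (card Z) else 0) P u p = (\<Sum>z\<in>Z. P u p / of_nat (card Z))"
  unfolding tmul_def
 proof (rule sum.mono_neutral_cong_right[OF finite_W Z_sub_W])
  fix z assume z: "z \<in> Z"
  have "Pol k k (P (invf z \<circ> u))" using P u Z_W[OF z] by simp
  note Pol_act_Z[OF Z_inv[OF z] this, of p]
  then show "(if z \<in> Z then 1 / of_nat (card Z) else 0) * P (invf z \<circ> u) (act (invf z) p) =
    P u p / of_nat (card Z)"
   using inv[OF Z_inv[OF z] u] z by simp
 qed auto
 moreover have "of_nat (card Z) \<noteq> (0::complex)" using finite_Z id_Z by (metis card_eq_0_iff empty_iff of_nat_eq_0_iff)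
 ultimately show ?thesis by simp
qed

lemma tmul_av_right:
 assumes inv: "\<And>z u. z \<in> Z \<Longrightarrow> u \<in> W \<Longrightarrow> P (z \<circ> u) p = P u p" and u: "u \<in> W"
 shows "tmul P (\<lambda>w p. if w \<in> Z then 1 / of_nat (card Z) else 0) u p = P u p"
proof -
 let ?g = "\<lambda>w. if w \<in> Z then 1 / of_nat (card Z) else (0::complex)"
 have "bij_betw (\<lambda>v. u \<circ> invf v) W W"
  using bij_betw_trans[OF bij_betw_inverse bij_betw_translate[OF u]] by (simp add: comp_def)
 then have "tmul P (\<lambda>w p. ?g w) u p = (\<Sum>v\<in>W. P (u \<circ> invf v) p * ?g (invf (u \<circ> invf v) \<circ> u))"
  unfolding tmul_def by (subst sum.reindex_bij_betw[symmetric]) auto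
 also have "\<dots> = (\<Sum>v\<in>W. P (u \<circ> invf v) p * ?g v)"
  using u by (intro sum.cong refl) (auto simp: inv_of_comp comp_assoc)
 also have "\<dots> = (\<Sum>z\<in>Z. P u p / of_nat (card Z))"
 proof (rule sum.mono_neutral_cong_right[OF finite_W Z_sub_W])
  fix z assume z: "z \<in> Z"
  have "u \<circ> invf z = invf z \<circ> u" using Z_inv[OF z] u by (simp add: group_center_def)
  then show "P (u \<circ> invf z) p * ?g z = P u p / of_nat (card Z)"
   using inv[OF Z_inv[OF z] u] z by simp
 qed auto
 moreover have "of_nat (card Z) \<noteq> (0::complex)" using finite_Z id_Z by (metis card_eq_0_iff empty_iff of_nat_eq_0_iff)
 ultimately show ?thesis by simp
qed

text \<open>The identity \<open>av Z \<otimes> x = x\<close> says that the symbol is its own average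
  over \<open>Z\<close>, since central elements do not move the arguments of diagonal
  functions.\<close>

lemma Rr_symbol:
 assumes x: "x \<in> carrier Rr" "R k k x P" and z: "z \<in> Z" and u: "u \<in> W"
 shows "P (z \<circ> u) p = P u p"
proof -
 let ?g = "\<lambda>w p. if w \<in> Z then 1 / of_nat (card Z) else (0::complex)"
 have "av Z \<otimes> x = x" using x Rr_carrier by simp
 then have R: "R k k x (tmul ?g P)" using R_mult[OF x(2) R_av[OF Z_sub_W]] by simp
 have eq: "P v p = (\<Sum>z\<in>Z. P (z \<circ> v) p / of_nat (card Z))" if v: "v \<in> W" for v
 proof -
  have "P v p = tmul ?g P v p" using R_eq[OF x(2) R] .
  also have "\<dots> = (\<Sum>z\<in>Z. P (invf z \<circ> v) p / of_nat (card Z))"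
   unfolding tmul_def
  proof (rule sum.mono_neutral_cong_right[OF finite_W Z_sub_W])
   fix z assume z: "z \<in> Z"
   show "?g z p * P (invf z \<circ> v) (act (invf z) p) = P (invf z \<circ> v) p / of_nat (card Z)"
    using Pol_act_Z[OF Z_inv[OF z] R_Pol[OF x(2)]] z by simp
  qed auto
  also have "\<dots> = (\<Sum>z\<in>Z. P (z \<circ> v) p / of_nat (card Z))"
  proof (rule sum.reindex_bij_betw)
   have "invf (invf z) = z" if "z \<in> Z" for z using Z_W[OF that] by simp
   then show "bij_betw (\<lambda>z. invf z) Z Z"
    using Z_inv by (intro bij_betw_byWitness[of _ "\<lambda>z. invf z"]) auto
  qed
  finally show ?thesis .
 qed
 have "P (z \<circ> u) p = (\<Sum>z'\<in>Z. P (z' \<circ> (z \<circ> u)) p / of_nat (card Z))" using eq[of "z \<circ> u"] Z_W[OF z] u by simp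
 also have "\<dots> = (\<Sum>z'\<in>Z. P (z' \<circ> u) p / of_nat (card Z))"
 proof -
  have "bij_betw (\<lambda>z'. z' \<circ> z) Z Z"
   using z Z_W[OF z] Z_closed Z_inv
   by (intro bij_betw_byWitness[of _ "\<lambda>z'. z' \<circ> invf z"]) (auto simp: comp_assoc)
  from sum.reindex_bij_betw[OF this, of "\<lambda>z'. P (z' \<circ> u) p / of_nat (card Z)"]
  show ?thesis by (simp add: comp_assoc)
 qed
 also have "\<dots> = P u p" using eq[OF u] by simp
 finally show ?thesis .
qed

lemma Rr_Tw: "x \<in> carrier Rr \<Longrightarrow> R k k x P \<Longrightarrow> Tw k P"
 unfolding Tw_def using R_Pol Rr_symbol by blast

text \<open>\<open>P\<close> need only agree on \<open>X\<close> with the symbol of some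
  representative, because the Euler relation identifies elements whose symbols differ by multiples
  of the pairing.\<close>

definition SymA :: "complex \<Rightarrow> int \<Rightarrow> 'a set \<Rightarrow> 'h sym \<Rightarrow> bool" where
 "SymA \<zeta> k Y P \<longleftrightarrow> Tw k P \<and> (\<exists>x P'. Y = quot_class Rr (JJ \<zeta>) x \<and> x \<in> carrier Rr \<and> R k k x P' \<and>
   (\<forall>u\<in>W. \<forall>p\<in>X. P' u p = P u p))"

text \<open>Averaging on both sides puts a lift into the corner. The given family is
  \<open>Z\<close>-invariant on \<open>X\<close> only, so its values are preserved only
  there.\<close>

lemma Tw_lift:
 assumes "Tw k P"
 shows "\<exists>x P'. x \<in> carrier Rr \<and> R k k x P' \<and> (\<forall>u\<in>W. \<forall>p\<in>X. P' u p = P u p)"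
proof -
 let ?g = "\<lambda>w p. if w \<in> Z then 1 / of_nat (card Z) else (0::complex)"
 have PP: "\<And>u. u \<in> W \<Longrightarrow> Pol k k (P u)" and inv: "\<And>z u p. z \<in> Z \<Longrightarrow> u \<in> W \<Longrightarrow> p \<in> X \<Longrightarrow> P (z \<circ> u) p = P u p"
  using assms by (auto simp: Tw_def)
 \<comment> \<open>Extended by zero, since the lifts of functions indexed by \<open>W\<close> have
   symbols that vanish off \<open>W\<close>.\<close>
 define P0 where "P0 w p = (if w \<in> W then P w p else 0)" for w p
 obtain x0 where x0: "R k k x0 P0" using R_lift[of k k P] PP unfolding P0_def by blast
 have 1: "R k k (av Z \<otimes> x0 \<otimes> av Z) (tmul (tmul ?g P0) ?g)"
  using R_mult[OF R_av[OF Z_sub_W] R_mult[OF x0 R_av[OF Z_sub_W]]] by simp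
 have 2: "tmul ?g P0 u p = P u p" if "u \<in> W" "p \<in> X" for u p
 proof -
  have "tmul ?g P0 u p = tmul ?g P u p"
   unfolding tmul_def by (rule sum.cong) (use that in \<open>auto simp: P0_def\<close>)
  also have "\<dots> = P u p" by (rule tmul_av_left[OF PP]) (use inv that in auto)
  finally show ?thesis .
 qed
 have "tmul (tmul ?g P0) ?g u p = P u p" if "u \<in> W" "p \<in> X" for u p
 proof -
  have "tmul (tmul ?g P0) ?g u p = tmul P ?g u p"
   unfolding tmul_def[of _ ?g] by (rule sum.cong) (use 2 that in auto)
  also have "\<dots> = P u p" by (rule tmul_av_right) (use inv that in auto)
  finally show ?thesis .
 qed
 moreover have "av Z \<otimes> x0 \<otimes> av Z \<in> carrier Rr" using x0 by (intro corner_mem) (auto simp: Hgl_def)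
 ultimately show ?thesis using 1 by blast
qed

text \<open>If \<open>u\<close> has nonzero symbol Q in degree l, then
  \<open>theta \<zeta> \<otimes> u\<close> has symbol q Q in degree l + 1, with q the pairing, and
  this is nonzero. Hence any symbol of it in degree \<open>k\<close> is q Q or 0, and both vanish on
  \<open>X\<close>.\<close>

lemma symbol_unique:
 assumes u: "u \<in> carrier Rr" and x: "R k k (theta \<zeta> \<otimes> u) P" and w: "w \<in> W" and p: "p \<in> X"
 shows "P w p = 0"
proof -
 have xc: "theta \<zeta> \<otimes> u = eu \<otimes> u \<ominus> \<zeta> \<odot> u" using theta_mult[OF u] .
 \<comment> \<open>The induction lowers the degree of \<open>u\<close> as long as its symbol there
   is zero.\<close>
 have "l < int n \<Longrightarrow> R l l u Q \<Longrightarrow> P w p = 0" for n l Q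
 proof (induction n arbitrary: l Q)
  case 0
  then have "u = \<zero>" using R_neg by auto
  then have "R k k \<zero> P" using x xc by (simp add: a_minus_def)
  then show ?case by (rule R_unique)
 next
  case (Suc n)
  show ?case
  proof (cases "\<forall>w p. Q w p = 0")
   case True
   then obtain Q' where "R (l - 1) (l - 1) u Q'" using R_kernel[OF Suc.prems(2)] by blast
   moreover have "l - 1 < int n" using Suc.prems(1) by simp
   ultimately show ?thesis using Suc.IH by blast
  next
   case False
   then obtain w1 p1 where Q1: "Q w1 p1 \<noteq> 0" by blast
   have "tmul (\<lambda>w p. if w = id then pr (fst p) (snd p) else 0) Q w p = pr (fst p) (snd p) * Q w p" for w p
   proof -
    have "tmul (\<lambda>w p. if w = id then pr (fst p) (snd p) else 0) Q w p =
      (\<Sum>v\<in>W. if v = id then pr (fst p) (snd p) * Q w p else 0)"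
     unfolding tmul_def by (rule sum.cong) auto
    then show ?thesis using finite_W by simp
   qed
   then have eq: "tmul (\<lambda>w p. if w = id then pr (fst p) (snd p) else 0) Q = (\<lambda>w p. pr (fst p) (snd p) * Q w p)"
    by (intro ext)
   have r1: "R (1 + l) (1 + l) (eu \<otimes> u) (\<lambda>w p. pr (fst p) (snd p) * Q w p)"
    using R_mult[OF Suc.prems(2) R_eu] unfolding eq .
   have r2: "R (1 + l) (1 + l) (\<zeta> \<odot> u) (\<lambda>_ _. 0)"
    by (rule R_cong[OF R_low[OF R_smult[OF Suc.prems(2)]]]) auto
   have y: "R (1 + l) (1 + l) (theta \<zeta> \<otimes> u) (\<lambda>w p. pr (fst p) (snd p) * Q w p)"
    unfolding xc by (rule R_cong[OF R_diff[OF r1 r2]]) auto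
   \<comment> \<open>For \<open>k\<close> above \<open>1 + l\<close> the symbol is 0, for equality
     it is q Q, and \<open>k\<close> below \<open>1 + l\<close> would make q Q zero.\<close>
   show ?thesis
   proof (cases "1 + l \<le> k")
    case True
    obtain Q' where Q': "R (1 + l + int (nat (k - (1 + l)))) (1 + l + int (nat (k - (1 + l)))) (theta \<zeta> \<otimes> u) Q'"
     "nat (k - (1 + l)) > 0 \<longrightarrow> Q' = (\<lambda>_ _. 0)" using R_raise[OF y] by blast
    have "R k k (theta \<zeta> \<otimes> u) Q'" using Q'(1) True by simp
    then have PQ: "P w p = Q' w p" using R_eq[OF x] by blast
    show ?thesis
    proof (cases "1 + l = k")
     case True
     then show ?thesis using R_eq[OF x, of "\<lambda>w p. pr (fst p) (snd p) * Q w p" w p] y p by (simp add: X_def)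
    next
     case False
     then show ?thesis using PQ Q'(2) True by simp
    qed
   next
    case False
    obtain Q' where Q': "R (k + int (nat (1 + l - k))) (k + int (nat (1 + l - k))) (theta \<zeta> \<otimes> u) Q'"
     "nat (1 + l - k) > 0 \<longrightarrow> Q' = (\<lambda>_ _. 0)" using R_raise[OF x] by blast
    have z: "R (1 + l) (1 + l) (theta \<zeta> \<otimes> u) (\<lambda>_ _. 0)" using Q' False by simp
    \<comment> \<open>At \<open>(b, b)\<close> the pairing is 1, so it is not the zero function and
      can be cancelled.\<close>
    obtain b where b: "b \<in> Bs" using card_Bs by fastforce
    have "Q w1 p1 = 0"
    proof (rule Pol_cancel[OF R_Pol[OF Suc.prems(2)] Pol_qI[of id id Bs], where ?p0.0 = "(b, b)"])
     show "qI id id Bs p * Q w1 p = 0" for p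
      using R_eq[OF y z, where w = w1 and p = p] dualb_pr[OF dualb_Bs, of "fst p" "snd p"] by (simp add: qI_def)
     show "qI id id Bs (b, b) \<noteq> 0"
      using dualb_pr[OF dualb_Bs, of b b] b by (simp add: qI_def pr_Bs)
    qed
    then show ?thesis using Q1 by simp
   qed
  qed
 qed
 moreover obtain l Q where "R l l u Q" using u Rr_carrier unfolding Hgl_def by blast
 moreover have "l < int (nat (l + 1))" by simp
 ultimately show ?thesis by blast
qed

text \<open>The pairing divides a symbol that vanishes on \<open>X\<close>, since there are at least
  two coordinates. Its quotient lifts to a cofactor of \<open>theta \<zeta>\<close>, and the
  difference has lower degree.\<close>

lemma symbol_kernel:
 assumes x: "x \<in> carrier Rr" "R k k x P" and P0: "\<And>u p. u \<in> W \<Longrightarrow> p \<in> X \<Longrightarrow> P u p = 0"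
 shows "\<exists>v y Q. v \<in> carrier Rr \<and> y \<in> carrier Rr \<and> x = theta \<zeta> \<otimes> v \<oplus> y \<and> R (k - 1) (k - 1) y Q"
proof -
 obtain c d where cd: "c \<in> Bs" "d \<in> Bs" "c \<noteq> d"
  using card_Bs finite_Basis by (metis card_2_iff' card_le_Suc0_iff_eq not_numeral_le_zero numeral_2_eq_2 not_less_eq_eq)
 have "\<exists>Q. Pol (k - 1) (k - 1) Q \<and> (\<forall>p. P u p = qI id id Bs p * Q p)" if u: "u \<in> W" for u
  by (rule quadric_divides[OF dualb_Bs order.refl cd R_Pol[OF x(2)]])
   (use P0[OF u] X_qI[OF dualb_Bs] in blast)
 then have "\<forall>u. \<exists>Q. u \<in> W \<longrightarrow> Pol (k - 1) (k - 1) Q \<and> (\<forall>p. P u p = qI id id Bs p * Q p)" by blast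
 from choice[OF this] obtain Q where Q: "\<And>u. u \<in> W \<Longrightarrow> Pol (k - 1) (k - 1) (Q u)"
  "\<And>u p. u \<in> W \<Longrightarrow> P u p = qI id id Bs p * Q u p" by blast
 have qI: "qI id id Bs p = pr (fst p) (snd p)" for p
  using dualb_pr[OF dualb_Bs, of "fst p" "snd p"] by (simp add: qI_def)
 define Q0 where "Q0 w p = (if w \<in> W then Q w p else 0)" for w p
 obtain v0 where v0: "R (k - 1) (k - 1) v0 Q0" using R_lift[of "k - 1" "k - 1" Q] Q(1) unfolding Q0_def by blast
 have v0c: "v0 \<in> carrier H" "v0 \<in> Hgl" using R_closed[OF v0] v0 by (auto simp: Hgl_def)
 have "tmul (\<lambda>w p. if w = id then pr (fst p) (snd p) else 0) Q0 w p = pr (fst p) (snd p) * Q0 w p" for w p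
 proof -
  have "tmul (\<lambda>w p. if w = id then pr (fst p) (snd p) else 0) Q0 w p =
    (\<Sum>v\<in>W. if v = id then pr (fst p) (snd p) * Q0 w p else 0)"
   unfolding tmul_def by (rule sum.cong) auto
  then show ?thesis using finite_W by simp
 qed
 then have 1: "R k k (eu \<otimes> v0) (\<lambda>w p. pr (fst p) (snd p) * Q0 w p)"
  by (intro R_cong[OF R_mult[OF v0 R_eu]]) auto
 have 2: "R k k (\<zeta> \<odot> v0) (\<lambda>_ _. 0)"
  by (rule R_cong[OF R_low[OF R_smult[OF v0]]]) auto
 define y0 where "y0 = x \<ominus> (eu \<otimes> v0 \<ominus> \<zeta> \<odot> v0)"
 have "P w p - (pr (fst p) (snd p) * Q0 w p - 0) = 0" for w p
  using Q(2)[of w p] R_offW[OF x(2), of w p] by (simp add: Q0_def qI)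
 from R_kernel[OF R_diff[OF x(2) R_diff[OF 1 2]] this]
 obtain Q1 where Q1: "R (k - 1) (k - 1) y0 Q1" unfolding y0_def by blast
 have y0c: "y0 \<in> carrier H" using R_closed[OF Q1] .
 let ?a = "av Z"
 have ac: "?a \<in> carrier H" using av_closed[OF Z_sub_W] .
 have xc: "x \<in> carrier H" "?a \<otimes> x = x" "x \<otimes> ?a = x" using x(1) Rr_carrier Rr_closed by auto
 \<comment> \<open>Multiplying by the average on both sides moves cofactor and remainder into the
   corner. It fixes \<open>x\<close> and commutes with the Euler element.\<close>
 define v where "v = ?a \<otimes> v0 \<otimes> ?a"
 define y where "y = ?a \<otimes> y0 \<otimes> ?a"
 have vR: "v \<in> carrier Rr" unfolding v_def by (rule corner_mem[OF v0c(2)])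
 have yR: "y \<in> carrier Rr" unfolding y_def using Q1 by (intro corner_mem) (auto simp: Hgl_def)
 have vc: "v \<in> carrier H" using Rr_closed[OF vR] .
 have "?a \<otimes> (eu \<otimes> v0) \<otimes> ?a = eu \<otimes> v"
 proof -
  have "?a \<otimes> (eu \<otimes> v0) \<otimes> ?a = (?a \<otimes> eu) \<otimes> v0 \<otimes> ?a" using ac v0c by (simp add: m_assoc)
  also have "\<dots> = eu \<otimes> v" using eu_central[OF av_Hgl[OF Z_sub_W]] ac v0c unfolding v_def
   by (metis eu_closed m_assoc m_closed)
  finally show ?thesis .
 qed
 then have "?a \<otimes> y0 \<otimes> ?a = x \<ominus> (eu \<otimes> v \<ominus> \<zeta> \<odot> v)"
  unfolding y0_def v_def using ac v0c xc
  by (simp add: a_minus_def l_distr r_distr l_minus r_minus smult_mult_left smult_mult_right)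
 then have "y = x \<ominus> theta \<zeta> \<otimes> v" unfolding y_def theta_mult[OF vR] .
 moreover have "theta \<zeta> \<otimes> v \<in> carrier H" using theta_mult[OF vR] vc by simp
 ultimately have "x = theta \<zeta> \<otimes> v \<oplus> y"
  using xc(1) by (simp add: a_minus_def a_ac r_neg)
 moreover obtain Q2 where "R (k - 1) (k - 1) y Q2"
  using R_mult[OF R_av[OF Z_sub_W] R_mult[OF Q1 R_av[OF Z_sub_W]]] unfolding y_def by auto
 ultimately show ?thesis using vR yR by blast
qed

text \<open>The Euler relation enters through two axioms: \<open>Sym_kernel\<close>, by subtracting
  a multiple of \<open>theta \<zeta>\<close>, and \<open>Sym_unique\<close>, by computing symbols of
  such multiples. Together they place the symbols of \<open>A\<close> on \<open>X\<close>.\<close>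

lemma filtered: "filtered_algebra scale Bs W (AA \<zeta>) (quot_class Rr (JJ \<zeta>) (av W)) (SymA \<zeta>)"
proof -
 interpret Q: calg_ideal Rr "JJ \<zeta>" by (rule JJ_ideal)
 interpret A: calg "AA \<zeta>" by (rule Q.quot_calg)
 let ?c = "quot_class Rr (JJ \<zeta>)"
 have eR: "av W \<in> carrier Rr" unfolding Rr_carrier using av_Hgl[OF order.refl] av_ZW by simp
 show ?thesis
 proof (intro filtered_algebra.intro filtered_algebra_axioms.intro)
  show "irred_group scale Bs W" by (rule irred_group_axioms)
  show "ring (AA \<zeta>)" by (rule A.ring_axioms)
  show "c \<odot>\<^bsub>AA \<zeta>\<^esub> x \<in> carrier (AA \<zeta>)" if "x \<in> carrier (AA \<zeta>)" for x c using that by simp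
  show "(c \<odot>\<^bsub>AA \<zeta>\<^esub> x) \<otimes>\<^bsub>AA \<zeta>\<^esub> y = c \<odot>\<^bsub>AA \<zeta>\<^esub> (x \<otimes>\<^bsub>AA \<zeta>\<^esub> y)"
   if "x \<in> carrier (AA \<zeta>)" "y \<in> carrier (AA \<zeta>)" for x y c using that by (rule A.smult_mult_left)
  show "x \<in> carrier (AA \<zeta>)" if "SymA \<zeta> k x P" for k x P
   using that unfolding SymA_def by (auto simp: Q.quot_carrier)
  show "Tw k P" if "SymA \<zeta> k x P" for k x P using that unfolding SymA_def by blast
  show "\<exists>k P. SymA \<zeta> k Y P" if Y: "Y \<in> carrier (AA \<zeta>)" for Y
  proof -
   obtain x where x: "x \<in> carrier Rr" "Y = ?c x" using Y by (auto simp: Q.quot_carrier)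
   obtain k P where "R k k x P" using x(1) Rr_carrier unfolding Hgl_def by blast
   then show ?thesis using x Rr_Tw unfolding SymA_def by blast
  qed
  show "\<exists>Y. SymA \<zeta> k Y P" if "Tw k P" for k P
   using Tw_lift[OF that] that unfolding SymA_def by blast
  show "SymA \<zeta> k (Y \<oplus>\<^bsub>AA \<zeta>\<^esub> Y') (\<lambda>u p. P u p + P' u p)" if S: "SymA \<zeta> k Y P" "SymA \<zeta> k Y' P'" for k Y P Y' P'
  proof -
   obtain x Q where x: "Y = ?c x" "x \<in> carrier Rr" "R k k x Q" "\<And>u p. u \<in> W \<Longrightarrow> p \<in> X \<Longrightarrow> Q u p = P u p"
    using S(1) unfolding SymA_def by blast
   obtain x' Q' where x': "Y' = ?c x'" "x' \<in> carrier Rr" "R k k x' Q'" "\<And>u p. u \<in> W \<Longrightarrow> p \<in> X \<Longrightarrow> Q' u p = P' u p"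
    using S(2) unfolding SymA_def by blast
   have "Y \<oplus>\<^bsub>AA \<zeta>\<^esub> Y' = ?c (x \<oplus> x')" using Q.quot_ops(1)[OF x(2) x'(2)] x x' by simp
   moreover have "x \<oplus> x' \<in> carrier Rr" using Rr.a_closed[OF x(2) x'(2)] by simp
   moreover have "Tw k (\<lambda>u p. P u p + P' u p)" using S unfolding SymA_def Tw_def by (auto intro: Pol_add)
   ultimately show ?thesis using R_add[OF x(3) x'(3)] x(4) x'(4) unfolding SymA_def
    by (intro conjI exI[of _ "x \<oplus> x'"] exI[of _ "\<lambda>u p. Q u p + Q' u p"]) auto
  qed
  show "SymA \<zeta> k (\<ominus>\<^bsub>AA \<zeta>\<^esub> Y) (\<lambda>u p. - P u p)" if S: "SymA \<zeta> k Y P" for k Y P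
  proof -
   obtain x Q where x: "Y = ?c x" "x \<in> carrier Rr" "R k k x Q" "\<And>u p. u \<in> W \<Longrightarrow> p \<in> X \<Longrightarrow> Q u p = P u p"
    using S unfolding SymA_def by blast
   have "\<ominus>\<^bsub>AA \<zeta>\<^esub> Y = ?c (\<ominus> x)" using Q.quot_minus[OF x(2)] x Rr_minus by simp
   moreover have "\<ominus> x \<in> carrier Rr" using Rr.a_inv_closed[OF x(2)] Rr_minus[OF x(2)] by simp
   moreover have "Tw k (\<lambda>u p. - P u p)" using S unfolding SymA_def Tw_def by (auto intro: Pol_uminus)
   ultimately show ?thesis using R_minus[OF x(3)] x(4) unfolding SymA_def
    by (intro conjI exI[of _ "\<ominus> x"] exI[of _ "\<lambda>u p. - Q u p"]) auto
  qed
  show "SymA \<zeta> (k + l) (Y \<otimes>\<^bsub>AA \<zeta>\<^esub> Y') (tmul P P')" if S: "SymA \<zeta> k Y P" "SymA \<zeta> l Y' P'" for k Y P l Y' P'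
  proof -
   obtain x Q where x: "Y = ?c x" "x \<in> carrier Rr" "R k k x Q" "\<And>u p. u \<in> W \<Longrightarrow> p \<in> X \<Longrightarrow> Q u p = P u p"
    using S(1) unfolding SymA_def by blast
   obtain x' Q' where x': "Y' = ?c x'" "x' \<in> carrier Rr" "R l l x' Q'" "\<And>u p. u \<in> W \<Longrightarrow> p \<in> X \<Longrightarrow> Q' u p = P' u p"
    using S(2) unfolding SymA_def by blast
   have "Y \<otimes>\<^bsub>AA \<zeta>\<^esub> Y' = ?c (x \<otimes> x')" using Q.quot_ops(2)[OF x(2) x'(2)] x x' by simp
   moreover have xx: "x \<otimes> x' \<in> carrier Rr" using Rr.m_closed[OF x(2) x'(2)] by simp
   moreover have R: "R (k + l) (k + l) (x \<otimes> x') (tmul Q Q')" by (rule R_mult[OF x'(3) x(3)])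
   moreover have eq: "tmul Q Q' u p = tmul P P' u p" if "u \<in> W" "p \<in> X" for u p
    unfolding tmul_def by (rule sum.cong) (use that x(4) x'(4) in auto)
   moreover have "Tw (k + l) (tmul P P')"
    unfolding Tw_def
   proof (intro conjI ballI)
    fix u assume u: "u \<in> W"
    have P: "Tw k P" "Tw l P'" using S unfolding SymA_def by auto
    show "Pol (k + l) (k + l) (tmul P P' u)" unfolding tmul_def[abs_def]
    proof (intro Pol_sum Pol_mult Pol_act)
     fix v assume v: "v \<in> W"
     then have "invf v \<circ> u \<in> W" using u by simp
     then show "Pol k k (P v)" "Pol l l (P' (invf v \<circ> u))" using P v unfolding Tw_def by blast+
     show "invf v \<in> W" using v by simp
    qed
   next
    fix z u p assume z: "z \<in> Z" and u: "u \<in> W" and p: "p \<in> X"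
    have "tmul Q Q' (z \<circ> u) p = tmul Q Q' u p" by (rule Rr_symbol[OF xx R z u])
    then show "tmul P P' (z \<circ> u) p = tmul P P' u p" using eq p u Z_W[OF z] by simp
   qed
   ultimately show ?thesis unfolding SymA_def by blast
  qed
  show "\<exists>P'. SymA \<zeta> (k - 1) Y P'" if S: "SymA \<zeta> k Y P" and P0: "\<And>u p. u \<in> W \<Longrightarrow> p \<in> X \<Longrightarrow> P u p = 0" for k Y P
  proof -
   obtain x Q where x: "Y = ?c x" "x \<in> carrier Rr" "R k k x Q" "\<And>u p. u \<in> W \<Longrightarrow> p \<in> X \<Longrightarrow> Q u p = P u p"
    using S(1) unfolding SymA_def by blast
   have Q0: "Q u p = 0" if "u \<in> W" "p \<in> X" for u p using x(4)[OF that] P0[OF that] by simp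
   obtain v y Q1 where v: "v \<in> carrier Rr" "y \<in> carrier Rr" "x = theta \<zeta> \<otimes> v \<oplus> y" "R (k - 1) (k - 1) y Q1"
    using symbol_kernel[OF x(2,3) Q0] by blast
   have "theta \<zeta> \<otimes> v \<in> carrier Rr" using Rr.m_closed[OF theta_Rr v(1)] by simp
   moreover have "theta \<zeta> \<otimes> v \<in> JJ \<zeta>" unfolding JJ_eq using v(1) by blast
   ultimately have tv: "theta \<zeta> \<otimes> v \<in> carrier Rr" "theta \<zeta> \<otimes> v \<in> JJ \<zeta>" .
   have "x \<ominus> y = theta \<zeta> \<otimes> v"
    unfolding v(3) using Rr_closed[OF tv(1)] Rr_closed[OF v(2)]
    by (simp add: a_minus_def a_assoc r_neg)
   then have "?c x = ?c y" using Q.cls_eq_iff[OF x(2) v(2)] tv(2) Rr_diff[OF x(2) v(2)] by simp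
   then show ?thesis using x(1) v(2,4) Rr_Tw[OF v(2,4)] unfolding SymA_def by blast
  qed
  show "Y = \<zero>\<^bsub>AA \<zeta>\<^esub>" if S: "SymA \<zeta> k Y P" and k: "k < 0" for k Y P
  proof -
   obtain x Q where x: "Y = ?c x" "R k k x Q" using S(1) unfolding SymA_def by blast
   then have "x = \<zero>" using R_neg k by blast
   then show ?thesis using x(1) Q.quot_zero by simp
  qed
  show "SymA \<zeta> (k + 1) Y (\<lambda>_ _. 0)" if S: "SymA \<zeta> k Y P" for k Y P
  proof -
   obtain x Q where x: "Y = ?c x" "x \<in> carrier Rr" "R k k x Q" using S unfolding SymA_def by blast
   then show ?thesis using R_low[OF x(3)] Pol_zero unfolding SymA_def Tw_def by blast
  qed
  show "P u p = 0" if S: "SymA \<zeta> k \<zero>\<^bsub>AA \<zeta>\<^esub> P" and u: "u \<in> W" and p: "p \<in> X" for k P u p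
  proof -
   obtain x Q where x: "\<zero>\<^bsub>AA \<zeta>\<^esub> = ?c x" "x \<in> carrier Rr" "R k k x Q" "\<And>u p. u \<in> W \<Longrightarrow> p \<in> X \<Longrightarrow> Q u p = P u p"
    using S unfolding SymA_def by blast
   have "?c x = ?c \<zero>" using x(1) Q.quot_zero by simp
   then have "x \<ominus>\<^bsub>Rr\<^esub> \<zero> \<in> JJ \<zeta>" using Q.cls_eq_iff[OF x(2), of \<zero>] Rr.zero_closed by simp
   then have "x \<in> JJ \<zeta>" using Rr_diff[OF x(2), of \<zero>] Rr.zero_closed Rr_closed[OF x(2)] by (simp add: a_minus_def)
   then obtain v where v: "x = theta \<zeta> \<otimes> v" "v \<in> carrier Rr" using JJ_eq by blast
   have "Q u p = 0" using symbol_unique[OF v(2) _ u p, of k \<zeta> Q] x(3) v(1) by simp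
   then show ?thesis using x(4)[OF u p] by simp
  qed
  show "SymA \<zeta> k Y P'" if S: "SymA \<zeta> k Y P" and "Tw k P'" "\<And>u p. u \<in> W \<Longrightarrow> p \<in> X \<Longrightarrow> P u p = P' u p" for k Y P P'
  proof -
   obtain x Q where x: "Y = ?c x" "x \<in> carrier Rr" "R k k x Q" "\<And>u p. u \<in> W \<Longrightarrow> p \<in> X \<Longrightarrow> Q u p = P u p"
    using S(1) unfolding SymA_def by blast
   then have "\<And>u p. u \<in> W \<Longrightarrow> p \<in> X \<Longrightarrow> Q u p = P' u p" using that(3) by simp
   then show ?thesis using x(1-3) that(2) unfolding SymA_def by blast
  qed
  show "?c (av W) \<in> carrier (AA \<zeta>)" using eR by (simp add: Q.quot_carrier)
  show "?c (av W) \<otimes>\<^bsub>AA \<zeta>\<^esub> ?c (av W) = ?c (av W)" using Q.quot_ops(2)[OF eR eR] av_ZW(4) by simp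
  show "SymA \<zeta> 0 (?c (av W)) (\<lambda>_ _. 1 / of_nat (card W))"
  proof -
   have "Tw 0 (\<lambda>_ _. 1 / of_nat (card W))" by (simp add: Tw_def Pol_const)
   then show ?thesis using eR R_av[OF order.refl] unfolding SymA_def by fastforce
  qed
 qed
qed

theorem cherednik_double_centralizer:
 defines "e \<equiv> \<lambda>\<zeta>. quot_class Rr (JJ \<zeta>) (av W)"
 shows "left_mult (AA \<zeta>) (left_ideal_gen (AA \<zeta>) (e \<zeta>)) \<in>
   alg_iso (AA \<zeta>) (right_End (AA \<zeta>) (carrier (corner (AA \<zeta>) (e \<zeta>))) (left_ideal_gen (AA \<zeta>) (e \<zeta>)))"
 unfolding e_def by (rule filtered_algebra.double_centralizer[OF filtered])

end

section \<open>Tensor algebras and crossed products\<close>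

lemma (in abelian_monoid) finsum_swap:
 assumes "finite I" "\<And>i j. i \<in> I \<Longrightarrow> j \<in> J \<Longrightarrow> f i j \<in> carrier G"
 shows "(\<Oplus>i\<in>I. \<Oplus>j\<in>J. f i j) = (\<Oplus>j\<in>J. \<Oplus>i\<in>I. f i j)"
 using assms
proof (induction I rule: finite_induct)
 case (insert x I)
 have 1: "(\<lambda>i. \<Oplus>j\<in>J. f i j) \<in> I \<rightarrow> carrier G" "(\<Oplus>j\<in>J. f x j) \<in> carrier G"
  using insert.prems by (auto intro!: finsum_closed)
 have "(\<Oplus>i\<in>insert x I. \<Oplus>j\<in>J. f i j) = (\<Oplus>j\<in>J. f x j) \<oplus> (\<Oplus>i\<in>I. \<Oplus>j\<in>J. f i j)"
  using finsum_insert[OF insert.hyps 1] .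
 also have "\<dots> = (\<Oplus>j\<in>J. f x j) \<oplus> (\<Oplus>j\<in>J. \<Oplus>i\<in>I. f i j)" using insert by simp
 also have "\<dots> = (\<Oplus>j\<in>J. f x j \<oplus> (\<Oplus>i\<in>I. f i j))"
  by (rule finsum_addf[symmetric]) (use insert.prems in \<open>auto intro!: finsum_closed\<close>)
 also have "\<dots> = (\<Oplus>j\<in>J. \<Oplus>i\<in>insert x I. f i j)"
 proof (rule finsum_cong'[OF refl])
  show "(\<lambda>j. \<Oplus>i\<in>insert x I. f i j) \<in> J \<rightarrow> carrier G" using insert.prems by (auto intro!: finsum_closed)
  fix j assume j: "j \<in> J"
  show "f x j \<oplus> (\<Oplus>i\<in>I. f i j) = (\<Oplus>i\<in>insert x I. f i j)"
   using insert j by (subst finsum_insert) auto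
 qed
 finally show ?case .
qed simp

lemma poly_mapping_keys_induct [consumes 1, case_names zero single add]:
 fixes p :: "'k \<Rightarrow>\<^sub>0 'c::comm_monoid_add"
 assumes "keys p \<subseteq> S" "P 0" "\<And>k c. k \<in> S \<Longrightarrow> P (single k c)"
  "\<And>p q. keys p \<subseteq> S \<Longrightarrow> keys q \<subseteq> S \<Longrightarrow> P p \<Longrightarrow> P q \<Longrightarrow> P (p + q)"
 shows "P p"
proof -
 let ?s = "\<lambda>K. \<Sum>k\<in>K. single k (lookup p k)"
 have "p = ?s (keys p)"
  by (rule poly_mapping_eqI)
   (simp add: lookup_sum lookup_single when_def in_keys_iff)
 moreover have "keys (?s K) \<subseteq> S \<and> P (?s K)" if "finite K" "K \<subseteq> S" for K
  using that
 proof (induction K rule: finite_induct)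
  case empty
  then show ?case using assms(2) by simp
 next
  case (insert k K)
  have k: "keys (single k (lookup p k)) \<subseteq> S" using insert by auto
  moreover have "keys (single k (lookup p k) + ?s K) \<subseteq> S"
   using Poly_Mapping.keys_add[of "single k (lookup p k)" "?s K"] k insert by blast
  ultimately show ?case using insert assms(3,4) by simp
 qed
 ultimately show ?thesis using assms(1) by (metis finite_keys)
qed

lemma poly_mapping_single_induct [case_names zero single add]:
 fixes p :: "'k \<Rightarrow>\<^sub>0 'c::comm_monoid_add"
 assumes "P 0" "\<And>k c. P (single k c)" "\<And>p q. P p \<Longrightarrow> P q \<Longrightarrow> P (p + q)"
 shows "P p"
 using poly_mapping_keys_induct[OF subset_UNIV, of P p] assms by blast

definition words :: "'v set \<Rightarrow> 'v fword set" where "words V = {w. set (letters w) \<subseteq> V}"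

lemma free_alg_sel [simp]:
 "carrier (free_alg V) = {p. keys p \<subseteq> words V}"
 "p \<otimes>\<^bsub>free_alg V\<^esub> q = p * q" "p \<oplus>\<^bsub>free_alg V\<^esub> q = p + q" "\<zero>\<^bsub>free_alg V\<^esub> = 0" "\<one>\<^bsub>free_alg V\<^esub> = 1"
 "c \<odot>\<^bsub>free_alg V\<^esub> p = single 0 c * p"
 by (auto simp: free_alg_def words_def)

lemma words_zero [simp]: "0 \<in> words V"
 by (simp add: words_def zero_fword_def)

lemma words_add: "v \<in> words V \<Longrightarrow> w \<in> words V \<Longrightarrow> v + w \<in> words V"
 by (simp add: words_def plus_fword_def)

lemma free_mult_closed:
 "keys p \<subseteq> words V \<Longrightarrow> keys q \<subseteq> words V \<Longrightarrow> keys (p * q) \<subseteq> words V"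
 using Poly_Mapping.keys_mult[of p q] words_add by fastforce

lemma free_add_closed:
 "keys p \<subseteq> A \<Longrightarrow> keys q \<subseteq> A \<Longrightarrow> keys (p + q) \<subseteq> A"
 using Poly_Mapping.keys_add[of p q] by blast

lemma single_zero_closed: "keys (single 0 c) \<subseteq> words V"
 by auto

lemma single_central: "p * single 0 c = single 0 c * (p :: 'v fword \<Rightarrow>\<^sub>0 complex)"
 by (induction p rule: poly_mapping_single_induct)
  (simp_all add: mult_single distrib_left distrib_right mult.commute)

lemma free_alg_calg: "calg (free_alg V)"
proof -
 have "ring (free_alg V)"
 proof (rule ringI)
  show "abelian_group (free_alg V)"
  proof (rule abelian_groupI)
   show "\<exists>y\<in>carrier (free_alg V). y \<oplus>\<^bsub>free_alg V\<^esub> x = \<zero>\<^bsub>free_alg V\<^esub>" if "x \<in> carrier (free_alg V)" for x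
    using that by (intro bexI[of _ "-x"]) auto
  qed (auto simp: add_ac dest: free_add_closed)
  show "monoid (free_alg V)"
   by (rule monoidI) (auto simp: mult.assoc dest: free_mult_closed)
 qed (auto simp: distrib_left distrib_right)
 then interpret F: ring "free_alg V" .
 show ?thesis
 proof (unfold_locales)
  fix c d :: complex and x y :: "'a fword \<Rightarrow>\<^sub>0 complex"
  assume x: "x \<in> carrier (free_alg V)"
  show "c \<odot>\<^bsub>free_alg V\<^esub> x \<in> carrier (free_alg V)" using x free_mult_closed[OF single_zero_closed] by simp
  show "(c + d) \<odot>\<^bsub>free_alg V\<^esub> x = c \<odot>\<^bsub>free_alg V\<^esub> x \<oplus>\<^bsub>free_alg V\<^esub> d \<odot>\<^bsub>free_alg V\<^esub> x"
   by (simp add: single_add distrib_right)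
  show "c \<odot>\<^bsub>free_alg V\<^esub> (d \<odot>\<^bsub>free_alg V\<^esub> x) = (c * d) \<odot>\<^bsub>free_alg V\<^esub> x"
   by (simp add: mult.assoc[symmetric] mult_single)
  show "1 \<odot>\<^bsub>free_alg V\<^esub> x = x" by simp
  assume y: "y \<in> carrier (free_alg V)"
  show "c \<odot>\<^bsub>free_alg V\<^esub> (x \<oplus>\<^bsub>free_alg V\<^esub> y) = c \<odot>\<^bsub>free_alg V\<^esub> x \<oplus>\<^bsub>free_alg V\<^esub> c \<odot>\<^bsub>free_alg V\<^esub> y"
   by (simp add: distrib_left)
  show "c \<odot>\<^bsub>free_alg V\<^esub> x \<otimes>\<^bsub>free_alg V\<^esub> y = c \<odot>\<^bsub>free_alg V\<^esub> (x \<otimes>\<^bsub>free_alg V\<^esub> y)"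
   by (simp add: mult.assoc)
  show "x \<otimes>\<^bsub>free_alg V\<^esub> (c \<odot>\<^bsub>free_alg V\<^esub> y) = c \<odot>\<^bsub>free_alg V\<^esub> (x \<otimes>\<^bsub>free_alg V\<^esub> y)"
   using single_central[of x c] by (metis free_alg_sel(2) free_alg_sel(6) mult.assoc)
 qed
qed

lemma free_alg_minus: "p \<in> carrier (free_alg V) \<Longrightarrow> \<ominus>\<^bsub>free_alg V\<^esub> p = - p"
proof -
 interpret F: calg "free_alg V" by (rule free_alg_calg)
 assume "p \<in> carrier (free_alg V)"
 then show ?thesis by (intro F.minus_equality) auto
qed

lemma free_gen_closed: "v \<in> V \<Longrightarrow> free_gen v \<in> carrier (free_alg V)"
 by (auto simp: free_gen_def words_def)

lemma free_map_single: "free_map \<phi> (single w c) = single (FWord (map \<phi> (letters w))) c"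
 by (simp add: free_map_def)

lemma free_map_superset:
 assumes "finite K" "keys p \<subseteq> K"
 shows "free_map \<phi> p = (\<Sum>w\<in>K. single (FWord (map \<phi> (letters w))) (lookup p w))"
 unfolding free_map_def using assms by (intro sum.mono_neutral_left) (auto simp: in_keys_iff)

lemma free_map_add: "free_map \<phi> (p + q) = free_map \<phi> p + free_map \<phi> q"
proof -
 let ?K = "keys p \<union> keys q"
 have K: "finite ?K" "keys (p + q) \<subseteq> ?K" using Poly_Mapping.keys_add[of p q] by auto
 show ?thesis
  using free_map_superset[OF K] free_map_superset[of ?K p] free_map_superset[of ?K q]
  by (simp add: lookup_add single_add sum.distrib)
qed

lemma free_map_zero: "free_map \<phi> 0 = 0"
 by (simp add: free_map_def)

lemma free_map_uminus: "free_map \<phi> (- p) = - free_map \<phi> p"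
 using free_map_add[of \<phi> p "-p"] by (simp add: free_map_zero eq_neg_iff_add_eq_0 add.commute)

lemma free_map_mult: "free_map \<phi> (p * q) = free_map \<phi> p * free_map \<phi> q"
proof (induction p rule: poly_mapping_single_induct)
 case (single k c)
 show ?case
 proof (induction q rule: poly_mapping_single_induct)
  case (single l d)
  show ?case by (simp add: mult_single free_map_single plus_fword_def)
 qed (simp_all add: free_map_zero free_map_add distrib_left)
qed (simp_all add: free_map_zero free_map_add distrib_right)

lemma free_map_one: "free_map \<phi> 1 = 1"
 unfolding single_one[symmetric] free_map_single by (simp add: zero_fword_def)

lemma free_map_comp: "free_map \<phi> (free_map \<psi> p) = free_map (\<phi> \<circ> \<psi>) p"
 by (induction p rule: poly_mapping_single_induct)
  (simp_all add: free_map_zero free_map_add free_map_single o_def)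

lemma free_map_id: "free_map id p = p"
 by (induction p rule: poly_mapping_single_induct)
  (simp_all add: free_map_zero free_map_add free_map_single)

lemma free_map_closed:
 assumes "\<And>v. v \<in> V \<Longrightarrow> \<phi> v \<in> V" "p \<in> carrier (free_alg V)"
 shows "free_map \<phi> p \<in> carrier (free_alg V)"
proof -
 have "keys p \<subseteq> words V" using assms(2) by simp
 then have "keys (free_map \<phi> p) \<subseteq> words V"
 proof (induction p rule: poly_mapping_keys_induct)
  case (single k c)
  then show ?case using assms(1) by (auto simp: free_map_single words_def)
 qed (auto simp: free_map_zero free_map_add dest: free_add_closed)
 then show ?thesis by simp
qed

locale tensor =
 fixes M :: "(complex, 'v) module"
 assumes M_add [simp]: "u \<in> carrier M \<Longrightarrow> v \<in> carrier M \<Longrightarrow> u \<oplus>\<^bsub>M\<^esub> v \<in> carrier M"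
  and M_smult [simp]: "v \<in> carrier M \<Longrightarrow> c \<odot>\<^bsub>M\<^esub> v \<in> carrier M"
begin

abbreviation FA where "FA \<equiv> free_alg (carrier M)"
abbreviation TR where "TR \<equiv> tensor_rel M"
abbreviation TA where "TA \<equiv> tensor_alg M"

definition tgens where "tgens =
 {free_gen (u \<oplus>\<^bsub>M\<^esub> v) - (free_gen u + free_gen v) | u v. u \<in> carrier M \<and> v \<in> carrier M} \<union>
 {free_gen (z \<odot>\<^bsub>M\<^esub> v) - single 0 z * free_gen v | z v. v \<in> carrier M}"

interpretation F: calg FA by (rule free_alg_calg)

lemma tgens_closed: "tgens \<subseteq> carrier FA"
proof -
 have *: "a - b \<in> carrier FA" if "a \<in> carrier FA" "b \<in> carrier FA" for a b :: "'v fword \<Rightarrow>\<^sub>0 complex"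
  using F.minus_closed[OF that] free_alg_minus[OF that(2)] by (simp add: a_minus_def)
 have "free_gen (u \<oplus>\<^bsub>M\<^esub> v) - (free_gen u + free_gen v) \<in> carrier FA" if "u \<in> carrier M" "v \<in> carrier M" for u v
  using *[OF free_gen_closed[OF M_add[OF that]], of "free_gen u + free_gen v"]
   F.a_closed[OF free_gen_closed[OF that(1)] free_gen_closed[OF that(2)]] by (simp del: free_alg_sel(1))
 moreover have "free_gen (z \<odot>\<^bsub>M\<^esub> v) - single 0 z * free_gen v \<in> carrier FA" if "v \<in> carrier M" for z v
  using *[OF free_gen_closed[OF M_smult[OF that]], of "single 0 z * free_gen v" z]
   F.smult_closed[OF free_gen_closed[OF that], of z] by (simp del: free_alg_sel(1))
 ultimately show ?thesis unfolding tgens_def by blast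
qed

lemma TR_eq: "TR = Idl\<^bsub>FA\<^esub> tgens"
 by (simp add: tensor_rel_def tgens_def)

lemma tensor_ideal: "calg_ideal FA TR"
 unfolding calg_ideal_def TR_eq using F.genideal_ideal[OF tgens_closed] F.calg_axioms by blast

interpretation T: calg_ideal FA TR by (rule tensor_ideal)

abbreviation tcls where "tcls \<equiv> quot_class FA TR"

lemma TA_calg: "calg TA"
 unfolding tensor_alg_def by (rule T.quot_calg)

lemma TA_carrier: "carrier TA = tcls ` carrier FA"
 unfolding tensor_alg_def by (rule T.quot_carrier)

lemmas TA_ops = T.quot_ops[folded tensor_alg_def]
lemmas TA_one = T.quot_one[folded tensor_alg_def]
lemmas TA_zero = T.quot_zero[folded tensor_alg_def]

lemma tgens_TR: "tgens \<subseteq> TR"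
 unfolding TR_eq using F.genideal_self[OF tgens_closed] .

lemma tensor_gen_closed: "v \<in> carrier M \<Longrightarrow> tensor_gen M v \<in> carrier TA"
 unfolding tensor_gen_def TA_carrier by (rule imageI[OF free_gen_closed])

lemma tensor_gen_add:
 assumes "u \<in> carrier M" "v \<in> carrier M"
 shows "tensor_gen M (u \<oplus>\<^bsub>M\<^esub> v) = tensor_gen M u \<oplus>\<^bsub>TA\<^esub> tensor_gen M v"
proof -
 have c: "free_gen u \<in> carrier FA" "free_gen v \<in> carrier FA" "free_gen (u \<oplus>\<^bsub>M\<^esub> v) \<in> carrier FA"
  by (simp_all only: assms free_gen_closed M_add M_smult)
 have s: "free_gen u + free_gen v \<in> carrier FA" using F.a_closed[OF c(1,2)] by (simp del: free_alg_sel(1))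
 have "free_gen (u \<oplus>\<^bsub>M\<^esub> v) - (free_gen u + free_gen v) \<in> TR" using tgens_TR assms unfolding tgens_def by blast
 then have "free_gen (u \<oplus>\<^bsub>M\<^esub> v) \<ominus>\<^bsub>FA\<^esub> (free_gen u + free_gen v) \<in> TR"
  by (simp only: a_minus_def free_alg_minus[OF s] free_alg_sel(3) diff_conv_add_uminus)
 then have "tcls (free_gen (u \<oplus>\<^bsub>M\<^esub> v)) = tcls (free_gen u + free_gen v)" using T.cls_eq_iff[OF c(3) s] by simp
 then show ?thesis using TA_ops(1)[OF c(1,2)] by (simp add: tensor_gen_def)
qed

lemma tensor_gen_smult:
 assumes "v \<in> carrier M"
 shows "tensor_gen M (z \<odot>\<^bsub>M\<^esub> v) = z \<odot>\<^bsub>TA\<^esub> tensor_gen M v"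
proof -
 have c: "free_gen v \<in> carrier FA" "free_gen (z \<odot>\<^bsub>M\<^esub> v) \<in> carrier FA"
  by (simp_all only: assms free_gen_closed M_add M_smult)
 have s: "single 0 z * free_gen v \<in> carrier FA" using F.smult_closed[OF c(1), of z] by (simp del: free_alg_sel(1))
 have "free_gen (z \<odot>\<^bsub>M\<^esub> v) - single 0 z * free_gen v \<in> TR" using tgens_TR assms unfolding tgens_def by blast
 then have "free_gen (z \<odot>\<^bsub>M\<^esub> v) \<ominus>\<^bsub>FA\<^esub> (single 0 z * free_gen v) \<in> TR"
  by (simp add: a_minus_def free_alg_minus[OF s] del: free_alg_sel(1))
 then have "tcls (free_gen (z \<odot>\<^bsub>M\<^esub> v)) = tcls (single 0 z * free_gen v)" using T.cls_eq_iff[OF c(2) s] by simp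
 then show ?thesis using TA_ops(3)[OF c(1,1), of z] by (simp add: tensor_gen_def)
qed

definition lin_endo :: "('v \<Rightarrow> 'v) \<Rightarrow> bool" where
 "lin_endo \<phi> \<longleftrightarrow> (\<forall>v\<in>carrier M. \<phi> v \<in> carrier M) \<and>
   (\<forall>u\<in>carrier M. \<forall>v\<in>carrier M. \<phi> (u \<oplus>\<^bsub>M\<^esub> v) = \<phi> u \<oplus>\<^bsub>M\<^esub> \<phi> v) \<and>
   (\<forall>z. \<forall>v\<in>carrier M. \<phi> (z \<odot>\<^bsub>M\<^esub> v) = z \<odot>\<^bsub>M\<^esub> \<phi> v)"

text \<open>The preimage of the relation ideal is an ideal, and the induced map permutes relations
  among themselves.\<close>

lemma free_map_TR:
 assumes \<phi>: "lin_endo \<phi>" and p: "p \<in> TR" shows "free_map \<phi> p \<in> TR"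
proof -
 have closed: "free_map \<phi> p \<in> carrier FA" if "p \<in> carrier FA" for p
  by (rule free_map_closed) (use \<phi> that in \<open>auto simp: lin_endo_def\<close>)
 let ?I = "{p \<in> carrier FA. free_map \<phi> p \<in> TR}"
 have "ideal ?I FA"
 proof (rule idealI)
  show "ring FA" by (rule F.ring_axioms)
  show "subgroup ?I (add_monoid FA)"
  proof (rule subgroup.intro)
   show "?I \<subseteq> carrier (add_monoid FA)" by auto
   show "\<one>\<^bsub>add_monoid FA\<^esub> \<in> ?I"
    using F.zero_closed T.additive_subgroup_axioms additive_subgroup.zero_closed[of TR FA] by (simp add: free_map_zero)
   fix x assume x: "x \<in> ?I"
   {
    fix y assume y: "y \<in> ?I"
    have "x + y \<in> carrier FA" using F.a_closed[of x y] x y by (simp del: free_alg_sel(1))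
    moreover have "free_map \<phi> (x + y) \<in> TR"
     using additive_subgroup.a_closed[OF T.additive_subgroup_axioms, of "free_map \<phi> x" "free_map \<phi> y"] x y
     by (simp add: free_map_add)
    ultimately show "x \<otimes>\<^bsub>add_monoid FA\<^esub> y \<in> ?I" by (simp del: free_alg_sel(1))
   }
   have xc: "x \<in> carrier FA" and xT: "free_map \<phi> x \<in> TR" using x by auto
   have inv: "inv\<^bsub>add_monoid FA\<^esub> x = - x" using free_alg_minus[OF xc] by (simp add: a_inv_def)
   have "- x \<in> carrier FA" using F.a_inv_closed[OF xc] free_alg_minus[OF xc] by (simp del: free_alg_sel(1))
   moreover have "- free_map \<phi> x \<in> TR"
    using additive_subgroup.a_inv_closed[OF T.additive_subgroup_axioms xT] free_alg_minus[OF closed[OF xc]] by simp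
   ultimately show "inv\<^bsub>add_monoid FA\<^esub> x \<in> ?I" unfolding inv by (simp add: free_map_uminus del: free_alg_sel(1))
  qed
  fix a x assume a: "a \<in> ?I" and x: "x \<in> carrier FA"
  have ac: "a \<in> carrier FA" using a by simp
  have "x * a \<in> carrier FA" "a * x \<in> carrier FA"
   using F.m_closed[OF x ac] F.m_closed[OF ac x] by (simp_all del: free_alg_sel(1))
  moreover have "free_map \<phi> x * free_map \<phi> a \<in> TR" "free_map \<phi> a * free_map \<phi> x \<in> TR"
   using T.I_l_closed[of "free_map \<phi> a" "free_map \<phi> x"] T.I_r_closed[of "free_map \<phi> a" "free_map \<phi> x"] closed[OF x] a
   by (simp_all del: free_alg_sel(1))
  ultimately show "x \<otimes>\<^bsub>FA\<^esub> a \<in> ?I" "a \<otimes>\<^bsub>FA\<^esub> x \<in> ?I"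
   by (simp_all add: free_map_mult del: free_alg_sel(1))
 qed
 moreover have "tgens \<subseteq> ?I"
 proof
  have diff: "free_map \<phi> (p - q) = free_map \<phi> p - free_map \<phi> q" for p q
   using free_map_add[of \<phi> p "-q"] by (simp add: free_map_uminus)
  have gen: "free_map \<phi> (free_gen v) = free_gen (\<phi> v)" for v by (simp add: free_gen_def free_map_single)
  have c: "free_map \<phi> (single 0 z) = single 0 z" for z
   by (simp add: free_map_single zero_fword_def)
  fix p assume p: "p \<in> tgens"
  then have "free_map \<phi> p \<in> tgens"
  proof (cases "p \<in> {free_gen (u \<oplus>\<^bsub>M\<^esub> v) - (free_gen u + free_gen v) | u v. u \<in> carrier M \<and> v \<in> carrier M}")
   case True
   then obtain u v where uv: "p = free_gen (u \<oplus>\<^bsub>M\<^esub> v) - (free_gen u + free_gen v)" "u \<in> carrier M" "v \<in> carrier M" by blast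
   have "free_map \<phi> p = free_gen (\<phi> u \<oplus>\<^bsub>M\<^esub> \<phi> v) - (free_gen (\<phi> u) + free_gen (\<phi> v))"
    using \<phi> uv by (simp add: diff free_map_add gen lin_endo_def)
   moreover have "\<phi> u \<in> carrier M" "\<phi> v \<in> carrier M" using \<phi> uv by (auto simp: lin_endo_def)
   ultimately show ?thesis unfolding tgens_def by blast
  next
   case False
   then obtain z v where zv: "p = free_gen (z \<odot>\<^bsub>M\<^esub> v) - single 0 z * free_gen v" "v \<in> carrier M"
    using p unfolding tgens_def by blast
   have "free_map \<phi> p = free_gen (z \<odot>\<^bsub>M\<^esub> \<phi> v) - single 0 z * free_gen (\<phi> v)"
    using \<phi> zv by (simp add: diff free_map_mult gen c lin_endo_def)
   moreover have "\<phi> v \<in> carrier M" using \<phi> zv by (auto simp: lin_endo_def)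
   ultimately show ?thesis unfolding tgens_def by blast
  qed
  then show "p \<in> ?I" using p tgens_closed tgens_TR by blast
 qed
 ultimately have "TR \<subseteq> ?I" unfolding TR_eq[of] by (rule F.genideal_minimal)
 then show ?thesis using p by blast
qed

text \<open>The union in the definition of \<open>tensor_map\<close> runs over sets that all
  coincide, because representatives differ by relations and relations are preserved.\<close>

lemma tensor_map_cls:
 assumes \<phi>: "lin_endo \<phi>" and p: "p \<in> carrier FA"
 shows "tensor_map M \<phi> (tcls p) = tcls (free_map \<phi> p)"
 unfolding tensor_map_def
proof (rule T.cls_UN[OF p])
 have closed: "free_map \<phi> p \<in> carrier FA" if "p \<in> carrier FA" for p
  by (rule free_map_closed) (use \<phi> that in \<open>auto simp: lin_endo_def\<close>)
 fix q assume "q \<in> tcls p"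
 then have q: "q \<in> carrier FA" "tcls q = tcls p" using T.cls_mem[OF p] by auto
 then have "q \<ominus>\<^bsub>FA\<^esub> p \<in> TR" using T.cls_eq_iff[OF q(1) p] by simp
 then have "q - p \<in> TR" using free_alg_minus[OF p] by (simp add: a_minus_def)
 then have "free_map \<phi> (q - p) \<in> TR" by (rule free_map_TR[OF \<phi>])
 then have "free_map \<phi> q \<ominus>\<^bsub>FA\<^esub> free_map \<phi> p \<in> TR"
  using free_map_add[of \<phi> q "-p"] free_alg_minus[OF closed[OF p]] by (simp add: a_minus_def free_map_uminus)
 then show "tcls (free_map \<phi> q) = tcls (free_map \<phi> p)"
  using T.cls_eq_iff[OF closed[OF q(1)] closed[OF p]] by simp
qed

end

section \<open>Crossed products\<close>

locale crossed = B: calg B + G: group G for B :: "(complex, 'b) module" (structure) and G :: "'g monoid" +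
 fixes act :: "'g \<Rightarrow> 'b \<Rightarrow> 'b"
 assumes finite_G: "finite (carrier G)"
  and act_closed [simp]: "g \<in> carrier G \<Longrightarrow> b \<in> carrier B \<Longrightarrow> act g b \<in> carrier B"
  and act_add: "g \<in> carrier G \<Longrightarrow> b \<in> carrier B \<Longrightarrow> b' \<in> carrier B \<Longrightarrow> act g (b \<oplus> b') = act g b \<oplus> act g b'"
  and act_mult: "g \<in> carrier G \<Longrightarrow> b \<in> carrier B \<Longrightarrow> b' \<in> carrier B \<Longrightarrow> act g (b \<otimes> b') = act g b \<otimes> act g b'"
  and act_smult: "g \<in> carrier G \<Longrightarrow> b \<in> carrier B \<Longrightarrow> act g (z \<odot> b) = z \<odot> act g b"
  and act_one [simp]: "g \<in> carrier G \<Longrightarrow> act g \<one> = \<one>"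
  and act_act: "g \<in> carrier G \<Longrightarrow> h \<in> carrier G \<Longrightarrow> b \<in> carrier B \<Longrightarrow> act (g \<otimes>\<^bsub>G\<^esub> h) b = act g (act h b)"
  and act_id [simp]: "b \<in> carrier B \<Longrightarrow> act \<one>\<^bsub>G\<^esub> b = b"
begin

abbreviation K where "K \<equiv> crossed_product B G act"
abbreviation ce where "ce \<equiv> crossed_elem B G"

lemma act_zero [simp]: "g \<in> carrier G \<Longrightarrow> act g \<zero> = \<zero>"
 using act_smult[of g "\<one>" 0] by simp

lemma act_finsum:
 "g \<in> carrier G \<Longrightarrow> f \<in> I \<rightarrow> carrier B \<Longrightarrow> act g (\<Oplus>i\<in>I. f i) = (\<Oplus>i\<in>I. act g (f i))"
proof (induction I rule: infinite_finite_induct)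
 case (insert x F)
 then have f: "f \<in> F \<rightarrow> carrier B" "f x \<in> carrier B" by auto
 moreover have "(\<lambda>i. act g (f i)) \<in> F \<rightarrow> carrier B" "act g (f x) \<in> carrier B" using f insert.prems by (auto simp: Pi_iff)
 ultimately show ?case using insert by (simp add: B.finsum_insert act_add)
qed simp_all

lemma K_carrier: "f \<in> carrier K \<longleftrightarrow> f \<in> carrier G \<rightarrow>\<^sub>E carrier B"
 by (simp add: crossed_product_def)

lemma K_app [simp]: "f \<in> carrier K \<Longrightarrow> w \<in> carrier G \<Longrightarrow> f w \<in> carrier B"
 by (auto simp: K_carrier)

lemma K_sel [simp]:
 "w \<in> carrier G \<Longrightarrow> (f \<otimes>\<^bsub>K\<^esub> g) w = (\<Oplus>u\<in>carrier G. f u \<otimes> act u (g (inv\<^bsub>G\<^esub> u \<otimes>\<^bsub>G\<^esub> w)))"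
 "w \<in> carrier G \<Longrightarrow> (f \<oplus>\<^bsub>K\<^esub> g) w = f w \<oplus> g w"
 "w \<in> carrier G \<Longrightarrow> (z \<odot>\<^bsub>K\<^esub> f) w = z \<odot> f w"
 "w \<in> carrier G \<Longrightarrow> \<one>\<^bsub>K\<^esub> w = (if w = \<one>\<^bsub>G\<^esub> then \<one> else \<zero>)"
 "w \<in> carrier G \<Longrightarrow> \<zero>\<^bsub>K\<^esub> w = \<zero>"
 by (simp_all add: crossed_product_def)

lemma K_ext: "f \<in> carrier K \<Longrightarrow> g \<in> carrier K \<Longrightarrow> (\<And>w. w \<in> carrier G \<Longrightarrow> f w = g w) \<Longrightarrow> f = g"
 unfolding K_carrier by (rule PiE_ext)

lemma K_closed:
 assumes "f \<in> carrier K"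
 shows "g \<in> carrier K \<Longrightarrow> f \<otimes>\<^bsub>K\<^esub> g \<in> carrier K" "g \<in> carrier K \<Longrightarrow> f \<oplus>\<^bsub>K\<^esub> g \<in> carrier K"
  "z \<odot>\<^bsub>K\<^esub> f \<in> carrier K"
 using assms by (auto simp: K_carrier crossed_product_def Pi_iff PiE_iff intro!: B.finsum_closed)

lemma K_const_closed: "\<one>\<^bsub>K\<^esub> \<in> carrier K" "\<zero>\<^bsub>K\<^esub> \<in> carrier K"
 by (auto simp: crossed_product_def)

lemma ce_closed: "b \<in> carrier B \<Longrightarrow> ce b g \<in> carrier K"
 by (auto simp: crossed_product_def crossed_elem_def)

lemma ce_app: "w \<in> carrier G \<Longrightarrow> ce b g w = (if w = g then b else \<zero>)"
 by (simp add: crossed_elem_def)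

lemma K_mult_single:
 assumes "g \<in> carrier G" "f' \<in> carrier K" "w \<in> carrier G" "b \<in> carrier B"
 shows "(ce b g \<otimes>\<^bsub>K\<^esub> f') w = b \<otimes> act g (f' (inv\<^bsub>G\<^esub> g \<otimes>\<^bsub>G\<^esub> w))"
proof -
 have "(ce b g \<otimes>\<^bsub>K\<^esub> f') w = (\<Oplus>u\<in>carrier G. ce b g u \<otimes> act u (f' (inv\<^bsub>G\<^esub> u \<otimes>\<^bsub>G\<^esub> w)))"
  using assms(3) by simp
 also have "\<dots> = ce b g g \<otimes> act g (f' (inv\<^bsub>G\<^esub> g \<otimes>\<^bsub>G\<^esub> w))"
  by (rule B.finsum_single[OF finite_G assms(1)]) (use assms in \<open>auto simp: ce_app\<close>)
 finally show ?thesis using assms by (simp add: ce_app)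
qed

lemma ce_mult:
 assumes "g \<in> carrier G" "h \<in> carrier G" "a \<in> carrier B" "b \<in> carrier B"
 shows "ce a g \<otimes>\<^bsub>K\<^esub> ce b h = ce (a \<otimes> act g b) (g \<otimes>\<^bsub>G\<^esub> h)"
proof (rule K_ext)
 fix w assume w: "w \<in> carrier G"
 have "inv\<^bsub>G\<^esub> g \<otimes>\<^bsub>G\<^esub> w = h \<longleftrightarrow> w = g \<otimes>\<^bsub>G\<^esub> h" using assms w G.inv_solve_left[of h g w] by auto
 then show "(ce a g \<otimes>\<^bsub>K\<^esub> ce b h) w = ce (a \<otimes> act g b) (g \<otimes>\<^bsub>G\<^esub> h) w"
  using assms w by (simp add: K_mult_single[OF assms(1) ce_closed[OF assms(4)] w assms(3)] ce_app)
qed (use assms in \<open>simp_all add: K_closed ce_closed\<close>)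

lemma one_ce: "\<one>\<^bsub>K\<^esub> = ce \<one> \<one>\<^bsub>G\<^esub>"
 by (simp add: crossed_product_def crossed_elem_def)

lemma ce_add: "a \<in> carrier B \<Longrightarrow> b \<in> carrier B \<Longrightarrow> ce a g \<oplus>\<^bsub>K\<^esub> ce b g = ce (a \<oplus> b) g"
 by (rule K_ext) (simp_all add: K_closed ce_closed ce_app)

lemma ce_smult: "b \<in> carrier B \<Longrightarrow> z \<odot>\<^bsub>K\<^esub> ce b g = ce (z \<odot> b) g"
 by (rule K_ext) (simp_all add: K_closed ce_closed ce_app)

text \<open>Both sides are double sums over the group; they agree after exchanging the order of
  summation and translating the inner variable.\<close>

lemma K_assoc:
 assumes f: "f \<in> carrier K" and g: "g \<in> carrier K" and h: "h \<in> carrier K"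
 shows "(f \<otimes>\<^bsub>K\<^esub> g) \<otimes>\<^bsub>K\<^esub> h = f \<otimes>\<^bsub>K\<^esub> (g \<otimes>\<^bsub>K\<^esub> h)"
proof (rule K_ext)
 fix w assume w: "w \<in> carrier G"
 let ?t = "\<lambda>v u. f v \<otimes> act v (g (inv\<^bsub>G\<^esub> v \<otimes>\<^bsub>G\<^esub> u)) \<otimes> act u (h (inv\<^bsub>G\<^esub> u \<otimes>\<^bsub>G\<^esub> w))"
 have "((f \<otimes>\<^bsub>K\<^esub> g) \<otimes>\<^bsub>K\<^esub> h) w = (\<Oplus>u\<in>carrier G. (f \<otimes>\<^bsub>K\<^esub> g) u \<otimes> act u (h (inv\<^bsub>G\<^esub> u \<otimes>\<^bsub>G\<^esub> w)))"
  using w by simp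
 also have "\<dots> = (\<Oplus>u\<in>carrier G. \<Oplus>v\<in>carrier G. ?t v u)"
 proof (rule B.finsum_cong'[OF refl])
  show "(\<lambda>u. \<Oplus>v\<in>carrier G. ?t v u) \<in> carrier G \<rightarrow> carrier B"
   using f g h w by (auto intro!: B.finsum_closed)
  fix u assume u: "u \<in> carrier G"
  show "(f \<otimes>\<^bsub>K\<^esub> g) u \<otimes> act u (h (inv\<^bsub>G\<^esub> u \<otimes>\<^bsub>G\<^esub> w)) = (\<Oplus>v\<in>carrier G. ?t v u)"
   unfolding K_sel(1)[OF u] by (rule B.finsum_ldistr[OF finite_G]) (use f g h w u in auto)
 qed
 also have "\<dots> = (\<Oplus>v\<in>carrier G. \<Oplus>u\<in>carrier G. ?t v u)"
  by (rule B.finsum_swap[OF finite_G]) (use f g h w in auto)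
 also have "\<dots> = (\<Oplus>v\<in>carrier G. f v \<otimes> act v ((g \<otimes>\<^bsub>K\<^esub> h) (inv\<^bsub>G\<^esub> v \<otimes>\<^bsub>G\<^esub> w)))"
 proof (rule B.finsum_cong'[OF refl])
  show "(\<lambda>v. f v \<otimes> act v ((g \<otimes>\<^bsub>K\<^esub> h) (inv\<^bsub>G\<^esub> v \<otimes>\<^bsub>G\<^esub> w))) \<in> carrier G \<rightarrow> carrier B"
   using f w K_closed(1)[OF g h] by (auto simp del: K_sel(1))
  fix v assume v: "v \<in> carrier G"
  let ?s = "\<lambda>u. g u \<otimes> act u (h (inv\<^bsub>G\<^esub> u \<otimes>\<^bsub>G\<^esub> (inv\<^bsub>G\<^esub> v \<otimes>\<^bsub>G\<^esub> w)))"
  \<comment> \<open>The inner variable \<open>u\<close> becomes \<open>v\<close> times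
    \<open>u\<close>, a permutation of the group.\<close>
  have inj: "inj_on (\<lambda>u. v \<otimes>\<^bsub>G\<^esub> u) (carrier G)" using v by (auto simp: inj_on_def)
  have im: "(\<lambda>u. v \<otimes>\<^bsub>G\<^esub> u) ` carrier G = carrier G" using G.surj_const_mult[OF v] .
  have "(\<Oplus>u\<in>carrier G. ?t v u) = (\<Oplus>u\<in>(\<lambda>u. v \<otimes>\<^bsub>G\<^esub> u) ` carrier G. ?t v u)" by (simp only: im)
  also have "\<dots> = (\<Oplus>u\<in>carrier G. ?t v (v \<otimes>\<^bsub>G\<^esub> u))"
   by (rule B.finsum_reindex[OF _ inj]) (use f g h v w in auto)
  also have "\<dots> = (\<Oplus>u\<in>carrier G. f v \<otimes> act v (?s u))"
  proof (rule B.finsum_cong'[OF refl])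
   show "(\<lambda>u. f v \<otimes> act v (?s u)) \<in> carrier G \<rightarrow> carrier B" using f g h v w by auto
   fix u assume u: "u \<in> carrier G"
   have 1: "inv\<^bsub>G\<^esub> v \<otimes>\<^bsub>G\<^esub> (v \<otimes>\<^bsub>G\<^esub> u) = u" using u v by (simp add: G.m_assoc[symmetric])
   have 2: "inv\<^bsub>G\<^esub> (v \<otimes>\<^bsub>G\<^esub> u) \<otimes>\<^bsub>G\<^esub> w = inv\<^bsub>G\<^esub> u \<otimes>\<^bsub>G\<^esub> (inv\<^bsub>G\<^esub> v \<otimes>\<^bsub>G\<^esub> w)"
    using u v w by (simp add: G.inv_mult_group G.m_assoc)
   show "?t v (v \<otimes>\<^bsub>G\<^esub> u) = f v \<otimes> act v (?s u)"
    unfolding 1 2 using f g h u v w by (simp add: act_mult act_act B.m_assoc)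
  qed
  also have "\<dots> = f v \<otimes> act v (\<Oplus>u\<in>carrier G. ?s u)"
   by (subst act_finsum[OF v]) (use f g h v w in \<open>auto intro!: B.finsum_rdistr[OF finite_G, symmetric]\<close>)
  finally show "(\<Oplus>u\<in>carrier G. ?t v u) = f v \<otimes> act v ((g \<otimes>\<^bsub>K\<^esub> h) (inv\<^bsub>G\<^esub> v \<otimes>\<^bsub>G\<^esub> w))"
   using v w by simp
 qed
 also have "\<dots> = (f \<otimes>\<^bsub>K\<^esub> (g \<otimes>\<^bsub>K\<^esub> h)) w" using w K_sel(1)[OF w, of f "g \<otimes>\<^bsub>K\<^esub> h"] by (simp del: K_sel(1))
 finally show "((f \<otimes>\<^bsub>K\<^esub> g) \<otimes>\<^bsub>K\<^esub> h) w = (f \<otimes>\<^bsub>K\<^esub> (g \<otimes>\<^bsub>K\<^esub> h)) w" .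
qed (use assms in \<open>simp_all add: K_closed\<close>)

lemma K_distr:
 assumes f: "f \<in> carrier K" and g: "g \<in> carrier K" and h: "h \<in> carrier K"
 shows "(f \<oplus>\<^bsub>K\<^esub> g) \<otimes>\<^bsub>K\<^esub> h = f \<otimes>\<^bsub>K\<^esub> h \<oplus>\<^bsub>K\<^esub> g \<otimes>\<^bsub>K\<^esub> h" "h \<otimes>\<^bsub>K\<^esub> (f \<oplus>\<^bsub>K\<^esub> g) = h \<otimes>\<^bsub>K\<^esub> f \<oplus>\<^bsub>K\<^esub> h \<otimes>\<^bsub>K\<^esub> g"
  "(z \<odot>\<^bsub>K\<^esub> f) \<otimes>\<^bsub>K\<^esub> h = z \<odot>\<^bsub>K\<^esub> (f \<otimes>\<^bsub>K\<^esub> h)" "f \<otimes>\<^bsub>K\<^esub> (z \<odot>\<^bsub>K\<^esub> h) = z \<odot>\<^bsub>K\<^esub> (f \<otimes>\<^bsub>K\<^esub> h)"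
proof -
 show "(f \<oplus>\<^bsub>K\<^esub> g) \<otimes>\<^bsub>K\<^esub> h = f \<otimes>\<^bsub>K\<^esub> h \<oplus>\<^bsub>K\<^esub> g \<otimes>\<^bsub>K\<^esub> h"
 proof (rule K_ext)
  fix w assume w: "w \<in> carrier G"
  show "((f \<oplus>\<^bsub>K\<^esub> g) \<otimes>\<^bsub>K\<^esub> h) w = (f \<otimes>\<^bsub>K\<^esub> h \<oplus>\<^bsub>K\<^esub> g \<otimes>\<^bsub>K\<^esub> h) w"
   using w f g h by (subst K_sel(2), simp, (subst K_sel(1), simp)+, subst B.finsum_addf[symmetric])
    (auto intro!: B.finsum_cong' simp: B.l_distr simp del: B.finsum_addf)
 qed (use assms in \<open>simp_all add: K_closed\<close>)
 show "h \<otimes>\<^bsub>K\<^esub> (f \<oplus>\<^bsub>K\<^esub> g) = h \<otimes>\<^bsub>K\<^esub> f \<oplus>\<^bsub>K\<^esub> h \<otimes>\<^bsub>K\<^esub> g"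
 proof (rule K_ext)
  fix w assume w: "w \<in> carrier G"
  show "(h \<otimes>\<^bsub>K\<^esub> (f \<oplus>\<^bsub>K\<^esub> g)) w = (h \<otimes>\<^bsub>K\<^esub> f \<oplus>\<^bsub>K\<^esub> h \<otimes>\<^bsub>K\<^esub> g) w"
   using w f g h by (subst K_sel(2), simp, (subst K_sel(1), simp)+, subst B.finsum_addf[symmetric])
    (auto intro!: B.finsum_cong' simp: B.r_distr act_add simp del: B.finsum_addf)
 qed (use assms in \<open>simp_all add: K_closed\<close>)
 show "(z \<odot>\<^bsub>K\<^esub> f) \<otimes>\<^bsub>K\<^esub> h = z \<odot>\<^bsub>K\<^esub> (f \<otimes>\<^bsub>K\<^esub> h)"
 proof (rule K_ext)
  fix w assume w: "w \<in> carrier G"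
  show "((z \<odot>\<^bsub>K\<^esub> f) \<otimes>\<^bsub>K\<^esub> h) w = (z \<odot>\<^bsub>K\<^esub> (f \<otimes>\<^bsub>K\<^esub> h)) w"
   using w f g h by (subst K_sel(3), simp, (subst K_sel(1), simp)+, subst B.smult_finsum)
    (auto intro!: B.finsum_cong' simp: B.smult_mult_left)
 qed (use assms in \<open>simp_all add: K_closed\<close>)
 show "f \<otimes>\<^bsub>K\<^esub> (z \<odot>\<^bsub>K\<^esub> h) = z \<odot>\<^bsub>K\<^esub> (f \<otimes>\<^bsub>K\<^esub> h)"
 proof (rule K_ext)
  fix w assume w: "w \<in> carrier G"
  show "(f \<otimes>\<^bsub>K\<^esub> (z \<odot>\<^bsub>K\<^esub> h)) w = (z \<odot>\<^bsub>K\<^esub> (f \<otimes>\<^bsub>K\<^esub> h)) w"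
   using w f g h by (subst K_sel(3), simp, (subst K_sel(1), simp)+, subst B.smult_finsum)
    (auto intro!: B.finsum_cong' simp: B.smult_mult_right act_smult)
 qed (use assms in \<open>simp_all add: K_closed\<close>)
qed

lemma K_one:
 assumes f: "f \<in> carrier K"
 shows "\<one>\<^bsub>K\<^esub> \<otimes>\<^bsub>K\<^esub> f = f" "f \<otimes>\<^bsub>K\<^esub> \<one>\<^bsub>K\<^esub> = f"
proof -
 show "\<one>\<^bsub>K\<^esub> \<otimes>\<^bsub>K\<^esub> f = f"
  by (rule K_ext) (use f in \<open>simp_all add: K_closed K_const_closed one_ce ce_closed K_mult_single del: K_sel\<close>)
 show "f \<otimes>\<^bsub>K\<^esub> \<one>\<^bsub>K\<^esub> = f"
 proof (rule K_ext)
  fix w assume w: "w \<in> carrier G"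
  have u: "inv\<^bsub>G\<^esub> u \<otimes>\<^bsub>G\<^esub> w = \<one>\<^bsub>G\<^esub> \<longleftrightarrow> u = w" if "u \<in> carrier G" for u
   using that w G.inv_solve_left[of "\<one>\<^bsub>G\<^esub>" u w] by auto
  have "(f \<otimes>\<^bsub>K\<^esub> \<one>\<^bsub>K\<^esub>) w = (\<Oplus>u\<in>carrier G. f u \<otimes> act u (\<one>\<^bsub>K\<^esub> (inv\<^bsub>G\<^esub> u \<otimes>\<^bsub>G\<^esub> w)))" using w by (rule K_sel(1))
  also have "\<dots> = f w \<otimes> act w (\<one>\<^bsub>K\<^esub> (inv\<^bsub>G\<^esub> w \<otimes>\<^bsub>G\<^esub> w))"
   by (rule B.finsum_single[OF finite_G w]) (use f w u in auto)
  finally show "(f \<otimes>\<^bsub>K\<^esub> \<one>\<^bsub>K\<^esub>) w = f w" using f w by simp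
 qed (use f in \<open>simp_all add: K_closed K_const_closed\<close>)
qed

lemma K_calg: "calg K"
proof -
 have "ring K"
 proof (rule ringI)
  show "abelian_group K"
  proof (rule abelian_groupI)
   fix f assume f: "f \<in> carrier K"
   show "\<exists>g\<in>carrier K. g \<oplus>\<^bsub>K\<^esub> f = \<zero>\<^bsub>K\<^esub>"
    by (rule bexI[of _ "(-1) \<odot>\<^bsub>K\<^esub> f"], rule K_ext)
     (use f in \<open>simp_all add: K_closed K_const_closed B.smult_minus_one B.l_neg\<close>)
   show "\<zero>\<^bsub>K\<^esub> \<oplus>\<^bsub>K\<^esub> f = f" by (rule K_ext) (use f in \<open>simp_all add: K_closed K_const_closed\<close>)
   fix g assume g: "g \<in> carrier K"
   show "f \<oplus>\<^bsub>K\<^esub> g = g \<oplus>\<^bsub>K\<^esub> f" by (rule K_ext) (use f g in \<open>simp_all add: K_closed B.a_comm\<close>)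
   fix h assume h: "h \<in> carrier K"
   show "f \<oplus>\<^bsub>K\<^esub> g \<oplus>\<^bsub>K\<^esub> h = f \<oplus>\<^bsub>K\<^esub> (g \<oplus>\<^bsub>K\<^esub> h)"
    by (rule K_ext) (use f g h in \<open>simp_all add: K_closed B.a_assoc\<close>)
  qed (simp_all add: K_closed K_const_closed)
  show "monoid K"
   by (rule monoidI) (simp_all add: K_closed K_const_closed K_assoc K_one)
 qed (simp_all add: K_distr)
 then interpret K: ring K .
 show ?thesis
 proof (unfold_locales)
  fix x y :: "'g \<Rightarrow> 'b" and c d
  assume x: "x \<in> carrier K"
  show "(c + d) \<odot>\<^bsub>K\<^esub> x = c \<odot>\<^bsub>K\<^esub> x \<oplus>\<^bsub>K\<^esub> d \<odot>\<^bsub>K\<^esub> x"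
   by (rule K_ext) (use x in \<open>simp_all add: K_closed B.smult_add_left\<close>)
  show "c \<odot>\<^bsub>K\<^esub> (d \<odot>\<^bsub>K\<^esub> x) = (c * d) \<odot>\<^bsub>K\<^esub> x"
   by (rule K_ext) (use x in \<open>simp_all add: K_closed B.smult_smult\<close>)
  show "1 \<odot>\<^bsub>K\<^esub> x = x"
   by (rule K_ext) (use x in \<open>simp_all add: K_closed B.smult_one\<close>)
  assume y: "y \<in> carrier K"
  show "c \<odot>\<^bsub>K\<^esub> (x \<oplus>\<^bsub>K\<^esub> y) = c \<odot>\<^bsub>K\<^esub> x \<oplus>\<^bsub>K\<^esub> c \<odot>\<^bsub>K\<^esub> y"
   by (rule K_ext) (use x y in \<open>simp_all add: K_closed B.smult_add_right\<close>)
 qed (simp_all add: K_closed K_distr del: K_sel)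
qed

end

section \<open>The smash product\<close>

context irred_group
begin

text \<open>Identifies the dual with the space itself, so that the x-generators can be indexed by
  vectors like the y-generators.\<close>

lemma dual_space_iff: "f \<in> dual_space scale \<longleftrightarrow> (\<exists>u. f = pr u)"
proof
 assume "f \<in> dual_space scale"
 then have "Vector_Spaces.linear scale (*) f" by (simp add: dual_space_def)
 then have "f = pr (\<Sum>b\<in>Bs. f b *s b)" by (rule ext[OF functional_eq_pr])
 then show "\<exists>u. f = pr u" by (rule exI)
qed (auto simp: dual_space_def linear_pr)

lemma dual_action_pr: "g \<in> W \<Longrightarrow> dual_action g (pr u) = pr (cg g u)"
 by (auto simp: dual_action_def pr_cg)

abbreviation HM where "HM \<equiv> hh_space scale"
abbreviation phi :: "('h \<Rightarrow> 'h) \<Rightarrow> 'h hh \<Rightarrow> 'h hh" where "phi w \<equiv> (\<lambda>(y, x). (w y, dual_action w x))"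

lemma HM_carrier: "v \<in> carrier HM \<longleftrightarrow> (\<exists>y u. v = (y, pr u))"
 by (cases v) (auto simp: hh_space_def dual_space_iff)

lemma HM_memb [simp]: "(y, pr u) \<in> carrier HM"
 by (auto simp: HM_carrier)

lemma HM_ops: "(y, pr u) \<oplus>\<^bsub>HM\<^esub> (y', pr u') = (y + y', pr (u + u'))" "z \<odot>\<^bsub>HM\<^esub> (y, pr u) = (z *s y, pr (z *s u))"
 by (auto simp: hh_space_def pr_simps)

sublocale HM: tensor HM
 by unfold_locales (auto simp: HM_carrier HM_ops)

lemma phi_pr: "g \<in> W \<Longrightarrow> phi g (y, pr u) = (g y, pr (cg g u))"
 by (simp add: dual_action_pr)

lemma phi_closed:
 assumes "g \<in> W" "v \<in> carrier HM" shows "phi g v \<in> carrier HM"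
proof -
 obtain y u where "v = (y, pr u)" using assms(2) HM_carrier by blast
 then show ?thesis using phi_pr[OF assms(1)] HM_memb by simp
qed

lemma phi_lin: "g \<in> W \<Longrightarrow> HM.lin_endo (phi g)"
 unfolding HM.lin_endo_def by (auto dest!: HM_carrier[THEN iffD1] simp: HM_ops dual_action_pr W_map cg_map)

lemma phi_comp: "g \<in> W \<Longrightarrow> h \<in> W \<Longrightarrow> phi (g \<circ> h) = phi g \<circ> phi h"
 by (auto simp: fun_eq_iff dual_action_def inv_of_comp)

lemma phi_id: "phi id = id"
 by (auto simp: fun_eq_iff dual_action_def)

abbreviation GW where "GW \<equiv> GL scale\<lparr>carrier := W\<rparr>"

lemma GW_sel [simp]: "carrier GW = W" "g \<otimes>\<^bsub>GW\<^esub> h = g \<circ> h" "\<one>\<^bsub>GW\<^esub> = id"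
 by (simp_all add: GL_def)

lemma GL_mult [simp]: "g \<otimes>\<^bsub>GL scale\<^esub> h = g \<circ> h"
 by (simp add: GL_def)

lemma free_map_FA: "g \<in> W \<Longrightarrow> p \<in> carrier HM.FA \<Longrightarrow> free_map (phi g) p \<in> carrier HM.FA"
 by (rule free_map_closed[OF phi_closed])

lemma tensor_map_phi: "g \<in> W \<Longrightarrow> p \<in> carrier HM.FA \<Longrightarrow> tensor_map HM (phi g) (HM.tcls p) = HM.tcls (free_map (phi g) p)"
 by (rule HM.tensor_map_cls[OF phi_lin])

lemma free_map_const: "free_map \<phi> (single 0 z) = single 0 z"
 by (simp add: free_map_single zero_fword_def)

sublocale CP: crossed HM.TA GW "\<lambda>g. tensor_map HM (phi g)"
proof -
 interpret T: calg HM.TA by (rule HM.TA_calg)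
 interpret F: calg HM.FA by (rule free_alg_calg)
 interpret G: group GW using subgroup.subgroup_is_group[OF subgroup_W] group_GL vector_space_axioms by blast
 show "crossed HM.TA GW (\<lambda>g. tensor_map HM (phi g))"
 proof (unfold_locales)
  show "finite (carrier GW)" using finite_W by simp
  fix g b assume g: "g \<in> carrier GW"
  have gW: "g \<in> W" using g by simp
  note cl = free_map_FA[OF gW] tensor_map_phi[OF gW]
  have one: "\<one>\<^bsub>HM.FA\<^esub> \<in> carrier HM.FA" by (rule F.one_closed)
  show "tensor_map HM (phi g) \<one>\<^bsub>HM.TA\<^esub> = \<one>\<^bsub>HM.TA\<^esub>"
   using cl(2)[OF one] by (simp only: HM.TA_one free_alg_sel(5) free_map_one)
  assume "b \<in> carrier HM.TA"
  then obtain p where b: "b = HM.tcls p" and p: "p \<in> carrier HM.FA" unfolding HM.TA_carrier by (rule imageE)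
  show "tensor_map HM (phi g) b \<in> carrier HM.TA"
   unfolding b cl(2)[OF p] HM.TA_carrier by (rule imageI[OF cl(1)[OF p]])
  {
   fix z
   have zp: "single 0 z * p \<in> carrier HM.FA" using F.smult_closed[OF p, of z] by (simp only: free_alg_sel(6))
   show "tensor_map HM (phi g) (z \<odot>\<^bsub>HM.TA\<^esub> b) = z \<odot>\<^bsub>HM.TA\<^esub> tensor_map HM (phi g) b"
    unfolding b cl(2)[OF p] HM.TA_ops(3)[OF p p] HM.TA_ops(3)[OF cl(1)[OF p] cl(1)[OF p]] free_alg_sel(6)
     cl(2)[OF zp] free_map_mult free_map_const ..
  }
  {
   fix b' assume "b' \<in> carrier HM.TA"
   then obtain p' where b': "b' = HM.tcls p'" and p': "p' \<in> carrier HM.FA" unfolding HM.TA_carrier by (rule imageE)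
   have a: "p + p' \<in> carrier HM.FA" using F.a_closed[OF p p'] by (simp only: free_alg_sel(3))
   have m: "p * p' \<in> carrier HM.FA" using F.m_closed[OF p p'] by (simp only: free_alg_sel(2))
   show "tensor_map HM (phi g) (b \<oplus>\<^bsub>HM.TA\<^esub> b') = tensor_map HM (phi g) b \<oplus>\<^bsub>HM.TA\<^esub> tensor_map HM (phi g) b'"
    unfolding b b' cl(2)[OF p] cl(2)[OF p'] HM.TA_ops(1)[OF p p'] HM.TA_ops(1)[OF cl(1)[OF p] cl(1)[OF p']]
     free_alg_sel(3) cl(2)[OF a] free_map_add ..
   show "tensor_map HM (phi g) (b \<otimes>\<^bsub>HM.TA\<^esub> b') = tensor_map HM (phi g) b \<otimes>\<^bsub>HM.TA\<^esub> tensor_map HM (phi g) b'"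
    unfolding b b' cl(2)[OF p] cl(2)[OF p'] HM.TA_ops(2)[OF p p'] HM.TA_ops(2)[OF cl(1)[OF p] cl(1)[OF p']]
     free_alg_sel(2) cl(2)[OF m] free_map_mult ..
  }
  {
   fix h assume "h \<in> carrier GW"
   then have h: "h \<in> W" by simp
   have gh: "g \<circ> h \<in> W" using gW h by simp
   show "tensor_map HM (phi (g \<otimes>\<^bsub>GW\<^esub> h)) b = tensor_map HM (phi g) (tensor_map HM (phi h) b)"
    unfolding b GW_sel(2) tensor_map_phi[OF h p] cl(2)[OF free_map_FA[OF h p]] free_map_comp
    by (subst tensor_map_phi[OF gh p]) (simp only: phi_comp[OF gW h])
  }
 next
  fix b assume "b \<in> carrier HM.TA"
  then obtain p where b: "b = HM.tcls p" and p: "p \<in> carrier HM.FA" unfolding HM.TA_carrier by (rule imageE)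
  show "tensor_map HM (phi \<one>\<^bsub>GW\<^esub>) b = b"
   unfolding b GW_sel(3) by (subst tensor_map_phi[OF W_id p]) (simp only: phi_id free_map_id)
 qed
qed

abbreviation Sm where "Sm \<equiv> smash_alg scale W"
abbreviation shh where "shh \<equiv> smash_hh scale W"
abbreviation sw where "sw \<equiv> smash_w scale W"

lemma Sm_eq: "Sm = CP.K"
 by (simp add: smash_alg_def)

lemma Sm_calg: "calg Sm"
 unfolding Sm_eq by (rule CP.K_calg)

lemma tgen_closed: "v \<in> carrier HM \<Longrightarrow> tensor_gen HM v \<in> carrier HM.TA"
 by (rule HM.tensor_gen_closed)

lemma shh_eq: "shh v = CP.ce (tensor_gen HM v) id"
 by (simp add: smash_hh_def GL_def)

lemma shh_closed: "v \<in> carrier HM \<Longrightarrow> shh v \<in> carrier Sm"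
 unfolding Sm_eq shh_eq by (intro CP.ce_closed tgen_closed)

lemma sw_closed: "sw g \<in> carrier Sm"
 unfolding Sm_eq smash_w_def by (intro CP.ce_closed CP.B.one_closed)

lemma shh_add: "u \<in> carrier HM \<Longrightarrow> v \<in> carrier HM \<Longrightarrow> shh (u \<oplus>\<^bsub>HM\<^esub> v) = shh u \<oplus>\<^bsub>Sm\<^esub> shh v"
 unfolding Sm_eq shh_eq by (simp only: CP.ce_add tgen_closed HM.tensor_gen_add)

lemma shh_smult: "v \<in> carrier HM \<Longrightarrow> shh (z \<odot>\<^bsub>HM\<^esub> v) = z \<odot>\<^bsub>Sm\<^esub> shh v"
 unfolding Sm_eq shh_eq by (simp only: CP.ce_smult tgen_closed HM.tensor_gen_smult)

lemma sw_id: "sw id = \<one>\<^bsub>Sm\<^esub>"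
 unfolding Sm_eq CP.one_ce smash_w_def GW_sel ..

lemma sw_comp: "g \<in> W \<Longrightarrow> h \<in> W \<Longrightarrow> sw (g \<circ> h) = sw g \<otimes>\<^bsub>Sm\<^esub> sw h"
 unfolding Sm_eq smash_w_def
 using CP.ce_mult[of g h "\<one>\<^bsub>HM.TA\<^esub>" "\<one>\<^bsub>HM.TA\<^esub>"] CP.act_one[of g] by simp

lemma tensor_map_gen:
 assumes g: "g \<in> W" and v: "v \<in> carrier HM"
 shows "tensor_map HM (phi g) (tensor_gen HM v) = tensor_gen HM (phi g v)"
 unfolding tensor_gen_def tensor_map_phi[OF g free_gen_closed[OF v]]
 by (simp add: free_gen_def free_map_single)

lemma sw_shh:
 assumes g: "g \<in> W" and v: "v \<in> carrier HM"
 shows "sw g \<otimes>\<^bsub>Sm\<^esub> shh v = shh (phi g v) \<otimes>\<^bsub>Sm\<^esub> sw g"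
proof -
 note c = tgen_closed[OF v] tgen_closed[OF phi_closed[OF g v]]
 have "sw g \<otimes>\<^bsub>Sm\<^esub> shh v = CP.ce (tensor_gen HM (phi g v)) g"
  unfolding Sm_eq smash_w_def shh_eq
  using CP.ce_mult[of g id "\<one>\<^bsub>HM.TA\<^esub>" "tensor_gen HM v"] g c by (simp add: tensor_map_gen[OF g v])
 moreover have "shh (phi g v) \<otimes>\<^bsub>Sm\<^esub> sw g = CP.ce (tensor_gen HM (phi g v)) g"
  unfolding Sm_eq smash_w_def shh_eq
  using CP.ce_mult[of id g "tensor_gen HM (phi g v)" "\<one>\<^bsub>HM.TA\<^esub>"] g c CP.act_one[of id] by simp
 ultimately show ?thesis by simp
qed

end

section \<open>Reflections\<close>

locale cherednik_data = irred_group scale Bs W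
 for scale :: "complex \<Rightarrow> 'h::ab_group_add \<Rightarrow> 'h" (infixr "*s" 75) and Bs W +
 fixes \<alpha> :: "('h \<Rightarrow> 'h) \<Rightarrow> 'h \<Rightarrow> complex" and \<alpha>v :: "('h \<Rightarrow> 'h) \<Rightarrow> 'h"
  and lam c :: "('h \<Rightarrow> 'h) \<Rightarrow> complex" and t :: complex
 assumes reflection_data: "reflection_data scale W \<alpha> \<alpha>v lam"
  and conj_invariant: "conj_invariant scale W c"
begin

abbreviation Rf where "Rf \<equiv> reflections scale W"

definition \<kappa> where "\<kappa> s = 2 * c s / (1 - lam s)"

lemma Rf_W: "Rf \<subseteq> W" "s \<in> Rf \<Longrightarrow> s \<in> W"
 by (auto simp: reflections_def)

lemma \<alpha>_lin:
 assumes "s \<in> Rf"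
 shows "\<alpha> s (u + v) = \<alpha> s u + \<alpha> s v" "\<alpha> s (z *s u) = z * \<alpha> s u" "\<alpha> s (u - v) = \<alpha> s u - \<alpha> s v"
proof -
 have "Vector_Spaces.linear scale (*) (\<alpha> s)"
  using reflection_data assms by (auto simp: reflection_data_def dual_space_def)
 then interpret a: Vector_Spaces.linear scale "(*)" "\<alpha> s" .
 show "\<alpha> s (u + v) = \<alpha> s u + \<alpha> s v" "\<alpha> s (z *s u) = z * \<alpha> s u" "\<alpha> s (u - v) = \<alpha> s u - \<alpha> s v"
  by (rule a.add a.scale a.diff)+
qed

text \<open>The coroot is not fixed, so it spans a complement of the reflecting hyperplane. The
  eigenvalues of \<open>s\<close> on root and coroot are inverse to each other, which makes the
  inverse of \<open>s\<close> scale the coroot by \<open>lam s\<close>.\<close>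

lemma reflection:
 assumes s: "s \<in> Rf"
 shows "\<alpha> s v = 0 \<longleftrightarrow> s v = v" "\<alpha> s (invf s v) = lam s * \<alpha> s v"
  "\<alpha> s (\<alpha>v s) \<noteq> 0" "lam s \<noteq> 1" "lam s \<noteq> 0"
  "v - invf s v = (\<alpha> s v * (1 - lam s) / \<alpha> s (\<alpha>v s)) *s \<alpha>v s"
proof -
 have sW: "s \<in> W" using s Rf_W by blast
 obtain \<mu> where d: "{v. \<alpha> s v = 0} = {v. s v = v}" "dual_action s (\<alpha> s) = (\<lambda>v. lam s * \<alpha> s v)"
  "\<alpha>v s \<noteq> 0" "\<mu> \<noteq> 1" "s (\<alpha>v s) = \<mu> *s \<alpha>v s"
  using reflection_data s unfolding reflection_data_def by blast
 show fix': "\<alpha> s v = 0 \<longleftrightarrow> s v = v" for v using d(1) by blast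
 show dual: "\<alpha> s (invf s v) = lam s * \<alpha> s v" for v
  using d(2) by (auto simp: dual_action_def fun_eq_iff)
 have "s (\<alpha>v s) \<noteq> \<alpha>v s"
  using d(3,4,5) by (metis scale_cancel_right scale_one)
 then show nz: "\<alpha> s (\<alpha>v s) \<noteq> 0" using fix' by blast
 have i0: "invf s (\<mu> *s \<alpha>v s) = \<alpha>v s" using d(5) inv_cancel(1)[OF sW, of "\<alpha>v s"] by simp
 have "\<alpha> s (\<alpha>v s) = lam s * (\<mu> * \<alpha> s (\<alpha>v s))"
  using dual[of "\<mu> *s \<alpha>v s"] by (simp only: i0 \<alpha>_lin(2)[OF s])
 then have lm: "lam s * \<mu> = 1" using nz by simp
 then show "lam s \<noteq> 1" "lam s \<noteq> 0" using d(4) by auto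
 \<comment> \<open>The coefficient for which \<open>v - z *s \<alpha>v s\<close> lies in the
   reflecting hyperplane.\<close>
 define z where "z = \<alpha> s v / \<alpha> s (\<alpha>v s)"
 define v' where "v' = v - z *s \<alpha>v s"
 have "\<alpha> s v' = 0" using nz \<alpha>_lin[OF s] by (simp add: v'_def z_def)
 then have "s v' = v'" using fix' by blast
 then have i1: "invf s v' = v'" using inv_cancel(1)[OF sW, of v'] by simp
 have "\<mu> *s invf s (\<alpha>v s) = \<alpha>v s" using i0 W_map(2)[OF W_inv[OF sW]] by simp
 then have i2: "invf s (\<alpha>v s) = lam s *s \<alpha>v s" using lm by (metis scale_scale scale_one)
 have v: "v = v' + z *s \<alpha>v s" by (simp add: v'_def)
 have "invf s v = v' + (z * lam s) *s \<alpha>v s"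
  unfolding v W_map(1,2)[OF W_inv[OF sW]] i1 i2 by simp
 then have "v - invf s v = z *s \<alpha>v s - (z * lam s) *s \<alpha>v s" by (simp add: v'_def)
 also have "\<dots> = (z * (1 - lam s)) *s \<alpha>v s" by (simp add: algebra_simps)
 finally show "v - invf s v = (\<alpha> s v * (1 - lam s) / \<alpha> s (\<alpha>v s)) *s \<alpha>v s" by (simp add: z_def)
qed

text \<open>Translates the coefficient of the defining relation into a form free of the choice of
  root and coroot; the factor 1 - \<lambda> in the denominator of \<kappa> comes from here.\<close>

lemma \<kappa>_pairing:
 assumes s: "s \<in> Rf"
 shows "2 * c s / \<alpha> s (\<alpha>v s) * pr u (\<alpha>v s) * \<alpha> s v = \<kappa> s * pr u (v - invf s v)"
 unfolding reflection(6)[OF s] pr_simps \<kappa>_def using reflection(3,4)[OF s] by (simp add: field_simps)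

text \<open>Conjugation carries eigenvectors to eigenvectors with the same eigenvalue, so
  \<open>lam\<close> is a class function although the chosen roots of conjugate reflections are
  unrelated.\<close>

lemma Rf_conj:
 assumes g: "g \<in> W" and s: "s \<in> Rf" shows "g \<circ> s \<circ> invf g \<in> Rf" "lam (g \<circ> s \<circ> invf g) = lam s"
  "\<kappa> (g \<circ> s \<circ> invf g) = \<kappa> s"
proof -
 let ?r = "g \<circ> s \<circ> invf g"
 have sW: "s \<in> W" using s Rf_W by blast
 have rW: "?r \<in> W" using g sW by simp
 have s': "complex_reflection scale s" using s by (simp add: reflections_def)
 have "(\<lambda>v. ?r v - v) ` UNIV = g ` ((\<lambda>v. s v - v) ` UNIV)"
 proof -
  have 1: "?r v - v = g (s (invf g v) - invf g v)" for v using W_map(3)[OF g] g by simp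
  have 2: "g (s v - v) = ?r (g v) - g v" for v using W_map(3)[OF g] g by simp
  show ?thesis
  proof
   show "(\<lambda>v. ?r v - v) ` UNIV \<subseteq> g ` ((\<lambda>v. s v - v) ` UNIV)" unfolding 1 by blast
   show "g ` ((\<lambda>v. s v - v) ` UNIV) \<subseteq> (\<lambda>v. ?r v - v) ` UNIV" unfolding image_image 2 by blast
  qed
 qed
 moreover have "dim (g ` ((\<lambda>v. s v - v) ` UNIV)) = dim ((\<lambda>v. s v - v) ` UNIV)"
 proof -
  interpret g: Vector_Spaces.linear scale scale g using W_linear[OF g] .
  interpret fg: finite_dimensional_vector_space_pair scale Bs scale Bs by unfold_locales
  show ?thesis by (rule fg.dim_image_eq[OF W_linear[OF g] inj_on_subset[OF bij_is_inj[OF W_bij[OF g]] subset_UNIV]])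
 qed
 ultimately have "dim ((\<lambda>v. ?r v - v) ` UNIV) = 1" using s' by (simp add: complex_reflection_def)
 then show r: "?r \<in> Rf"
  using rW W_finite_order[OF rW] W_GL[OF rW] by (auto simp: reflections_def complex_reflection_def)
 have inv_r: "invf ?r v = g (invf s (invf g v))" for v
  using g sW by (simp add: inv_of_comp)
 \<comment> \<open>The translated coroot is an eigenvector of the conjugate; since it is not fixed,
   the chosen root of the conjugate is nonzero on it and detects the eigenvalue.\<close>
 define v where "v = g (\<alpha>v s)"
 have i: "invf s (\<alpha>v s) = lam s *s \<alpha>v s"
 proof -
  have "\<alpha>v s - invf s (\<alpha>v s) = (1 - lam s) *s \<alpha>v s" using reflection(6)[OF s, of "\<alpha>v s"] reflection(3)[OF s] by simp
  then show ?thesis by (simp add: scale_left_diff_distrib)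
 qed
 have iv: "invf ?r v = lam s *s v" unfolding inv_r v_def using g by (simp add: i W_map)
 have "\<alpha>v s \<noteq> 0" using reflection(3)[OF s] \<alpha>_lin(2)[OF s, of 0 0] by auto
 then have v0: "v \<noteq> 0" using inv_cancel(1)[OF g, of "\<alpha>v s"] W_map(4)[OF W_inv[OF g]] by (auto simp: v_def)
 have "\<alpha> ?r v \<noteq> 0"
 proof
  assume "\<alpha> ?r v = 0"
  then have "?r v = v" using reflection(1)[OF r] by blast
  then have "invf ?r v = v" using inv_cancel(1)[OF rW, of v] by simp
  then have "(lam s - 1) *s v = 0" using iv by (simp add: algebra_simps)
  then show False using v0 reflection(4)[OF s] by simp
 qed
 moreover have "lam ?r * \<alpha> ?r v = lam s * \<alpha> ?r v"
  using reflection(2)[OF r, of v] unfolding iv \<alpha>_lin[OF r] by (rule sym)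
 ultimately show lm: "lam ?r = lam s" using mult_right_cancel by blast
 have "c (g \<otimes>\<^bsub>GL scale\<^esub> s \<otimes>\<^bsub>GL scale\<^esub> inv\<^bsub>GL scale\<^esub> g) = c s"
  using conj_invariant s g unfolding conj_invariant_def by blast
 then have "c ?r = c s" unfolding m_inv_GL[OF g] by (simp add: GL_def)
 then show "\<kappa> ?r = \<kappa> s" by (simp add: \<kappa>_def lm)
qed

end

section \<open>Dunkl operators\<close>

context cherednik_data
begin

text \<open>The representation is induced from the \<open>y\<close>-subalgebra: functions of \<open>(v, \<eta>, w)\<close> that do not depend on \<open>v\<close>
 are multiplied by \<open>\<langle>u, \<eta>\<rangle>\<close> under the action of \<open>y = u\<close>.\<close>

inductive Vf :: "'h dfun \<Rightarrow> bool" where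
 Vf_base: "Vf (\<lambda>v \<eta> w. m \<eta> w)"
| Vf_mult: "Vf F \<Longrightarrow> Vf (\<lambda>v \<eta> w. pr a v * F v \<eta> w)"
| Vf_add: "Vf F \<Longrightarrow> Vf G \<Longrightarrow> Vf (\<lambda>v \<eta> w. F v \<eta> w + G v \<eta> w)"

definition rho :: "('h \<Rightarrow> 'h) \<Rightarrow> 'h dfun \<Rightarrow> 'h dfun" where
 "rho g F = (\<lambda>v \<eta> w. F (invf g v) (cg (invf g) \<eta>) (invf g \<circ> w))"

text \<open>Directional derivative in \<open>v\<close>. As a definite description it is meaningful
  where the derivative exists, and in particular on \<open>Vf\<close>.\<close>

definition pd :: "'h \<Rightarrow> 'h dfun \<Rightarrow> 'h dfun" where
 "pd u F v \<eta> w = (THE d. ((\<lambda>T. F (v + T *s u) \<eta> w) has_field_derivative d) (at 0))"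

text \<open>The multiple of the coroot for which \<open>v - invf s v\<close> is
  \<open>\<alpha> s v *s \<beta> s\<close>; the divided difference of a linear form is then its
  constant value at this vector.\<close>

definition \<beta> where "\<beta> s = ((1 - lam s) / \<alpha> s (\<alpha>v s)) *s \<alpha>v s"

text \<open>The divided difference, continued to the reflecting hyperplane by a derivative.\<close>

definition Dl where "Dl s F v \<eta> w = (if \<alpha> s v = 0 then pd (\<beta> s) F v \<eta> w
 else (F v \<eta> w - F (invf s v) \<eta> w) / \<alpha> s v)"

text \<open>The Dunkl operator of the induced module: the first term and the divided differences act
  on \<open>v\<close>, the second term is the action of y on the fibre, and each reflection also
  moves the fibre coordinates \<open>\<eta>\<close> and \<open>w\<close>.\<close>

definition Do :: "'h \<Rightarrow> 'h dfun \<Rightarrow> 'h dfun" where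
 "Do u F = (\<lambda>v \<eta> w. t * pd u F v \<eta> w + pr u \<eta> * F v \<eta> w
   - (\<Sum>s\<in>Rf. \<kappa> s * \<alpha> s u * Dl s F v (cg (invf s) \<eta>) (invf s \<circ> w)))"

lemma beta: "s \<in> Rf \<Longrightarrow> v - invf s v = \<alpha> s v *s \<beta> s"
 using reflection(6)[of s v] by (simp add: \<beta>_def)

lemma Vf_scale: "Vf F \<Longrightarrow> Vf (\<lambda>v \<eta> w. z * F v \<eta> w)"
proof (induction rule: Vf.induct)
 case (Vf_base m)
 then show ?case using Vf.Vf_base[of "\<lambda>\<eta> w. z * m \<eta> w"] by simp
next
 case (Vf_mult F a)
 then show ?case using Vf.Vf_mult[of "\<lambda>v \<eta> w. z * F v \<eta> w" a] by (simp add: mult.left_commute)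
next
 case (Vf_add F G)
 then show ?case using Vf.Vf_add by (simp add: distrib_left)
qed

lemma Vf_minus: "Vf F \<Longrightarrow> Vf G \<Longrightarrow> Vf (\<lambda>v \<eta> w. F v \<eta> w - G v \<eta> w)"
 using Vf_add[OF _ Vf_scale[of G "-1"]] by simp

lemma Vf_sum: "(\<And>i. i \<in> I \<Longrightarrow> Vf (F i)) \<Longrightarrow> Vf (\<lambda>v \<eta> w. \<Sum>i\<in>I. F i v \<eta> w)"
 by (induction I rule: infinite_finite_induct) (auto intro: Vf_base[of "\<lambda>_ _. 0"] Vf_add)

lemma Vf_rho: "Vf F \<Longrightarrow> g \<in> W \<Longrightarrow> Vf (rho g F)"
proof (induction rule: Vf.induct)
 case (Vf_base m)
 show ?case unfolding rho_def by (rule Vf.Vf_base)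
next
 case (Vf_mult F a)
 have "rho g (\<lambda>v \<eta> w. pr a v * F v \<eta> w) = (\<lambda>v \<eta> w. pr (cg g a) v * rho g F v \<eta> w)"
  using Vf_mult.prems by (simp add: rho_def pr_cg)
 then show ?case using Vf.Vf_mult[OF Vf_mult.IH[OF Vf_mult.prems]] by simp
next
 case (Vf_add F G)
 then show ?case using Vf.Vf_add[of "rho g F" "rho g G"] by (simp add: rho_def)
qed

lemma pd_eqI: "((\<lambda>T. F (v + T *s u) \<eta> w) has_field_derivative d) (at 0) \<Longrightarrow> pd u F v \<eta> w = d"
 unfolding pd_def by (rule the_equality) (auto intro: DERIV_unique)

lemma pd_mult_DERIV:
 assumes "((\<lambda>T. F (v + T *s u) \<eta> w) has_field_derivative d) (at 0)"
 shows "((\<lambda>T. pr a (v + T *s u) * F (v + T *s u) \<eta> w) has_field_derivative pr a u * F v \<eta> w + pr a v * d) (at 0)"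
proof -
 have "((\<lambda>T. pr a v + T * pr a u) has_field_derivative pr a u) (at 0)"
  by (auto intro!: derivative_eq_intros)
 then have "((\<lambda>T. pr a (v + T *s u)) has_field_derivative pr a u) (at 0)" by (simp add: pr_simps)
 from DERIV_mult[OF this assms] show ?thesis by (simp add: algebra_simps)
qed

lemma pd_DERIV: "Vf F \<Longrightarrow> ((\<lambda>T. F (v + T *s u) \<eta> w) has_field_derivative pd u F v \<eta> w) (at 0)"
proof -
 have "Vf F \<Longrightarrow> \<exists>d. ((\<lambda>T. F (v + T *s u) \<eta> w) has_field_derivative d) (at 0)"
 proof (induction rule: Vf.induct)
  case (Vf_base m)
  show ?case by (rule exI) (rule DERIV_const)
 next
  case (Vf_mult F a)
  obtain d where "((\<lambda>T. F (v + T *s u) \<eta> w) has_field_derivative d) (at 0)" using Vf_mult.IH by (rule exE)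
  from pd_mult_DERIV[where F = F and v = v and u = u and \<eta> = \<eta> and w = w and d = d and a = a, OF this] show ?case by (rule exI)
 next
  case (Vf_add F G)
  then show ?case using DERIV_add by blast
 qed
 then show "Vf F \<Longrightarrow> ?thesis" using pd_eqI by metis
qed

lemma pd_base: "pd u (\<lambda>v \<eta> w. m \<eta> w) v \<eta> w = 0"
 by (rule pd_eqI) (rule DERIV_const)

lemma pd_mult: "Vf F \<Longrightarrow> pd u (\<lambda>v \<eta> w. pr a v * F v \<eta> w) v \<eta> w = pr a u * F v \<eta> w + pr a v * pd u F v \<eta> w"
 by (rule pd_eqI) (rule pd_mult_DERIV[OF pd_DERIV])

lemma pd_add: "Vf F \<Longrightarrow> Vf G \<Longrightarrow> pd u (\<lambda>v \<eta> w. F v \<eta> w + G v \<eta> w) v \<eta> w = pd u F v \<eta> w + pd u G v \<eta> w"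
 by (rule pd_eqI) (intro DERIV_add pd_DERIV)

lemma pd_scale: "Vf F \<Longrightarrow> pd u (\<lambda>v \<eta> w. z * F v \<eta> w) v \<eta> w = z * pd u F v \<eta> w"
 by (rule pd_eqI) (intro DERIV_cmult pd_DERIV)

lemma pd_dir:
 assumes "Vf F"
 shows "pd (u + u') F v \<eta> w = pd u F v \<eta> w + pd u' F v \<eta> w" "pd (z *s u) F v \<eta> w = z * pd u F v \<eta> w"
 using assms
proof (induction rule: Vf.induct)
 case (Vf_base m)
 { case 1 then show ?case by (simp add: pd_base) }
 { case 2 then show ?case by (simp add: pd_base) }
next
 case (Vf_mult F a)
 { case 1 show ?case by (simp only: pd_mult[OF Vf_mult.hyps] Vf_mult.IH pr_simps) (simp add: algebra_simps) }
 { case 2 show ?case by (simp only: pd_mult[OF Vf_mult.hyps] Vf_mult.IH pr_simps) (simp add: algebra_simps) }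
next
 case (Vf_add F G)
 { case 1 then show ?case using Vf_add by (simp add: pd_add) }
 { case 2 then show ?case using Vf_add by (simp add: pd_add distrib_left) }
qed

lemma Dl_base: "Dl s (\<lambda>v \<eta> w. m \<eta> w) v \<eta> w = 0"
 by (simp add: Dl_def pd_base)

text \<open>Twisted Leibniz rule. On the reflecting hyperplane it is the ordinary Leibniz rule in
  direction \<open>\<beta> s\<close>, since \<open>v\<close> is then fixed by
  \<open>s\<close>.\<close>

lemma Dl_mult:
 assumes "Vf F" and s: "s \<in> Rf"
 shows "Dl s (\<lambda>v \<eta> w. pr a v * F v \<eta> w) v \<eta> w = pr a (\<beta> s) * F (invf s v) \<eta> w + pr a v * Dl s F v \<eta> w"
proof -
 have e: "pr a v - pr a (invf s v) = \<alpha> s v * pr a (\<beta> s)"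
  using arg_cong[OF beta[OF s, of v], of "pr a"] by (simp add: pr_simps)
 show ?thesis
 proof (cases "\<alpha> s v = 0")
  case True
  then have "invf s v = v" using beta[OF s, of v] by simp
  then show ?thesis using True by (simp add: Dl_def pd_mult[OF assms(1)])
 next
  case False
  have "pr a v * F v \<eta> w - pr a (invf s v) * F (invf s v) \<eta> w
   = \<alpha> s v * pr a (\<beta> s) * F (invf s v) \<eta> w + pr a v * (F v \<eta> w - F (invf s v) \<eta> w)"
   unfolding e[symmetric] by (simp add: algebra_simps)
  then show ?thesis using False by (simp add: Dl_def add_divide_distrib)
 qed
qed

lemma Dl_add: "Vf F \<Longrightarrow> Vf G \<Longrightarrow> Dl s (\<lambda>v \<eta> w. F v \<eta> w + G v \<eta> w) v \<eta> w = Dl s F v \<eta> w + Dl s G v \<eta> w"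
 by (simp add: Dl_def pd_add diff_divide_distrib add_divide_distrib)

lemma Dl_scale: "Vf F \<Longrightarrow> Dl s (\<lambda>v \<eta> w. z * F v \<eta> w) v \<eta> w = z * Dl s F v \<eta> w"
 by (simp add: Dl_def pd_scale right_diff_distrib diff_divide_distrib)

lemma Do_base: "Do u (\<lambda>v \<eta> w. m \<eta> w) = (\<lambda>v \<eta> w. pr u \<eta> * m \<eta> w)"
 by (simp add: Do_def pd_base Dl_base)

text \<open>The defining relation for [y, x] as an identity of operators. It also reduces every
  statement about \<open>Do\<close> on \<open>Vf\<close> to functions independent of
  \<open>v\<close>.\<close>

lemma Do_mult:
 assumes F: "Vf F"
 shows "Do u (\<lambda>v \<eta> w. pr a v * F v \<eta> w) = (\<lambda>v \<eta> w. pr a v * Do u F v \<eta> w + t * pr a u * F v \<eta> w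
   - (\<Sum>s\<in>Rf. \<kappa> s * pr a (u - invf s u) * rho s F v \<eta> w))"
proof (intro ext)
 fix v \<eta> w
 have "(\<Sum>s\<in>Rf. \<kappa> s * \<alpha> s u * Dl s (\<lambda>v \<eta> w. pr a v * F v \<eta> w) v (cg (invf s) \<eta>) (invf s \<circ> w))
  = (\<Sum>s\<in>Rf. \<kappa> s * pr a (u - invf s u) * rho s F v \<eta> w
    + pr a v * (\<kappa> s * \<alpha> s u * Dl s F v (cg (invf s) \<eta>) (invf s \<circ> w)))"
  by (rule sum.cong[OF refl]) (simp only: Dl_mult[OF F] beta pr_scale_right rho_def, simp add: algebra_simps)
 also have "\<dots> = (\<Sum>s\<in>Rf. \<kappa> s * pr a (u - invf s u) * rho s F v \<eta> w)
  + pr a v * (\<Sum>s\<in>Rf. \<kappa> s * \<alpha> s u * Dl s F v (cg (invf s) \<eta>) (invf s \<circ> w))"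
  by (simp add: sum.distrib sum_distrib_left)
 finally show "Do u (\<lambda>v \<eta> w. pr a v * F v \<eta> w) v \<eta> w = pr a v * Do u F v \<eta> w + t * pr a u * F v \<eta> w
   - (\<Sum>s\<in>Rf. \<kappa> s * pr a (u - invf s u) * rho s F v \<eta> w)"
  unfolding Do_def pd_mult[OF F] by (simp add: algebra_simps)
qed

lemma Do_add: "Vf F \<Longrightarrow> Vf G \<Longrightarrow> Do u (\<lambda>v \<eta> w. F v \<eta> w + G v \<eta> w) = (\<lambda>v \<eta> w. Do u F v \<eta> w + Do u G v \<eta> w)"
 by (simp add: Do_def pd_add Dl_add algebra_simps sum.distrib)

lemma Do_scale: "Vf F \<Longrightarrow> Do u (\<lambda>v \<eta> w. z * F v \<eta> w) = (\<lambda>v \<eta> w. z * Do u F v \<eta> w)"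
 by (simp add: Do_def pd_scale Dl_scale algebra_simps sum_distrib_left)

lemma Do_dir:
 assumes "Vf F"
 shows "Do (u + u') F v \<eta> w = Do u F v \<eta> w + Do u' F v \<eta> w" "Do (z *s u) F v \<eta> w = z * Do u F v \<eta> w"
 by (simp_all add: Do_def pd_dir[OF assms] pr_simps \<alpha>_lin algebra_simps sum.distrib sum_distrib_left)

lemma Do_minus: "Vf F \<Longrightarrow> Vf G \<Longrightarrow> Do u (\<lambda>v \<eta> w. F v \<eta> w - G v \<eta> w) = (\<lambda>v \<eta> w. Do u F v \<eta> w - Do u G v \<eta> w)"
 using Do_add[of F "\<lambda>v \<eta> w. -1 * G v \<eta> w" u] Do_scale[of G u "-1"] Vf_scale[of G "-1"] by simp

lemma Do_sum: "(\<And>i. i \<in> I \<Longrightarrow> Vf (F i)) \<Longrightarrow> Do u (\<lambda>v \<eta> w. \<Sum>i\<in>I. F i v \<eta> w) = (\<lambda>v \<eta> w. \<Sum>i\<in>I. Do u (F i) v \<eta> w)"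
proof (induction I rule: infinite_finite_induct)
 case (insert i I)
 have "Vf (F i)" "Vf (\<lambda>v \<eta> w. \<Sum>i\<in>I. F i v \<eta> w)" using insert.prems by (auto intro: Vf_sum)
 from Do_add[OF this, of u] show ?case using insert by simp
qed (use Do_base[of u "\<lambda>_ _. 0"] in simp_all)

lemma Vf_Do: "Vf F \<Longrightarrow> Vf (Do u F)"
proof (induction rule: Vf.induct)
 case (Vf_base m)
 show ?case unfolding Do_base by (rule Vf.Vf_base)
next
 case (Vf_mult F a)
 have r: "Vf (rho s F)" if "s \<in> Rf" for s using Vf_rho[OF Vf_mult.hyps Rf_W(2)[OF that]] .
 show ?case unfolding Do_mult[OF Vf_mult.hyps]
  by (intro Vf_minus Vf_add Vf_sum Vf_scale Vf.Vf_mult Vf_mult.IH Vf_mult.hyps r)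
next
 case (Vf_add F G)
 then show ?case unfolding Do_add[OF Vf_add.hyps] by (intro Vf.Vf_add)
qed

lemma rho_rho: "g \<in> W \<Longrightarrow> h \<in> W \<Longrightarrow> rho g (rho h F) = rho (g \<circ> h) F"
 by (simp add: rho_def inv_of_comp cg_comp comp_assoc)

lemma rho_id: "rho id F = F"
 by (simp add: rho_def)

text \<open>Induction over \<open>Vf\<close>: the commutators with coordinate multiplication match
  because conjugation permutes the reflections and preserves \<kappa>.\<close>

lemma rho_Do: "Vf F \<Longrightarrow> g \<in> W \<Longrightarrow> rho g (Do u F) = Do (g u) (rho g F)"
proof (induction rule: Vf.induct)
 case (Vf_base m)
 have "rho g (\<lambda>v \<eta> w. m \<eta> w) = (\<lambda>v \<eta> w. m (cg (invf g) \<eta>) (invf g \<circ> w))" by (simp add: rho_def)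
 then show ?case using Vf_base Do_base[of "g u" "\<lambda>\<eta> w. m (cg (invf g) \<eta>) (invf g \<circ> w)"]
  by (simp add: Do_base) (simp add: rho_def pr_cg_right)
next
 case (Vf_add F G)
 have r: "rho g (\<lambda>v \<eta> w. F v \<eta> w + G v \<eta> w) = (\<lambda>v \<eta> w. rho g F v \<eta> w + rho g G v \<eta> w)" for F G by (simp add: rho_def)
 show ?case unfolding Do_add[OF Vf_add.hyps] r
  using Vf_add.IH Vf_add.prems Do_add[OF Vf_rho[OF Vf_add.hyps(1)] Vf_rho[OF Vf_add.hyps(2)]] by simp
next
 case (Vf_mult F a)
 note F = Vf_mult.hyps and g = Vf_mult.prems
 have r: "rho g (\<lambda>v \<eta> w. pr a v * F v \<eta> w) = (\<lambda>v \<eta> w. pr (cg g a) v * rho g F v \<eta> w)"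
  using g by (simp add: rho_def pr_cg)
 let ?c = "\<lambda>s. g \<circ> s \<circ> invf g"
 \<comment> \<open>The inverse map is conjugation by the inverse of \<open>g\<close>.\<close>
 have bij: "bij_betw ?c Rf Rf"
 proof (rule bij_betw_byWitness[of _ "\<lambda>s. invf g \<circ> s \<circ> g"])
  show "?c ` Rf \<subseteq> Rf" using Rf_conj(1)[OF g] by blast
  have "invf g \<circ> s \<circ> invf (invf g) \<in> Rf" if "s \<in> Rf" for s
   by (rule Rf_conj(1)[OF W_inv[OF g] that])
  then show "(\<lambda>s. invf g \<circ> s \<circ> g) ` Rf \<subseteq> Rf" using g by (auto simp: image_subset_iff)
 qed (use g in \<open>auto simp: fun_eq_iff\<close>)
 have conj: "\<kappa> (?c s) * pr (cg g a) (g u - invf (?c s) (g u)) * rho (?c s) (rho g F) v \<eta> w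
   = \<kappa> s * pr a (u - invf s u) * rho g (rho s F) v \<eta> w" if s: "s \<in> Rf" for s v \<eta> w
 proof -
  have sW: "s \<in> W" using s Rf_W by blast
  have 1: "invf (?c s) (g u) = g (invf s u)" using g sW by (simp add: inv_of_comp)
  have 2: "pr (cg g a) (g u - g (invf s u)) = pr a (u - invf s u)"
   using g by (simp add: pr_cg W_map)
  have "?c s \<circ> g = g \<circ> s" using g by (auto simp: fun_eq_iff)
  then have 3: "rho (?c s) (rho g F) = rho g (rho s F)" using g sW rho_rho by simp
  show ?thesis unfolding 1 2 3 Rf_conj(3)[OF g s] ..
 qed
 have m: "rho g (\<lambda>v \<eta> w. pr a v * D v \<eta> w + z * F v \<eta> w - (\<Sum>s\<in>Rf. q s * E s v \<eta> w))
  = (\<lambda>v \<eta> w. pr (cg g a) v * rho g D v \<eta> w + z * rho g F v \<eta> w - (\<Sum>s\<in>Rf. q s * rho g (E s) v \<eta> w))" for D E z q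
  using g by (simp add: rho_def pr_cg)
 have "rho g (Do u (\<lambda>v \<eta> w. pr a v * F v \<eta> w)) = (\<lambda>v \<eta> w. pr (cg g a) v * Do (g u) (rho g F) v \<eta> w
   + t * pr a u * rho g F v \<eta> w - (\<Sum>s\<in>Rf. \<kappa> s * pr a (u - invf s u) * rho g (rho s F) v \<eta> w))"
  unfolding Do_mult[OF F] m Vf_mult.IH[OF g] ..
 also have "\<dots> = (\<lambda>v \<eta> w. pr (cg g a) v * Do (g u) (rho g F) v \<eta> w
   + t * pr (cg g a) (g u) * rho g F v \<eta> w
   - (\<Sum>s\<in>Rf. \<kappa> s * pr (cg g a) (g u - invf s (g u)) * rho s (rho g F) v \<eta> w))"
 proof (intro ext arg_cong2[where f = "(-)"] arg_cong2[where f = "(+)"])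
  fix v \<eta> w
  show "(\<Sum>s\<in>Rf. \<kappa> s * pr a (u - invf s u) * rho g (rho s F) v \<eta> w)
   = (\<Sum>s\<in>Rf. \<kappa> s * pr (cg g a) (g u - invf s (g u)) * rho s (rho g F) v \<eta> w)"
   using sum.reindex_bij_betw[OF bij, of "\<lambda>s. \<kappa> s * pr (cg g a) (g u - invf s (g u)) * rho s (rho g F) v \<eta> w"]
   by (simp add: conj cong: sum.cong)
 qed (use g in \<open>simp_all add: pr_cg\<close>)
 also have "\<dots> = Do (g u) (rho g (\<lambda>v \<eta> w. pr a v * F v \<eta> w))"
  unfolding r Do_mult[OF Vf_rho[OF F g]] ..
 finally show ?case .
qed

text \<open>On functions independent of \<open>v\<close> the operators are multiplications and
  commute. The rest follows by induction: passing both operators over a coordinate leaves only terms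
  symmetric in \<open>a\<close> and \<open>b\<close>.\<close>

lemma Do_comm: "Vf F \<Longrightarrow> Do a (Do b F) = Do b (Do a F)"
proof (induction rule: Vf.induct)
 case (Vf_base m)
 show ?case by (simp add: Do_base mult.left_commute)
next
 case (Vf_add F G)
 then show ?case using Do_add[OF Vf_Do Vf_Do] by (simp add: Do_add)
next
 case (Vf_mult F x)
 note F = Vf_mult.hyps
 have r: "Vf (rho s F)" if "s \<in> Rf" for s using Vf_rho[OF F Rf_W(2)[OF that]] .
 \<comment> \<open>The reflection terms that arise when two Dunkl operators pass the coordinate
   \<open>x\<close>.\<close>
 define Q where "Q a b v \<eta> w = (\<Sum>s\<in>Rf. \<kappa> s * pr x (a - invf s a) * rho s (Do b F) v \<eta> w
   + \<kappa> s * pr x (b - invf s b) * Do a (rho s F) v \<eta> w)" for a b v \<eta> w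
 have Q: "Q a b v \<eta> w = Q b a v \<eta> w" for a b v \<eta> w
  unfolding Q_def
 proof (rule sum.cong[OF refl])
  fix s assume s: "s \<in> Rf"
  have sW: "s \<in> W" using s Rf_W by blast
  \<comment> \<open>Equivariance brings in the operator of \<open>s b\<close>, which differs from
    that of \<open>b\<close> by a multiple of the operator of \<open>\<beta> s\<close>. The extra
    term is a product of the root at \<open>a\<close> and at \<open>b\<close>, hence
    symmetric.\<close>
  have e: "Do (s b) (rho s F) v \<eta> w = Do b (rho s F) v \<eta> w + \<alpha> s b / lam s * Do (\<beta> s) (rho s F) v \<eta> w" for b
  proof -
   have "\<alpha> s b = lam s * \<alpha> s (s b)" using reflection(2)[OF s, of "s b"] sW by simp
   then have "s b = b + (\<alpha> s b / lam s) *s \<beta> s" using beta[OF s, of "s b"] sW reflection(5)[OF s]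
    by (simp add: algebra_simps)
   then show ?thesis using Do_dir[OF r[OF s]] by metis
  qed
  show "\<kappa> s * pr x (a - invf s a) * rho s (Do b F) v \<eta> w + \<kappa> s * pr x (b - invf s b) * Do a (rho s F) v \<eta> w
   = \<kappa> s * pr x (b - invf s b) * rho s (Do a F) v \<eta> w + \<kappa> s * pr x (a - invf s a) * Do b (rho s F) v \<eta> w"
   unfolding rho_Do[OF F sW] e beta[OF s] pr_scale_right by (simp add: algebra_simps)
 qed
 have "Do a (Do b (\<lambda>v \<eta> w. pr x v * F v \<eta> w)) v \<eta> w = pr x v * Do a (Do b F) v \<eta> w
   + t * pr x a * Do b F v \<eta> w + t * pr x b * Do a F v \<eta> w - Q a b v \<eta> w" for a b v \<eta> w
 proof -
  have "Do a (Do b (\<lambda>v \<eta> w. pr x v * F v \<eta> w)) = (\<lambda>v \<eta> w. Do a (\<lambda>v \<eta> w. pr x v * Do b F v \<eta> w) v \<eta> w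
   + t * pr x b * Do a F v \<eta> w - (\<Sum>s\<in>Rf. \<kappa> s * pr x (b - invf s b) * Do a (rho s F) v \<eta> w))"
  proof -
   have 1: "Vf (\<lambda>v \<eta> w. pr x v * Do b F v \<eta> w)" by (intro Vf.Vf_mult Vf_Do F)
   have 2: "Vf (\<lambda>v \<eta> w. t * pr x b * F v \<eta> w)" by (intro Vf_scale F)
   have 3: "Vf (\<lambda>v \<eta> w. \<kappa> s * pr x (b - invf s b) * rho s F v \<eta> w)" if "s \<in> Rf" for s by (intro Vf_scale r that)
   have "(\<Sum>s\<in>Rf. Do a (\<lambda>v \<eta> w. \<kappa> s * pr x (b - invf s b) * rho s F v \<eta> w) v \<eta> w)
    = (\<Sum>s\<in>Rf. \<kappa> s * pr x (b - invf s b) * Do a (rho s F) v \<eta> w)" for v \<eta> w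
    by (rule sum.cong[OF refl]) (simp only: Do_scale[OF r])
   moreover have 4: "Vf (\<lambda>v \<eta> w. \<Sum>s\<in>Rf. \<kappa> s * pr x (b - invf s b) * rho s F v \<eta> w)" by (rule Vf_sum) (rule 3)
   moreover have "Do a (\<lambda>v \<eta> w. \<Sum>s\<in>Rf. \<kappa> s * pr x (b - invf s b) * rho s F v \<eta> w)
    = (\<lambda>v \<eta> w. \<Sum>s\<in>Rf. Do a (\<lambda>v \<eta> w. \<kappa> s * pr x (b - invf s b) * rho s F v \<eta> w) v \<eta> w)" by (rule Do_sum) (rule 3)
   ultimately show ?thesis unfolding Do_mult[OF F]
    using Do_minus[OF Vf_add[OF 1 2] 4, of a] by (simp only: Do_add[OF 1 2] Do_scale[OF F])
  qed
  then show ?thesis unfolding Do_mult[OF Vf_Do[OF F]] Q_def by (simp add: sum.distrib)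
 qed
 note E = this
 show ?case
  by (intro ext) (simp only: E Q[of a b] Vf_mult.IH, simp)
qed

end

section \<open>The Dunkl representation\<close>

lemma (in calg) ideal_by_closure:
 assumes "I \<subseteq> carrier A" "\<zero> \<in> I" "\<And>x y. x \<in> I \<Longrightarrow> y \<in> I \<Longrightarrow> x \<oplus> y \<in> I" "\<And>x z. x \<in> I \<Longrightarrow> z \<odot> x \<in> I"
  "\<And>x y. x \<in> I \<Longrightarrow> y \<in> carrier A \<Longrightarrow> y \<otimes> x \<in> I" "\<And>x y. x \<in> I \<Longrightarrow> y \<in> carrier A \<Longrightarrow> x \<otimes> y \<in> I"
 shows "ideal I A"
proof (rule idealI)
 show "ring A" by (rule ring_axioms)
 show "subgroup I (add_monoid A)"
 proof (rule subgroup.intro)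
  fix x assume x: "x \<in> I"
  then have xc: "x \<in> carrier A" using assms(1) by blast
  have "inv\<^bsub>add_monoid A\<^esub> x = (-1) \<odot> x" using smult_minus_one[OF xc] by (simp add: a_inv_def)
  then show "inv\<^bsub>add_monoid A\<^esub> x \<in> I" using assms(4)[OF x] by simp
 qed (use assms in auto)
qed (use assms in auto)

context cherednik_data
begin

text \<open>\<open>Vf\<close> singles out a subspace of a function type, so linearity and stability
  are demanded on this subspace.\<close>

definition linop :: "('h dfun \<Rightarrow> 'h \<Rightarrow> 'h \<Rightarrow> ('h \<Rightarrow> 'h) \<Rightarrow> complex) \<Rightarrow> bool" where
 "linop T \<longleftrightarrow> (\<forall>F. Vf F \<longrightarrow> Vf (T F)) \<and>
   (\<forall>F G. Vf F \<longrightarrow> Vf G \<longrightarrow> T (\<lambda>v \<eta> w. F v \<eta> w + G v \<eta> w) = (\<lambda>v \<eta> w. T F v \<eta> w + T G v \<eta> w)) \<and>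
   (\<forall>F z. Vf F \<longrightarrow> T (\<lambda>v \<eta> w. z * F v \<eta> w) = (\<lambda>v \<eta> w. z * T F v \<eta> w))"

lemma linopD:
 assumes "linop T" "Vf F"
 shows "Vf (T F)" "Vf G \<Longrightarrow> T (\<lambda>v \<eta> w. F v \<eta> w + G v \<eta> w) = (\<lambda>v \<eta> w. T F v \<eta> w + T G v \<eta> w)"
  "T (\<lambda>v \<eta> w. z * F v \<eta> w) = (\<lambda>v \<eta> w. z * T F v \<eta> w)"
 using assms by (auto simp: linop_def)

lemma linopI:
 assumes "\<And>F. Vf F \<Longrightarrow> Vf (T F)"
  "\<And>F G. Vf F \<Longrightarrow> Vf G \<Longrightarrow> T (\<lambda>v \<eta> w. F v \<eta> w + G v \<eta> w) = (\<lambda>v \<eta> w. T F v \<eta> w + T G v \<eta> w)"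
  "\<And>F z. Vf F \<Longrightarrow> T (\<lambda>v \<eta> w. z * F v \<eta> w) = (\<lambda>v \<eta> w. z * T F v \<eta> w)"
 shows "linop T"
 using assms by (simp add: linop_def)

lemma linop_zero: "linop T \<Longrightarrow> T (\<lambda>v \<eta> w. 0) = (\<lambda>v \<eta> w. 0)"
 using linopD(3)[of T "\<lambda>v \<eta> w. 0" 0] Vf_base[of "\<lambda>_ _. 0"] by simp

lemma linop_sum_arg:
 assumes T: "linop T" and "\<And>i. i \<in> I \<Longrightarrow> Vf (F i)"
 shows "T (\<lambda>v \<eta> w. \<Sum>i\<in>I. F i v \<eta> w) = (\<lambda>v \<eta> w. \<Sum>i\<in>I. T (F i) v \<eta> w)"
 using assms(2)
proof (induction I rule: infinite_finite_induct)
 case (insert i I)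
 have "Vf (F i)" "Vf (\<lambda>v \<eta> w. \<Sum>i\<in>I. F i v \<eta> w)" using insert.prems by (auto intro: Vf_sum)
 from linopD(2)[OF T this] show ?case using insert by simp
qed (use linop_zero[OF T] in simp_all)

lemma linop_id: "linop (\<lambda>F. F)"
 by (rule linopI) auto

lemma linop_comp:
 assumes "linop S" "linop T" shows "linop (\<lambda>F. S (T F))"
 by (rule linopI) (simp_all add: linopD[OF assms(1)] linopD[OF assms(2)])

lemma linop_sum:
 assumes "\<And>i. i \<in> I \<Longrightarrow> linop (T i)"
 shows "linop (\<lambda>F v \<eta> w. \<Sum>i\<in>I. a i * T i F v \<eta> w)"
proof (rule linopI)
 fix F assume F: "Vf F"
 show "Vf (\<lambda>v \<eta> w. \<Sum>i\<in>I. a i * T i F v \<eta> w)"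
  by (intro Vf_sum Vf_scale linopD(1)[OF assms F])
 show "(\<lambda>v \<eta> w. \<Sum>i\<in>I. a i * T i (\<lambda>v \<eta> w. z * F v \<eta> w) v \<eta> w) = (\<lambda>v \<eta> w. z * (\<Sum>i\<in>I. a i * T i F v \<eta> w))" for z
  by (intro ext) (simp add: linopD(3)[OF assms F] sum_distrib_left mult.left_commute)
 fix G assume G: "Vf G"
 show "(\<lambda>v \<eta> w. \<Sum>i\<in>I. a i * T i (\<lambda>v \<eta> w. F v \<eta> w + G v \<eta> w) v \<eta> w)
  = (\<lambda>v \<eta> w. (\<Sum>i\<in>I. a i * T i F v \<eta> w) + (\<Sum>i\<in>I. a i * T i G v \<eta> w))"
  by (intro ext) (simp add: linopD(2)[OF assms F G] distrib_left sum.distrib)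
qed

lemma linop_rho: "g \<in> W \<Longrightarrow> linop (rho g)"
 by (rule linopI) (auto simp: Vf_rho, auto simp: rho_def)

definition Lop :: "'h hh \<Rightarrow> 'h dfun \<Rightarrow> 'h dfun" where
 "Lop v F = (\<lambda>z \<eta> w. Do (fst v) F z \<eta> w + snd v z * F z \<eta> w)"

lemma linop_Lop:
 assumes "v \<in> carrier HM" shows "linop (Lop v)"
proof -
 obtain y u where v: "v = (y, pr u)" using assms HM_carrier by blast
 show ?thesis
 proof (rule linopI)
  fix F assume F: "Vf F"
  show "Vf (Lop v F)" unfolding Lop_def v fst_conv snd_conv by (intro Vf_add Vf_mult Vf_Do F)
  show "Lop v (\<lambda>v \<eta> w. z * F v \<eta> w) = (\<lambda>x \<eta> w. z * Lop v F x \<eta> w)" for z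
   by (simp add: Lop_def Do_scale[OF F] distrib_left mult.left_commute)
  fix G assume G: "Vf G"
  show "Lop v (\<lambda>v \<eta> w. F v \<eta> w + G v \<eta> w) = (\<lambda>z \<eta> w. Lop v F z \<eta> w + Lop v G z \<eta> w)"
   by (simp add: Lop_def Do_add[OF F G] distrib_left add_ac)
 qed
qed

lemma linop_word: "set ls \<subseteq> carrier HM \<Longrightarrow> linop (foldr Lop ls)"
proof (induction ls)
 case Nil
 then show ?case using linop_id by (simp add: id_def)
next
 case (Cons v ls)
 then show ?case using linop_comp[OF linop_Lop[of v], of "foldr Lop ls"] by (simp add: o_def)
qed

definition ev :: "('h hh fword \<Rightarrow>\<^sub>0 complex) \<Rightarrow> 'h dfun \<Rightarrow> 'h dfun" where
 "ev p F = (\<lambda>v \<eta> w. \<Sum>k\<in>keys p. lookup p k * foldr Lop (letters k) F v \<eta> w)"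

lemma ev_superset:
 assumes "finite K" "keys p \<subseteq> K"
 shows "ev p F v \<eta> w = (\<Sum>k\<in>K. lookup p k * foldr Lop (letters k) F v \<eta> w)"
 unfolding ev_def using assms by (intro sum.mono_neutral_left) (auto simp: in_keys_iff)

lemma ev_single: "ev (single k z) F = (\<lambda>v \<eta> w. z * foldr Lop (letters k) F v \<eta> w)"
 by (intro ext) (simp add: ev_superset[of "{k}"])

lemma ev_add: "ev (p + q) F = (\<lambda>v \<eta> w. ev p F v \<eta> w + ev q F v \<eta> w)"
proof (intro ext)
 fix v \<eta> w
 let ?K = "keys p \<union> keys q"
 have K: "finite ?K" "keys (p + q) \<subseteq> ?K" using Poly_Mapping.keys_add[of p q] by auto
 show "ev (p + q) F v \<eta> w = ev p F v \<eta> w + ev q F v \<eta> w"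
  using ev_superset[OF K] ev_superset[of ?K p] ev_superset[of ?K q]
  by (simp add: lookup_add distrib_right sum.distrib)
qed

lemma ev_zero: "ev 0 F = (\<lambda>v \<eta> w. 0)"
 by (simp add: ev_def)

lemma linop_ev: "p \<in> carrier HM.FA \<Longrightarrow> linop (ev p)"
 unfolding ev_def by (rule linop_sum, rule linop_word) (auto simp: words_def)

lemma ev_mult:
 assumes "p \<in> carrier HM.FA" "q \<in> carrier HM.FA" and F: "Vf F"
 shows "ev (p * q) F = ev p (ev q F)"
proof -
 let ?S = "words (carrier HM)"
 have "keys p \<subseteq> ?S" "keys q \<subseteq> ?S" using assms by simp_all
 then show ?thesis
 proof (induction p rule: poly_mapping_keys_induct)
  case (single k z)
  from single.prems show ?case
  proof (induction q rule: poly_mapping_keys_induct)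
   case zero
   have "linop (ev (single k z))" using single.hyps by (intro linop_ev) auto
   then show ?case by (simp add: ev_zero linop_zero)
  next
   case (single l d)
   have k: "linop (foldr Lop (letters k))" and l: "linop (foldr Lop (letters l))"
    using \<open>k \<in> ?S\<close> \<open>l \<in> ?S\<close> by (auto simp: words_def linop_word)
   show ?case
    using linopD(3)[OF k linopD(1)[OF l F], of d]
    by (simp add: mult_single ev_single plus_fword_def mult.assoc)
  next
   case (add q q')
   have k: "linop (ev (single k z))" using single.hyps by (intro linop_ev) auto
   have q: "Vf (ev q F)" "Vf (ev q' F)" using add.hyps linopD(1)[OF linop_ev F] by auto
   show ?case using linopD(2)[OF k q] add.IH by (simp add: distrib_left ev_add)
  qed
 next
  case zero
  then show ?case by (simp add: ev_zero)
 next
  case (add p p')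
  then show ?case by (simp add: distrib_right ev_add)
 qed
qed

lemma ev_gen: "ev (free_gen v) F = Lop v F"
 by (simp add: free_gen_def ev_single)

lemma ev_const: "ev (single 0 z) F = (\<lambda>v \<eta> w. z * F v \<eta> w)"
 by (simp add: ev_single zero_fword_def)

lemma ev_uminus: "ev (- p) F = (\<lambda>v \<eta> w. - ev p F v \<eta> w)"
 using ev_add[of p "-p" F] by (simp add: ev_zero fun_eq_iff eq_neg_iff_add_eq_0 add.commute)

lemma ev_diff: "ev (p - q) F = (\<lambda>v \<eta> w. ev p F v \<eta> w - ev q F v \<eta> w)"
 using ev_add[of p "-q" F] by (simp add: ev_uminus)

text \<open>The elements that act by zero on \<open>Vf\<close> form an ideal; linearity of Dunkl
  operators in their direction puts the tensor relations into it.\<close>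

lemma ev_TR:
 assumes "p \<in> HM.TR" "Vf F" shows "ev p F = (\<lambda>v \<eta> w. 0)"
proof -
 interpret F: calg HM.FA by (rule free_alg_calg)
 let ?I = "{p \<in> carrier HM.FA. \<forall>F. Vf F \<longrightarrow> ev p F = (\<lambda>v \<eta> w. 0)}"
 have "ideal ?I HM.FA"
 proof (rule F.ideal_by_closure)
  show "\<zero>\<^bsub>HM.FA\<^esub> \<in> ?I" by (simp add: ev_zero)
  fix x y :: "'h hh fword \<Rightarrow>\<^sub>0 complex" and z
  assume x: "x \<in> ?I"
  then have xc: "x \<in> carrier HM.FA" and x0: "\<And>F. Vf F \<Longrightarrow> ev x F = (\<lambda>v \<eta> w. 0)" by blast+
  {
   assume y: "y \<in> ?I"
   then have "x \<oplus>\<^bsub>HM.FA\<^esub> y \<in> carrier HM.FA" using F.a_closed[OF xc] by blast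
   moreover have "ev (x + y) F = (\<lambda>v \<eta> w. 0)" if "Vf F" for F using y x0 that by (simp add: ev_add)
   ultimately show "x \<oplus>\<^bsub>HM.FA\<^esub> y \<in> ?I" by (simp del: free_alg_sel(1))
  }
  have mult: "ev (y * x) F = (\<lambda>v \<eta> w. 0)" if "y \<in> carrier HM.FA" "Vf F" for y F
   using ev_mult[OF that(1) xc that(2)] x0[OF that(2)] linop_zero[OF linop_ev[OF that(1)]] by simp
  have "ev (single 0 z * x) F = (\<lambda>v \<eta> w. 0)" if "Vf F" for F
   by (rule mult[OF _ that]) simp
  then show "z \<odot>\<^bsub>HM.FA\<^esub> x \<in> ?I" using F.smult_closed[OF xc, of z] by (simp del: free_alg_sel(1))
  assume y: "y \<in> carrier HM.FA"
  show "y \<otimes>\<^bsub>HM.FA\<^esub> x \<in> ?I" using F.m_closed[OF y xc] mult[OF y] by (simp del: free_alg_sel(1))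
  have "ev (x * y) F = (\<lambda>v \<eta> w. 0)" if "Vf F" for F
   using ev_mult[OF xc y that] x0[OF linopD(1)[OF linop_ev[OF y] that]] by simp
  then show "x \<otimes>\<^bsub>HM.FA\<^esub> y \<in> ?I" using F.m_closed[OF xc y] by (simp del: free_alg_sel(1))
 qed blast
 moreover have "HM.tgens \<subseteq> ?I"
 proof
  fix p assume p: "p \<in> HM.tgens"
  then have pc: "p \<in> carrier HM.FA" using HM.tgens_closed by blast
  have "ev p F = (\<lambda>v \<eta> w. 0)" if F: "Vf F" for F
  proof -
   from p consider u v where "u \<in> carrier HM" "v \<in> carrier HM" "p = free_gen (u \<oplus>\<^bsub>HM\<^esub> v) - (free_gen u + free_gen v)"
    | z v where "v \<in> carrier HM" "p = free_gen (z \<odot>\<^bsub>HM\<^esub> v) - single 0 z * free_gen v"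
    unfolding HM.tgens_def by blast
   then show ?thesis
   proof cases
    case 1
    obtain y x y' x' where uv: "u = (y, pr x)" "v = (y', pr x')" using 1(1,2) HM_carrier by blast
    show ?thesis unfolding 1(3) ev_diff ev_add ev_gen uv HM_ops Lop_def
     by (intro ext) (simp add: Do_dir[OF F] pr_simps algebra_simps)
   next
    case 2
    obtain y x where v: "v = (y, pr x)" using 2(1) HM_carrier by blast
    have g: "free_gen v \<in> carrier HM.FA" by (rule free_gen_closed[OF 2(1)])
    have "ev (single 0 z * free_gen v) F = (\<lambda>a \<eta> w. z * Lop v F a \<eta> w)"
     by (subst ev_mult[OF _ g F]) (simp_all add: ev_const ev_gen)
    then show ?thesis unfolding 2(2) ev_diff ev_gen v HM_ops Lop_def
     by (intro ext) (simp add: Do_dir[OF F] pr_simps algebra_simps)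
   qed
  qed
  then show "p \<in> ?I" using pc by blast
 qed
 ultimately have "HM.TR \<subseteq> ?I" unfolding HM.TR_eq by (rule F.genideal_minimal)
 then show ?thesis using assms by blast
qed

lemma rho_Lop:
 assumes g: "g \<in> W" and v: "v \<in> carrier HM" and F: "Vf F"
 shows "rho g (Lop v F) = Lop (phi g v) (rho g F)"
proof -
 obtain y u where v: "v = (y, pr u)" using v HM_carrier by blast
 have "rho g (Lop v F) = (\<lambda>z \<eta> w. rho g (Do y F) z \<eta> w + pr (cg g u) z * rho g F z \<eta> w)"
  using g by (simp add: v Lop_def rho_def pr_cg)
 then show ?thesis unfolding rho_Do[OF F g] v phi_pr[OF g] Lop_def fst_conv snd_conv .
qed

lemma rho_word:
 "g \<in> W \<Longrightarrow> set ls \<subseteq> carrier HM \<Longrightarrow> Vf F \<Longrightarrow> rho g (foldr Lop ls F) = foldr Lop (map (phi g) ls) (rho g F)"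
proof (induction ls)
 case (Cons v ls)
 have "Vf (foldr Lop ls F)" using linopD(1)[OF linop_word Cons.prems(3)] Cons.prems(2) by simp
 then show ?case using Cons rho_Lop[of g v "foldr Lop ls F"] by simp
qed simp

lemma rho_ev:
 assumes g: "g \<in> W" and p: "p \<in> carrier HM.FA" and F: "Vf F"
 shows "rho g (ev p F) = ev (free_map (phi g) p) (rho g F)"
proof -
 have "keys p \<subseteq> words (carrier HM)" using p by simp
 then show ?thesis
 proof (induction p rule: poly_mapping_keys_induct)
  case zero
  then show ?case using linop_zero[OF linop_rho[OF g]] by (simp add: ev_zero free_map_zero)
 next
  case (single k z)
  then have k: "set (letters k) \<subseteq> carrier HM" by (simp add: words_def)
  show ?case unfolding free_map_single ev_single fword.sel linopD(3)[OF linop_rho[OF g] linopD(1)[OF linop_word[OF k] F]]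
   rho_word[OF g k F] ..
 next
  case (add p q)
  then have "Vf (ev p F)" "Vf (ev q F)" using linopD(1)[OF linop_ev F] by auto
  from linopD(2)[OF linop_rho[OF g] this] show ?case using add.IH by (simp add: ev_add free_map_add)
 qed
qed

text \<open>An arbitrary representative is chosen; on \<open>Vf\<close> the resulting operator does
  not depend on it.\<close>

definition tev where "tev C = ev (SOME p. p \<in> carrier HM.FA \<and> HM.tcls p = C)"

lemma tev_cls:
 assumes p: "p \<in> carrier HM.FA" and F: "Vf F" shows "tev (HM.tcls p) F = ev p F"
proof -
 interpret F: calg HM.FA by (rule free_alg_calg)
 interpret T: calg_ideal HM.FA HM.TR by (rule HM.tensor_ideal)
 define q where "q = (SOME q. q \<in> carrier HM.FA \<and> HM.tcls q = HM.tcls p)"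
 have q: "q \<in> carrier HM.FA" "HM.tcls q = HM.tcls p"
  using someI[of "\<lambda>q. q \<in> carrier HM.FA \<and> HM.tcls q = HM.tcls p" p] p unfolding q_def by blast+
 have "q \<ominus>\<^bsub>HM.FA\<^esub> p \<in> HM.TR" using T.cls_eq_iff[OF q(1) p] q(2) by blast
 then have "q - p \<in> HM.TR" by (simp only: a_minus_def free_alg_minus[OF p] free_alg_sel(3) diff_conv_add_uminus)
 from ev_TR[OF this F] have "ev q F = ev p F" by (simp add: ev_diff fun_eq_iff)
 then show ?thesis by (simp add: tev_def q_def)
qed

lemma TA_rep: "C \<in> carrier HM.TA \<Longrightarrow> \<exists>p. p \<in> carrier HM.FA \<and> C = HM.tcls p"
 unfolding HM.TA_carrier by (erule imageE) blast

lemma linop_tev: assumes "C \<in> carrier HM.TA" shows "linop (tev C)"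
proof -
 obtain p where "p \<in> carrier HM.FA \<and> HM.tcls p = C" using TA_rep[OF assms] by blast
 then have "(SOME p. p \<in> carrier HM.FA \<and> HM.tcls p = C) \<in> carrier HM.FA"
  using someI[of "\<lambda>p. p \<in> carrier HM.FA \<and> HM.tcls p = C" p] by blast
 then show ?thesis unfolding tev_def by (rule linop_ev)
qed

lemma tev_ops:
 assumes "C \<in> carrier HM.TA" "D \<in> carrier HM.TA" and F: "Vf F"
 shows "tev (C \<oplus>\<^bsub>HM.TA\<^esub> D) F = (\<lambda>v \<eta> w. tev C F v \<eta> w + tev D F v \<eta> w)"
  "tev (C \<otimes>\<^bsub>HM.TA\<^esub> D) F = tev C (tev D F)"
  "tev (z \<odot>\<^bsub>HM.TA\<^esub> C) F = (\<lambda>v \<eta> w. z * tev C F v \<eta> w)"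
  "g \<in> W \<Longrightarrow> rho g (tev C F) = tev (tensor_map HM (phi g) C) (rho g F)"
proof -
 interpret F: calg HM.FA by (rule free_alg_calg)
 obtain p q where p: "p \<in> carrier HM.FA" "C = HM.tcls p" and q: "q \<in> carrier HM.FA" "D = HM.tcls q"
  using TA_rep[OF assms(1)] TA_rep[OF assms(2)] by blast
 have z: "single 0 z \<in> carrier HM.FA" by simp
 show "tev (C \<oplus>\<^bsub>HM.TA\<^esub> D) F = (\<lambda>v \<eta> w. tev C F v \<eta> w + tev D F v \<eta> w)"
  unfolding p(2) q(2) HM.TA_ops(1)[OF p(1) q(1)] tev_cls[OF F.a_closed[OF p(1) q(1)] F, unfolded free_alg_sel(3)] tev_cls[OF p(1) F] tev_cls[OF q(1) F]
   free_alg_sel(3) ev_add ..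
 show "tev (C \<otimes>\<^bsub>HM.TA\<^esub> D) F = tev C (tev D F)"
  unfolding p(2) q(2) HM.TA_ops(2)[OF p(1) q(1)] tev_cls[OF F.m_closed[OF p(1) q(1)] F, unfolded free_alg_sel(2)] tev_cls[OF q(1) F]
   tev_cls[OF p(1) linopD(1)[OF linop_ev[OF q(1)] F]] free_alg_sel(2) ev_mult[OF p(1) q(1) F] ..
 show "tev (z \<odot>\<^bsub>HM.TA\<^esub> C) F = (\<lambda>v \<eta> w. z * tev C F v \<eta> w)"
  unfolding p(2) HM.TA_ops(3)[OF p(1) p(1)] tev_cls[OF F.smult_closed[OF p(1)] F, unfolded free_alg_sel(6)] tev_cls[OF p(1) F]
   free_alg_sel(6) ev_mult[OF z p(1) F] ev_const ..
 show "rho g (tev C F) = tev (tensor_map HM (phi g) C) (rho g F)" if g: "g \<in> W"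
  unfolding p(2) tensor_map_phi[OF g p(1)] tev_cls[OF p(1) F] tev_cls[OF free_map_FA[OF g p(1)] Vf_rho[OF F g]]
   rho_ev[OF g p(1) F] ..
qed

lemma tev_gen: "v \<in> carrier HM \<Longrightarrow> Vf F \<Longrightarrow> tev (tensor_gen HM v) F = Lop v F"
 unfolding tensor_gen_def by (simp only: tev_cls free_gen_closed ev_gen)

lemma tev_one: "Vf F \<Longrightarrow> tev \<one>\<^bsub>HM.TA\<^esub> F = F"
proof -
 interpret F: calg HM.FA by (rule free_alg_calg)
 assume "Vf F"
 then show ?thesis unfolding HM.TA_one using tev_cls[OF F.one_closed] ev_const[of 1 F] by (simp add: single_one)
qed

lemma tev_zero: "Vf F \<Longrightarrow> tev \<zero>\<^bsub>HM.TA\<^esub> F = (\<lambda>v \<eta> w. 0)"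
proof -
 interpret F: calg HM.FA by (rule free_alg_calg)
 assume "Vf F"
 then show ?thesis unfolding HM.TA_zero using tev_cls[OF F.zero_closed] ev_zero by simp
qed

lemma tev_finsum:
 "Vf F \<Longrightarrow> (\<And>i. i \<in> I \<Longrightarrow> C i \<in> carrier HM.TA) \<Longrightarrow>
  tev (\<Oplus>\<^bsub>HM.TA\<^esub>i\<in>I. C i) F = (\<lambda>v \<eta> w. \<Sum>i\<in>I. tev (C i) F v \<eta> w)"
proof (induction I rule: infinite_finite_induct)
 case (insert i I)
 have "C \<in> I \<rightarrow> carrier HM.TA" "C i \<in> carrier HM.TA" using insert.prems by auto
 then show ?case using insert CP.B.finsum_insert[of I i C] tev_ops(1)[of "C i" "\<Oplus>\<^bsub>HM.TA\<^esub>i\<in>I. C i" F] by simp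
qed (simp_all add: tev_zero)

end

text \<open>Merges the scalar term and the reflection terms of a commutator into one sum over the
  group, the form required by the coefficients \<gamma>.\<close>

lemma (in calg) finsum_minus_indicator:
 assumes "finite I" "i0 \<in> I" "J \<subseteq> I" "\<And>i. i \<in> I \<Longrightarrow> x i \<in> carrier A"
 shows "(\<Oplus>i\<in>I. ((if i = i0 then a else 0) - (if i \<in> J then f i else 0)) \<odot> x i) = a \<odot> x i0 \<ominus> (\<Oplus>i\<in>J. f i \<odot> x i)"
proof -
 let ?s = "\<lambda>i. (if i = i0 then a else 0) \<odot> x i" and ?t = "\<lambda>i. (if i \<in> J then f i else 0) \<odot> x i"
 have "(\<Oplus>i\<in>I. ((if i = i0 then a else 0) - (if i \<in> J then f i else 0)) \<odot> x i) = (\<Oplus>i\<in>I. ?s i \<oplus> (-1) \<odot> ?t i)"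
 proof (rule finsum_cong'[OF refl])
  fix i assume i: "i \<in> I"
  show "((if i = i0 then a else 0) - (if i \<in> J then f i else 0)) \<odot> x i = ?s i \<oplus> (-1) \<odot> ?t i"
   using smult_add_left[OF assms(4)[OF i], of "if i = i0 then a else 0" "- (if i \<in> J then f i else 0)"]
   by (simp add: smult_smult assms(4)[OF i])
 qed (use assms in auto)
 also have "\<dots> = (\<Oplus>i\<in>I. ?s i) \<oplus> (-1) \<odot> (\<Oplus>i\<in>I. ?t i)"
  using assms by (subst finsum_addf) (auto simp: smult_finsum)
 also have "(\<Oplus>i\<in>I. ?s i) = a \<odot> x i0"
  using finsum_single[OF assms(1,2), of ?s] assms by simp
 also have "(\<Oplus>i\<in>I. ?t i) = (\<Oplus>i\<in>J. f i \<odot> x i)"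
  using assms by (intro add.finprod_mono_neutral_cong_right) auto
 also have "(-1) \<odot> \<dots> = \<ominus> \<dots>"
  using assms by (intro smult_minus_one finsum_closed) auto
 finally show ?thesis by (simp add: a_minus_def)
qed

context cherednik_data
begin

definition Th :: "'h smash \<Rightarrow> 'h dfun \<Rightarrow> 'h dfun" where
 "Th f F = (\<lambda>v \<eta> w. \<Sum>g\<in>W. tev (f g) (rho g F) v \<eta> w)"

lemma Sm_app: "f \<in> carrier Sm \<Longrightarrow> g \<in> W \<Longrightarrow> f g \<in> carrier HM.TA"
 unfolding Sm_eq using CP.K_app[of f g] by simp

lemma linop_Th: "f \<in> carrier Sm \<Longrightarrow> linop (Th f)"
 using linop_sum[of W "\<lambda>g F. tev (f g) (rho g F)" "\<lambda>_. 1"] linop_comp[OF linop_tev linop_rho] Sm_app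
 by (simp add: Th_def[abs_def])

lemma Th_add:
 assumes "f \<in> carrier Sm" "f' \<in> carrier Sm" "Vf F"
 shows "Th (f \<oplus>\<^bsub>Sm\<^esub> f') F = (\<lambda>v \<eta> w. Th f F v \<eta> w + Th f' F v \<eta> w)"
 unfolding Th_def Sm_eq
 by (simp add: tev_ops(1)[OF Sm_app[OF assms(1)] Sm_app[OF assms(2)] Vf_rho[OF assms(3)]] sum.distrib cong: sum.cong)

lemma Th_smult:
 assumes "f \<in> carrier Sm" "Vf F"
 shows "Th (z \<odot>\<^bsub>Sm\<^esub> f) F = (\<lambda>v \<eta> w. z * Th f F v \<eta> w)"
 unfolding Th_def Sm_eq
 by (simp add: tev_ops(3)[OF Sm_app[OF assms(1)] Sm_app[OF assms(1)] Vf_rho[OF assms(2)]] sum_distrib_left cong: sum.cong)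

lemma Th_minus:
 assumes "f \<in> carrier Sm" "f' \<in> carrier Sm" "Vf F"
 shows "Th (f \<ominus>\<^bsub>Sm\<^esub> f') F = (\<lambda>v \<eta> w. Th f F v \<eta> w - Th f' F v \<eta> w)"
proof -
 interpret S: calg Sm by (rule Sm_calg)
 have "f \<ominus>\<^bsub>Sm\<^esub> f' = f \<oplus>\<^bsub>Sm\<^esub> (-1) \<odot>\<^bsub>Sm\<^esub> f'" using S.smult_minus_one[OF assms(2)] by (simp add: a_minus_def)
 then show ?thesis using Th_add[OF assms(1) S.smult_closed[OF assms(2)] assms(3)] Th_smult[OF assms(2,3)] by simp
qed

lemma Th_ce:
 assumes b: "b \<in> carrier HM.TA" and g: "g \<in> W" and F: "Vf F"
 shows "Th (CP.ce b g) F = tev b (rho g F)"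
proof (intro ext)
 fix v \<eta> w
 have "Th (CP.ce b g) F v \<eta> w = (\<Sum>h\<in>W. if h = g then tev b (rho g F) v \<eta> w else 0)"
  unfolding Th_def by (rule sum.cong[OF refl]) (auto simp: crossed_elem_def tev_zero Vf_rho[OF F])
 then show "Th (CP.ce b g) F v \<eta> w = tev b (rho g F) v \<eta> w" using g finite_W by simp
qed

lemma Th_shh: "v \<in> carrier HM \<Longrightarrow> Vf F \<Longrightarrow> Th (shh v) F = Lop v F"
 unfolding shh_eq using Th_ce[OF tgen_closed W_id] tev_gen by (simp add: rho_id)

lemma Th_sw: "g \<in> W \<Longrightarrow> Vf F \<Longrightarrow> Th (sw g) F = rho g F"
 unfolding smash_w_def using Th_ce[OF CP.B.one_closed] tev_one Vf_rho by simp

lemma Th_mult: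
 assumes f: "f \<in> carrier Sm" and f': "f' \<in> carrier Sm" and F: "Vf F"
 shows "Th (f \<otimes>\<^bsub>Sm\<^esub> f') F = Th f (Th f' F)"
proof (intro ext)
 fix v \<eta> w
 let ?c = "\<lambda>u h. tensor_map HM (phi u) (f' (invf u \<circ> h))"
 have c: "?c u h \<in> carrier HM.TA" if "u \<in> W" "h \<in> W" for u h
  using CP.act_closed[of u "f' (invf u \<circ> h)"] Sm_app[OF f', of "invf u \<circ> h"] that by simp
 have 1: "(f \<otimes>\<^bsub>Sm\<^esub> f') h = (\<Oplus>\<^bsub>HM.TA\<^esub>u\<in>W. f u \<otimes>\<^bsub>HM.TA\<^esub> ?c u h)" if h: "h \<in> W" for h
 proof -
  have "inv\<^bsub>GW\<^esub> u = invf u" if "u \<in> W" for u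
  proof -
   have "group (GL scale)" using group_GL vector_space_axioms by blast
   then show ?thesis using group.m_inv_consistent[OF _ subgroup_W that] m_inv_GL[OF that] by simp
  qed
  then have i: "f u \<otimes>\<^bsub>HM.TA\<^esub> tensor_map HM (phi u) (f' (inv\<^bsub>GW\<^esub> u \<otimes>\<^bsub>GW\<^esub> h)) = f u \<otimes>\<^bsub>HM.TA\<^esub> ?c u h"
   if "u \<in> W" for u using that by simp
  have "(f \<otimes>\<^bsub>Sm\<^esub> f') h = (\<Oplus>\<^bsub>HM.TA\<^esub>u\<in>carrier GW. f u \<otimes>\<^bsub>HM.TA\<^esub> tensor_map HM (phi u) (f' (inv\<^bsub>GW\<^esub> u \<otimes>\<^bsub>GW\<^esub> h)))"
   unfolding Sm_eq by (rule CP.K_sel(1)) (use h in simp)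
  also have "\<dots> = (\<Oplus>\<^bsub>HM.TA\<^esub>u\<in>W. f u \<otimes>\<^bsub>HM.TA\<^esub> ?c u h)"
   by (rule CP.B.finsum_cong'[OF GW_sel(1) _ i]) (use Sm_app[OF f] c h in auto)
  finally show ?thesis .
 qed
 have r: "Vf (rho h F)" if "h \<in> W" for h using Vf_rho[OF F that] .
 have T: "linop (tev (f u))" if "u \<in> W" for u using linop_tev[OF Sm_app[OF f that]] .
 have "Th (f \<otimes>\<^bsub>Sm\<^esub> f') F v \<eta> w = (\<Sum>h\<in>W. \<Sum>u\<in>W. tev (f u) (tev (?c u h) (rho h F)) v \<eta> w)"
  unfolding Th_def
 proof (rule sum.cong[OF refl])
  fix h assume h: "h \<in> W"
  show "tev ((f \<otimes>\<^bsub>Sm\<^esub> f') h) (rho h F) v \<eta> w = (\<Sum>u\<in>W. tev (f u) (tev (?c u h) (rho h F)) v \<eta> w)"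
   unfolding 1[OF h]
   by (subst tev_finsum[OF r[OF h]]) (use c[OF _ h] Sm_app[OF f] r[OF h] in \<open>auto simp: tev_ops(2) intro!: sum.cong\<close>)
 qed
 also have "\<dots> = (\<Sum>u\<in>W. \<Sum>h\<in>W. tev (f u) (tev (?c u h) (rho h F)) v \<eta> w)" by (rule sum.swap)
 also have "\<dots> = (\<Sum>u\<in>W. tev (f u) (rho u (Th f' F)) v \<eta> w)"
 proof (rule sum.cong[OF refl])
  fix u assume u: "u \<in> W"
  have t: "Vf (tev (f' h) (rho h F))" if "h \<in> W" for h using linopD(1)[OF linop_tev[OF Sm_app[OF f' that]] r[OF that]] .
  \<comment> \<open>Replacing \<open>h\<close> by \<open>u \<circ> h\<close> removes the inverse
    from the argument of \<open>f'\<close>, after which equivariance pulls \<open>rho u\<close>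
    out.\<close>
  have "(\<Sum>h\<in>W. tev (f u) (tev (?c u h) (rho h F)) v \<eta> w)
   = (\<Sum>h\<in>W. tev (f u) (tev (?c u (u \<circ> h)) (rho (u \<circ> h) F)) v \<eta> w)"
   by (rule sum.reindex_bij_betw[OF bij_betw_translate[OF u], symmetric])
  also have "\<dots> = (\<Sum>h\<in>W. tev (f u) (rho u (tev (f' h) (rho h F))) v \<eta> w)"
  proof (rule sum.cong[OF refl])
   fix h assume h: "h \<in> W"
   have 2: "invf u \<circ> (u \<circ> h) = h" using u by (simp add: comp_assoc[symmetric])
   show "tev (f u) (tev (?c u (u \<circ> h)) (rho (u \<circ> h) F)) v \<eta> w = tev (f u) (rho u (tev (f' h) (rho h F))) v \<eta> w"
    unfolding 2 rho_rho[OF u h, symmetric] tev_ops(4)[OF Sm_app[OF f' h] Sm_app[OF f' h] r[OF h] u] ..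
  qed
  also have "\<dots> = tev (f u) (rho u (Th f' F)) v \<eta> w"
   unfolding Th_def using linop_sum_arg[OF linop_comp[OF T[OF u] linop_rho[OF u]], of W "\<lambda>h. tev (f' h) (rho h F)"] t by simp
  finally show "(\<Sum>h\<in>W. tev (f u) (tev (?c u h) (rho h F)) v \<eta> w) = tev (f u) (rho u (Th f' F)) v \<eta> w" .
 qed
 finally show "Th (f \<otimes>\<^bsub>Sm\<^esub> f') F v \<eta> w = Th f (Th f' F) v \<eta> w" unfolding Th_def[of f] .
qed

lemma Th_zero: "Vf F \<Longrightarrow> Th \<zero>\<^bsub>Sm\<^esub> F = (\<lambda>v \<eta> w. 0)"
proof -
 interpret S: calg Sm by (rule Sm_calg)
 assume "Vf F"
 then show ?thesis using Th_smult[OF S.one_closed, of F 0] by simp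
qed

lemma Th_finsum:
 "Vf F \<Longrightarrow> (\<And>i. i \<in> I \<Longrightarrow> f i \<in> carrier Sm) \<Longrightarrow> Th (\<Oplus>\<^bsub>Sm\<^esub>i\<in>I. f i) F = (\<lambda>v \<eta> w. \<Sum>i\<in>I. Th (f i) F v \<eta> w)"
proof -
 interpret S: calg Sm by (rule Sm_calg)
 show "Vf F \<Longrightarrow> (\<And>i. i \<in> I \<Longrightarrow> f i \<in> carrier Sm) \<Longrightarrow> ?thesis"
 proof (induction I rule: infinite_finite_induct)
  case (insert i I)
  have "f \<in> I \<rightarrow> carrier Sm" "f i \<in> carrier Sm" using insert.prems by auto
  then show ?case using insert S.finsum_insert[of I i f] Th_add[of "f i" "\<Oplus>\<^bsub>Sm\<^esub>i\<in>I. f i" F] by simp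
 qed (simp_all add: Th_zero)
qed

abbreviation sx where "sx u \<equiv> smash_x scale W (pr u)"
abbreviation sy where "sy u \<equiv> smash_y scale W u"

lemma pr_zero_fun: "(\<lambda>_. 0) = pr 0"
 by auto

lemma sx_eq: "sx u = shh (0, pr u)" and sy_eq: "sy u = shh (u, pr 0)"
 by (simp_all add: smash_x_def smash_y_def pr_zero_fun)

lemma sxy_closed: "sx u \<in> carrier Sm" "sy u \<in> carrier Sm"
 unfolding sx_eq sy_eq by (rule shh_closed, rule HM_memb)+

lemma Th_sx: "Vf F \<Longrightarrow> Th (sx u) F = (\<lambda>v \<eta> w. pr u v * F v \<eta> w)"
 unfolding sx_eq using Do_dir(2)[of F 0 0] by (simp add: Th_shh Lop_def)

lemma Th_sy: "Vf F \<Longrightarrow> Th (sy u) F = Do u F"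
 unfolding sy_eq by (simp add: Th_shh Lop_def)

definition relz where "relz y u = (t * pr u y) \<odot>\<^bsub>Sm\<^esub> \<one>\<^bsub>Sm\<^esub> \<ominus>\<^bsub>Sm\<^esub>
 (\<Oplus>\<^bsub>Sm\<^esub>s\<in>Rf. (2 * c s / \<alpha> s (\<alpha>v s) * pr u (\<alpha>v s) * \<alpha> s y) \<odot>\<^bsub>Sm\<^esub> sw s)"

definition crels where "crels = {commutator Sm (sx u) (sx u') | u u'. True} \<union> {commutator Sm (sy u) (sy u') | u u'. True} \<union>
 {commutator Sm (sy y) (sx u) \<ominus>\<^bsub>Sm\<^esub> relz y u | y u. True}"

abbreviation CR where "CR \<equiv> cherednik_rel scale W \<alpha> \<alpha>v t c"

lemma CR_eq: "CR = Idl\<^bsub>Sm\<^esub> crels"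
proof -
 have "{commutator Sm (smash_x scale W x) (smash_x scale W x') | x x'. x \<in> dual_space scale \<and> x' \<in> dual_space scale}
  = {commutator Sm (sx u) (sx u') | u u'. True}" unfolding dual_space_iff by blast
 moreover have "{commutator Sm (smash_y scale W y) (smash_x scale W x) \<ominus>\<^bsub>Sm\<^esub>
     ((t * x y) \<odot>\<^bsub>Sm\<^esub> \<one>\<^bsub>Sm\<^esub> \<ominus>\<^bsub>Sm\<^esub>
      (\<Oplus>\<^bsub>Sm\<^esub>s\<in>Rf. (2 * c s / \<alpha> s (\<alpha>v s) * x (\<alpha>v s) * \<alpha> s y) \<odot>\<^bsub>Sm\<^esub> sw s)) | x y. x \<in> dual_space scale}
  = {commutator Sm (sy y) (sx u) \<ominus>\<^bsub>Sm\<^esub> relz y u | y u. True}" unfolding dual_space_iff relz_def by blast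
 ultimately show ?thesis unfolding cherednik_rel_def Let_def crels_def by simp
qed

lemma relz_closed: "relz y u \<in> carrier Sm"
proof -
 interpret S: calg Sm by (rule Sm_calg)
 show ?thesis unfolding relz_def by (intro S.minus_closed S.smult_closed S.one_closed S.finsum_closed Pi_I sw_closed)
qed

lemma comm_closed: "a \<in> carrier Sm \<Longrightarrow> b \<in> carrier Sm \<Longrightarrow> commutator Sm a b \<in> carrier Sm"
proof -
 interpret S: calg Sm by (rule Sm_calg)
 show "a \<in> carrier Sm \<Longrightarrow> b \<in> carrier Sm \<Longrightarrow> commutator Sm a b \<in> carrier Sm" by (simp add: commutator_def)
qed

lemma crels_closed: "crels \<subseteq> carrier Sm"
proof -
 interpret S: calg Sm by (rule Sm_calg)
 show ?thesis unfolding crels_def using comm_closed sxy_closed relz_closed S.minus_closed by blast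
qed

lemma CR_ideal: "calg_ideal Sm CR"
proof -
 interpret S: calg Sm by (rule Sm_calg)
 show ?thesis unfolding calg_ideal_def CR_eq using S.genideal_ideal[OF crels_closed] S.calg_axioms by blast
qed

lemma Th_comm:
 assumes "a \<in> carrier Sm" "b \<in> carrier Sm" "Vf F"
 shows "Th (commutator Sm a b) F = (\<lambda>v \<eta> w. Th a (Th b F) v \<eta> w - Th b (Th a F) v \<eta> w)"
proof -
 interpret S: calg Sm by (rule Sm_calg)
 show ?thesis unfolding commutator_def using assms by (simp add: Th_minus Th_mult)
qed

lemma Th_relz:
 assumes F: "Vf F"
 shows "Th (relz y u) F = (\<lambda>v \<eta> w. t * pr u y * F v \<eta> w - (\<Sum>s\<in>Rf. \<kappa> s * pr u (y - invf s y) * rho s F v \<eta> w))"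
proof -
 interpret S: calg Sm by (rule Sm_calg)
 have k: "z \<odot>\<^bsub>Sm\<^esub> sw s \<in> carrier Sm" for z s by (rule S.smult_closed[OF sw_closed])
 have one: "Th \<one>\<^bsub>Sm\<^esub> F = F" using Th_sw[OF W_id F] by (simp add: sw_id rho_id)
 have sum: "(\<Sum>s\<in>Rf. Th ((2 * c s / \<alpha> s (\<alpha>v s) * pr u (\<alpha>v s) * \<alpha> s y) \<odot>\<^bsub>Sm\<^esub> sw s) F v \<eta> w)
  = (\<Sum>s\<in>Rf. \<kappa> s * pr u (y - invf s y) * rho s F v \<eta> w)" for v \<eta> w
  by (rule sum.cong[OF refl]) (simp only: Th_smult[OF sw_closed F] Th_sw[OF Rf_W(2) F] \<kappa>_pairing)
 have "Th (relz y u) F v \<eta> w = t * pr u y * F v \<eta> w - (\<Sum>s\<in>Rf. \<kappa> s * pr u (y - invf s y) * rho s F v \<eta> w)" for v \<eta> w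
  unfolding relz_def
  by (subst Th_minus, (intro S.smult_closed S.one_closed S.finsum_closed Pi_I k F)+, subst Th_finsum[OF F k])
   (simp only: Th_smult[OF S.one_closed F] one sum)
 then show ?thesis by (intro ext)
qed

text \<open>The annihilator of \<open>Vf\<close> is an ideal, so only the generating relations have
  to be checked: x commutes as multiplication, y by \<open>Do_comm\<close>, and the mixed relation
  is \<open>Do_mult\<close>.\<close>

lemma Th_CR:
 assumes "f \<in> CR" "Vf F" shows "Th f F = (\<lambda>v \<eta> w. 0)"
proof -
 interpret S: calg Sm by (rule Sm_calg)
 let ?I = "{f \<in> carrier Sm. \<forall>F. Vf F \<longrightarrow> Th f F = (\<lambda>v \<eta> w. 0)}"
 have "ideal ?I Sm"
 proof (rule S.ideal_by_closure)
  fix x y and z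
  assume x: "x \<in> ?I"
  then have xc: "x \<in> carrier Sm" and x0: "\<And>F. Vf F \<Longrightarrow> Th x F = (\<lambda>v \<eta> w. 0)" by blast+
  show "z \<odot>\<^bsub>Sm\<^esub> x \<in> ?I" using xc by (simp add: Th_smult x0)
  show "x \<oplus>\<^bsub>Sm\<^esub> y \<in> ?I" if "y \<in> ?I" using that xc by (simp add: Th_add x0)
  assume y: "y \<in> carrier Sm"
  show "y \<otimes>\<^bsub>Sm\<^esub> x \<in> ?I" using xc y by (simp add: Th_mult x0 linop_zero[OF linop_Th[OF y]])
  show "x \<otimes>\<^bsub>Sm\<^esub> y \<in> ?I" using xc y by (simp add: Th_mult x0 linopD(1)[OF linop_Th[OF y]])
 qed (auto simp: Th_zero)
 moreover have "crels \<subseteq> ?I"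
 proof
  fix f assume f: "f \<in> crels"
  have "Th f F = (\<lambda>v \<eta> w. 0)" if F: "Vf F" for F
  proof -
   consider u u' where "f = commutator Sm (sx u) (sx u')" | u u' where "f = commutator Sm (sy u) (sy u')"
    | y u where "f = commutator Sm (sy y) (sx u) \<ominus>\<^bsub>Sm\<^esub> relz y u" using f unfolding crels_def by blast
   then show ?thesis
   proof cases
    case 1
    show ?thesis unfolding 1 Th_comm[OF sxy_closed(1,1) F] Th_sx[OF F] Th_sx[OF Vf_mult[OF F]]
     by (simp add: mult.left_commute)
   next
    case 2
    show ?thesis unfolding 2 Th_comm[OF sxy_closed(2,2) F] Th_sy[OF F] Th_sy[OF Vf_Do[OF F]]
     using Do_comm[OF F, of u u'] by simp
   next
    case 3
    show ?thesis unfolding 3 Th_minus[OF comm_closed[OF sxy_closed(2,1)] relz_closed F] Th_comm[OF sxy_closed(2,1) F]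
      Th_relz[OF F] Th_sx[OF F] Th_sy[OF F] Th_sx[OF Vf_Do[OF F]] Th_sy[OF Vf_mult[OF F]] Do_mult[OF F]
     by simp
   qed
  qed
  then show "f \<in> ?I" using f crels_closed by blast
 qed
 ultimately have "CR \<subseteq> ?I" unfolding CR_eq by (rule S.genideal_minimal)
 then show ?thesis using assms by blast
qed

end

section \<open>The rational Cherednik algebra\<close>

context cherednik_data
begin

abbreviation Hc where "Hc \<equiv> cherednik scale W \<alpha> \<alpha>v t c"
abbreviation xc where "xc u \<equiv> cherednik_x scale W \<alpha> \<alpha>v t c (pr u)"
abbreviation yc where "yc \<equiv> cherednik_y scale W \<alpha> \<alpha>v t c"
abbreviation wc where "wc \<equiv> cherednik_w scale W \<alpha> \<alpha>v t c"

definition gammac :: "'h dfun" where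
 "gammac v u g = (if g = id then t * pr u v else 0) - (if g \<in> Rf then \<kappa> g * pr u (v - invf g v) else 0)"

text \<open>The cyclic vector: applied to it, a normally ordered word displays its letters as a
  function of \<open>v\<close>, \<open>\<eta>\<close> and \<open>w\<close>.\<close>

definition delta :: "'h dfun" where
 "delta = (\<lambda>v \<eta> w. if w = id then 1 else 0)"

text \<open>The coefficient functions of the normal form are the values of an element on the cyclic
  vector; the choice of representative is harmless because the relations act by zero.\<close>

definition pic :: "'h smash set \<Rightarrow> ('h \<Rightarrow> 'h) \<Rightarrow> 'h pfun" where
 "pic h w p = Th (SOME f. f \<in> carrier Sm \<and> quot_class Sm CR f = h) delta (fst p) (snd p) w"

lemma Vf_delta: "Vf delta"
 unfolding delta_def by (rule Vf_base)

interpretation S: calg Sm by (rule Sm_calg)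
interpretation Q: calg_ideal Sm CR by (rule CR_ideal)

lemma Hc_eq: "Hc = quot_alg Sm CR"
 by (simp add: cherednik_def)

lemma Hc_gens: "xc u = Q.cls (sx u)" "yc u = Q.cls (sy u)" "wc g = Q.cls (sw g)"
 by (simp_all add: cherednik_x_def cherednik_y_def cherednik_w_def)

lemma Hc_calg: "calg Hc"
 unfolding Hc_eq by (rule Q.quot_calg)

lemmas Hc_ops = Q.quot_ops[folded Hc_eq]

lemma Hc_rep: "h \<in> carrier Hc \<Longrightarrow> \<exists>f. f \<in> carrier Sm \<and> h = Q.cls f"
 unfolding Hc_eq Q.quot_carrier by (erule imageE) blast

lemma cls_closed: "f \<in> carrier Sm \<Longrightarrow> Q.cls f \<in> carrier Hc"
 unfolding Hc_eq Q.quot_carrier by (rule imageI)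

lemma pic_cls:
 assumes f: "f \<in> carrier Sm" shows "pic (Q.cls f) w p = Th f delta (fst p) (snd p) w"
proof -
 define f' where "f' = (SOME f'. f' \<in> carrier Sm \<and> Q.cls f' = Q.cls f)"
 have f': "f' \<in> carrier Sm" "Q.cls f' = Q.cls f"
  using someI[of "\<lambda>f'. f' \<in> carrier Sm \<and> Q.cls f' = Q.cls f" f] f unfolding f'_def by blast+
 have "f' \<ominus>\<^bsub>Sm\<^esub> f \<in> CR" using Q.cls_eq_iff[OF f'(1) f] f'(2) by blast
 from Th_CR[OF this Vf_delta] have "Th f' delta = Th f delta"
  by (simp add: Th_minus[OF f'(1) f Vf_delta] fun_eq_iff)
 then show ?thesis by (simp add: pic_def f'_def)
qed

lemma cls_eqI: "f \<in> carrier Sm \<Longrightarrow> g \<in> carrier Sm \<Longrightarrow> f \<ominus>\<^bsub>Sm\<^esub> g \<in> crels \<Longrightarrow> Q.cls f = Q.cls g"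
 using Q.cls_eq_iff[of f g] S.genideal_self[OF crels_closed] unfolding CR_eq by blast

lemma Hc_yx: "yc v \<otimes>\<^bsub>Hc\<^esub> xc u = xc u \<otimes>\<^bsub>Hc\<^esub> yc v \<oplus>\<^bsub>Hc\<^esub> (\<Oplus>\<^bsub>Hc\<^esub>g\<in>W. gammac v u g \<odot>\<^bsub>Hc\<^esub> wc g)"
proof -
 interpret H: calg Hc by (rule Hc_calg)
 note sc = sxy_closed(1)[of u] sxy_closed(2)[of v]
 note k = S.smult_closed[OF sw_closed]
 have "commutator Sm (sy v) (sx u) \<ominus>\<^bsub>Sm\<^esub> relz v u \<in> crels" unfolding crels_def by blast
 from cls_eqI[OF comm_closed[OF sc(2,1)] relz_closed this]
 have "yc v \<otimes>\<^bsub>Hc\<^esub> xc u \<ominus>\<^bsub>Hc\<^esub> xc u \<otimes>\<^bsub>Hc\<^esub> yc v = Q.cls (relz v u)"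
  unfolding commutator_def Hc_gens Hc_eq Q.quot_ops(2)[OF sc] Q.quot_ops(2)[OF sc(2,1)]
  using Q.quot_diff[OF S.m_closed[OF sc(2,1)] S.m_closed[OF sc]] by simp
 also have "\<dots> = (t * pr u v) \<odot>\<^bsub>Hc\<^esub> wc id \<ominus>\<^bsub>Hc\<^esub> (\<Oplus>\<^bsub>Hc\<^esub>s\<in>Rf. (2 * c s / \<alpha> s (\<alpha>v s) * pr u (\<alpha>v s) * \<alpha> s v) \<odot>\<^bsub>Hc\<^esub> wc s)"
  unfolding Hc_gens Hc_eq Q.quot_ops(3)[OF sw_closed sw_closed] relz_def
  by (subst Q.quot_finsum, rule k, subst Q.quot_diff, rule k, intro S.finsum_closed Pi_I k) (simp only: sw_id)
 also have "(\<Oplus>\<^bsub>Hc\<^esub>s\<in>Rf. (2 * c s / \<alpha> s (\<alpha>v s) * pr u (\<alpha>v s) * \<alpha> s v) \<odot>\<^bsub>Hc\<^esub> wc s)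
  = (\<Oplus>\<^bsub>Hc\<^esub>s\<in>Rf. (\<kappa> s * pr u (v - invf s v)) \<odot>\<^bsub>Hc\<^esub> wc s)"
 proof (rule H.finsum_cong'[OF refl])
  show "(\<lambda>s. (\<kappa> s * pr u (v - invf s v)) \<odot>\<^bsub>Hc\<^esub> wc s) \<in> Rf \<rightarrow> carrier Hc"
   unfolding Hc_gens by (intro Pi_I H.smult_closed cls_closed sw_closed)
 qed (simp only: \<kappa>_pairing)
 also have "(t * pr u v) \<odot>\<^bsub>Hc\<^esub> wc id \<ominus>\<^bsub>Hc\<^esub> \<dots> = (\<Oplus>\<^bsub>Hc\<^esub>g\<in>W. gammac v u g \<odot>\<^bsub>Hc\<^esub> wc g)"
  unfolding gammac_def Hc_gens
  by (rule H.finsum_minus_indicator[OF finite_W W_id Rf_W(1) cls_closed[OF sw_closed], symmetric])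
 finally have e: "yc v \<otimes>\<^bsub>Hc\<^esub> xc u \<ominus>\<^bsub>Hc\<^esub> xc u \<otimes>\<^bsub>Hc\<^esub> yc v = (\<Oplus>\<^bsub>Hc\<^esub>g\<in>W. gammac v u g \<odot>\<^bsub>Hc\<^esub> wc g)" .
 have c: "xc u \<in> carrier Hc" "yc v \<in> carrier Hc" unfolding Hc_gens by (rule cls_closed[OF sxy_closed(1)], rule cls_closed[OF sxy_closed(2)])
 show ?thesis unfolding e[symmetric] a_minus_def
  using H.m_closed[OF c] H.m_closed[OF c(2,1)] by (simp add: H.a_lcomm H.r_neg)
qed

lemma Hc_commute: "xc u \<otimes>\<^bsub>Hc\<^esub> xc u' = xc u' \<otimes>\<^bsub>Hc\<^esub> xc u" "yc u \<otimes>\<^bsub>Hc\<^esub> yc u' = yc u' \<otimes>\<^bsub>Hc\<^esub> yc u"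
proof -
 have *: "Q.cls a \<otimes>\<^bsub>Hc\<^esub> Q.cls b = Q.cls b \<otimes>\<^bsub>Hc\<^esub> Q.cls a"
  if "a \<in> carrier Sm" "b \<in> carrier Sm" "commutator Sm a b \<in> crels" for a b
  unfolding Hc_ops(2)[OF that(1,2)] Hc_ops(2)[OF that(2,1)]
  by (rule cls_eqI) (use that in \<open>simp_all add: commutator_def\<close>)
 show "xc u \<otimes>\<^bsub>Hc\<^esub> xc u' = xc u' \<otimes>\<^bsub>Hc\<^esub> xc u" unfolding Hc_gens
  by (rule *[OF sxy_closed(1) sxy_closed(1)]) (unfold crels_def, blast)
 show "yc u \<otimes>\<^bsub>Hc\<^esub> yc u' = yc u' \<otimes>\<^bsub>Hc\<^esub> yc u" unfolding Hc_gens
  by (rule *[OF sxy_closed(2) sxy_closed(2)]) (unfold crels_def, blast)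
qed

lemma sx_lin: "sx (u + u') = sx u \<oplus>\<^bsub>Sm\<^esub> sx u'" "sx (z *s u) = z \<odot>\<^bsub>Sm\<^esub> sx u"
 "sy (u + u') = sy u \<oplus>\<^bsub>Sm\<^esub> sy u'" "sy (z *s u) = z \<odot>\<^bsub>Sm\<^esub> sy u"
 unfolding sx_eq sy_eq by (simp_all add: shh_add[symmetric] shh_smult[symmetric] HM_ops)

lemma sw_sx: "g \<in> W \<Longrightarrow> sw g \<otimes>\<^bsub>Sm\<^esub> sx u = sx (cg g u) \<otimes>\<^bsub>Sm\<^esub> sw g"
 and sw_sy: "g \<in> W \<Longrightarrow> sw g \<otimes>\<^bsub>Sm\<^esub> sy u = sy (g u) \<otimes>\<^bsub>Sm\<^esub> sw g"
proof -
 assume g: "g \<in> W"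
 have "cg g 0 = 0" using cg_map(2)[OF g, of 0 0] by simp
 then show "sw g \<otimes>\<^bsub>Sm\<^esub> sx u = sx (cg g u) \<otimes>\<^bsub>Sm\<^esub> sw g" "sw g \<otimes>\<^bsub>Sm\<^esub> sy u = sy (g u) \<otimes>\<^bsub>Sm\<^esub> sw g"
  unfolding sx_eq sy_eq sw_shh[OF g HM_memb] phi_pr[OF g] using W_map(4)[OF g] by simp_all
qed

lemma cherednik_euler: "cherednik_euler scale Bs W Hc xc yc wc gammac pic t \<kappa> Rf"
proof -
 interpret H: calg Hc by (rule Hc_calg)
 note cl = cls_closed[OF sxy_closed(1)] cls_closed[OF sxy_closed(2)] cls_closed[OF sw_closed]
 note sc = sxy_closed sw_closed
 show ?thesis
 proof (unfold_locales)
  fix u u' :: 'h and z :: complex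
  show "xc u \<in> carrier Hc" "yc u \<in> carrier Hc" unfolding Hc_gens by (rule cl)+
  show "xc (u + u') = xc u \<oplus>\<^bsub>Hc\<^esub> xc u'" unfolding Hc_gens Hc_ops(1)[OF sc(1,1)] sx_lin ..
  show "yc (u + u') = yc u \<oplus>\<^bsub>Hc\<^esub> yc u'" unfolding Hc_gens Hc_ops(1)[OF sc(2,2)] sx_lin ..
  show "xc (z *s u) = z \<odot>\<^bsub>Hc\<^esub> xc u" unfolding Hc_gens Hc_ops(3)[OF sc(1,1)] sx_lin ..
  show "yc (z *s u) = z \<odot>\<^bsub>Hc\<^esub> yc u" unfolding Hc_gens Hc_ops(3)[OF sc(2,2)] sx_lin ..
  show "wc id = \<one>\<^bsub>Hc\<^esub>" unfolding Hc_gens Hc_eq Q.quot_one sw_id ..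
  show "xc u \<otimes>\<^bsub>Hc\<^esub> xc u' = xc u' \<otimes>\<^bsub>Hc\<^esub> xc u" by (rule Hc_commute)
  show "yc u \<otimes>\<^bsub>Hc\<^esub> yc u' = yc u' \<otimes>\<^bsub>Hc\<^esub> yc u" by (rule Hc_commute)
  show "yc u' \<otimes>\<^bsub>Hc\<^esub> xc u = xc u \<otimes>\<^bsub>Hc\<^esub> yc u' \<oplus>\<^bsub>Hc\<^esub> (\<Oplus>\<^bsub>Hc\<^esub>g\<in>W. gammac u' u g \<odot>\<^bsub>Hc\<^esub> wc g)" by (rule Hc_yx)
  fix g :: "'h \<Rightarrow> 'h" assume g: "g \<in> W"
  show "wc g \<in> carrier Hc" unfolding Hc_gens by (rule cl)
  show "wc g \<otimes>\<^bsub>Hc\<^esub> xc u = xc (cg g u) \<otimes>\<^bsub>Hc\<^esub> wc g"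
   unfolding Hc_gens Hc_ops(2)[OF sc(3,1)] Hc_ops(2)[OF sc(1,3)] sw_sx[OF g] ..
  show "wc g \<otimes>\<^bsub>Hc\<^esub> yc u = yc (g u) \<otimes>\<^bsub>Hc\<^esub> wc g"
   unfolding Hc_gens Hc_ops(2)[OF sc(3,2)] Hc_ops(2)[OF sc(2,3)] sw_sy[OF g] ..
  show "gammac u u' g = (if g = id then t * pr u' u else 0) - (if g \<in> Rf then \<kappa> g * pr u' (u - invf g u) else 0)"
   by (simp add: gammac_def)
  {
   fix h assume h: "h \<in> W"
   show "wc (g \<circ> h) = wc g \<otimes>\<^bsub>Hc\<^esub> wc h" unfolding Hc_gens Hc_ops(2)[OF sc(3,3)] sw_comp[OF g h] ..
  }
  fix w and p :: "'h \<times> 'h"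
  have "invf g \<circ> w = id \<longleftrightarrow> w = g"
  proof
   assume "invf g \<circ> w = id"
   then have "g (invf g (w v)) = g v" for v by (simp add: fun_eq_iff)
   then show "w = g" using g by auto
  qed (use g in simp)
  then show "pic (wc g) w p = (if w = g then 1 else 0)"
   unfolding Hc_gens pic_cls[OF sw_closed] Th_sw[OF g Vf_delta] by (simp add: rho_def delta_def)
  fix s assume s: "s \<in> Rf"
  show "g \<circ> s \<circ> invf g \<in> Rf" "\<kappa> (g \<circ> s \<circ> invf g) = \<kappa> s" by (rule Rf_conj[OF g s])+
 next
  fix x and u :: 'h and w and p :: "'h \<times> 'h" and z
  assume "x \<in> carrier Hc"
  then obtain f where f: "f \<in> carrier Sm" and x: "x = Q.cls f" using Hc_rep by blast
  have V: "Vf (Th f delta)" using linopD(1)[OF linop_Th[OF f] Vf_delta] .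
  show "pic (z \<odot>\<^bsub>Hc\<^esub> x) w p = z * pic x w p"
   unfolding x Hc_ops(3)[OF f f] pic_cls[OF f] pic_cls[OF S.smult_closed[OF f]] Th_smult[OF f Vf_delta] ..
  show "pic (xc u \<otimes>\<^bsub>Hc\<^esub> x) w p = pr u (fst p) * pic x w p"
   unfolding x Hc_gens Hc_ops(2)[OF sc(1) f] pic_cls[OF f] pic_cls[OF S.m_closed[OF sc(1) f]]
    Th_mult[OF sc(1) f Vf_delta] Th_sx[OF V] ..
  show "pic (yc u \<otimes>\<^bsub>Hc\<^esub> x) w p = pr u (snd p) * pic x w p"
   if i: "\<And>w v v' \<eta>. pic x w (v, \<eta>) = pic x w (v', \<eta>)"
  proof -
   \<comment> \<open>The hypothesis makes the function independent of \<open>v\<close>; on such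
     functions a Dunkl operator is multiplication by the pairing with \<open>\<eta>\<close>.\<close>
   have "Th f delta v \<eta> w = Th f delta 0 \<eta> w" for v \<eta> w using i[of w v \<eta> 0] unfolding x pic_cls[OF f] by simp
   then have e: "Th f delta = (\<lambda>v \<eta> w. Th f delta 0 \<eta> w)" by (intro ext)
   have "Do u (Th f delta) = (\<lambda>v \<eta> w. pr u \<eta> * Th f delta 0 \<eta> w)" by (subst e) (rule Do_base)
   also have "\<dots> = (\<lambda>v \<eta> w. pr u \<eta> * Th f delta v \<eta> w)" by (subst (2) e) (rule refl)
   finally show ?thesis
    unfolding x Hc_gens Hc_ops(2)[OF sc(2) f] pic_cls[OF f] pic_cls[OF S.m_closed[OF sc(2) f]]
     Th_mult[OF sc(2) f Vf_delta] Th_sy[OF V] by simp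
  qed
  fix x' assume "x' \<in> carrier Hc"
  then obtain f' where f': "f' \<in> carrier Sm" and x': "x' = Q.cls f'" using Hc_rep by blast
  show "pic (x \<oplus>\<^bsub>Hc\<^esub> x') w p = pic x w p + pic x' w p"
   unfolding x x' Hc_ops(1)[OF f f'] pic_cls[OF f] pic_cls[OF f'] pic_cls[OF S.a_closed[OF f f']]
    Th_add[OF f f' Vf_delta] ..
 qed (rule Rf_W(1))
qed

lemma dual_basis_pr: "b \<in> Bs \<Longrightarrow> dual_basis scale Bs b = pr b"
 by (auto simp: dual_basis_def pr_Bs_left)

text \<open>The chosen basis is orthonormal for \<open>pr\<close>, so the dual basis functions are
  the \<open>pr b\<close>; with this the constructions of the statement become those of the normal
  ordering setting.\<close>

theorem double_centralizer_A:
 fixes \<zeta> defines "A \<equiv> A_alg scale Bs W \<alpha> \<alpha>v lam t c \<zeta>" and "e \<equiv> A_e scale Bs W \<alpha> \<alpha>v lam t c \<zeta>"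
 shows "left_mult A (left_ideal_gen A e) \<in> alg_iso A (right_End A (carrier (corner A e)) (left_ideal_gen A e))"
proof -
 interpret E: cherednik_euler scale Bs W Hc xc yc wc gammac pic t \<kappa> Rf by (rule cherednik_euler)
 have gens: "{cherednik_x scale W \<alpha> \<alpha>v t c (dual_basis scale Bs b) \<otimes>\<^bsub>Hc\<^esub> yc b' | b b'. b \<in> Bs \<and> b' \<in> Bs}
  = {xc b \<otimes>\<^bsub>Hc\<^esub> yc b' | b b'. b \<in> Bs \<and> b' \<in> Bs}" using dual_basis_pr by force
 have Gl: "cherednik_gl scale Bs W \<alpha> \<alpha>v t c = E.Gl"
  unfolding cherednik_gl_def Let_def gens E.Hgl_generated ..
 have av: "average scale W \<alpha> \<alpha>v t c G = E.av G" for G by (simp add: average_def Let_def E.av_def)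
 have "(\<Oplus>\<^bsub>Hc\<^esub>b\<in>Bs. cherednik_x scale W \<alpha> \<alpha>v t c (dual_basis scale Bs b) \<otimes>\<^bsub>Hc\<^esub> yc b) = E.qh"
  unfolding E.qh_def by (rule E.finsum_cong'[OF refl]) (auto simp: dual_basis_pr)
 then have eu: "euler scale Bs W \<alpha> \<alpha>v lam t c = E.eu"
  by (simp add: euler_def Let_def E.eu_def E.kh_def \<kappa>_def)
 have R: "aHa scale Bs W \<alpha> \<alpha>v t c = E.Rr" by (simp only: aHa_def Gl av)
 have J: "A_rel scale Bs W \<alpha> \<alpha>v lam t c \<zeta> = E.JJ \<zeta>" by (simp only: A_rel_def Let_def R av eu E.theta_def)
 have A: "A = E.AA \<zeta>" by (simp only: A_def A_alg_def R J)
 have e: "e = quot_class E.Rr (E.JJ \<zeta>) (E.av W)" by (simp only: e_def A_e_def R J av)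
 show ?thesis unfolding A e by (rule E.cherednik_double_centralizer)
qed

end

theorem theorem8p11:
  fixes scale :: "complex \<Rightarrow> 'h::ab_group_add \<Rightarrow> 'h"
    and Bs :: "'h set"
    and W :: "('h \<Rightarrow> 'h) set"
    and \<alpha> :: "('h \<Rightarrow> 'h) \<Rightarrow> 'h \<Rightarrow> complex"
    and \<alpha>v :: "('h \<Rightarrow> 'h) \<Rightarrow> 'h"
    and lam c :: "('h \<Rightarrow> 'h) \<Rightarrow> complex"
    and t \<zeta> :: complex
  assumes "finite_dimensional_vector_space scale Bs"
    and "vector_space.dim scale (UNIV :: 'h set) > 1"
    and "complex_reflection_group scale W"
    and "irreducible_group scale W"
    and "reflection_data scale W \<alpha> \<alpha>v lam"
    and "conj_invariant scale W c"
  shows "let A = A_alg scale Bs W \<alpha> \<alpha>v lam t c \<zeta>;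
             e = A_e scale Bs W \<alpha> \<alpha>v lam t c \<zeta>;
             Ae = left_ideal_gen A e;
             eAe = carrier (corner A e)
         in left_mult A Ae \<in> alg_iso A (right_End A eAe Ae)"
proof -
  interpret V: finite_dimensional_vector_space scale Bs by fact
  have "finite W" "subgroup W (GL scale)" using assms(3) unfolding complex_reflection_group_def by blast+
  moreover have "card Bs \<ge> 2" using assms(2) unfolding V.dim_UNIV V.dimension_def by simp
  ultimately interpret cherednik_data scale Bs W \<alpha> \<alpha>v lam c t
    by (intro cherednik_data.intro irred_group.intro pairing_space.intro cherednik_data_axioms.intro irred_group_axioms.intro assms)
  show ?thesis unfolding Let_def by (rule double_centralizer_A)
qed

end
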